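(* Let $(R,\mathfrak m)$ be a local Buchsbaum ring of dimension $d>0$ with infinite residue field and let $J$ be a minimal reduction of $\mathfrak m$. Then the Sally module $S_J(\mathfrak m)$ of $\mathfrak m$ with respect to $J$ has either dimension $d$ or dimension $0$.
   Context: Let $\lambda(\cdot)$ denote length. A local Noetherian ring $(R,\mathfrak m)$ of dimension $d>0$ is a Buchsbaum ring if there is a non-negative integer $I(R)$ such that $\lambda(R/J)-e_0(J)=I(R)$ for every ideal $J=(x_1,\dots,x_d)$ generated by a system of parameters of $R$, where $e_0(J)$ is the multiplicity of $J$. A minimal reduction $J$ of an $\mathfrak m$-primary ideal $I$ is an ideal $J\subseteq I$ generated by $d$ elements such that $I^{r+1}=JI^r$ for some integer $r\ge 0$. The Rees algebra of $I$ is $\mathcal R(I)=\bigoplus_{n\ge 0}I^nt^n$. The Sally module of $I$ with respect to a minimal reduction $J$ is the finitely generated graded $\mathcal R(J)$-module $S_J(I)=I\mathcal R(I)/I\mathcal R(J)=\bigoplus_{n\ge 2}I^n/IJ^{n-1}$. Its dimension is its Krull dimension as an $\mathcal R(J)$-module. Convention: the zero module is counted as having dimension $0$. *)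

theory Defs
  imports
    "HOL-Computational_Algebra.Polynomial"
    "HOL-Library.Extended_Nat"
    "HOL-Algebra.Ideal_Product"
    "HOL-Algebra.QuotRing"
    "HOL-Algebra.Module"
    "HOL-Algebra.UnivPoly"
    "HOL-Algebra.Ring_Divisibility"
begin

text \<open>
  Powers of ideals are taken in the library's multiplicative monoid of ideals
  \<^const>\<open>ideals_set\<close>, in which the zeroth power of an ideal is the whole ring.
\<close>

abbreviation ideal_power :: "('a, 'b) ring_scheme \<Rightarrow> 'a set \<Rightarrow> nat \<Rightarrow> 'a set"
  where "ideal_power R I n \<equiv> I [^]\<^bsub>ideals_set R\<^esub> n"

definition local_noetherian_ring :: "('a, 'b) ring_scheme \<Rightarrow> 'a set \<Rightarrow> bool"
  where "local_noetherian_ring R \<mm> \<longleftrightarrow>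
    cring R \<and> noetherian_ring R \<and> {M. maximalideal M R} = {\<mm>}"


section \<open>Krull dimension\<close>

text \<open>The supremum of the empty set in \<^typ>\<open>enat\<close> is \<open>0\<close>, so the zero ring has dimension \<open>0\<close>.\<close>

definition krull_dim :: "('a, 'b) ring_scheme \<Rightarrow> enat"
  where "krull_dim R = Sup {enat n | n.
    \<exists>P. (\<forall>i\<le>n. primeideal (P i) R) \<and> (\<forall>i<n. P i \<subset> P (Suc i))}"

definition annihilator :: "('a, 'b) ring_scheme \<Rightarrow> ('a, 'c, 'd) module_scheme \<Rightarrow> 'a set"
  where "annihilator A M = {a \<in> carrier A. \<forall>x\<in>carrier M. a \<odot>\<^bsub>M\<^esub> x = \<zero>\<^bsub>M\<^esub>}"

text \<open>
  The Krull dimension of a finitely generated module. The zero module has annihilator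
  \<open>carrier A\<close>, hence dimension \<open>0\<close>.
\<close>

definition module_dim :: "('a, 'b) ring_scheme \<Rightarrow> ('a, 'c, 'd) module_scheme \<Rightarrow> enat"
  where "module_dim A M = krull_dim (A Quot (annihilator A M))"


section \<open>Modules inside a ring, quotient modules and length\<close>

text \<open>
  The additive subgroup \<open>N\<close> of the ring \<open>S\<close>, with scalars from a subring of \<open>S\<close> acting by
  multiplication. The fields \<open>mult\<close> and \<open>one\<close> of a module record play no role in the
  locale \<^locale>\<open>module\<close>.
\<close>

definition ring_module :: "('a, 'b) ring_scheme \<Rightarrow> 'a set \<Rightarrow> ('a, 'a) module"
  where "ring_module S N =
    \<lparr> carrier = N, mult = mult S, one = one S, zero = zero S, add = add S, smult = mult S \<rparr>"

text \<open>The additive group is that of \<^const>\<open>FactRing\<close>.\<close>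

definition quotient_module :: "('a, 'c, 'd) module_scheme \<Rightarrow> 'c set \<Rightarrow> ('a, 'c set) module"
  where "quotient_module M N =
    \<lparr> carrier = a_rcosets\<^bsub>M\<^esub> N, mult = rcoset_mult M N, one = N +>\<^bsub>M\<^esub> \<one>\<^bsub>M\<^esub>, zero = N,
      add = set_add M, smult = (\<lambda>a X. \<Union>x\<in>X. N +>\<^bsub>M\<^esub> (a \<odot>\<^bsub>M\<^esub> x)) \<rparr>"

definition module_length :: "('a, 'b) ring_scheme \<Rightarrow> ('a, 'c, 'd) module_scheme \<Rightarrow> enat"
  where "module_length A M = Sup {enat n | n.
    \<exists>N. (\<forall>i\<le>n. submodule (N i) A M) \<and> (\<forall>i<n. N i \<subset> N (Suc i))}"

definition colength :: "('a, 'b) ring_scheme \<Rightarrow> 'a set \<Rightarrow> enat"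
  where "colength R I = module_length R (quotient_module (ring_module R (carrier R)) I)"


section \<open>Multiplicity and Buchsbaum rings\<close>

definition radical :: "('a, 'b) ring_scheme \<Rightarrow> 'a set \<Rightarrow> 'a set"
  where "radical R I = {a \<in> carrier R. \<exists>n::nat. a [^]\<^bsub>R\<^esub> n \<in> I}"

definition primary_ideal :: "('a, 'b) ring_scheme \<Rightarrow> 'a set \<Rightarrow> bool"
  where "primary_ideal R Q \<longleftrightarrow> ideal Q R \<and> Q \<noteq> carrier R \<and>
    (\<forall>a\<in>carrier R. \<forall>b\<in>carrier R. a \<otimes>\<^bsub>R\<^esub> b \<in> Q \<longrightarrow> a \<in> Q \<or> b \<in> radical R Q)"

definition system_of_parameters :: "('a, 'b) ring_scheme \<Rightarrow> 'a set \<Rightarrow> 'a list \<Rightarrow> bool"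
  where "system_of_parameters R \<mm> xs \<longleftrightarrow>
    enat (length xs) = krull_dim R \<and> set xs \<subseteq> \<mm> \<and>
    primary_ideal R (Idl\<^bsub>R\<^esub> (set xs)) \<and> radical R (Idl\<^bsub>R\<^esub> (set xs)) = \<mm>"

text \<open>
  The polynomial agreeing with the length of \<open>R/I\<^sup>n\<close> for all large \<open>n\<close>. It exists, and these
  lengths are finite, when \<open>I\<close> is primary to the maximal ideal of a local Noetherian ring;
  the definition is meaningful only in that case.
\<close>

definition hilbert_samuel_poly :: "('a, 'b) ring_scheme \<Rightarrow> 'a set \<Rightarrow> rat poly"
  where "hilbert_samuel_poly R I = (THE p. \<forall>\<^sub>F n in sequentially.
    of_nat (the_enat (colength R (ideal_power R I n))) = poly p (of_nat n))"

text \<open>The multiplicity \<open>e\<^sub>0(I)\<close>: the Hilbert-Samuel polynomial is \<open>e\<^sub>0(I) n\<^sup>d / d!\<close> plus lower terms.\<close>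

definition samuel_multiplicity :: "('a, 'b) ring_scheme \<Rightarrow> 'a set \<Rightarrow> rat"
  where "samuel_multiplicity R I =
    (let d = the_enat (krull_dim R) in fact d * Polynomial.coeff (hilbert_samuel_poly R I) d)"

definition buchsbaum_ring :: "('a, 'b) ring_scheme \<Rightarrow> 'a set \<Rightarrow> bool"
  where "buchsbaum_ring R \<mm> \<longleftrightarrow>
    local_noetherian_ring R \<mm> \<and> 0 < krull_dim R \<and>
    (\<exists>c::nat. \<forall>xs. system_of_parameters R \<mm> xs \<longrightarrow>
      of_nat (the_enat (colength R (Idl\<^bsub>R\<^esub> (set xs)))) - samuel_multiplicity R (Idl\<^bsub>R\<^esub> (set xs))
        = of_nat c)"


section \<open>Minimal reductions, Rees algebras and Sally modules\<close>

definition minimal_reduction :: "('a, 'b) ring_scheme \<Rightarrow> 'a set \<Rightarrow> 'a set \<Rightarrow> bool"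
  where "minimal_reduction R J I \<longleftrightarrow>
    J \<subseteq> I \<and>
    (\<exists>xs. enat (length xs) = krull_dim R \<and> set xs \<subseteq> carrier R \<and> J = Idl\<^bsub>R\<^esub> (set xs)) \<and>
    (\<exists>r::nat. ideal_power R I (r + 1) = J \<cdot>\<^bsub>R\<^esub> ideal_power R I r)"

text \<open>The Rees algebra as the subring of \<open>R[t]\<close> of polynomials whose \<open>t\<^sup>n\<close>-coefficient lies in \<open>I\<^sup>n\<close>.\<close>

definition rees_algebra :: "('a, 'b) ring_scheme \<Rightarrow> 'a set \<Rightarrow> (nat \<Rightarrow> 'a) ring"
  where "rees_algebra R I =
    \<lparr> carrier = {f \<in> carrier (UP R). \<forall>n. up_ring.coeff (UP R) f n \<in> ideal_power R I n},
      mult = mult (UP R), one = one (UP R), zero = zero (UP R), add = add (UP R) \<rparr>"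

text \<open>
  The product \<open>I \<R>(K)\<close> inside \<open>R[t]\<close>: all finite sums of products of a constant polynomial
  from \<open>I\<close> with an element of \<open>\<R>(K)\<close>.
\<close>

definition ideal_times_rees :: "('a, 'b) ring_scheme \<Rightarrow> 'a set \<Rightarrow> 'a set \<Rightarrow> (nat \<Rightarrow> 'a) set"
  where "ideal_times_rees R I K =
    ideal_prod (UP R) ((\<lambda>a. up_ring.monom (UP R) a 0) ` I) (carrier (rees_algebra R K))"

text \<open>
  \<open>I \<R>(I) / I \<R>(J)\<close>, to be regarded as a module over \<open>\<R>(J)\<close>. The grading, which differs by
  a shift from that of \<open>\<Oplus>\<^bsub>n\<ge>2\<^esub> I\<^sup>n / I J\<^sup>n\<^sup>-\<^sup>1\<close>, is not recorded: it does not affect the dimension.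
\<close>

definition sally_module ::
    "('a, 'b) ring_scheme \<Rightarrow> 'a set \<Rightarrow> 'a set \<Rightarrow> (nat \<Rightarrow> 'a, (nat \<Rightarrow> 'a) set) module"
  where "sally_module R J I =
    quotient_module (ring_module (UP R) (ideal_times_rees R I I)) (ideal_times_rees R I J)"

end

theory Submission
  imports Defs "HOL-Library.List_Lexorder"
begin

text \<open>
  The annihilator of \<open>S\<^sub>J(\<mm>)\<close> is homogeneous and contains a power of \<open>\<mm>\<close>, so the support of the Sally
  module consists of primes above \<open>\<mm>\<R>(J)\<close>. As parameters are analytically independent, the ideals of
  \<open>\<R>(J)\<close> generated by \<open>\<mm>\<close> and some of the \<open>x\<^sub>i t\<close> are prime, and \<open>\<R>(J)/\<mm>\<R>(J)\<close> has dimension \<open>d\<close>. If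
  the annihilator lies in \<open>\<mm>\<R>(J)\<close>, the dimension is therefore \<open>d\<close>.

  Otherwise some \<open>f \<in> J\<^sup>s - \<mm>J\<^sup>s\<close> satisfies \<open>f \<mm>\<^sup>2 \<subseteq> \<mm>J\<^sup>s\<^sup>+\<^sup>1\<close>. In a Buchsbaum ring every system of
  parameters is a weak sequence, \<open>Q : y\<^sup>2 = Q : y\<close> for \<open>Q\<close> generated by some of the parameters and \<open>y\<close>
  another one: this follows by comparing lengths with multiplicities after replacing parameters by powers.
  For parameters in general position relative to \<open>f\<close> it yields \<open>\<mm>\<^sup>2 \<subseteq> \<mm>J + (0 : J)\<close>. Hence
  \<open>\<mm>\<^sup>n\<^sup>+\<^sup>1 = \<mm>J\<^sup>n\<close> for large \<open>n\<close>, so the Sally module is also killed by a power of \<open>J t\<close> and only the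
  maximal homogeneous ideal can lie in its support.
\<close>

section \<open>Lengths of chains\<close>

text \<open>The hypothesis compares lengths with multiplicities, but what is needed concerns colon
  ideals. The bridge: raising all parameters to the power \<open>K\<close> multiplies multiplicities
  by \<open>K^d\<close> and leaves the invariant \<open>c\<close> alone, so for large
  \<open>K\<close> an inequality between lengths becomes one between multiplicities, and these turn
  out to be linear in the exponent of a single parameter. General position means that
  \<open>f\<close>, as a form over the residue field, vanishes at none of the \<open>d\<close>
  coordinate points. For every \<open>i\<close> it is then a unit times a power of
  \<open>y_i\<close> modulo the other parameters, which confines \<open>\<mm>^2\<close> to
  \<open>J + ((y_j, j \<noteq> i) : y_i)\<close>; intersecting these \<open>d\<close> ideals gives
  \<open>J + (0 : J)\<close>. The infinite residue field enters here: a nonzero form of degree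
  \<open>s\<close> has at most \<open>s\<close> pairwise coprime linear factors. The upper bound
  \<open>d\<close> for chains of primes comes from counting: up to degree \<open>D\<close> there are
  at most \<open>(D+1)^d\<close> monomials, while a chain of \<open>n + 1\<close> primes forces
  growth of order \<open>n\<close>. Krull dimension, length and this growth are all the
  \<open>height\<close> of a family of sets.\<close>

definition chain_in :: "'a set set \<Rightarrow> nat \<Rightarrow> (nat \<Rightarrow> 'a set) \<Rightarrow> bool"
  where "chain_in F n N \<longleftrightarrow> (\<forall>i\<le>n. N i \<in> F) \<and> (\<forall>i<n. N i \<subset> N (Suc i))"

definition height :: "'a set set \<Rightarrow> enat"
  where "height F = Sup {enat n | n. \<exists>N. chain_in F n N}"

lemma height_ge: "chain_in F n N \<Longrightarrow> enat n \<le> height F"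
  unfolding height_def by (intro Sup_upper) auto

lemma height_le: "(\<And>n N. chain_in F n N \<Longrightarrow> enat n \<le> b) \<Longrightarrow> height F \<le> b"
  unfolding height_def by (intro Sup_least) auto

lemma height_empty [simp]: "height {} = 0"
proof -
  have "height {} \<le> (0::enat)"
    by (rule height_le) (auto simp: chain_in_def)
  then show ?thesis by simp
qed

text \<open>An infinite supremum is not attained, but a finite \<open>k\<close> below it is reached
  by an actual chain, whose first \<open>k\<close> steps serve. The case \<open>k = 0\<close> is
  separate because the height of the empty family is also 0.\<close>

lemma height_obtain:
  assumes "enat k \<le> height F" "F \<noteq> {}"
  obtains N where "chain_in F k N"
proof (cases "k = 0")
  case True
  obtain X where "X \<in> F" using assms(2) by auto
  then have "chain_in F k (\<lambda>_. X)" using True by (simp add: chain_in_def)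
  then show ?thesis by (rule that)
next
  case False
  then have "enat (k - 1) < height F"
    using assms(1) by (metis One_nat_def Suc_pred enat_ord_simps(2) lessI less_le_trans neq0_conv)
  then obtain n N where "chain_in F n N" "enat (k - 1) < enat n"
    unfolding height_def less_Sup_iff by auto
  then have "chain_in F k N" unfolding chain_in_def by auto
  then show ?thesis by (rule that)
qed

lemma height_map:
  assumes "\<And>A. A \<in> F \<Longrightarrow> f A \<in> G" "\<And>A B. A \<in> F \<Longrightarrow> B \<in> F \<Longrightarrow> A \<subset> B \<Longrightarrow> f A \<subset> f B"
  shows "height F \<le> height G"
proof (rule height_le)
  fix n N assume "chain_in F n N"
  then have "chain_in G n (\<lambda>i. f (N i))" using assms by (simp add: chain_in_def)
  then show "enat n \<le> height G" by (rule height_ge)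
qed

lemma height_mono: "F \<subseteq> G \<Longrightarrow> height F \<le> height G"
  by (rule height_map[of F "\<lambda>x. x"]) auto

lemma chain_in_extend:
  assumes "chain_in F n N" "X \<in> F" "N n \<subset> X"
  shows "chain_in F (Suc n) (N(Suc n := X))"
  using assms by (auto simp: chain_in_def less_Suc_eq le_Suc_eq)

text \<open>Each step of a chain in \<open>F\<close> is strict for \<open>f\<close> or for
  \<open>g\<close>, so the two image chains, with repetitions removed, have together at least as
  many steps. This is the upper half of the additivity of length; it is applied to the maps
  \<open>A + (y)\<close>, \<open>A : y\<close> and to the maps \<open>V \<inter> U\<close>,
  \<open>V + U\<close>.\<close>

lemma height_split:
  assumes f: "\<And>A. A \<in> F \<Longrightarrow> f A \<in> G" and g: "\<And>A. A \<in> F \<Longrightarrow> g A \<in> H"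
    and fm: "\<And>A B. A \<in> F \<Longrightarrow> B \<in> F \<Longrightarrow> A \<subset> B \<Longrightarrow> f A \<subseteq> f B"
    and gm: "\<And>A B. A \<in> F \<Longrightarrow> B \<in> F \<Longrightarrow> A \<subset> B \<Longrightarrow> g A \<subseteq> g B"
    and st: "\<And>A B. A \<in> F \<Longrightarrow> B \<in> F \<Longrightarrow> A \<subset> B \<Longrightarrow> f A = f B \<Longrightarrow> g A = g B \<Longrightarrow> False"
  shows "height F \<le> height G + height H"
proof (rule height_le)
  fix n N assume "chain_in F n N"
  \<comment> \<open>The induction remembers the top members of both chains: at the next step each
    chain is either extended from there or left alone.\<close>
  then have "\<exists>p q K L. n \<le> p + q \<and> chain_in G p K \<and> K p = f (N n) \<and> chain_in H q L \<and> L q = g (N n)"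
  proof (induction n)
    case 0
    then have "N 0 \<in> F" by (simp add: chain_in_def)
    then have "chain_in G 0 (\<lambda>_. f (N 0))" "chain_in H 0 (\<lambda>_. g (N 0))"
      using f g by (auto simp: chain_in_def)
    then show ?case by (metis le0)
  next
    case (Suc n)
    then have NF: "N n \<in> F" "N (Suc n) \<in> F" "N n \<subset> N (Suc n)" and "chain_in F n N"
      by (auto simp: chain_in_def)
    then obtain p q K L where *: "n \<le> p + q" "chain_in G p K" "K p = f (N n)" "chain_in H q L" "L q = g (N n)"
      using Suc.IH by blast
    have le: "f (N n) \<subseteq> f (N (Suc n))" "g (N n) \<subseteq> g (N (Suc n))" using NF fm gm by auto
    have K: "\<exists>p' K'. chain_in G p' K' \<and> K' p' = f (N (Suc n)) \<and> p' = (if f (N n) = f (N (Suc n)) then p else Suc p)"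
    proof (cases "f (N n) = f (N (Suc n))")
      case True then show ?thesis using * by auto
    next
      case False
      then have "chain_in G (Suc p) (K(Suc p := f (N (Suc n))))"
        using * le f NF by (intro chain_in_extend) auto
      then show ?thesis using False by (intro exI[of _ "Suc p"] exI[of _ "K(Suc p := f (N (Suc n)))"]) auto
    qed
    have L: "\<exists>p' K'. chain_in H p' K' \<and> K' p' = g (N (Suc n)) \<and> p' = (if g (N n) = g (N (Suc n)) then q else Suc q)"
    proof (cases "g (N n) = g (N (Suc n))")
      case True then show ?thesis using * by auto
    next
      case False
      then have "chain_in H (Suc q) (L(Suc q := g (N (Suc n))))"
        using * le g NF by (intro chain_in_extend) auto
      then show ?thesis using False by (intro exI[of _ "Suc q"] exI[of _ "L(Suc q := g (N (Suc n)))"]) auto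
    qed
    obtain p' K' where K': "chain_in G p' K'" "K' p' = f (N (Suc n))" "p' = (if f (N n) = f (N (Suc n)) then p else Suc p)"
      using K by blast
    obtain q' L' where L': "chain_in H q' L'" "L' q' = g (N (Suc n))" "q' = (if g (N n) = g (N (Suc n)) then q else Suc q)"
      using L by blast
    have "Suc n \<le> p' + q'" using st[OF NF] K'(3) L'(3) *(1) by (auto split: if_splits)
    then show ?case using K' L' by blast
  qed
  then obtain p q K L where *: "n \<le> p + q" "chain_in G p K" "chain_in H q L" by blast
  have "enat n \<le> enat p + enat q" using *(1) by simp
  also have "\<dots> \<le> height G + height H"
    using height_ge[OF *(2)] height_ge[OF *(3)] by (rule add_mono)
  finally show "enat n \<le> height G + height H" .
qed

text \<open>Heights may be infinite, so an upper bound for a sum is tested on finite approximations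
  from below.\<close>

lemma enat_add_le:
  assumes "\<And>i j. enat i \<le> a \<Longrightarrow> enat j \<le> b \<Longrightarrow> enat (i + j) \<le> c"
  shows "a + b \<le> c"
proof (cases c)
  case (enat k)
  have "False" if "a = \<infinity>"
    using assms[of "Suc k" 0] that enat zero_enat_def by simp
  moreover have "False" if "b = \<infinity>"
    using assms[of 0 "Suc k"] that enat zero_enat_def by simp
  ultimately have ab: "a \<noteq> \<infinity>" "b \<noteq> \<infinity>" by auto
  obtain i j where "a = enat i" "b = enat j" using ab by (metis enat.exhaust infinity_enat_def)
  then show ?thesis using assms[of i j] by simp
qed auto

lemma height_concat:
  assumes F: "G \<subseteq> F" "H \<subseteq> F" and le: "\<And>A B. A \<in> G \<Longrightarrow> B \<in> H \<Longrightarrow> A \<subseteq> B"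
  shows "height G + height H \<le> height F"
proof (cases "G = {} \<or> H = {}")
  case True
  then show ?thesis using height_mono[OF F(1)] height_mono[OF F(2)] by auto
next
  case False
  show ?thesis
  proof (rule enat_add_le)
    fix p q assume "enat p \<le> height G" "enat q \<le> height H"
    with False obtain K L where K: "chain_in G p K" and L: "chain_in H q L"
      by (meson height_obtain)
    \<comment> \<open>The first member of \<open>L\<close> is dropped:
      \<open>K p \<subseteq> L 0\<close> may be an equality, whereas
      \<open>K p \<subset> L 1\<close> is certain. The number of steps is still
      \<open>p + q\<close>.\<close>
    have "chain_in F (p + q) (\<lambda>i. if i \<le> p then K i else L (i - p))"
      unfolding chain_in_def
    proof (intro conjI allI impI)
      fix i assume "i \<le> p + q"
      then show "(if i \<le> p then K i else L (i - p)) \<in> F" using K L F by (auto simp: chain_in_def)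
    next
      fix i assume i: "i < p + q"
      consider "i < p" | "i = p" | "i > p" by linarith
      then show "(if i \<le> p then K i else L (i - p)) \<subset> (if Suc i \<le> p then K (Suc i) else L (Suc i - p))"
      proof cases
        case 2
        then have "0 < q" using i by simp
        then have "K p \<subseteq> L 0" "L 0 \<subset> L (Suc 0)" using K L le by (auto simp: chain_in_def)
        then show ?thesis using 2 by (auto simp: Suc_diff_le)
      qed (use K L i in \<open>auto simp: chain_in_def Suc_diff_le\<close>)
    qed
    then show "enat (p + q) \<le> height F" by (rule height_ge)
  qed
qed

lemma height_singleton:
  assumes "F \<subseteq> {A}"
  shows "height F = 0"
proof -
  have "height F \<le> 0"
  proof (rule height_le)
    fix n N assume N: "chain_in F n N"
    have "\<not> 0 < n"
    proof
      assume "0 < n"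
      then have "N 0 \<in> F" "N (Suc 0) \<in> F" "N 0 \<subset> N (Suc 0)" using N by (auto simp: chain_in_def)
      then show False using assms by auto
    qed
    then show "enat n \<le> 0" by (simp add: zero_enat_def)
  qed
  then show ?thesis by simp
qed

lemma height_le_one:
  assumes "F \<subseteq> {A, B}"
  shows "height F \<le> 1"
proof (rule height_le)
  fix n N assume N: "chain_in F n N"
  show "enat n \<le> 1"
  proof (rule ccontr)
    assume "\<not> enat n \<le> 1"
    then have n: "n \<ge> 2" by (simp add: one_enat_def)
    then have "N 0 \<in> {A, B}" "N 1 \<in> {A, B}" "N 2 \<in> {A, B}" "N 0 \<subset> N 1" "N 1 \<subset> N 2"
      using N assms by (auto simp: chain_in_def numeral_2_eq_2 subset_eq)
    then show False by auto
  qed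
qed

no_notation Sum_Type.Plus (infixr \<open><+>\<close> 65)

section \<open>Ideals of a commutative ring\<close>

lemma ideal_zero_mem: "ideal I R \<Longrightarrow> \<zero>\<^bsub>R\<^esub> \<in> I"
  by (simp add: additive_subgroup.zero_closed ideal.axioms(1))

lemma ideal_add_mem: "ideal I R \<Longrightarrow> a \<in> I \<Longrightarrow> b \<in> I \<Longrightarrow> a \<oplus>\<^bsub>R\<^esub> b \<in> I"
  by (simp add: additive_subgroup.a_closed ideal.axioms(1))

lemma ideal_subset_carrier: "ideal I R \<Longrightarrow> I \<subseteq> carrier R"
  using ideal.Icarr by fastforce

context cring begin

lemma ideal_minus_mem: "ideal I R \<Longrightarrow> a \<in> I \<Longrightarrow> \<ominus> a \<in> I"
  by (simp add: additive_subgroup.a_inv_closed ideal.axioms(1))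

lemma ideal_diff_mem: "ideal I R \<Longrightarrow> a \<in> I \<Longrightarrow> b \<in> I \<Longrightarrow> a \<ominus> b \<in> I"
  by (simp add: a_minus_def ideal_minus_mem ideal_add_mem)

lemma ideal_of_closed:
  assumes "I \<subseteq> carrier R" "\<zero> \<in> I" "\<And>a b. a \<in> I \<Longrightarrow> b \<in> I \<Longrightarrow> a \<oplus> b \<in> I"
    "\<And>r a. r \<in> carrier R \<Longrightarrow> a \<in> I \<Longrightarrow> r \<otimes> a \<in> I"
  shows "ideal I R"
proof (rule idealI)
  show "ring R" by (rule ring_axioms)
  show "subgroup I (add_monoid R)"
  proof (rule add.subgroupI)
    show "I \<subseteq> carrier R" "I \<noteq> {}" using assms by auto
    fix a assume a: "a \<in> I"
    then have "(\<ominus> \<one>) \<otimes> a \<in> I" using assms(4) by simp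
    then show "\<ominus> a \<in> I" using a assms(1) by (metis l_minus l_one one_closed subsetD)
    fix b assume "b \<in> I"
    then show "a \<oplus> b \<in> I" using a assms by simp
  qed
next
  fix a x assume "a \<in> I" "x \<in> carrier R"
  moreover from this have "a \<otimes> x = x \<otimes> a" using assms(1) by (intro m_comm) auto
  ultimately show "x \<otimes> a \<in> I" "a \<otimes> x \<in> I" using assms(4) by auto
qed

lemma ideal_mem_of_diff:
  assumes "ideal I R" "a \<ominus> b \<in> I" "b \<in> I" "a \<in> carrier R"
  shows "a \<in> I"
proof -
  have "b \<in> carrier R" using assms ideal.Icarr by metis
  then have "a = (a \<ominus> b) \<oplus> b" using assms(4) by algebra
  then show ?thesis using assms ideal_add_mem by metis
qed

lemma ideal_mem_of_add:
  assumes "ideal I R" "a \<oplus> b \<in> I" "b \<in> I" "a \<in> carrier R"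
  shows "a \<in> I"
proof -
  have "b \<in> carrier R" using assms ideal.Icarr by metis
  then have "a = (a \<oplus> b) \<ominus> b" using assms(4) by algebra
  then show ?thesis using assms ideal_diff_mem by metis
qed

subsection \<open>Sums and colon ideals\<close>

lemma mem_ideal_sum: "x \<in> A <+> B \<longleftrightarrow> (\<exists>a\<in>A. \<exists>b\<in>B. x = a \<oplus> b)"
  by (auto simp: set_add_def')

lemma ideal_sum_le: "ideal K R \<Longrightarrow> A \<subseteq> K \<Longrightarrow> B \<subseteq> K \<Longrightarrow> A <+> B \<subseteq> K"
  by (auto simp: mem_ideal_sum ideal_add_mem subset_eq)

lemma ideal_sum_ge1: "ideal B R \<Longrightarrow> A \<subseteq> carrier R \<Longrightarrow> A \<subseteq> A <+> B"
proof
  fix x assume "ideal B R" "A \<subseteq> carrier R" "x \<in> A"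
  then have "x = x \<oplus> \<zero>" "\<zero> \<in> B" by (auto simp: ideal_zero_mem)
  then show "x \<in> A <+> B" using \<open>x \<in> A\<close> unfolding mem_ideal_sum by blast
qed

lemma ideal_sum_ge2: "ideal A R \<Longrightarrow> B \<subseteq> carrier R \<Longrightarrow> B \<subseteq> A <+> B"
proof
  fix x assume "ideal A R" "B \<subseteq> carrier R" "x \<in> B"
  then have "x = \<zero> \<oplus> x" "\<zero> \<in> A" by (auto simp: ideal_zero_mem)
  then show "x \<in> A <+> B" using \<open>x \<in> B\<close> unfolding mem_ideal_sum by blast
qed

lemma ideal_sum_mono: "A \<subseteq> A' \<Longrightarrow> B \<subseteq> B' \<Longrightarrow> A <+> B \<subseteq> A' <+> B'"
  by (fastforce simp: mem_ideal_sum)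

definition adjoin :: "'a set \<Rightarrow> 'a \<Rightarrow> 'a set"
  where "adjoin I y = I <+> PIdl y"

lemma mem_adjoin: "x \<in> adjoin I y \<longleftrightarrow> (\<exists>i\<in>I. \<exists>r\<in>carrier R. x = i \<oplus> r \<otimes> y)"
  by (auto simp: adjoin_def mem_ideal_sum cgenideal_def)

lemma adjoin_ideal: "ideal I R \<Longrightarrow> y \<in> carrier R \<Longrightarrow> ideal (adjoin I y) R"
  unfolding adjoin_def by (intro add_ideals cgenideal_ideal)

lemma adjoin_ge: "ideal I R \<Longrightarrow> y \<in> carrier R \<Longrightarrow> I \<subseteq> adjoin I y"
  unfolding adjoin_def by (intro ideal_sum_ge1 cgenideal_ideal ideal_subset_carrier)

lemma adjoin_self: "ideal I R \<Longrightarrow> y \<in> carrier R \<Longrightarrow> y \<in> adjoin I y"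
  unfolding mem_adjoin by (intro bexI[of _ \<zero>] bexI[of _ \<one>]) (auto simp: ideal_zero_mem)

lemma adjoin_le: "ideal K R \<Longrightarrow> I \<subseteq> K \<Longrightarrow> y \<in> K \<Longrightarrow> adjoin I y \<subseteq> K"
  by (auto simp: mem_adjoin subset_eq ideal_add_mem ideal.I_l_closed)

lemma adjoin_mono: "I \<subseteq> K \<Longrightarrow> adjoin I y \<subseteq> adjoin K y"
  unfolding mem_adjoin subset_iff by blast

definition colon :: "'a set \<Rightarrow> 'a \<Rightarrow> 'a set"
  where "colon I y = {r \<in> carrier R. r \<otimes> y \<in> I}"

lemma mem_colon: "r \<in> colon I y \<longleftrightarrow> r \<in> carrier R \<and> r \<otimes> y \<in> I"
  by (simp add: colon_def)

lemma colon_ideal: "ideal I R \<Longrightarrow> y \<in> carrier R \<Longrightarrow> ideal (colon I y) R"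
  by (rule ideal_of_closed)
    (auto simp: colon_def ideal_zero_mem l_distr ideal_add_mem m_assoc ideal.I_l_closed)

lemma colon_ge: "ideal I R \<Longrightarrow> y \<in> carrier R \<Longrightarrow> I \<subseteq> colon I y"
  by (auto simp: colon_def ideal.I_r_closed ideal.Icarr)

lemma colon_mono: "I \<subseteq> K \<Longrightarrow> colon I y \<subseteq> colon K y"
  by (auto simp: colon_def)

lemma colon_colon: "y \<in> carrier R \<Longrightarrow> z \<in> carrier R \<Longrightarrow> colon (colon I y) z = colon I (z \<otimes> y)"
  by (auto simp: colon_def m_assoc)

subsection \<open>Generated ideals\<close>

lemma Idl_le: "ideal K R \<Longrightarrow> Y \<subseteq> K \<Longrightarrow> Idl Y \<subseteq> K"
  by (rule genideal_minimal)

lemma Idl_mono: "Y \<subseteq> Z \<Longrightarrow> Z \<subseteq> carrier R \<Longrightarrow> Idl Y \<subseteq> Idl Z"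
  using subset_Idl_subset genideal_self by (meson Idl_le dual_order.trans genideal_ideal)

lemma Idl_mem: "y \<in> Y \<Longrightarrow> Y \<subseteq> carrier R \<Longrightarrow> y \<in> Idl Y"
  using genideal_self by blast

lemma Idl_insert:
  assumes "y \<in> carrier R" "Y \<subseteq> carrier R"
  shows "Idl (insert y Y) = adjoin (Idl Y) y"
proof
  have Y: "ideal (Idl Y) R" using assms genideal_ideal by auto
  show "Idl (insert y Y) \<subseteq> adjoin (Idl Y) y"
    using assms Y adjoin_self[OF Y assms(1)] adjoin_ge[OF Y assms(1)] genideal_self[OF assms(2)]
    by (intro Idl_le adjoin_ideal) auto
  show "adjoin (Idl Y) y \<subseteq> Idl (insert y Y)"
    using assms by (intro adjoin_le genideal_ideal Idl_mono Idl_mem) auto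
qed

lemma Idl_empty: "Idl {} = {\<zero>}"
  using Idl_le[OF zeroideal, of "{}"] ideal_zero_mem[OF genideal_ideal[of "{}"]] by auto

text \<open>The elements that \<open>a\<close> multiplies into \<open>K\<close> form a colon ideal,
  so generators suffice.\<close>

lemma mult_Idl_mem:
  assumes "ideal K R" "a \<in> carrier R" "Y \<subseteq> carrier R" "\<And>y. y \<in> Y \<Longrightarrow> a \<otimes> y \<in> K" "z \<in> Idl Y"
  shows "a \<otimes> z \<in> K"
proof -
  have "Idl Y \<subseteq> colon K a"
    using assms by (intro Idl_le colon_ideal) (auto simp: mem_colon m_comm subset_eq)
  then have "z \<otimes> a \<in> K" "z \<in> carrier R" using assms(5) by (auto simp: colon_def)
  then show ?thesis using assms(2) m_comm by metis
qed

subsection \<open>Products and powers\<close>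

lemma ideal_prod_le_iff:
  assumes "ideal K R"
  shows "I \<cdot> J \<subseteq> K \<longleftrightarrow> (\<forall>a\<in>I. \<forall>b\<in>J. a \<otimes> b \<in> K)"
proof
  assume *: "\<forall>a\<in>I. \<forall>b\<in>J. a \<otimes> b \<in> K"
  show "I \<cdot> J \<subseteq> K"
  proof
    fix x assume "x \<in> I \<cdot> J"
    then show "x \<in> K" by induction (use * assms ideal_add_mem in auto)
  qed
qed (auto intro: ideal_prod.prod)

lemma ideal_prod_mono: "I \<subseteq> I' \<Longrightarrow> J \<subseteq> J' \<Longrightarrow> I \<cdot> J \<subseteq> I' \<cdot> J'"
proof
  fix x assume "I \<subseteq> I'" "J \<subseteq> J'" "x \<in> I \<cdot> J"
  from this(3,1,2) show "x \<in> I' \<cdot> J'" by induction (auto intro: ideal_prod.intros)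
qed

lemma ideal_prod_le1: "ideal I R \<Longrightarrow> ideal J R \<Longrightarrow> I \<cdot> J \<subseteq> I"
  using ideal_prod_inter by blast

lemma ideal_prod_le2: "ideal I R \<Longrightarrow> ideal J R \<Longrightarrow> I \<cdot> J \<subseteq> J"
  using ideal_prod_inter by blast

lemma carrier_prod: "ideal I R \<Longrightarrow> carrier R \<cdot> I = I"
  by (simp add: ideal_prod_commute oneideal ideal_prod_one)

declare Group.nat_pow_0 [simp del] Group.nat_pow_Suc [simp del]

lemma ideal_power_0: "ideal_power R I 0 = carrier R"
  by (simp add: Group.nat_pow_0 ideals_set_def)

lemma ideal_power_Suc: "ideal_power R I (Suc n) = ideal_power R I n \<cdot> I"
  by (simp add: Group.nat_pow_Suc ideals_set_def)

lemma ideal_power_ideal [simp]: "ideal I R \<Longrightarrow> ideal (ideal_power R I n) R"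
  by (induction n) (auto simp: ideal_power_0 ideal_power_Suc oneideal ideal_prod_is_ideal)

lemma ideal_power_1: "ideal I R \<Longrightarrow> ideal_power R I (Suc 0) = I"
  by (simp only: ideal_power_Suc ideal_power_0 carrier_prod)

lemma ideal_power_add:
  assumes "ideal I R"
  shows "ideal_power R I (m + n) = ideal_power R I m \<cdot> ideal_power R I n"
  using assms
  by (induction n) (simp_all only: ideal_power_Suc ideal_power_0 ideal_prod_one ideal_power_ideal
    add_0_right add_Suc_right ideal_prod_assoc)

lemma ideal_power_mult:
  assumes "ideal I R"
  shows "ideal_power R (ideal_power R I m) n = ideal_power R I (m * n)"
  using assms
  by (induction n) (simp_all only: ideal_power_Suc ideal_power_0 ideal_power_add mult_Suc_right
     mult_0_right ideal_prod_commute ideal_power_ideal)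

lemma ideal_power_base_mono: "I \<subseteq> J \<Longrightarrow> ideal_power R I n \<subseteq> ideal_power R J n"
  by (induction n) (simp_all only: ideal_power_Suc ideal_power_0 ideal_prod_mono order_refl)

lemma ideal_power_antimono:
  assumes "ideal I R" "m \<le> n"
  shows "ideal_power R I n \<subseteq> ideal_power R I m"
  using ideal_prod_le1[of "ideal_power R I m" "ideal_power R I (n - m)"] assms
  by (simp flip: ideal_power_add)

lemma ideal_power_prod_mem:
  "ideal I R \<Longrightarrow> a \<in> ideal_power R I m \<Longrightarrow> b \<in> ideal_power R I n \<Longrightarrow> a \<otimes> b \<in> ideal_power R I (m + n)"
  by (simp add: ideal_power_add ideal_prod.prod)

lemma elem_power_mem:
  assumes "ideal I R" "y \<in> I"
  shows "y [^] n \<in> ideal_power R I n"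
proof (induction n)
  case 0
  then show ?case by (simp add: ideal_power_0)
next
  case (Suc n)
  have "y [^] Suc n = y [^] n \<otimes> y" by simp
  then show ?case unfolding ideal_power_Suc using Suc assms(2) by (simp add: ideal_prod.prod)
qed

text \<open>Splitting the last factor \<open>A + B\<close>, the part ending in \<open>A\<close> uses
  the claim for \<open>(p - 1, q)\<close> and the part ending in \<open>B\<close> the claim for
  \<open>(p, q - 1)\<close>. If \<open>p\<close> or \<open>q\<close> is 0, the right-hand side is
  the whole ring.\<close>

lemma ideal_power_sum:
  assumes A: "ideal A R" and B: "ideal B R"
  shows "ideal_power R (A <+> B) (p + q) \<subseteq> ideal_power R A p <+> ideal_power R B q"
proof (induction "p + q" arbitrary: p q)
  case 0
  then show ?case using ideal_sum_ge1[OF oneideal, of "carrier R"] by (simp add: ideal_power_0)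
next
  case (Suc k)
  let ?T = "ideal_power R A p <+> ideal_power R B q"
  have AB: "ideal (A <+> B) R" and T: "ideal ?T R" using A B by (auto intro!: add_ideals)
  show ?case
  proof (cases "p = 0 \<or> q = 0")
    case True
    have "carrier R \<subseteq> ?T"
    proof (cases "p = 0")
      case True
      then show ?thesis using ideal_sum_ge1[of "ideal_power R B q" "carrier R"] B
        by (simp add: ideal_power_0)
    next
      case False
      then show ?thesis using True ideal_sum_ge2[of "ideal_power R A p" "carrier R"] A
        by (simp add: ideal_power_0)
    qed
    then show ?thesis using ideal_subset_carrier[OF ideal_power_ideal[OF AB]] by blast
  next
    case False
    then obtain p' q' where pq: "p = Suc p'" "q = Suc q'" by (meson not0_implies_Suc)
    let ?P = "ideal_power R (A <+> B) k"
    have P: "ideal ?P R" using AB by simp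
    have 1: "?P \<subseteq> ideal_power R A p' <+> ideal_power R B q"
      and 2: "?P \<subseteq> ideal_power R A p <+> ideal_power R B q'"
      using Suc(1)[of p' q] Suc(1)[of p q'] Suc(2) pq by auto
    have "?P \<cdot> A \<subseteq> (ideal_power R A p' <+> ideal_power R B q) \<cdot> A"
      by (intro ideal_prod_mono 1 order_refl)
    also have "\<dots> = ideal_power R A p <+> ideal_power R B q \<cdot> A"
      using A B by (simp only: pq ideal_power_Suc ideal_prod_distr ideal_power_ideal ideal_prod_is_ideal)
    also have "\<dots> \<subseteq> ?T" using A B by (intro ideal_sum_mono order_refl ideal_prod_le1) auto
    finally have a: "?P \<cdot> A \<subseteq> ?T" .
    have "?P \<cdot> B \<subseteq> (ideal_power R A p <+> ideal_power R B q') \<cdot> B"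
      by (intro ideal_prod_mono 2 order_refl)
    also have "\<dots> = ideal_power R A p \<cdot> B <+> ideal_power R B q"
      using A B by (simp only: pq(2) ideal_power_Suc ideal_prod_distr ideal_power_ideal ideal_prod_is_ideal)
    also have "\<dots> \<subseteq> ?T" using A B by (intro ideal_sum_mono order_refl ideal_prod_le1) auto
    finally have b: "?P \<cdot> B \<subseteq> ?T" .
    have "ideal_power R (A <+> B) (p + q) = ?P \<cdot> A <+> ?P \<cdot> B"
      unfolding Suc(2)[symmetric] ideal_power_Suc using P A B by (intro ideal_prod_distr)
    then show ?thesis using ideal_sum_le[OF T a b] by simp
  qed
qed

lemma PIdl_power_le:
  assumes x: "x \<in> carrier R"
  shows "ideal_power R (PIdl x) j \<subseteq> PIdl (x [^] j)"
proof (induction j)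
  case 0
  then show ?case using cgenideal_self[OF one_closed]
      ideal.one_imp_carrier[OF cgenideal_ideal[OF one_closed]] by (simp add: ideal_power_0)
next
  case (Suc j)
  have "ideal_power R (PIdl x) j \<cdot> (PIdl x) \<subseteq> (PIdl (x [^] j)) \<cdot> (PIdl x)"
    by (intro ideal_prod_mono Suc order_refl)
  also have "\<dots> \<subseteq> PIdl (x [^] Suc j)"
    unfolding ideal_prod_le_iff[OF cgenideal_ideal[OF nat_pow_closed[OF x]]]
  proof (intro ballI)
    fix a b assume "a \<in> PIdl (x [^] j)" "b \<in> PIdl x"
    then obtain r s where "r \<in> carrier R" "s \<in> carrier R" "a = r \<otimes> x [^] j" "b = s \<otimes> x"
      by (auto simp: cgenideal_def)
    moreover have "(r \<otimes> x [^] j) \<otimes> (s \<otimes> x) = (r \<otimes> s) \<otimes> (x [^] j \<otimes> x)"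
      using x calculation nat_pow_closed[of x j] by algebra
    ultimately show "a \<otimes> b \<in> PIdl (x [^] Suc j)"
      by (auto simp: cgenideal_def Group.nat_pow_Suc)
  qed
  finally show ?case by (simp only: ideal_power_Suc)
qed

text \<open>The exponents belonging to the single generators are added up by
  \<open>ideal_power_sum\<close>.\<close>

lemma Idl_power_le:
  assumes "finite X" "X \<subseteq> carrier R" "ideal K R" "\<And>x. x \<in> X \<Longrightarrow> \<exists>n::nat. x [^] n \<in> K"
  shows "\<exists>n. ideal_power R (Idl X) n \<subseteq> K"
  using assms
proof (induction X rule: finite_induct)
  case empty
  have "ideal_power R (Idl {}) 1 \<subseteq> K"
    using empty by (simp add: Idl_empty ideal_power_1 zeroideal ideal_zero_mem)
  then show ?case by blast
next
  case (insert x X)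
  then obtain n k where n: "ideal_power R (Idl X) n \<subseteq> K" and k: "x [^] (k::nat) \<in> K" by (meson insertCI insert_subset)
  have xX: "x \<in> carrier R" "X \<subseteq> carrier R" using insert by auto
  have "ideal_power R (PIdl x) k \<subseteq> PIdl (x [^] k)" by (rule PIdl_power_le[OF xX(1)])
  then have "ideal_power R (PIdl x) k \<subseteq> K"
    using k insert.prems(2) cgenideal_minimal by blast
  then have "ideal_power R (Idl X <+> PIdl x) (n + k) \<subseteq> K"
    using ideal_power_sum[of "Idl X" "PIdl x" n k] n ideal_sum_le[OF insert.prems(2)]
      genideal_ideal[OF xX(2)] cgenideal_ideal[OF xX(1)] by blast
  moreover have "Idl (insert x X) = Idl X <+> PIdl x"
    using Idl_insert xX by (simp add: adjoin_def)
  ultimately show ?case by auto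
qed

end

section \<open>Local Noetherian rings\<close>

locale local_noetherian = cring R for R (structure) +
  fixes \<mm> :: "'a set"
  assumes noetherian: "noetherian_ring R" and maximal_eq: "{M. maximalideal M R} = {\<mm>}"
begin

text \<open>The maximal condition for an arbitrary property of ideals. It also supplies the
  stabilisation of ascending colon ideals and Noetherian induction on counterexamples.\<close>

lemma ex_maximal:
  assumes "P I" "\<And>I. P I \<Longrightarrow> ideal I R"
  obtains M where "P M" "\<And>K. P K \<Longrightarrow> M \<subseteq> K \<Longrightarrow> K = M"
proof -
  let ?S = "Collect P"
  have "\<exists>M\<in>?S. \<forall>X\<in>?S. M \<subseteq> X \<longrightarrow> X = M"
  proof (rule subset_Zorn_nonempty)
    show "?S \<noteq> {}" using assms(1) by auto
    fix C assume C: "C \<noteq> {}" "subset.chain ?S C"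
    then have "subset.chain {I. ideal I R} C" using assms(2) by (auto simp: pred_on.chain_def)
    then show "\<Union>C \<in> ?S"
      using noetherian_ring.ideal_chain_is_trivial[OF noetherian C(1)] C(2)
      by (auto simp: pred_on.chain_def)
  qed
  then show ?thesis using that by blast
qed

lemma m_maximal: "maximalideal \<mm> R"
  using maximal_eq by auto

lemma m_ideal [simp]: "ideal \<mm> R"
  using m_maximal by (simp add: maximalideal.axioms(1))

lemma m_carrier: "a \<in> \<mm> \<Longrightarrow> a \<in> carrier R"
  using m_ideal ideal.Icarr by fastforce

lemma m_prime: "primeideal \<mm> R"
  using m_maximal by (rule maximalideal_prime)

lemma one_not_in_m: "\<one> \<notin> \<mm>"
  using maximalideal.I_notcarr[OF m_maximal] ideal.one_imp_carrier[OF m_ideal] by metis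

lemma proper_le_m:
  assumes "ideal I R" "I \<noteq> carrier R"
  shows "I \<subseteq> \<mm>"
proof -
  obtain M where M: "ideal M R \<and> I \<subseteq> M \<and> M \<noteq> carrier R"
      "\<And>K. ideal K R \<and> I \<subseteq> K \<and> K \<noteq> carrier R \<Longrightarrow> M \<subseteq> K \<Longrightarrow> K = M"
    by (rule ex_maximal[of "\<lambda>K. ideal K R \<and> I \<subseteq> K \<and> K \<noteq> carrier R" I]) (use assms in auto)
  have "maximalideal M R"
  proof (rule maximalidealI)
    show "ideal M R" "carrier R \<noteq> M" using M(1) by auto
    fix K assume "ideal K R" "M \<subseteq> K" "K \<subseteq> carrier R"
    then show "K = M \<or> K = carrier R" using M(1) M(2)[of K] by auto
  qed
  then show ?thesis using M maximal_eq by auto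
qed

lemma unit_of_not_in_m:
  assumes "u \<in> carrier R" "u \<notin> \<mm>"
  obtains v where "v \<in> carrier R" "v \<otimes> u = \<one>"
proof -
  have "PIdl u = carrier R"
    using proper_le_m[OF cgenideal_ideal[OF assms(1)]] cgenideal_self[OF assms(1)] assms(2) by auto
  then have "\<one> \<in> PIdl u" by simp
  then show ?thesis using that by (auto simp: cgenideal_def)
qed

lemma unit_cancel_mem:
  assumes "ideal K R" "u \<in> carrier R" "u \<notin> \<mm>" "b \<in> carrier R" "u \<otimes> b \<in> K"
  shows "b \<in> K"
proof -
  obtain v where v: "v \<in> carrier R" "v \<otimes> u = \<one>" using unit_of_not_in_m assms by blast
  have "b = v \<otimes> (u \<otimes> b)" using v assms by (metis l_one m_assoc)
  then show ?thesis using assms v ideal.I_l_closed by metis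
qed

lemma one_minus_unit: "z \<in> \<mm> \<Longrightarrow> \<one> \<ominus> z \<notin> \<mm>"
  using one_not_in_m ideal_mem_of_diff[OF m_ideal, of \<one> z] by blast

lemma prime_le_m: "primeideal P R \<Longrightarrow> P \<subseteq> \<mm>"
  using proper_le_m[of P] primeideal.I_notcarr primeideal.axioms(1) by metis

lemma finite_generators:
  assumes "ideal I R"
  obtains X where "X \<subseteq> carrier R" "finite X" "I = Idl X"
  using noetherian_ring.finetely_gen[OF noetherian assms] by blast

text \<open>A maximal ideal \<open>K\<close> among those above \<open>I\<close> avoiding \<open>b\<close> satisfies \<open>\<mm> b \<subseteq> K\<close>;
  as the colon ideals of \<open>K\<close> by powers of \<open>z \<in> \<mm>\<close> stabilise, it contains a power of \<open>\<mm>\<close>.\<close>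

lemma krull_intersection:
  assumes I: "ideal I R" and b: "b \<in> carrier R" and *: "\<And>n. b \<in> I <+> ideal_power R \<mm> n"
  shows "b \<in> I"
proof (rule ccontr)
  assume "b \<notin> I"
  obtain K where K: "ideal K R \<and> I \<subseteq> K \<and> b \<notin> K"
    and max: "\<And>L. ideal L R \<and> I \<subseteq> L \<and> b \<notin> L \<Longrightarrow> K \<subseteq> L \<Longrightarrow> L = K"
    by (rule ex_maximal[of "\<lambda>K. ideal K R \<and> I \<subseteq> K \<and> b \<notin> K" I]) (use I \<open>b \<notin> I\<close> in auto)
  then have Ki: "ideal K R" and IK: "I \<subseteq> K" and bK: "b \<notin> K" by auto
  have grow: "b \<in> adjoin K y" if "y \<in> carrier R" "y \<notin> K" for y
  proof (rule ccontr)
    assume "b \<notin> adjoin K y"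
    then have "adjoin K y = K"
      using max[of "adjoin K y"] adjoin_ideal[OF Ki that(1)] adjoin_ge[OF Ki that(1)] IK by auto
    then show False using adjoin_self[OF Ki that(1)] that(2) by auto
  qed
  \<comment> \<open>If \<open>z b\<close> were outside \<open>K\<close>, maximality would give
    \<open>b = k + r z b\<close>, and the unit \<open>1 - r z\<close> would move \<open>b\<close>
    into \<open>K\<close>.\<close>
  have mb: "z \<otimes> b \<in> K" if z: "z \<in> \<mm>" for z
  proof (rule ccontr)
    assume n: "z \<otimes> b \<notin> K"
    have zc: "z \<in> carrier R" "z \<otimes> b \<in> carrier R" using z m_carrier b by auto
    have "b \<in> adjoin K (z \<otimes> b)" using grow n zc(2) by simp
    then obtain k r where kr: "k \<in> K" "r \<in> carrier R" "b = k \<oplus> r \<otimes> (z \<otimes> b)" by (auto simp: mem_adjoin)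
    have kc: "k \<in> carrier R" using kr(1) Ki ideal.Icarr by metis
    have "k = b \<ominus> r \<otimes> (z \<otimes> b)"
    proof -
      have "(k \<oplus> r \<otimes> (z \<otimes> b)) \<ominus> r \<otimes> (z \<otimes> b) = k" using kc kr(2) zc b by algebra
      then show ?thesis using kr(3) by simp
    qed
    also have "\<dots> = (\<one> \<ominus> r \<otimes> z) \<otimes> b" using kc kr(2) zc b by algebra
    finally have "(\<one> \<ominus> r \<otimes> z) \<otimes> b \<in> K" using kr(1) by simp
    moreover have "\<one> \<ominus> r \<otimes> z \<notin> \<mm>" using one_minus_unit ideal.I_l_closed[OF m_ideal z kr(2)] by blast
    ultimately show False using unit_cancel_mem[OF Ki, of "\<one> \<ominus> r \<otimes> z" b] bK b zc kr(2) by auto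
  qed
  \<comment> \<open>Otherwise \<open>b = k + r z^n\<close> by maximality. From
    \<open>z b \<in> K\<close> follows \<open>r z^(n+1) \<in> K\<close>; as the colon ideals are
    stable this already means \<open>r z^n \<in> K\<close>, hence \<open>b \<in> K\<close>.\<close>
  have pw: "\<exists>n::nat. z [^] n \<in> K" if z: "z \<in> \<mm>" for z
  proof -
    have zc: "z \<in> carrier R" using z m_carrier by auto
    let ?P = "\<lambda>L. \<exists>n::nat. L = colon K (z [^] n)"
    obtain M where "?P M" and Mx: "\<And>L. ?P L \<Longrightarrow> M \<subseteq> L \<Longrightarrow> L = M"
      by (rule ex_maximal[of ?P "colon K (z [^] (0::nat))"])
        (use colon_ideal[OF Ki nat_pow_closed[OF zc]] in \<open>blast, metis, auto\<close>)
    then obtain n0 where n0: "M = colon K (z [^] (n0::nat))" by blast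
    define n where "n = Suc n0"
    have st: "colon K (z [^] (n0 + j)) = M" for j :: nat
    proof (rule Mx)
      show "?P (colon K (z [^] (n0 + j)))" by blast
      show "M \<subseteq> colon K (z [^] (n0 + j))"
      proof -
        have "colon K (z [^] (n0 + j)) = colon (colon K (z [^] n0)) (z [^] j)"
          using zc by (simp add: colon_colon nat_pow_mult add.commute)
        then show ?thesis using n0 colon_ge[OF colon_ideal[OF Ki]] zc by simp
      qed
    qed
    have "z [^] n \<in> K"
    proof (rule ccontr)
      assume nK: "z [^] n \<notin> K"
      have znc: "z [^] n \<in> carrier R" using zc by simp
      have "b \<in> adjoin K (z [^] n)" using grow nK znc by simp
      then obtain k r where kr: "k \<in> K" "r \<in> carrier R" "b = k \<oplus> r \<otimes> z [^] n" by (auto simp: mem_adjoin)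
      have kc: "k \<in> carrier R" using kr(1) Ki ideal.Icarr by metis
      have "z \<otimes> (r \<otimes> z [^] n) = z \<otimes> b \<ominus> z \<otimes> k"
        unfolding kr(3) using kc kr(2) znc zc by algebra
      then have "z \<otimes> (r \<otimes> z [^] n) \<in> K"
        using mb[OF z] ideal.I_l_closed[OF Ki kr(1) zc] ideal_diff_mem[OF Ki] by simp
      moreover have "z \<otimes> (r \<otimes> z [^] n) = r \<otimes> z [^] (n0 + 2)"
        using zc kr(2) by (simp add: n_def m_ac)
      ultimately have "r \<in> colon K (z [^] (n0 + 2))" using kr(2) by (simp add: mem_colon)
      then have "r \<in> colon K (z [^] (n0 + 1))" using st by blast
      then have "r \<otimes> z [^] n \<in> K" by (simp add: mem_colon n_def)
      then show False using kr bK ideal_add_mem[OF Ki] by metis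
    qed
    then show ?thesis by blast
  qed
  obtain X where X: "X \<subseteq> carrier R" "finite X" "\<mm> = Idl X" using finite_generators[OF m_ideal] .
  then obtain n where n: "ideal_power R \<mm> n \<subseteq> K"
    using Idl_power_le[OF X(2,1) Ki] pw genideal_self[OF X(1)] by blast
  then show False using *[of n] ideal_sum_le[OF Ki IK n] bK by blast
qed

lemma ideal_sum_m_power: "ideal (I <+> ideal_power R \<mm> n) R" if "ideal I R"
  using that by (intro add_ideals) auto

text \<open>Iterating the inclusion gives \<open>K \<subseteq> L + \<mm>^n K\<close> for every
  \<open>n\<close>, and Krull's intersection theorem for \<open>L\<close> finishes the
  proof.\<close>

lemma nakayama:
  assumes K: "ideal K R" and L: "ideal L R" and le: "K \<subseteq> L <+> \<mm> \<cdot> K"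
  shows "K \<subseteq> L"
proof
  fix b assume b: "b \<in> K"
  have "K \<subseteq> L <+> ideal_power R \<mm> n \<cdot> K" for n
  proof (induction n)
    case 0
    then show ?case using K L by (simp add: ideal_power_0 carrier_prod ideal_sum_ge2 ideal_subset_carrier)
  next
    case (Suc n)
    have mn: "ideal (ideal_power R \<mm> n) R" "ideal (\<mm> \<cdot> K) R" using K by (auto intro: ideal_prod_is_ideal)
    have "ideal_power R \<mm> n \<cdot> K \<subseteq> ideal_power R \<mm> n \<cdot> (L <+> \<mm> \<cdot> K)"
      by (intro ideal_prod_mono le order_refl)
    also have "\<dots> = ideal_power R \<mm> n \<cdot> L <+> ideal_power R \<mm> (Suc n) \<cdot> K"
      using K L mn by (simp only: ideal_prod_distr ideal_prod_assoc ideal_power_Suc m_ideal)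
    also have "\<dots> \<subseteq> L <+> ideal_power R \<mm> (Suc n) \<cdot> K"
      using L mn by (intro ideal_sum_mono ideal_prod_le2 order_refl)
    finally have 1: "ideal_power R \<mm> n \<cdot> K \<subseteq> L <+> ideal_power R \<mm> (Suc n) \<cdot> K" .
    have mK: "ideal (ideal_power R \<mm> (Suc n) \<cdot> K) R" using K by (intro ideal_prod_is_ideal) auto
    have 2: "ideal (L <+> ideal_power R \<mm> (Suc n) \<cdot> K) R" "L \<subseteq> L <+> ideal_power R \<mm> (Suc n) \<cdot> K"
      using mK L by (auto intro!: add_ideals intro: subsetD[OF ideal_sum_ge1[OF mK ideal_subset_carrier]])
    show ?case using Suc ideal_sum_le[OF 2(1) 2(2) 1] by blast
  qed
  moreover have "L <+> ideal_power R \<mm> n \<cdot> K \<subseteq> L <+> ideal_power R \<mm> n" for n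
    using K by (intro ideal_sum_mono ideal_prod_le1 order_refl) auto
  ultimately have "b \<in> L <+> ideal_power R \<mm> n" for n using b by blast
  then show "b \<in> L" using krull_intersection[OF L] b K ideal.Icarr by metis
qed

subsection \<open>Colength of primary ideals\<close>

definition ideals_over :: "'a set \<Rightarrow> 'a set set"
  where "ideals_over I = {K. ideal K R \<and> I \<subseteq> K}"

definition len :: "'a set \<Rightarrow> nat"
  where "len I = the_enat (height (ideals_over I))"

definition mprimary :: "'a set \<Rightarrow> bool"
  where "mprimary I \<longleftrightarrow> ideal I R \<and> (\<exists>n. ideal_power R \<mm> n \<subseteq> I)"

lemma mprimary_ideal: "mprimary I \<Longrightarrow> ideal I R"
  by (simp add: mprimary_def)

lemma mprimary_mono: "mprimary I \<Longrightarrow> ideal K R \<Longrightarrow> I \<subseteq> K \<Longrightarrow> mprimary K"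
  by (auto simp: mprimary_def)

lemma mprimary_adjoin: "mprimary I \<Longrightarrow> y \<in> carrier R \<Longrightarrow> mprimary (adjoin I y)"
  using mprimary_mono adjoin_ge adjoin_ideal mprimary_ideal by metis

lemma mprimary_colon: "mprimary I \<Longrightarrow> y \<in> carrier R \<Longrightarrow> mprimary (colon I y)"
  using mprimary_mono colon_ge colon_ideal mprimary_ideal by metis

text \<open>Additivity of length on the exact sequence from \<open>R / (I : y)\<close> by
  multiplication with \<open>y\<close> to \<open>R / I\<close> and on to
  \<open>R / (I + (y))\<close>.\<close>

lemma height_adjoin_colon:
  assumes I: "ideal I R" and y: "y \<in> carrier R"
  shows "height (ideals_over I) = height (ideals_over (adjoin I y)) + height (ideals_over (colon I y))"
proof (rule antisym)
  show "height (ideals_over I) \<le> height (ideals_over (adjoin I y)) + height (ideals_over (colon I y))"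
  proof (rule height_split[where f = "\<lambda>A. adjoin A y" and g = "\<lambda>A. colon A y"])
    fix A assume A: "A \<in> ideals_over I"
    then show "adjoin A y \<in> ideals_over (adjoin I y)" "colon A y \<in> ideals_over (colon I y)"
      using y by (auto simp: ideals_over_def adjoin_ideal colon_ideal dest: adjoin_mono colon_mono)
    fix B assume B: "B \<in> ideals_over I" "A \<subset> B"
    then show "adjoin A y \<subseteq> adjoin B y" "colon A y \<subseteq> colon B y"
      by (auto intro!: adjoin_mono colon_mono)
    assume e: "adjoin A y = adjoin B y" "colon A y = colon B y"
    have AB: "ideal A R" "ideal B R" using A B by (auto simp: ideals_over_def)
    \<comment> \<open>An element of \<open>B\<close> has the form \<open>a + r y\<close> with
      \<open>a \<in> A\<close>; then \<open>r\<close> lies in \<open>B : y = A : y\<close>, so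
      \<open>r y\<close> is in \<open>A\<close> too.\<close>
    have "B \<subseteq> A"
    proof
      fix b assume b: "b \<in> B"
      then have "b \<in> adjoin A y" using e adjoin_ge[OF AB(2) y] by auto
      then obtain a r where ar: "a \<in> A" "r \<in> carrier R" "b = a \<oplus> r \<otimes> y" by (auto simp: mem_adjoin)
      have "r \<otimes> y \<oplus> a \<in> B" using b ar AB y ideal.Icarr[OF AB(1)] by (simp add: a_comm)
      then have "r \<otimes> y \<in> B" using ar B y AB(2) ideal_mem_of_add[of B "r \<otimes> y" a] by auto
      then have "r \<in> colon A y" using e ar by (simp add: mem_colon)
      then show "b \<in> A" using ar AB ideal_add_mem[of A] by (simp add: mem_colon)
    qed
    then show False using B by auto
  qed
  let ?G = "{K. ideal K R \<and> I \<subseteq> K \<and> K \<subseteq> adjoin I y}"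
  \<comment> \<open>An ideal \<open>B\<close> above the colon goes to \<open>I + B y\<close>, which
    lies between \<open>I\<close> and \<open>I + (y)\<close>. Such chains can be continued by chains
    of ideals above \<open>I + (y)\<close>.\<close>
  have "height (ideals_over (colon I y)) \<le> height ?G"
  proof (rule height_map[where f = "\<lambda>B. {i \<oplus> b \<otimes> y | i b. i \<in> I \<and> b \<in> B}"])
    fix A assume A: "A \<in> ideals_over (colon I y)"
    let ?f = "\<lambda>B. {i \<oplus> b \<otimes> y | i b. i \<in> I \<and> b \<in> B}"
    have Ai: "ideal A R" and Ac: "A \<subseteq> carrier R" and Ic: "I \<subseteq> carrier R"
      using A I by (auto simp: ideals_over_def ideal_subset_carrier ideal.Icarr)
    have "ideal (?f A) R"
    proof (rule ideal_of_closed)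
      show "?f A \<subseteq> carrier R" using Ac Ic y by auto
      show "\<zero> \<in> ?f A" using ideal_zero_mem[OF Ai] ideal_zero_mem[OF I] y by force
    next
      fix a b assume "a \<in> ?f A" "b \<in> ?f A"
      then obtain i r j s where *: "a = i \<oplus> r \<otimes> y" "b = j \<oplus> s \<otimes> y" "i \<in> I" "j \<in> I" "r \<in> A" "s \<in> A" by blast
      have "i \<in> carrier R" "j \<in> carrier R" "r \<in> carrier R" "s \<in> carrier R" using * Ac Ic by auto
      then have "a \<oplus> b = (i \<oplus> j) \<oplus> (r \<oplus> s) \<otimes> y" unfolding * using y by algebra
      then show "a \<oplus> b \<in> ?f A" using * ideal_add_mem[OF Ai] ideal_add_mem[OF I] by blast
    next
      fix t a assume t: "t \<in> carrier R" "a \<in> ?f A"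
      then obtain i r where *: "a = i \<oplus> r \<otimes> y" "i \<in> I" "r \<in> A" by blast
      have "i \<in> carrier R" "r \<in> carrier R" using * Ac Ic by auto
      then have "t \<otimes> a = t \<otimes> i \<oplus> (t \<otimes> r) \<otimes> y" unfolding * using y t by algebra
      then show "t \<otimes> a \<in> ?f A" using * ideal.I_l_closed[OF Ai] ideal.I_l_closed[OF I] t by blast
    qed
    moreover have "I \<subseteq> ?f A"
    proof
      fix i assume "i \<in> I"
      then have "i = i \<oplus> \<zero> \<otimes> y" "\<zero> \<in> A" using Ic y ideal_zero_mem[OF Ai] by auto
      then show "i \<in> ?f A" using \<open>i \<in> I\<close> by blast
    qed
    moreover have "?f A \<subseteq> adjoin I y" using Ac unfolding mem_adjoin subset_iff by blast
    ultimately show "?f A \<in> ?G" by simp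
    fix B assume B: "B \<in> ideals_over (colon I y)" "A \<subset> B"
    have Bi: "ideal B R" using B by (simp add: ideals_over_def)
    obtain b where b: "b \<in> B" "b \<notin> A" using B by auto
    have bc: "b \<in> carrier R" using b Bi ideal.Icarr by metis
    have bB: "b \<otimes> y \<in> ?f B"
    proof -
      have "b \<otimes> y = \<zero> \<oplus> b \<otimes> y" using bc y by simp
      then show ?thesis using b ideal_zero_mem[OF I] by blast
    qed
    have bA: "b \<otimes> y \<notin> ?f A"
    proof
      assume "b \<otimes> y \<in> ?f A"
      then obtain i a where ia: "b \<otimes> y = i \<oplus> a \<otimes> y" "i \<in> I" "a \<in> A" by blast
      have iac: "i \<in> carrier R" "a \<in> carrier R" using ia Ac Ic by auto
      have "(b \<ominus> a) \<otimes> y = b \<otimes> y \<ominus> a \<otimes> y" using iac bc y by algebra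
      also have "\<dots> = i" unfolding ia(1) using iac y by algebra
      finally have "b \<ominus> a \<in> colon I y" using ia iac bc by (simp add: mem_colon)
      then have "b \<ominus> a \<in> A" using A by (auto simp: ideals_over_def)
      then show False using b ia ideal_mem_of_diff[OF Ai, of b a] bc by blast
    qed
    have "?f A \<subseteq> ?f B" using B by blast
    then show "?f A \<subset> ?f B" using bA bB by blast
  qed
  then have "height (ideals_over (adjoin I y)) + height (ideals_over (colon I y))
      \<le> height ?G + height (ideals_over (adjoin I y))"
    by (simp add: add.commute add_mono)
  also have "\<dots> \<le> height (ideals_over I)"
    using adjoin_ge[OF I y] by (intro height_concat) (auto simp: ideals_over_def)
  finally show "height (ideals_over (adjoin I y)) + height (ideals_over (colon I y)) \<le> height (ideals_over I)" .
qed

lemma ideals_over_m: "ideals_over \<mm> = {\<mm>, carrier R}"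
  using proper_le_m oneideal ideal_subset_carrier[OF m_ideal] by (auto simp: ideals_over_def)

text \<open>If \<open>\<mm>^k\<close> is the last power of \<open>\<mm>\<close> not inside
  \<open>I\<close>, every \<open>y \<in> \<mm>^k - I\<close> is annihilated by \<open>\<mm>\<close>
  modulo \<open>I\<close>.\<close>

lemma socle_element:
  assumes "mprimary I" "I \<noteq> carrier R"
  obtains y where "y \<in> carrier R" "y \<notin> I" "colon I y = \<mm>"
proof -
  have I: "ideal I R" using assms by (simp add: mprimary_def)
  obtain n where n: "ideal_power R \<mm> n \<subseteq> I" "\<And>k. k < n \<Longrightarrow> \<not> ideal_power R \<mm> k \<subseteq> I"
    using assms(1) exists_least_iff[of "\<lambda>n. ideal_power R \<mm> n \<subseteq> I"] by (auto simp: mprimary_def)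
  have "n \<noteq> 0" using n(1) assms(2) ideal_subset_carrier[OF I] by (auto simp: ideal_power_0)
  then obtain k where k: "n = Suc k" by (meson not0_implies_Suc)
  then obtain y where y: "y \<in> ideal_power R \<mm> k" "y \<notin> I" using n(2)[of k] by auto
  have yc: "y \<in> carrier R" using y ideal.Icarr[OF ideal_power_ideal[OF m_ideal]] by blast
  have "\<mm> \<subseteq> colon I y"
  proof
    fix z assume z: "z \<in> \<mm>"
    have "y \<otimes> z \<in> I" using n(1) y z unfolding k ideal_power_Suc by (auto intro: ideal_prod.prod)
    then show "z \<in> colon I y" using z m_carrier yc by (simp add: mem_colon m_comm)
  qed
  moreover have "colon I y \<noteq> carrier R"
    using y yc one_closed by (metis l_one mem_colon)
  ultimately have "colon I y = \<mm>"
    using proper_le_m[OF colon_ideal[OF I yc]] by blast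
  then show ?thesis using that y yc by blast
qed

text \<open>Noetherian induction: for a maximal counterexample \<open>K\<close> and a socle element
  \<open>y\<close>, the height splits into that of \<open>K + (y)\<close>, finite by maximality, and
  that of \<open>K : y = \<mm>\<close>, which is at most 1.\<close>

lemma height_finite:
  assumes "mprimary I"
  shows "height (ideals_over I) \<noteq> \<infinity>"
proof (rule ccontr)
  assume "\<not> height (ideals_over I) \<noteq> \<infinity>"
  then have "mprimary I \<and> height (ideals_over I) = \<infinity>" using assms by simp
  then obtain K where K': "mprimary K \<and> height (ideals_over K) = \<infinity>"
    and max: "\<And>L. mprimary L \<and> height (ideals_over L) = \<infinity> \<Longrightarrow> K \<subseteq> L \<Longrightarrow> L = K"
    by (rule ex_maximal[of "\<lambda>I. mprimary I \<and> height (ideals_over I) = \<infinity>" I])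
      (auto simp: mprimary_def)
  then have K: "mprimary K" "height (ideals_over K) = \<infinity>" by auto
  have "K \<noteq> carrier R"
  proof
    assume "K = carrier R"
    then have "height (ideals_over K) \<le> 1"
      by (intro height_le_one[of _ "carrier R" "carrier R"]) (auto simp: ideals_over_def ideal.Icarr)
    then show False using K(2) by simp
  qed
  then obtain y where y: "y \<in> carrier R" "y \<notin> K" "colon K y = \<mm>" using socle_element[OF K(1)] by blast
  have Ki: "ideal K R" using K(1) by (simp add: mprimary_def)
  have "adjoin K y \<noteq> K" using adjoin_self[OF Ki y(1)] y by auto
  then have "height (ideals_over (adjoin K y)) \<noteq> \<infinity>"
    using max[of "adjoin K y"] mprimary_adjoin[OF K(1) y(1)] adjoin_ge[OF Ki y(1)] by auto
  moreover have "height (ideals_over \<mm>) \<noteq> \<infinity>"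
    using height_le_one[of "ideals_over \<mm>" \<mm> "carrier R"] ideals_over_m
    by (metis infinity_ileE one_enat_def order_refl)
  ultimately show False using height_adjoin_colon[OF Ki y(1)] K(2) y(3) by auto
qed

lemma len_adjoin_colon:
  assumes "mprimary I" "y \<in> carrier R"
  shows "len I = len (adjoin I y) + len (colon I y)"
  using height_adjoin_colon[OF mprimary_ideal[OF assms(1)] assms(2)]
    height_finite[OF mprimary_adjoin[OF assms]] height_finite[OF mprimary_colon[OF assms]]
  by (auto simp: len_def)

lemma len_carrier: "len (carrier R) = 0"
proof -
  have "ideals_over (carrier R) = {carrier R}" using oneideal by (auto simp: ideals_over_def ideal.Icarr)
  moreover have "height {carrier R} = 0" by (rule height_singleton) simp
  ultimately show ?thesis by (simp add: len_def zero_enat_def)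
qed

lemma len_mono:
  assumes "mprimary I" "ideal K R" "I \<subseteq> K"
  shows "len K \<le> len I"
proof -
  have "height (ideals_over K) \<le> height (ideals_over I)"
    using assms by (intro height_mono) (auto simp: ideals_over_def)
  then show ?thesis using height_finite[OF assms(1)] height_finite[OF mprimary_mono[OF assms]]
    by (auto simp: len_def)
qed

lemma len_pos:
  assumes "mprimary I" "I \<noteq> carrier R"
  shows "0 < len I"
proof -
  have I: "ideal I R" using assms by (simp add: mprimary_def)
  then have "chain_in (ideals_over I) 1 (\<lambda>i. if i = 0 then I else carrier R)"
    using assms oneideal ideal_subset_carrier[OF I] by (auto simp: chain_in_def ideals_over_def)
  then have "enat 1 \<le> height (ideals_over I)" by (rule height_ge)
  then show ?thesis using height_finite[OF assms(1)] by (auto simp: len_def)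
qed

text \<open>An element \<open>y \<in> K - I\<close> would make the colengths differ by at least
  \<open>len (colon I y) > 0\<close>.\<close>

lemma len_eq_imp_eq:
  assumes "mprimary I" "ideal K R" "I \<subseteq> K" "len I \<le> len K"
  shows "I = K"
proof (rule ccontr)
  assume "I \<noteq> K"
  then obtain y where y: "y \<in> K" "y \<notin> I" using assms by auto
  have yc: "y \<in> carrier R" using y assms(2) ideal.Icarr by metis
  have "colon I y \<noteq> carrier R" using y yc one_closed by (metis l_one mem_colon)
  then have "0 < len (colon I y)" using len_pos mprimary_colon[OF assms(1) yc] by blast
  moreover have "len K \<le> len (adjoin I y)"
    using y assms(2,3) by (intro len_mono mprimary_adjoin assms(1) yc adjoin_le)
  ultimately show False using len_adjoin_colon[OF assms(1) yc] assms(4) by linarith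
qed

end

section \<open>Sums of antitone functions over lattice points\<close>

definition expos_lt :: "nat \<Rightarrow> nat \<Rightarrow> nat list set"
  where "expos_lt d n = {a. length a = d \<and> sum_list a < n}"

definition expos :: "nat \<Rightarrow> nat \<Rightarrow> nat list set"
  where "expos d n = {a. length a = d \<and> sum_list a = n}"

text \<open>Models the length of \<open>R\<close> modulo an ideal that grows with an exponent
  vector. Hilbert-Samuel functions will be sums of such functions over
  \<open>expos_lt d n\<close>.\<close>

definition antitone :: "nat \<Rightarrow> (nat list \<Rightarrow> nat) \<Rightarrow> bool"
  where "antitone d g \<longleftrightarrow> (\<forall>a b. length a = d \<longrightarrow> list_all2 (\<le>) a b \<longrightarrow> g b \<le> g a)"

definition inc_hd :: "nat list \<Rightarrow> nat list"
  where "inc_hd a = Suc (hd a) # tl a"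

lemma inc_hd_Cons [simp]: "inc_hd (k # a) = Suc k # a"
  by (simp add: inc_hd_def)

lemma inj_on_inc_hd: "inj_on inc_hd (expos_lt (Suc d) n)"
proof (rule inj_onI)
  fix a b assume "a \<in> expos_lt (Suc d) n" "b \<in> expos_lt (Suc d) n" "inc_hd a = inc_hd b"
  then show "a = b" by (cases a; cases b) (simp_all add: expos_lt_def)
qed

lemma expos_lt_subset: "expos_lt d n \<subseteq> {a. set a \<subseteq> {..<n} \<and> length a = d}"
  using member_le_sum_list le_less_trans by (fastforce simp: expos_lt_def)

lemma finite_expos_lt [simp]: "finite (expos_lt d n)"
  by (rule finite_subset[OF expos_lt_subset]) (simp add: finite_lists_length_eq)

lemma finite_expos [simp]: "finite (expos d n)"
proof (rule finite_subset[OF _ finite_expos_lt])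
  show "expos d n \<subseteq> expos_lt d (Suc n)" by (auto simp: expos_def expos_lt_def)
qed

lemma expos_lt_Suc: "expos_lt d (Suc n) = expos_lt d n \<union> expos d n"
  by (auto simp: expos_lt_def expos_def)

lemma sum_expos_lt_Suc: "sum g (expos_lt d (Suc n)) = sum g (expos_lt d n) + sum g (expos d n)"
  unfolding expos_lt_Suc
proof (rule sum.union_disjoint)
  show "expos_lt d n \<inter> expos d n = {}" by (auto simp: expos_lt_def expos_def)
qed simp_all

lemma expos_lt_0 [simp]: "expos_lt d 0 = {}"
  by (simp add: expos_lt_def)

lemma sum_expos_lt_mono: "m \<le> n \<Longrightarrow> sum g (expos_lt d m) \<le> sum (g :: nat list \<Rightarrow> nat) (expos_lt d n)"
proof (rule sum_mono2[OF finite_expos_lt])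
  show "m \<le> n \<Longrightarrow> expos_lt d m \<subseteq> expos_lt d n" by (auto simp: expos_lt_def)
qed simp

lemma sum_expos_lt_rec:
  "sum (g :: nat list \<Rightarrow> nat) (expos_lt (Suc d) (Suc n)) =
     sum (\<lambda>a. g (0 # a)) (expos_lt d (Suc n)) + sum (\<lambda>a. g (inc_hd a)) (expos_lt (Suc d) n)"
proof -
  have *: "expos_lt (Suc d) (Suc n) = (#) 0 ` expos_lt d (Suc n) \<union> inc_hd ` expos_lt (Suc d) n"
  proof (intro equalityI subsetI)
    fix a assume a: "a \<in> expos_lt (Suc d) (Suc n)"
    then obtain k b where kb: "a = k # b" by (cases a) (auto simp: expos_lt_def)
    show "a \<in> (#) 0 ` expos_lt d (Suc n) \<union> inc_hd ` expos_lt (Suc d) n"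
    proof (cases k)
      case 0
      then show ?thesis using a kb by (auto simp: expos_lt_def)
    next
      case (Suc j)
      then have "a = inc_hd (j # b)" "j # b \<in> expos_lt (Suc d) n"
        using a kb by (auto simp: expos_lt_def inc_hd_def)
      then show ?thesis by blast
    qed
  next
    fix a assume "a \<in> (#) 0 ` expos_lt d (Suc n) \<union> inc_hd ` expos_lt (Suc d) n"
    then show "a \<in> expos_lt (Suc d) (Suc n)"
      by (auto simp: expos_lt_def inc_hd_def length_Suc_conv)
  qed
  have "sum g (expos_lt (Suc d) (Suc n)) =
      sum g ((#) 0 ` expos_lt d (Suc n)) + sum g (inc_hd ` expos_lt (Suc d) n)"
    unfolding *
  proof (rule sum.union_disjoint)
    show "(#) 0 ` expos_lt d (Suc n) \<inter> inc_hd ` expos_lt (Suc d) n = {}" by (auto simp: inc_hd_def)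
  qed simp_all
  also have "sum g ((#) 0 ` expos_lt d (Suc n)) = sum (\<lambda>a. g (0 # a)) (expos_lt d (Suc n))"
    by (subst sum.reindex) (auto simp: inj_on_def)
  also have "sum g (inc_hd ` expos_lt (Suc d) n) = sum (\<lambda>a. g (inc_hd a)) (expos_lt (Suc d) n)"
    by (simp add: sum.reindex[OF inj_on_inc_hd])
  finally show ?thesis .
qed

lemma list_all2_refl_le [simp]: "list_all2 (\<le>) a (a :: nat list)"
  by (simp add: list.rel_refl)

lemma antitone_Cons: "antitone (Suc d) g \<Longrightarrow> antitone d (\<lambda>a. g (k # a))"
  by (auto simp: antitone_def)

lemma antitone_inc_hd: "antitone (Suc d) g \<Longrightarrow> antitone (Suc d) (\<lambda>a. g (inc_hd a))"
  unfolding antitone_def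
proof (intro allI impI)
  fix a b :: "nat list"
  assume g: "\<forall>a b. length a = Suc d \<longrightarrow> list_all2 (\<le>) a b \<longrightarrow> g b \<le> g a"
    and "length a = Suc d" "list_all2 (\<le>) a b"
  then have "length (inc_hd a) = Suc d" "list_all2 (\<le>) (inc_hd a) (inc_hd b)"
    by (cases a; cases b; simp)+
  then show "g (inc_hd b) \<le> g (inc_hd a)" using g by blast
qed

lemma antitone_inc_hd_le:
  assumes "antitone (Suc d) g" "length a = Suc d"
  shows "g (inc_hd a) \<le> g a"
  using assms unfolding antitone_def inc_hd_def by (cases a) auto

text \<open>A relative of Dickson's lemma. On the diagonal of the first two entries induction gives
  a bound \<open>K0\<close>; a value with both entries at least \<open>K0\<close> is squeezed
  between two equal diagonal values. For each of the finitely many second entries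
  \<open>j < K0\<close> induction applies to the remaining ones, and \<open>K\<close> is the maximum
  of all bounds.\<close>

lemma antitone_stabilises:
  "antitone (Suc d) g \<Longrightarrow> \<exists>K. \<forall>k\<ge>K. \<forall>a. length a = d \<longrightarrow> g (k # a) = g (K # a)"
proof (induction d arbitrary: g)
  case 0
  obtain K where K: "\<And>k. g [K] \<le> g [k]" using ex_has_least_nat[of "\<lambda>_. True" 0 "\<lambda>k. g [k]"] by auto
  have "g [k] \<le> g [K]" if "k \<ge> K" for k
    using 0 that by (auto simp: antitone_def)
  then show ?case using K by (metis le_antisym length_0_conv)
next
  case (Suc d)
  have mono: "g (k # j # a) \<le> g (k' # j' # a)" if "k' \<le> k" "j' \<le> j" "length a = d" for k j k' j' a
    using Suc.prems that by (auto simp: antitone_def)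
  have "antitone (Suc d) (\<lambda>b. g (hd b # b))"
    unfolding antitone_def
  proof (intro allI impI)
    fix a b :: "nat list" assume "length a = Suc d" and le: "list_all2 (\<le>) a b"
    moreover from this have "hd a \<le> hd b" by (cases a; cases b) auto
    ultimately have "length (hd a # a) = Suc (Suc d)" "list_all2 (\<le>) (hd a # a) (hd b # b)" by auto
    then show "g (hd b # b) \<le> g (hd a # a)" using Suc.prems by (simp add: antitone_def)
  qed
  then obtain K0 where K0: "\<And>k a. k \<ge> K0 \<Longrightarrow> length a = d \<Longrightarrow> g (k # k # a) = g (K0 # K0 # a)"
    using Suc.IH[of "\<lambda>b. g (hd b # b)"] by auto
  have "\<exists>K. \<forall>k\<ge>K. \<forall>a. length a = d \<longrightarrow> g (k # j # a) = g (K # j # a)" for j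
  proof -
    have "antitone (Suc d) (\<lambda>b. g (hd b # j # tl b))"
      unfolding antitone_def
    proof (intro allI impI)
      fix a b :: "nat list" assume "length a = Suc d" and le: "list_all2 (\<le>) a b"
      then have "length (hd a # j # tl a) = Suc (Suc d)" "list_all2 (\<le>) (hd a # j # tl a) (hd b # j # tl b)"
        by (cases a; cases b; auto)+
      then show "g (hd b # j # tl b) \<le> g (hd a # j # tl a)" using Suc.prems by (simp add: antitone_def)
    qed
    then show ?thesis using Suc.IH[of "\<lambda>b. g (hd b # j # tl b)"] by simp
  qed
  then obtain F where F: "\<And>j k a. k \<ge> F j \<Longrightarrow> length a = d \<Longrightarrow> g (k # j # a) = g (F j # j # a)" by metis
  define K where "K = Max (insert K0 (F ` {..<K0}))"
  have K: "K0 \<le> K" "\<And>j. j < K0 \<Longrightarrow> F j \<le> K" by (auto simp: K_def)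
  have "g (k # a) = g (K # a)" if k: "k \<ge> K" and a: "length a = Suc d" for k a
  proof -
    obtain j b where jb: "a = j # b" "length b = d" using a by (cases a) auto
    show ?thesis
    proof (cases "j < K0")
      case True
      then show ?thesis using F[of j k b] F[of j K b] k K(2)[of j] jb by auto
    next
      case False
      have "g (l # j # b) = g (K0 # K0 # b)" if "l \<ge> K0" for l
        using mono[of l "max l j" j "max l j" b] mono[of K0 l K0 j b] K0[of "max l j" b] False that jb by auto
      then show ?thesis using K(1) k jb by simp
    qed
  qed
  then show ?case by blast
qed

subsection \<open>Eventually polynomial functions\<close>

definition ev_poly :: "nat \<Rightarrow> (nat \<Rightarrow> nat) \<Rightarrow> bool"
  where "ev_poly d f \<longleftrightarrow> (\<exists>p :: rat poly. degree p \<le> d \<and> (\<exists>n0. \<forall>n\<ge>n0. of_nat (f n) = poly p (of_nat n)))"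

text \<open>The first difference \<open>D\<close> of \<open>X^(d+2)\<close> has coefficient
  \<open>d + 2\<close> at \<open>d + 1\<close> and none above, which explains the denominator in
  \<open>?c\<close>. Subtracting \<open>?c\<close> times \<open>D\<close> lowers the degree of
  \<open>p\<close>.\<close>

lemma poly_antidifference:
  fixes p :: "rat poly"
  shows "degree p \<le> d \<Longrightarrow> \<exists>q. degree q \<le> Suc d \<and> (\<forall>x. poly q (x + 1) = poly q x + poly p x)"
proof (induction d arbitrary: p)
  case 0
  then obtain c where "p = [:c:]" by (metis degree_eq_zeroE le_zero_eq)
  then show ?case by (intro exI[of _ "[:0, c:]"]) (auto simp: algebra_simps)
next
  case (Suc d)
  let ?M = "Polynomial.monom (1::rat) (Suc (Suc d))" and ?c = "Polynomial.coeff p (Suc d) / of_nat (Suc (Suc d))"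
  define D where "D = [:1, 1:] ^ Suc (Suc d) - ?M"
  have D: "poly D x = poly ?M (x + 1) - poly ?M x" for x
    by (simp add: D_def poly_monom poly_power add.commute del: power_Suc)
  have cD: "Polynomial.coeff D i = of_nat (Suc (Suc d) choose i) - (if i = Suc (Suc d) then 1 else 0)" for i
  proof (cases "i \<le> Suc (Suc d)")
    case False
    then have "Polynomial.coeff ([:1, 1::rat:] ^ Suc (Suc d)) i = 0"
      by (intro coeff_eq_0) (use degree_power_le[of "[:1, 1::rat:]" "Suc (Suc d)"] in simp)
    then show ?thesis using False by (simp add: D_def del: power_Suc binomial_Suc_Suc)
  qed (simp add: D_def coeff_linear_poly_power del: power_Suc binomial_Suc_Suc)
  have "Polynomial.coeff (p - Polynomial.smult ?c D) i = 0" if i: "i > d" for i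
  proof -
    consider "i = Suc d" | "i > Suc d" using i by linarith
    then show ?thesis
    proof cases
      case 1
      then show ?thesis by (simp add: cD binomial_Suc_n del: binomial_Suc_Suc)
    next
      case 2
      then have "Polynomial.coeff p i = 0" using Suc.prems by (intro coeff_eq_0) auto
      moreover have "Polynomial.coeff D i = 0"
      proof (cases "i = Suc (Suc d)")
        case False
        then have "Suc (Suc d) choose i = 0" using 2 by (intro binomial_eq_0) simp
        then show ?thesis using False by (simp only: cD) simp
      qed (simp only: cD binomial_n_n, simp)
      ultimately show ?thesis by simp
    qed
  qed
  then have "degree (p - Polynomial.smult ?c D) \<le> d" using degree_le by blast
  then obtain q where q: "degree q \<le> Suc d" "\<And>x. poly q (x + 1) = poly q x + poly (p - Polynomial.smult ?c D) x"
    using Suc.IH by blast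
  have "degree (q + Polynomial.smult ?c ?M) \<le> Suc (Suc d)"
  proof (rule degree_add_le)
    show "degree q \<le> Suc (Suc d)" using q(1) by simp
    show "degree (Polynomial.smult ?c ?M) \<le> Suc (Suc d)"
      by (rule order_trans[OF degree_smult_le degree_monom_le])
  qed
  moreover have "poly (q + Polynomial.smult ?c ?M) (x + 1) = poly (q + Polynomial.smult ?c ?M) x + poly p x" for x
    using q(2)[of x] D[of x] by (simp add: algebra_simps)
  ultimately show ?case by blast
qed

lemma degree_pcompose_linear: "degree (pcompose p [:c, 1 :: rat:]) \<le> degree p"
  using degree_pcompose_le[of p "[:c, 1:]"] by simp

lemma ev_poly_shift:
  assumes "ev_poly d (\<lambda>n. f (Suc n))"
  shows "ev_poly d f"
proof -
  obtain p :: "rat poly" and n0 where p: "degree p \<le> d" "\<And>n. n \<ge> n0 \<Longrightarrow> of_nat (f (Suc n)) = poly p (of_nat n)"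
    using assms by (auto simp: ev_poly_def)
  have "of_nat (f n) = poly (pcompose p [:-1, 1:]) (of_nat n)" if n: "n \<ge> Suc n0" for n
  proof -
    obtain m where m: "n = Suc m" using n by (cases n) auto
    then show ?thesis using p(2)[of m] n by (simp add: poly_pcompose)
  qed
  then show ?thesis using p(1) degree_pcompose_linear[of p "-1"] unfolding ev_poly_def
    by (meson le_trans)
qed

lemma ev_poly_add: "ev_poly d f \<Longrightarrow> ev_poly d g \<Longrightarrow> ev_poly d (\<lambda>n. f n + g n)"
proof -
  assume "ev_poly d f" "ev_poly d g"
  then obtain p q :: "rat poly" and n0 n1 where
    p: "degree p \<le> d" "\<And>n. n \<ge> n0 \<Longrightarrow> of_nat (f n) = poly p (of_nat n)" and
    q: "degree q \<le> d" "\<And>n. n \<ge> n1 \<Longrightarrow> of_nat (g n) = poly q (of_nat n)"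
    by (auto simp: ev_poly_def)
  have "degree (p + q) \<le> d" "\<forall>n\<ge>max n0 n1. of_nat (f n + g n) = poly (p + q) (of_nat n)"
    using p q by (auto intro: degree_add_le)
  then show ?thesis unfolding ev_poly_def by blast
qed

lemma ev_poly_mono: "ev_poly d f \<Longrightarrow> d \<le> e \<Longrightarrow> ev_poly e f"
  unfolding ev_poly_def by (meson le_trans)

lemma ev_poly_Suc_arg: "ev_poly d f \<Longrightarrow> ev_poly d (\<lambda>n. f (Suc n))"
proof -
  assume "ev_poly d f"
  then obtain p :: "rat poly" and n0 where
    p: "degree p \<le> d" "\<And>n. n \<ge> n0 \<Longrightarrow> of_nat (f n) = poly p (of_nat n)" by (auto simp: ev_poly_def)
  have "\<forall>n\<ge>n0. of_nat (f (Suc n)) = poly (pcompose p [:1, 1:]) (of_nat n)"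
    using p(2) by (simp add: poly_pcompose)
  then show ?thesis using p(1) degree_pcompose_linear[of p 1] unfolding ev_poly_def
    by (meson le_trans)
qed

lemma ev_poly_summation:
  assumes h: "ev_poly d h" and f: "\<And>n. f (Suc n) = h n + f n"
  shows "ev_poly (Suc d) f"
proof -
  obtain p :: "rat poly" and n0 where
    p: "degree p \<le> d" "\<And>n. n \<ge> n0 \<Longrightarrow> of_nat (h n) = poly p (of_nat n)" using h by (auto simp: ev_poly_def)
  obtain q where q: "degree q \<le> Suc d" "\<And>x. poly q (x + 1) = poly q x + poly p x"
    using poly_antidifference[OF p(1)] by blast
  define c where "c = of_nat (f n0) - poly q (of_nat n0)"
  have "of_nat (f n) = poly (q + [:c:]) (of_nat n)" if "n \<ge> n0" for n
    using that
  proof (induction n rule: dec_induct)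
    case base
    then show ?case by (simp add: c_def)
  next
    case (step n)
    then show ?case using f[of n] p(2)[of n] q(2)[of "of_nat n"] by (simp add: add.commute)
  qed
  moreover have "degree (q + [:c:]) \<le> Suc d" using q(1) by (intro degree_add_le) auto
  ultimately show ?thesis unfolding ev_poly_def by blast
qed

text \<open>Induction on \<open>d\<close> and on the index \<open>K\<close> from which
  \<open>g\<close> no longer depends on its first entry. For \<open>K = 0\<close> the first
  difference of the sum is a sum in one variable fewer, so summation raises the degree by one.
  Otherwise the slice with first entry 0 is split off, and for the shifted function \<open>K\<close>
  drops.\<close>

lemma ev_poly_sum_antitone: "antitone d g \<Longrightarrow> ev_poly d (\<lambda>n. sum g (expos_lt d n))"
proof (induction d arbitrary: g)
  case 0
  have "sum g (expos_lt 0 n) = g []" if "n \<ge> 1" for n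
  proof -
    have "expos_lt 0 n = {[]}" using that by (auto simp: expos_lt_def)
    then show ?thesis by simp
  qed
  then show ?case unfolding ev_poly_def
    by (intro exI[of _ "[:of_nat (g []):]"] conjI exI[of _ "1::nat"]) auto
next
  case (Suc d)
  obtain K where "\<And>k a. k \<ge> K \<Longrightarrow> length a = d \<Longrightarrow> g (k # a) = g (K # a)"
    using antitone_stabilises[OF Suc.prems] by blast
  then show ?case using Suc.prems
  proof (induction K arbitrary: g)
    case 0
    have *: "sum g (expos_lt (Suc d) (Suc n)) =
        sum (\<lambda>a. g (0 # a)) (expos_lt d (Suc n)) + sum g (expos_lt (Suc d) n)" for n
    proof -
      have "g (inc_hd a) = g a" if "a \<in> expos_lt (Suc d) n" for a
      proof -
        have "length a = Suc d" using that by (simp add: expos_lt_def)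
        then obtain k b where "a = k # b" "length b = d" by (metis length_Suc_conv)
        then show ?thesis using 0(1)[of k b] 0(1)[of "Suc k" b] by simp
      qed
      then show ?thesis by (simp add: sum_expos_lt_rec)
    qed
    show ?case
      by (rule ev_poly_summation[OF ev_poly_Suc_arg[OF Suc.IH[OF antitone_Cons[OF 0(2), of 0]]] *])
  next
    case (Suc K)
    have "ev_poly (Suc d) (\<lambda>n. sum (\<lambda>a. g (inc_hd a)) (expos_lt (Suc d) n))"
    proof (rule Suc.IH)
      show "antitone (Suc d) (\<lambda>a. g (inc_hd a))" using Suc.prems(2) by (rule antitone_inc_hd)
      show "g (inc_hd (k # a)) = g (inc_hd (K # a))" if "k \<ge> K" "length a = d" for k a
        using Suc.prems(1)[of "Suc k" a] that by (simp add: inc_hd_def)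
    qed
    moreover have "ev_poly (Suc d) (\<lambda>n. sum (\<lambda>a. g (0 # a)) (expos_lt d (Suc n)))"
      by (rule ev_poly_mono[OF ev_poly_Suc_arg[OF \<open>\<And>g. antitone d g \<Longrightarrow> ev_poly d (\<lambda>n. sum g (expos_lt d n))\<close>]])
        (use antitone_Cons[OF Suc.prems(2)] in auto)
    ultimately show ?case
      by (intro ev_poly_shift[of "Suc d" "\<lambda>n. sum g (expos_lt (Suc d) n)"]) (simp add: sum_expos_lt_rec ev_poly_add)
  qed
qed

lemma sum_expos_lt_le: "antitone d g \<Longrightarrow> sum g (expos_lt d n) \<le> g (replicate d 0) * n ^ d"
proof -
  assume g: "antitone d g"
  have "sum g (expos_lt d n) \<le> of_nat (card (expos_lt d n)) * g (replicate d 0)"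
  proof (rule sum_bounded_above)
    fix a assume "a \<in> expos_lt d n"
    then have "list_all2 (\<le>) (replicate d 0) a" by (auto simp: expos_lt_def list_all2_conv_all_nth)
    then show "g a \<le> g (replicate d 0)" using g by (simp add: antitone_def)
  qed
  also have "card (expos_lt d n) \<le> card {a. set a \<subseteq> {..<n} \<and> length a = d}"
    by (rule card_mono[OF _ expos_lt_subset]) (simp add: finite_lists_length_eq)
  also have "\<dots> = n ^ d" by (simp add: card_lists_length_eq)
  finally show ?thesis by (simp add: mult.commute)
qed

text \<open>If \<open>g\<close> vanishes at \<open>e\<close>, it vanishes on the whole orthant above
  \<open>e\<close>. Its support then lies in finitely many coordinate hyperplane slices, and the sum
  is of order \<open>n^(d-1)\<close>; the factor \<open>n\<close> on the left avoids the exponent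
  \<open>d - 1\<close>.\<close>

lemma sum_expos_lt_vanishing:
  "antitone d g \<Longrightarrow> length e = d \<Longrightarrow> g e = 0 \<Longrightarrow> \<exists>C. \<forall>n. n * sum g (expos_lt d n) \<le> C * n ^ d"
proof (induction d arbitrary: g e)
  case 0
  then have "sum g (expos_lt 0 n) = 0" for n by (auto simp: expos_lt_def)
  then show ?case by simp
next
  case (Suc d)
  obtain k a where e: "e = k # a" "length a = d" using Suc.prems(2) by (cases e) auto
  have "g (k # a) = 0" using Suc.prems e by simp
  then show ?case using Suc.prems(1)
  proof (induction k arbitrary: g)
    case 0
    obtain C where C: "\<And>n. n * sum (\<lambda>a. g (0 # a)) (expos_lt d n) \<le> C * n ^ d"
      using Suc.IH[OF antitone_Cons[OF 0(2)] e(2)] 0(1) by blast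
    \<comment> \<open>As \<open>g\<close> decreases in the first entry, each of the \<open>n\<close>
      slices is dominated by the slice with first entry 0, to which the induction on
      \<open>d\<close> applies.\<close>
    have "sum g (expos_lt (Suc d) n) \<le> n * sum (\<lambda>a. g (0 # a)) (expos_lt d n)" for n
    proof (induction n)
      case (Suc n)
      have "sum (\<lambda>a. g (inc_hd a)) (expos_lt (Suc d) n) \<le> sum g (expos_lt (Suc d) n)"
        using antitone_inc_hd_le[OF 0(2)] by (intro sum_mono) (auto simp: expos_lt_def)
      also have "\<dots> \<le> n * sum (\<lambda>a. g (0 # a)) (expos_lt d (Suc n))"
        using Suc sum_expos_lt_mono[of n "Suc n" "\<lambda>a. g (0 # a)" d] by (meson le_SucI le_refl le_trans mult_le_mono2)
      finally show ?case by (simp add: sum_expos_lt_rec)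
    qed simp
    then have "n * sum g (expos_lt (Suc d) n) \<le> C * n ^ Suc d" for n
      using C[of n] mult_le_mono2[of _ _ n] by (fastforce simp: mult.assoc mult.left_commute intro: le_trans)
    then show ?case by blast
  next
    case (Suc k)
    obtain C where C: "\<And>n. n * sum (\<lambda>a. g (inc_hd a)) (expos_lt (Suc d) n) \<le> C * n ^ Suc d"
      using Suc.IH[OF _ antitone_inc_hd[OF Suc.prems(2)]] Suc.prems(1) by (auto simp: inc_hd_def)
    \<comment> \<open>The extra slice with first entry 0 has one variable fewer, so the crude bound
      \<open>sum_expos_lt_le\<close> is good enough for it.\<close>
    have rec: "sum g (expos_lt (Suc d) n) \<le> sum (\<lambda>a. g (0 # a)) (expos_lt d n) + sum (\<lambda>a. g (inc_hd a)) (expos_lt (Suc d) n)" for n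
    proof (cases n)
      case (Suc m)
      have "sum g (expos_lt (Suc d) n) = sum (\<lambda>a. g (0 # a)) (expos_lt d n) + sum (\<lambda>a. g (inc_hd a)) (expos_lt (Suc d) m)"
        unfolding Suc by (rule sum_expos_lt_rec)
      then show ?thesis using sum_expos_lt_mono[of m n "\<lambda>a. g (inc_hd a)" "Suc d"] Suc by simp
    qed simp
    have "n * sum g (expos_lt (Suc d) n) \<le> (g (replicate (Suc d) 0) + C) * n ^ Suc d" for n
    proof -
      have "n * sum g (expos_lt (Suc d) n)
          \<le> n * sum (\<lambda>a. g (0 # a)) (expos_lt d n) + n * sum (\<lambda>a. g (inc_hd a)) (expos_lt (Suc d) n)"
        using mult_le_mono2[OF rec[of n], of n] by (simp add: distrib_left)
      then have "n * sum g (expos_lt (Suc d) n) \<le> n * sum (\<lambda>a. g (0 # a)) (expos_lt d n) + C * n ^ Suc d"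
        using C[of n] by linarith
      also have "n * sum (\<lambda>a. g (0 # a)) (expos_lt d n) \<le> n * (g (replicate (Suc d) 0) * n ^ d)"
        using sum_expos_lt_le[OF antitone_Cons[OF Suc.prems(2), of 0], of n] by (intro mult_le_mono2) simp
      finally show ?thesis by (simp add: algebra_simps)
    qed
    then show ?case by blast
  qed
qed

subsection \<open>Comparison of leading coefficients\<close>

lemma poly_eventually_pos:
  fixes p :: "rat poly"
  shows "lead_coeff p > 0 \<Longrightarrow> \<exists>b. \<forall>x\<ge>b. poly p x \<ge> lead_coeff p"
proof (induction p)
  case (pCons a p)
  show ?case
  proof (cases "p = 0")
    case False
    then have l: "lead_coeff p > 0" using pCons.prems by simp
    then obtain b where b: "\<And>x. x \<ge> b \<Longrightarrow> poly p x \<ge> lead_coeff p" using pCons.IH by blast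
    have "poly (pCons a p) x \<ge> lead_coeff (pCons a p)" if x: "x \<ge> max (max 1 b) (1 - a / lead_coeff p)" for x
    proof -
      have "lead_coeff p - a \<le> x * lead_coeff p"
      proof -
        have "(1 - a / lead_coeff p) * lead_coeff p \<le> x * lead_coeff p"
          using x l by (intro mult_right_mono) auto
        then show ?thesis using l False by (simp add: left_diff_distrib)
      qed
      also have "\<dots> \<le> x * poly p x" using b[of x] x by (intro mult_left_mono) auto
      finally show ?thesis using False by simp
    qed
    then show ?thesis by blast
  qed simp
qed simp

text \<open>Otherwise \<open>p - q\<close> has degree exactly \<open>d\<close> and a positive
  leading coefficient, hence is eventually positive.\<close>

lemma coeff_le_of_eventually_le:
  fixes p q :: "rat poly"
  assumes "degree p \<le> d" "degree q \<le> d" "\<And>n :: nat. n \<ge> n0 \<Longrightarrow> poly p (of_nat n) \<le> poly q (of_nat n)"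
  shows "Polynomial.coeff p d \<le> Polynomial.coeff q d"
proof (rule ccontr)
  assume "\<not> Polynomial.coeff p d \<le> Polynomial.coeff q d"
  then have c: "Polynomial.coeff (p - q) d > 0" by simp
  moreover have "degree (p - q) \<le> d" using assms(1,2) by (rule degree_diff_le)
  ultimately have "degree (p - q) = d" by (metis le_antisym le_degree less_irrefl)
  then obtain b where b: "\<And>x. x \<ge> b \<Longrightarrow> poly (p - q) x \<ge> Polynomial.coeff (p - q) d"
    using poly_eventually_pos[of "p - q"] c by auto
  obtain m :: nat where "b \<le> of_nat m" using real_arch_simple by blast
  then have "b \<le> of_nat (max m n0)" using of_nat_mono[of m "max m n0", where ?'a = rat] by linarith
  then have "poly (p - q) (of_nat (max m n0)) > 0" using b[of "of_nat (max m n0)"] c by linarith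
  then show False using assms(3)[of "max m n0"] by simp
qed

lemma poly_eq_of_eventually_eq:
  fixes p q :: "rat poly"
  assumes "\<And>n :: nat. n \<ge> n0 \<Longrightarrow> poly p (of_nat n) = poly q (of_nat n)"
  shows "p = q"
proof -
  have "Polynomial.coeff p i = Polynomial.coeff q i" for i
  proof (cases "i \<le> max (degree p) (degree q)")
    case True
    have "infinite ((of_nat :: nat \<Rightarrow> rat) ` {n0..})"
      using infinite_Ici by (subst finite_image_iff) (auto simp: inj_on_def)
    moreover have "(of_nat :: nat \<Rightarrow> rat) ` {n0..} \<subseteq> {x. poly (p - q) x = 0}" using assms by auto
    ultimately have "infinite {x. poly (p - q) x = 0}" using finite_subset by blast
    then have "p - q = 0" using poly_roots_finite by blast
    then show ?thesis by simp
  qed (auto simp: coeff_eq_0)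
  then show ?thesis by (rule poly_eqI)
qed

section \<open>Monomials and the Hilbert-Samuel polynomial\<close>

definition incr :: "nat list \<Rightarrow> nat \<Rightarrow> nat list"
  where "incr a i = a[i := Suc (a ! i)]"

lemma length_incr [simp]: "length (incr a i) = length a"
  by (simp add: incr_def)

lemma sum_list_incr: "i < length a \<Longrightarrow> sum_list (incr a i) = Suc (sum_list a)"
  unfolding incr_def by (induction a arbitrary: i) (auto split: nat.splits simp: nth_Cons)

lemma incr_in_expos: "a \<in> expos d n \<Longrightarrow> i < d \<Longrightarrow> incr a i \<in> expos d (Suc n)"
  by (simp add: expos_def sum_list_incr)

lemma expos_SucE:
  assumes "a \<in> expos d (Suc n)"
  obtains b i where "b \<in> expos d n" "i < d" "a = incr b i"
proof -
  have "\<exists>b i. i < length b \<and> a = incr b i" if "sum_list a = Suc n" for a n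
    using that
  proof (induction a arbitrary: n)
    case (Cons k a)
    show ?case
    proof (cases k)
      case 0
      then obtain b i where "i < length b" "a = incr b i" using Cons by auto
      then have "Suc i < length (0 # b)" "k # a = incr (0 # b) (Suc i)" using 0 by (auto simp: incr_def)
      then show ?thesis by blast
    next
      case (Suc j)
      then have "0 < length (j # a)" "k # a = incr (j # a) 0" by (auto simp: incr_def)
      then show ?thesis by blast
    qed
  qed simp
  from this[of a n] obtain b i where "i < length b" "a = incr b i" using assms by (auto simp: expos_def)
  moreover from this have "b \<in> expos d n" using assms by (auto simp: expos_def sum_list_incr)
  ultimately show ?thesis using that[of b i] by (auto simp: expos_def)
qed

lemma expos_0: "expos d 0 = {replicate d 0}"
  by (auto simp: expos_def list_eq_iff_nth_eq)

abbreviation list_add :: "nat list \<Rightarrow> nat list \<Rightarrow> nat list"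
  where "list_add \<equiv> map2 (+)"

text \<open>This makes the lexicographic order a monomial order, the basis of all leading term
  arguments below.\<close>

lemma list_add_less:
  "a < b \<Longrightarrow> length a = length b \<Longrightarrow> length b = length c \<Longrightarrow> list_add a c < list_add b c"
proof (induction c arbitrary: a b)
  case (Cons k c)
  then show ?case by (cases a; cases b) (auto simp: Cons_less_Cons)
qed simp

lemma sum_list_add: "length a = length b \<Longrightarrow> sum_list (list_add a b) = sum_list a + sum_list b"
  by (induction a b rule: list_induct2) auto

lemma list_add_in_expos: "a \<in> expos d m \<Longrightarrow> b \<in> expos d n \<Longrightarrow> list_add a b \<in> expos d (m + n)"
  by (simp add: expos_def sum_list_add)

lemma list_add_commute: "list_add a b = list_add b a"
  by (induction a b rule: list_induct2') auto

lemma list_le_diff: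
  assumes "list_all2 (\<le>) a b"
  obtains c where "length c = length a" "b = list_add a c"
proof -
  have "b = list_add a (map2 (-) b a)" using assms
    by (induction a b rule: list_all2_induct) auto
  then show ?thesis using that[of "map2 (-) b a"] list_all2_lengthD[OF assms] by simp
qed

context cring begin

primrec mon :: "(nat \<Rightarrow> 'a) \<Rightarrow> nat list \<Rightarrow> 'a" where
  "mon x [] = \<one>"
| "mon x (k # a) = x 0 [^] k \<otimes> mon (\<lambda>i. x (Suc i)) a"

lemma mon_closed: "(\<And>i. i < length a \<Longrightarrow> x i \<in> carrier R) \<Longrightarrow> mon x a \<in> carrier R"
proof (induction a arbitrary: x)
  case (Cons k a)
  have "x 0 \<in> carrier R" "mon (\<lambda>i. x (Suc i)) a \<in> carrier R"
    using Cons.prems[of 0] Cons.IH[of "\<lambda>i. x (Suc i)"] Cons.prems by auto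
  then show ?case by simp
qed simp

lemma mon_add:
  "length a = length b \<Longrightarrow> (\<And>i. i < length a \<Longrightarrow> x i \<in> carrier R) \<Longrightarrow>
    mon x (list_add a b) = mon x a \<otimes> mon x b"
proof (induction a b arbitrary: x rule: list_induct2)
  case (Cons k a l b)
  have c: "x 0 \<in> carrier R" "mon (\<lambda>i. x (Suc i)) a \<in> carrier R" "mon (\<lambda>i. x (Suc i)) b \<in> carrier R"
    using Cons.prems Cons.hyps by (auto intro!: mon_closed)
  have "mon (\<lambda>i. x (Suc i)) (list_add a b) = mon (\<lambda>i. x (Suc i)) a \<otimes> mon (\<lambda>i. x (Suc i)) b"
    using Cons.IH[of "\<lambda>i. x (Suc i)"] Cons.prems by auto
  moreover have "x 0 [^] (k + l) = x 0 [^] k \<otimes> x 0 [^] l" using c by (simp add: nat_pow_mult)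
  ultimately show ?case using c by (simp add: m_ac)
qed simp

lemma mon_incr:
  "i < length a \<Longrightarrow> (\<And>i. i < length a \<Longrightarrow> x i \<in> carrier R) \<Longrightarrow> mon x (incr a i) = mon x a \<otimes> x i"
proof (induction a arbitrary: x i)
  case (Cons k a)
  have c: "x 0 \<in> carrier R" "mon (\<lambda>i. x (Suc i)) a \<in> carrier R"
    using Cons.prems by (auto intro!: mon_closed)
  show ?case
  proof (cases i)
    case 0
    then show ?thesis using c by (simp add: incr_def m_ac)
  next
    case (Suc j)
    then have "mon (\<lambda>i. x (Suc i)) (incr a j) = mon (\<lambda>i. x (Suc i)) a \<otimes> x i"
      using Cons.IH[of j "\<lambda>i. x (Suc i)"] Cons.prems by auto
    then show ?thesis using c Cons.prems(2)[OF Cons.prems(1)] Suc by (simp add: incr_def m_ac)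
  qed
qed simp

lemma mon_replicate_0: "mon x (replicate d 0) = \<one>"
  by (induction d arbitrary: x) auto

lemma mon_power:
  "(\<And>i. i < length a \<Longrightarrow> x i \<in> carrier R) \<Longrightarrow> mon (\<lambda>i. x i [^] (N::nat)) a = mon x (map ((*) N) a)"
proof (induction a arbitrary: x)
  case (Cons k a)
  have "x 0 \<in> carrier R" using Cons.prems by auto
  then show ?case using Cons.IH[of "\<lambda>i. x (Suc i)"] Cons.prems by (simp add: nat_pow_pow)
qed simp

lemma Idl_prod_le:
  assumes "ideal K R" "A \<subseteq> carrier R" "B \<subseteq> carrier R" "\<And>a b. a \<in> A \<Longrightarrow> b \<in> B \<Longrightarrow> a \<otimes> b \<in> K"
  shows "(Idl A) \<cdot> (Idl B) \<subseteq> K"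
  unfolding ideal_prod_le_iff[OF assms(1)]
proof (intro ballI)
  fix a b assume a: "a \<in> Idl A" and b: "b \<in> Idl B"
  have bc: "b \<in> carrier R" using b genideal_ideal[OF assms(3)] ideal.Icarr by metis
  have "a' \<otimes> b \<in> K" if "a' \<in> A" for a'
    using mult_Idl_mem[OF assms(1) _ assms(3) _ b, of a'] assms that by blast
  then have "b \<otimes> a' \<in> K" if "a' \<in> A" for a' using m_comm[OF bc, of a'] that assms(2) by auto
  then have "b \<otimes> a \<in> K" using mult_Idl_mem[OF assms(1) bc assms(2) _ a] by blast
  then show "a \<otimes> b \<in> K" using m_comm[OF bc, of a] a genideal_ideal[OF assms(2)] ideal.Icarr by metis
qed

lemma mon_image_carrier: "x ` {..<d} \<subseteq> carrier R \<Longrightarrow> S \<subseteq> {a. length a = d} \<Longrightarrow> mon x ` S \<subseteq> carrier R"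
  by (auto intro!: mon_closed)

lemma ideal_power_eq_monomials:
  assumes x: "x ` {..<d} \<subseteq> carrier R"
  shows "ideal_power R (Idl (x ` {..<d})) n = Idl (mon x ` expos d n)"
proof (induction n)
  case 0
  show ?case by (simp add: ideal_power_0 expos_0 mon_replicate_0 genideal_one)
next
  case (Suc n)
  have xi: "\<And>i. i < d \<Longrightarrow> x i \<in> carrier R" using x by auto
  have c: "mon x ` expos d k \<subseteq> carrier R" for k using x by (intro mon_image_carrier) (auto simp: expos_def)
  have "(Idl (mon x ` expos d n)) \<cdot> (Idl (x ` {..<d})) \<subseteq> Idl (mon x ` expos d (Suc n))"
  proof (rule Idl_prod_le)
    fix a b assume "a \<in> mon x ` expos d n" "b \<in> x ` {..<d}"
    then obtain e i where "e \<in> expos d n" "i < d" "a = mon x e" "b = x i" by auto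
    then have "a \<otimes> b = mon x (incr e i)" "incr e i \<in> expos d (Suc n)"
      using mon_incr[of i e x] xi by (auto simp: expos_def sum_list_incr)
    then show "a \<otimes> b \<in> Idl (mon x ` expos d (Suc n))" using c by (auto intro!: Idl_mem)
  qed (use x c genideal_ideal[OF c] in auto)
  moreover have "Idl (mon x ` expos d (Suc n)) \<subseteq> (Idl (mon x ` expos d n)) \<cdot> (Idl (x ` {..<d}))"
  proof (rule Idl_le)
    show "ideal ((Idl (mon x ` expos d n)) \<cdot> (Idl (x ` {..<d}))) R"
      using c x by (intro ideal_prod_is_ideal genideal_ideal)
    show "mon x ` expos d (Suc n) \<subseteq> (Idl (mon x ` expos d n)) \<cdot> (Idl (x ` {..<d}))"
    proof (rule image_subsetI)
      fix a assume "a \<in> expos d (Suc n)"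
      then obtain e i where e: "e \<in> expos d n" "i < d" "a = incr e i" by (rule expos_SucE)
      then have "mon x a = mon x e \<otimes> x i" using mon_incr[of i e x] xi by (auto simp: expos_def)
      moreover have "mon x e \<in> Idl (mon x ` expos d n)" "x i \<in> Idl (x ` {..<d})"
        using e c x by (auto intro!: Idl_mem)
      ultimately show "mon x a \<in> (Idl (mon x ` expos d n)) \<cdot> (Idl (x ` {..<d}))"
        by (simp add: ideal_prod.prod)
    qed
  qed
  ultimately show ?case by (simp add: Suc ideal_power_Suc)
qed

lemma mon_in_power:
  assumes x: "x ` {..<d} \<subseteq> carrier R" and "length a = d"
  shows "mon x a \<in> ideal_power R (Idl (x ` {..<d})) (sum_list a)"
  unfolding ideal_power_eq_monomials[OF x]
  using assms by (intro Idl_mem mon_image_carrier) (auto simp: expos_def)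

lemma power_param_le:
  assumes x: "x ` {..<d} \<subseteq> carrier R"
  shows "ideal_power R (Idl ((\<lambda>i. x i [^] N) ` {..<d})) k \<subseteq> ideal_power R (Idl (x ` {..<d})) (N * k)"
proof -
  have J: "ideal (Idl (x ` {..<d})) R" using x by (rule genideal_ideal)
  have "Idl ((\<lambda>i. x i [^] N) ` {..<d}) \<subseteq> ideal_power R (Idl (x ` {..<d})) N"
    using J x by (intro Idl_le) (auto intro!: elem_power_mem Idl_mem)
  then show ?thesis using ideal_power_base_mono by (metis ideal_power_mult[OF J])
qed

text \<open>Dividing the exponents of a monomial of degree \<open>N k + N d\<close> by
  \<open>N\<close> leaves remainders of sum at most \<open>N d\<close>, so the quotients have sum at
  least \<open>k\<close>. With \<open>power_param_le\<close> this traps the powers of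
  \<open>(x_i^N)\<close> between powers of \<open>J\<close>, up to a shift independent of
  \<open>k\<close>.\<close>

lemma power_le_power_param:
  assumes x: "x ` {..<d} \<subseteq> carrier R" and N: "N > 0"
  shows "ideal_power R (Idl (x ` {..<d})) (N * k + N * d) \<subseteq> ideal_power R (Idl ((\<lambda>i. x i [^] N) ` {..<d})) k"
proof -
  have x': "(\<lambda>i. x i [^] N) ` {..<d} \<subseteq> carrier R" using x by auto
  let ?K = "Idl ((\<lambda>i. x i [^] N) ` {..<d})"
  have K: "ideal ?K R" using x' by (rule genideal_ideal)
  show ?thesis unfolding ideal_power_eq_monomials[OF x]
  proof (rule Idl_le)
    show "ideal (ideal_power R ?K k) R" using K by simp
    show "mon x ` expos d (N * k + N * d) \<subseteq> ideal_power R ?K k"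
    proof (rule image_subsetI)
      fix a assume a: "a \<in> expos d (N * k + N * d)"
      define q where "q = map (\<lambda>k. k div N) a"
      define r where "r = map (\<lambda>k. k mod N) a"
      have lq: "length q = d" "length r = d" "length a = d" using a by (auto simp: q_def r_def expos_def)
      have split: "a = list_add (map ((*) N) q) r" unfolding q_def r_def by (induction a) auto
      have "sum_list r \<le> N * length a" unfolding r_def using N
        by (induction a) (auto intro: add_mono less_imp_le)
      then have "sum_list r \<le> N * d" using lq(3) by simp
      moreover have "sum_list (map ((*) N) q) = N * sum_list q" by (simp add: sum_list_const_mult)
      moreover have "sum_list a = sum_list (map ((*) N) q) + sum_list r"
        using split sum_list_add[of "map ((*) N) q" r] lq by simp
      moreover have "sum_list a = N * k + N * d" using a by (simp add: expos_def)
      ultimately have "N * k \<le> N * sum_list q" by linarith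
      then have kq: "k \<le> sum_list q" using N by simp
      have xi: "\<And>i. i < d \<Longrightarrow> x i \<in> carrier R" using x by auto
      have "mon x a = mon x (map ((*) N) q) \<otimes> mon x r"
        using mon_add[of "map ((*) N) q" r x] split lq xi by simp
      also have "mon x (map ((*) N) q) = mon (\<lambda>i. x i [^] N) q" using mon_power[of q x N] lq xi by simp
      finally have "mon x a = mon (\<lambda>i. x i [^] N) q \<otimes> mon x r" .
      moreover have "mon (\<lambda>i. x i [^] N) q \<in> ideal_power R ?K k"
        using mon_in_power[OF x' lq(1)] ideal_power_antimono[OF K kq] by auto
      moreover have "mon x r \<in> carrier R" using lq xi by (intro mon_closed) auto
      ultimately show "mon x a \<in> ideal_power R ?K k"
        using ideal.I_r_closed[OF ideal_power_ideal[OF K]] by metis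
    qed
  qed
qed

end

section \<open>Hilbert-Samuel polynomials and multiplicities\<close>

context local_noetherian begin

lemma mprimary_power: "mprimary I \<Longrightarrow> mprimary (ideal_power R I n)"
proof -
  assume I: "mprimary I"
  then obtain k where "ideal_power R \<mm> k \<subseteq> I" by (auto simp: mprimary_def)
  then have "ideal_power R \<mm> (k * n) \<subseteq> ideal_power R I n"
    using ideal_power_base_mono ideal_power_mult[OF m_ideal] by metis
  then show ?thesis using I by (auto simp: mprimary_def)
qed

text \<open>The generators are adjoined in increasing order, each at the cost given by
  \<open>len_adjoin_colon\<close>; the order on the index set decides which ones are already present
  when \<open>f a\<close> is adjoined.\<close>

lemma len_adjoin_finite:
  fixes f :: "'i :: linorder \<Rightarrow> 'a"
  assumes L: "mprimary L"
  shows "finite S \<Longrightarrow> f ` S \<subseteq> carrier R \<Longrightarrow>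
    len L = len (L <+> Idl (f ` S)) + (\<Sum>a\<in>S. len (colon (L <+> Idl (f ` {b\<in>S. b < a})) (f a)))"
proof (induction S rule: finite_linorder_max_induct)
  case empty
  have Li: "ideal L R" using L by (simp add: mprimary_def)
  have "L <+> {\<zero>} = L" using ideal.Icarr[OF Li] by (force simp: set_add_def')
  then show ?case by (simp add: Idl_empty)
next
  case (insert b A)
  have Li: "ideal L R" using L by (simp add: mprimary_def)
  have A: "f ` A \<subseteq> carrier R" "f b \<in> carrier R" using insert by auto
  have IA: "ideal (Idl (f ` A)) R" using A by (intro genideal_ideal)
  have mp: "mprimary (L <+> Idl (f ` A))"
    using mprimary_mono[OF L] IA Li by (simp add: add_ideals ideal_sum_ge1 ideal_subset_carrier)
  have bA: "b \<notin> A" using insert.hyps by auto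
  have "Idl (f ` insert b A) = Idl (f ` A) <+> PIdl (f b)"
    using Idl_insert[OF A(2,1)] by (simp add: adjoin_def)
  then have adj: "L <+> Idl (f ` insert b A) = adjoin (L <+> Idl (f ` A)) (f b)"
    unfolding adjoin_def using ideal_subset_carrier[OF Li] ideal_subset_carrier[OF IA]
      ideal_subset_carrier[OF cgenideal_ideal[OF A(2)]]
    by (simp add: add.set_mult_assoc set_add_defs(1))
  have 1: "{c \<in> insert b A. c < b} = A" using insert.hyps by auto
  have 2: "{c \<in> insert b A. c < a} = {c \<in> A. c < a}" if "a \<in> A" for a using insert.hyps that by auto
  have "len L = len (L <+> Idl (f ` A)) + (\<Sum>a\<in>A. len (colon (L <+> Idl (f ` {b\<in>A. b < a})) (f a)))"
    using insert.IH A by blast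
  also have "len (L <+> Idl (f ` A)) = len (L <+> Idl (f ` insert b A)) + len (colon (L <+> Idl (f ` A)) (f b))"
    unfolding adj using len_adjoin_colon[OF mp A(2)] .
  finally show ?case
  proof -
    assume *: "len L = len (L <+> Idl (f ` insert b A)) + len (colon (L <+> Idl (f ` A)) (f b)) +
      (\<Sum>a\<in>A. len (colon (L <+> Idl (f ` {b\<in>A. b < a})) (f a)))"
    have "(\<Sum>a\<in>insert b A. len (colon (L <+> Idl (f ` {c\<in>insert b A. c < a})) (f a))) =
      len (colon (L <+> Idl (f ` A)) (f b)) + (\<Sum>a\<in>A. len (colon (L <+> Idl (f ` {c\<in>insert b A. c < a})) (f a)))"
      by (simp only: sum.insert[OF insert.hyps(1) bA] 1)
    also have "(\<Sum>a\<in>A. len (colon (L <+> Idl (f ` {c\<in>insert b A. c < a})) (f a))) =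
      (\<Sum>a\<in>A. len (colon (L <+> Idl (f ` {b\<in>A. b < a})) (f a)))"
      by (intro sum.cong refl) (simp only: 2)
    finally show ?thesis using * by (simp only: add.assoc)
  qed
qed

text \<open>Filtering \<open>J\<^sup>n / J\<^sup>n\<^sup>+\<^sup>1\<close> by the monomials of degree \<open>n\<close> in lexicographic order, the factor
  belonging to the monomial with exponent \<open>a\<close> is \<open>R\<close> modulo the following ideal, which grows with \<open>a\<close>.\<close>

definition mon_colon :: "(nat \<Rightarrow> 'a) \<Rightarrow> nat \<Rightarrow> nat list \<Rightarrow> 'a set"
  where "mon_colon x d a = colon (ideal_power R (Idl (x ` {..<d})) (Suc (sum_list a))
    <+> Idl (mon x ` {b \<in> expos d (sum_list a). b < a})) (mon x a)"

text \<open>Writing \<open>b = a + c\<close>, multiplication by \<open>x^c\<close> raises the power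
  of \<open>J\<close> by the degree of \<open>c\<close> and takes monomials below \<open>a\<close>
  to monomials below \<open>b\<close>.\<close>

lemma mon_colon_mono:
  assumes x: "x ` {..<d} \<subseteq> carrier R" and le: "list_all2 (\<le>) a b" and a: "length a = d"
  shows "mon_colon x d a \<subseteq> mon_colon x d b"
proof
  obtain c where c: "length c = d" "b = list_add a c" using list_le_diff[OF le] a by auto
  let ?J = "Idl (x ` {..<d})"
  have J: "ideal ?J R" using x by (rule genideal_ideal)
  have xi: "\<And>i. i < d \<Longrightarrow> x i \<in> carrier R" using x by auto
  have ca: "mon x a \<in> carrier R" "mon x c \<in> carrier R" using xi a c by (auto intro!: mon_closed)
  have sub: "mon x ` {b' \<in> expos d n. P b'} \<subseteq> carrier R" for n P
    using x by (intro mon_image_carrier) (auto simp: expos_def)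
  let ?T = "ideal_power R ?J (Suc (sum_list b)) <+> Idl (mon x ` {b' \<in> expos d (sum_list b). b' < b})"
  have T: "ideal ?T R" using J sub by (intro add_ideals genideal_ideal) auto
  have sb: "sum_list b = sum_list a + sum_list c" using sum_list_add[of a c] a c by simp
  fix r assume r: "r \<in> mon_colon x d a"
  then have rc: "r \<in> carrier R" by (simp add: mon_colon_def mem_colon)
  obtain p q where pq: "p \<in> ideal_power R ?J (Suc (sum_list a))"
      "q \<in> Idl (mon x ` {b' \<in> expos d (sum_list a). b' < a})" "r \<otimes> mon x a = p \<oplus> q"
    using r unfolding mon_colon_def mem_colon mem_ideal_sum by blast
  have pqc: "p \<in> carrier R" "q \<in> carrier R"
    using ideal.Icarr[OF ideal_power_ideal[OF J] pq(1)] ideal.Icarr[OF genideal_ideal[OF sub] pq(2)] by auto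
  have "mon x c \<otimes> p \<in> ideal_power R ?J (sum_list c + Suc (sum_list a))"
    by (rule ideal_power_prod_mem[OF J mon_in_power[OF x c(1)] pq(1)])
  then have p': "mon x c \<otimes> p \<in> ?T"
    by (intro subsetD[OF ideal_sum_ge1[OF genideal_ideal[OF sub] ideal_subset_carrier[OF ideal_power_ideal[OF J]]]])
      (simp add: sb add.commute)
  have "mon x c \<otimes> q \<in> ?T"
  proof (rule mult_Idl_mem[OF T ca(2) sub _ pq(2)])
    fix y assume "y \<in> mon x ` {b' \<in> expos d (sum_list a). b' < a}"
    then obtain b' where b': "b' \<in> expos d (sum_list a)" "b' < a" "y = mon x b'" by auto
    have lb: "length b' = d" using b' by (simp add: expos_def)
    have "mon x c \<otimes> y = mon x (list_add b' c)"
      using mon_add[of b' c x] lb c xi b'(3) ca m_comm[OF ca(2), of y] mon_closed[of b' x] by simp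
    moreover have "list_add b' c \<in> expos d (sum_list b)" "list_add b' c < b"
      using b' c a lb sb list_add_less[of b' a c] sum_list_add[of b' c] by (auto simp: expos_def)
    ultimately have "mon x c \<otimes> y \<in> Idl (mon x ` {b' \<in> expos d (sum_list b). b' < b})"
      using sub by (auto intro!: Idl_mem)
    then show "mon x c \<otimes> y \<in> ?T"
      by (rule subsetD[OF ideal_sum_ge2[OF ideal_power_ideal[OF J] ideal_subset_carrier[OF genideal_ideal[OF sub]]]])
  qed
  moreover have "r \<otimes> mon x b = mon x c \<otimes> p \<oplus> mon x c \<otimes> q"
  proof -
    have "mon x b = mon x a \<otimes> mon x c" using mon_add[of a c x] a c xi by simp
    then have "r \<otimes> mon x b = mon x c \<otimes> (r \<otimes> mon x a)" using ca rc by (simp add: m_ac)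
    then show ?thesis using pq(3) pqc ca by (simp add: r_distr)
  qed
  ultimately have "r \<otimes> mon x b \<in> ?T" using p' ideal_add_mem[OF T] by simp
  then show "r \<in> mon_colon x d b" using rc by (simp add: mon_colon_def mem_colon)
qed

text \<open>Telescoping over the quotients \<open>J^n / J^(n+1)\<close> expresses the colength as
  the sum of \<open>len (mon_colon x d a)\<close> over all \<open>a\<close> of degree below
  \<open>n\<close>, and by \<open>mon_colon_mono\<close> the summand is antitone.\<close>

lemma hilbert_samuel:
  assumes x: "x ` {..<d} \<subseteq> carrier R" and mp: "mprimary (Idl (x ` {..<d}))"
  shows "ev_poly d (\<lambda>n. len (ideal_power R (Idl (x ` {..<d})) n))"
proof -
  let ?J = "Idl (x ` {..<d})"
  have J: "ideal ?J R" using x by (rule genideal_ideal)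
  have xi: "\<And>i. i < d \<Longrightarrow> x i \<in> carrier R" using x by auto
  have sub: "S \<subseteq> expos d n \<Longrightarrow> mon x ` S \<subseteq> carrier R" for n S
    using x by (intro mon_image_carrier) (auto simp: expos_def)
  have "len (ideal_power R ?J n) = sum (\<lambda>a. len (mon_colon x d a)) (expos_lt d n)" for n
  proof (induction n)
    case 0
    then show ?case by (simp add: ideal_power_0 len_carrier)
  next
    case (Suc n)
    have JS: "ideal_power R ?J (Suc n) <+> Idl (mon x ` expos d n) = ideal_power R ?J n"
    proof
      show "ideal_power R ?J (Suc n) <+> Idl (mon x ` expos d n) \<subseteq> ideal_power R ?J n"
        unfolding ideal_power_eq_monomials[OF x, of n, symmetric]
        using J by (intro ideal_sum_le ideal_power_antimono) auto
      show "ideal_power R ?J n \<subseteq> ideal_power R ?J (Suc n) <+> Idl (mon x ` expos d n)"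
        using J ideal_subset_carrier[OF ideal_power_ideal[OF J]] 
        by (simp add: ideal_power_eq_monomials[OF x, of n, symmetric] ideal_sum_ge2)
    qed
    have "len (ideal_power R ?J (Suc n)) = len (ideal_power R ?J n) +
       (\<Sum>a\<in>expos d n. len (colon (ideal_power R ?J (Suc n) <+> Idl (mon x ` {b\<in>expos d n. b < a})) (mon x a)))"
      using len_adjoin_finite[OF mprimary_power[OF mp, of "Suc n"] finite_expos sub[OF order_refl], of n]
      unfolding JS .
    also have "(\<Sum>a\<in>expos d n. len (colon (ideal_power R ?J (Suc n) <+> Idl (mon x ` {b\<in>expos d n. b < a})) (mon x a)))
      = sum (\<lambda>a. len (mon_colon x d a)) (expos d n)"
      by (intro sum.cong refl) (auto simp: mon_colon_def expos_def)
    finally show ?case using Suc by (simp add: sum_expos_lt_Suc)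
  qed
  moreover have "antitone d (\<lambda>a. len (mon_colon x d a))"
    unfolding antitone_def
  proof (intro allI impI)
    fix a b :: "nat list" assume a: "length a = d" and ab: "list_all2 (\<le>) a b"
    then have b: "length b = d" by (simp add: list_all2_lengthD[symmetric])
    have mc: "mprimary (mon_colon x d a)" if "length a = d" for a
      unfolding mon_colon_def
    proof (rule mprimary_colon[OF mprimary_mono[OF mprimary_power[OF mp, of "Suc (sum_list a)"]]])
      have g: "ideal (Idl (mon x ` {b \<in> expos d (sum_list a). b < a})) R"
        by (intro genideal_ideal sub) auto
      show "ideal (ideal_power R ?J (Suc (sum_list a)) <+> Idl (mon x ` {b \<in> expos d (sum_list a). b < a})) R"
        using J g by (intro add_ideals) auto
      show "ideal_power R ?J (Suc (sum_list a)) \<subseteq>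
          ideal_power R ?J (Suc (sum_list a)) <+> Idl (mon x ` {b \<in> expos d (sum_list a). b < a})"
        using J by (intro ideal_sum_ge1 g ideal_subset_carrier) simp
      show "mon x a \<in> carrier R" using that xi by (intro mon_closed) auto
    qed
    show "len (mon_colon x d b) \<le> len (mon_colon x d a)"
      using mon_colon_mono[OF x ab a] mc[OF a] mprimary_ideal[OF mc[OF b]] by (intro len_mono)
  qed
  ultimately show ?thesis using ev_poly_sum_antitone[of d "\<lambda>a. len (mon_colon x d a)"] by simp
qed

definition hs_poly :: "'a set \<Rightarrow> rat poly"
  where "hs_poly I = (THE p. \<forall>\<^sub>F n in sequentially. of_nat (len (ideal_power R I n)) = poly p (of_nat n))"

text \<open>The coefficient at \<open>d\<close> is taken, which a priori may be 0; for parameters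
  this is excluded later by \<open>E_pos\<close>.\<close>

definition mult_at :: "nat \<Rightarrow> 'a set \<Rightarrow> rat"
  where "mult_at d I = fact d * Polynomial.coeff (hs_poly I) d"

lemma hs_poly_eqI:
  fixes p :: "rat poly"
  assumes "\<And>n. n \<ge> n0 \<Longrightarrow> of_nat (len (ideal_power R I n)) = poly p (of_nat n)"
  shows "hs_poly I = p"
  unfolding hs_poly_def
proof (rule the_equality)
  show "\<forall>\<^sub>F n in sequentially. of_nat (len (ideal_power R I n)) = poly p (of_nat n)"
    unfolding eventually_sequentially using assms by blast
  fix q :: "rat poly" assume "\<forall>\<^sub>F n in sequentially. of_nat (len (ideal_power R I n)) = poly q (of_nat n)"
  then obtain n1 where "\<And>n. n \<ge> n1 \<Longrightarrow> of_nat (len (ideal_power R I n)) = poly q (of_nat n)"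
    unfolding eventually_sequentially by blast
  then show "q = p" using assms by (intro poly_eq_of_eventually_eq[of "max n0 n1"]) (metis max.bounded_iff)
qed

lemma hs_poly_props:
  assumes "x ` {..<d} \<subseteq> carrier R" and "mprimary (Idl (x ` {..<d}))"
  obtains n0 where "degree (hs_poly (Idl (x ` {..<d}))) \<le> d"
    "\<And>n. n \<ge> n0 \<Longrightarrow> of_nat (len (ideal_power R (Idl (x ` {..<d})) n)) = poly (hs_poly (Idl (x ` {..<d}))) (of_nat n)"
proof -
  obtain p :: "rat poly" and n0 where p: "degree p \<le> d"
     "\<And>n. n \<ge> n0 \<Longrightarrow> of_nat (len (ideal_power R (Idl (x ` {..<d})) n)) = poly p (of_nat n)"
    using hilbert_samuel[OF assms] by (auto simp: ev_poly_def)
  then show ?thesis using that hs_poly_eqI[OF p(2)] by blast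
qed

lemma mult_at_nonneg:
  assumes "x ` {..<d} \<subseteq> carrier R" and "mprimary (Idl (x ` {..<d}))"
  shows "0 \<le> mult_at d (Idl (x ` {..<d}))"
proof -
  obtain n0 where p: "degree (hs_poly (Idl (x ` {..<d}))) \<le> d"
    "\<And>n. n \<ge> n0 \<Longrightarrow> of_nat (len (ideal_power R (Idl (x ` {..<d})) n)) = poly (hs_poly (Idl (x ` {..<d}))) (of_nat n)"
    using hs_poly_props[OF assms] by blast
  have "Polynomial.coeff 0 d \<le> Polynomial.coeff (hs_poly (Idl (x ` {..<d}))) d"
  proof (rule coeff_le_of_eventually_le[of _ _ _ n0])
    fix n :: nat assume "n0 \<le> n"
    then show "poly 0 (of_nat n) \<le> poly (hs_poly (Idl (x ` {..<d}))) (of_nat n)"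
      using p(2)[of n, symmetric] by simp
  qed (use p(1) in simp_all)
  then show ?thesis by (simp add: mult_at_def)
qed

end

lemma coeff_pcompose_linear:
  fixes p :: "rat poly"
  assumes "degree p \<le> d" "b \<noteq> 0"
  shows "degree (pcompose p [:c, b:]) \<le> d" "Polynomial.coeff (pcompose p [:c, b:]) d = b ^ d * Polynomial.coeff p d"
proof -
  have dg: "degree (pcompose p [:c, b:]) = degree p" using assms by (simp add: degree_pcompose)
  then show "degree (pcompose p [:c, b:]) \<le> d" using assms by simp
  show "Polynomial.coeff (pcompose p [:c, b:]) d = b ^ d * Polynomial.coeff p d"
  proof (cases "degree p = d")
    case True
    then show ?thesis using lead_coeff_comp[of "[:c, b:]" p] dg assms by simp
  next
    case False
    then show ?thesis using dg assms by (simp add: coeff_eq_0)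
  qed
qed

text \<open>The colength of \<open>(x_i^N)^k\<close> lies between those of \<open>J^(N k)\<close>
  and \<open>J^(N k + N d)\<close>. Substituting \<open>N k + c\<close> into the polynomial of
  \<open>J\<close> multiplies its coefficient at \<open>d\<close> by \<open>N^d\<close>, whatever
  the shift \<open>c\<close> is.\<close>

lemma (in local_noetherian) mult_at_power:
  assumes x: "x ` {..<d} \<subseteq> carrier R" and mp: "mprimary (Idl (x ` {..<d}))" and N: "N > 0"
  shows "mprimary (Idl ((\<lambda>i. x i [^] (N::nat)) ` {..<d}))"
    and "mult_at d (Idl ((\<lambda>i. x i [^] N) ` {..<d})) = of_nat N ^ d * mult_at d (Idl (x ` {..<d}))"
proof -
  let ?J = "Idl (x ` {..<d})" and ?K = "Idl ((\<lambda>i. x i [^] N) ` {..<d})"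
  have x': "(\<lambda>i. x i [^] N) ` {..<d} \<subseteq> carrier R" using x by auto
  have J: "ideal ?J R" and K: "ideal ?K R" using x x' by (auto intro: genideal_ideal)
  have "ideal_power R ?J (N * 1 + N * d) \<subseteq> ?K"
    using power_le_power_param[OF x N, of 1] K by (simp add: ideal_power_1 del: mult_1_right)
  then show mpK: "mprimary ?K" using mprimary_mono[OF mprimary_power[OF mp] K] by blast
  obtain n0 where p: "degree (hs_poly ?J) \<le> d"
    "\<And>n. n \<ge> n0 \<Longrightarrow> of_nat (len (ideal_power R ?J n)) = poly (hs_poly ?J) (of_nat n)"
    using hs_poly_props[OF x mp] by blast
  obtain n1 where q: "degree (hs_poly ?K) \<le> d"
    "\<And>n. n \<ge> n1 \<Longrightarrow> of_nat (len (ideal_power R ?K n)) = poly (hs_poly ?K) (of_nat n)"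
    using hs_poly_props[OF x' mpK] by blast
  let ?P = "\<lambda>c. pcompose (hs_poly ?J) [:c, of_nat N:]"
  have NN: "(of_nat N :: rat) \<noteq> 0" using N by simp
  have P: "poly (?P (of_nat c)) (of_nat k) = of_nat (len (ideal_power R ?J (N * k + c)))" if "k \<ge> n0" for c k
  proof -
    have "N * k + c \<ge> n0" using that N by (cases N) auto
    then show ?thesis using p(2)[of "N * k + c"] by (simp add: poly_pcompose algebra_simps)
  qed
  have "Polynomial.coeff (?P (of_nat 0)) d \<le> Polynomial.coeff (hs_poly ?K) d"
  proof (rule coeff_le_of_eventually_le[of _ _ _ "max n0 n1"])
    show "degree (?P (of_nat 0)) \<le> d" "degree (hs_poly ?K) \<le> d"
      using coeff_pcompose_linear(1)[OF p(1) NN] q by auto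
    fix n assume n: "max n0 n1 \<le> n"
    have "len (ideal_power R ?J (N * n + 0)) \<le> len (ideal_power R ?K n)"
      using power_param_le[OF x] J by (intro len_mono mprimary_power mpK) auto
    then show "poly (?P (of_nat 0)) (of_nat n) \<le> poly (hs_poly ?K) (of_nat n)"
      using P[of n 0] q(2)[of n] n by (simp del: of_nat_0)
  qed
  moreover have "Polynomial.coeff (hs_poly ?K) d \<le> Polynomial.coeff (?P (of_nat (N * d))) d"
  proof (rule coeff_le_of_eventually_le[of _ _ _ "max n0 n1"])
    show "degree (?P (of_nat (N * d))) \<le> d" "degree (hs_poly ?K) \<le> d"
      using coeff_pcompose_linear(1)[OF p(1) NN] q by auto
    fix n assume n: "max n0 n1 \<le> n"
    have "len (ideal_power R ?K n) \<le> len (ideal_power R ?J (N * n + N * d))"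
      using power_le_power_param[OF x N] K by (intro len_mono mprimary_power mp) auto
    then show "poly (hs_poly ?K) (of_nat n) \<le> poly (?P (of_nat (N * d))) (of_nat n)"
      using P[of n "N * d"] q(2)[of n] n by simp
  qed
  ultimately have "Polynomial.coeff (hs_poly ?K) d = of_nat N ^ d * Polynomial.coeff (hs_poly ?J) d"
    unfolding coeff_pcompose_linear(2)[OF p(1) NN] by (rule antisym[rotated])
  then show "mult_at d ?K = of_nat N ^ d * mult_at d ?J" by (simp add: mult_at_def)
qed

section \<open>Buchsbaum rings\<close>

context cring begin

text \<open>Together with \<open>adjoin_adjoin_mult\<close> it yields
  \<open>len_adjoin_mult\<close>, the comparison of colengths for different powers of one
  parameter.\<close>

lemma colon_adjoin_mult:
  assumes Q: "ideal Q R" and y: "y \<in> carrier R" and z: "z \<in> carrier R"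
  shows "colon (adjoin Q (y \<otimes> z)) z = adjoin (colon Q z) y"
proof
  show "colon (adjoin Q (y \<otimes> z)) z \<subseteq> adjoin (colon Q z) y"
  proof
    fix r assume "r \<in> colon (adjoin Q (y \<otimes> z)) z"
    then obtain q s where *: "r \<in> carrier R" "q \<in> Q" "s \<in> carrier R" "r \<otimes> z = q \<oplus> s \<otimes> (y \<otimes> z)"
      by (auto simp: mem_colon mem_adjoin)
    have q: "q \<in> carrier R" using *(2) Q ideal.Icarr by metis
    have "(r \<ominus> s \<otimes> y) \<otimes> z = r \<otimes> z \<ominus> s \<otimes> (y \<otimes> z)" using * y z by algebra
    also have "\<dots> = q" unfolding *(4) using * q y z by algebra
    finally have "r \<ominus> s \<otimes> y \<in> colon Q z" using * y by (simp add: mem_colon)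
    moreover have "r = (r \<ominus> s \<otimes> y) \<oplus> s \<otimes> y" using * y by algebra
    ultimately show "r \<in> adjoin (colon Q z) y" unfolding mem_adjoin using *(3) by blast
  qed
  show "adjoin (colon Q z) y \<subseteq> colon (adjoin Q (y \<otimes> z)) z"
  proof
    fix r assume "r \<in> adjoin (colon Q z) y"
    then obtain q s where *: "q \<in> colon Q z" "s \<in> carrier R" "r = q \<oplus> s \<otimes> y" by (auto simp: mem_adjoin)
    then have q: "q \<in> carrier R" "q \<otimes> z \<in> Q" by (auto simp: mem_colon)
    have "r \<otimes> z = q \<otimes> z \<oplus> s \<otimes> (y \<otimes> z)" using * q y z by algebra
    then have "r \<otimes> z \<in> adjoin Q (y \<otimes> z)" using q * by (auto simp: mem_adjoin)
    then show "r \<in> colon (adjoin Q (y \<otimes> z)) z" using * q y by (simp add: mem_colon)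
  qed
qed

lemma adjoin_adjoin_mult:
  assumes Q: "ideal Q R" and y: "y \<in> carrier R" and z: "z \<in> carrier R"
  shows "adjoin (adjoin Q (y \<otimes> z)) z = adjoin Q z"
proof
  have a: "ideal (adjoin Q z) R" "Q \<subseteq> adjoin Q z" "z \<in> adjoin Q z"
    using Q z by (auto intro: adjoin_ideal adjoin_self subsetD[OF adjoin_ge])
  then show "adjoin (adjoin Q (y \<otimes> z)) z \<subseteq> adjoin Q z"
    using y ideal.I_l_closed[OF a(1)] by (intro adjoin_le) auto
  show "adjoin Q z \<subseteq> adjoin (adjoin Q (y \<otimes> z)) z"
    using Q y z by (intro adjoin_mono adjoin_ge) auto
qed

lemma Idl_image_split:
  assumes "x ` {..<d} \<subseteq> carrier R" "i < d"
  shows "Idl (x ` {..<d}) = adjoin (Idl (x ` ({..<d} - {i}))) (x i)"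
proof -
  have "x ` {..<d} = insert (x i) (x ` ({..<d} - {i}))" using assms(2) by auto
  then show ?thesis using Idl_insert[of "x i" "x ` ({..<d} - {i})"] assms by auto
qed

lemma Idl_update_split:
  assumes "x ` ({..<d} - {i}) \<subseteq> carrier R" "z \<in> carrier R" "i < d"
  shows "Idl (x(i := z) ` {..<d}) = adjoin (Idl (x ` ({..<d} - {i}))) z"
proof -
  have "x(i := z) ` {..<d} = insert z (x ` ({..<d} - {i}))" using assms(3) by auto
  then show ?thesis using Idl_insert[OF assms(2,1)] by simp
qed

end

section \<open>Systems of parameters and powers of one parameter\<close>

context local_noetherian begin

definition param :: "nat \<Rightarrow> (nat \<Rightarrow> 'a) \<Rightarrow> bool"
  where "param d x \<longleftrightarrow> x ` {..<d} \<subseteq> \<mm> \<and> mprimary (Idl (x ` {..<d}))"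

lemma param_carrier: "param d x \<Longrightarrow> x ` {..<d} \<subseteq> carrier R"
  using m_carrier by (auto simp: param_def)

lemma param_in_m: "param d x \<Longrightarrow> i < d \<Longrightarrow> x i \<in> \<mm>"
  by (auto simp: param_def)

lemma param_in_carrier: "param d x \<Longrightarrow> i < d \<Longrightarrow> x i \<in> carrier R"
  using m_carrier by (auto simp: param_def)

lemma param_ideal: "param d x \<Longrightarrow> A \<subseteq> {..<d} \<Longrightarrow> ideal (Idl (x ` A)) R"
  using param_carrier by (intro genideal_ideal) blast

lemma param_of_powers:
  assumes x: "param d x" and y: "y ` {..<d} \<subseteq> \<mm>" and *: "\<And>i. i < d \<Longrightarrow> \<exists>n::nat. x i [^] n \<in> Idl (y ` {..<d})"
  shows "param d y"
proof -
  have Y: "ideal (Idl (y ` {..<d})) R" using y m_carrier by (intro genideal_ideal) auto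
  have "\<exists>n. ideal_power R (Idl (x ` {..<d})) n \<subseteq> Idl (y ` {..<d})"
    using * by (intro Idl_power_le[OF _ param_carrier[OF x] Y]) auto
  moreover have "mprimary (ideal_power R (Idl (x ` {..<d})) n)" for n
    using x mprimary_power by (simp add: param_def)
  ultimately have "mprimary (Idl (y ` {..<d}))" using Y mprimary_mono by metis
  then show ?thesis using y by (simp add: param_def)
qed

lemma m_pow_mem: "z \<in> \<mm> \<Longrightarrow> n > 0 \<Longrightarrow> z [^] (n::nat) \<in> \<mm>"
proof -
  assume z: "z \<in> \<mm>" "n > 0"
  then obtain k where "n = Suc k" by (meson gr0_conv_Suc)
  then show ?thesis using z m_carrier ideal.I_l_closed[OF m_ideal] by simp
qed

lemma param_pow:
  assumes x: "param d x" and k: "\<And>i. i < d \<Longrightarrow> k i > (0::nat)"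
  shows "param d (\<lambda>i. x i [^] k i)"
proof (rule param_of_powers[OF x])
  show y: "(\<lambda>i. x i [^] k i) ` {..<d} \<subseteq> \<mm>" using k param_in_m[OF x] m_pow_mem by auto
  fix i assume "i < d"
  then have "x i [^] k i \<in> Idl ((\<lambda>i. x i [^] k i) ` {..<d})"
    using y m_carrier by (intro Idl_mem) auto
  then show "\<exists>n::nat. x i [^] n \<in> Idl ((\<lambda>i. x i [^] k i) ` {..<d})" by blast
qed

lemma param_pow_on: "param d x \<Longrightarrow> N > 0 \<Longrightarrow> param d (\<lambda>j. if j \<in> A then x j [^] (N::nat) else x j)"
proof -
  assume x: "param d x" "N > 0"
  have "param d (\<lambda>j. x j [^] (if j \<in> A then N else 1))" using x by (intro param_pow) auto
  moreover have "(\<lambda>j. x j [^] (if j \<in> A then N else 1)) ` {..<d} = (\<lambda>j. if j \<in> A then x j [^] N else x j) ` {..<d}"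
    using param_in_carrier[OF x(1)] by (intro image_cong) auto
  ultimately show ?thesis unfolding param_def by simp
qed

lemma param_pow_at: "param d x \<Longrightarrow> N > 0 \<Longrightarrow> param d (x(i := x i [^] (N::nat)))"
proof -
  assume x: "param d x" "N > 0"
  have "(\<lambda>j. if j \<in> {i} then x j [^] N else x j) = x(i := x i [^] N)" by auto
  then show ?thesis using param_pow_on[OF x, of "{i}"] by simp
qed

lemma len_adjoin_mult:
  assumes "ideal Q R" "y \<in> carrier R" "z \<in> carrier R" "mprimary (adjoin Q (y \<otimes> z))"
  shows "len (adjoin Q (y \<otimes> z)) = len (adjoin Q z) + len (adjoin (colon Q z) y)"
  using len_adjoin_colon[OF assms(4,3)] adjoin_adjoin_mult[OF assms(1-3)] colon_adjoin_mult[OF assms(1-3)]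
  by simp

lemma mprimary_adjoin_power:
  assumes "ideal Q R" "y \<in> carrier R" "mprimary (adjoin Q y)"
  shows "mprimary (adjoin Q (y [^] (n::nat)))"
proof -
  have "ideal (adjoin Q (y [^] n)) R" using assms by (intro adjoin_ideal) auto
  moreover have "ideal_power R (Q <+> PIdl y) (1 + n) \<subseteq> adjoin Q (y [^] n)"
  proof -
    have "ideal_power R (PIdl y) n \<subseteq> PIdl (y [^] n)" using assms(2) by (rule PIdl_power_le)
    then have "ideal_power R Q 1 <+> ideal_power R (PIdl y) n \<subseteq> Q <+> PIdl (y [^] n)"
      using assms(1) by (intro ideal_sum_mono) (auto simp: ideal_power_1)
    then show ?thesis
      using ideal_power_sum[OF assms(1) cgenideal_ideal[OF assms(2)], of 1 n] by (auto simp: adjoin_def)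
  qed
  ultimately show ?thesis
    using mprimary_mono[OF mprimary_power[OF assms(3), of "1 + n"]] by (simp add: adjoin_def)
qed

text \<open>Passing from \<open>y^n\<close> to \<open>y^(n+1)\<close> adds the colength of
  \<open>(Q : y^n) + (y)\<close>, which is at most that of \<open>Q + (y)\<close>.\<close>

lemma len_adjoin_power_le:
  assumes Q: "ideal Q R" and y: "y \<in> carrier R" and mp: "mprimary (adjoin Q y)"
  shows "len (adjoin Q (y [^] (n::nat))) \<le> n * len (adjoin Q y)"
proof (induction n)
  case 0
  have "adjoin Q \<one> = carrier R" using adjoin_self[OF Q one_closed] ideal.one_imp_carrier[OF adjoin_ideal[OF Q one_closed]] by simp
  then show ?case by (simp add: len_carrier)
next
  case (Suc n)
  have "len (adjoin Q (y \<otimes> y [^] n)) = len (adjoin Q (y [^] n)) + len (adjoin (colon Q (y [^] n)) y)"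
    using mprimary_adjoin_power[OF Q y mp, of "Suc n"] y by (intro len_adjoin_mult Q) (auto simp: m_comm)
  moreover have "len (adjoin (colon Q (y [^] n)) y) \<le> len (adjoin Q y)"
    using Q y by (intro len_mono mp adjoin_ideal adjoin_mono colon_ge colon_ideal) auto
  moreover have "y [^] Suc n = y \<otimes> y [^] n" using y by (simp add: m_comm)
  ultimately show ?case using Suc by simp
qed

lemma colon_powers_stabilise:
  assumes Q: "ideal Q R" and y: "y \<in> carrier R"
  obtains M :: nat where "M > 0" "\<And>j. colon (colon Q (y [^] M)) (y [^] (j::nat)) = colon Q (y [^] M)"
proof -
  let ?P = "\<lambda>L. \<exists>n::nat. n > 0 \<and> L = colon Q (y [^] n)"
  obtain L where "?P L" and Lx: "\<And>K. ?P K \<Longrightarrow> L \<subseteq> K \<Longrightarrow> K = L"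
    by (rule ex_maximal[of ?P "colon Q (y [^] (1::nat))"])
      (use colon_ideal[OF Q nat_pow_closed[OF y]] in \<open>blast, metis, auto\<close>)
  then obtain M where M: "M > 0" "L = colon Q (y [^] (M::nat))" by blast
  have "colon (colon Q (y [^] M)) (y [^] (j::nat)) = L" for j
  proof (rule Lx)
    have "colon (colon Q (y [^] M)) (y [^] j) = colon Q (y [^] (M + j))"
      using y by (simp add: colon_colon nat_pow_mult add.commute)
    then show "?P (colon (colon Q (y [^] M)) (y [^] j))" using M(1) by auto
    show "L \<subseteq> colon (colon Q (y [^] M)) (y [^] j)" unfolding M(2)
      using Q y by (intro colon_ge colon_ideal) auto
  qed
  then show ?thesis using that M by blast
qed

end

text \<open>Here \<open>c\<close> is the Buchsbaum invariant \<open>I(R)\<close>. Positive dimension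
  enters as \<open>d_pos\<close> and as \<open>not_nilpotent\<close>, which makes multiplicities
  positive in \<open>E_pos\<close>.\<close>

locale buchsbaum_local = local_noetherian +
  fixes d c :: nat
  assumes d_pos: "d > 0"
    and not_nilpotent: "\<And>n. ideal_power R \<mm> n \<noteq> {\<zero>}"
    and len_param: "\<And>x. param d x \<Longrightarrow>
      of_nat (len (Idl (x ` {..<d}))) = mult_at d (Idl (x ` {..<d})) + (of_nat c :: rat)"
begin

abbreviation E :: "(nat \<Rightarrow> 'a) \<Rightarrow> rat"
  where "E x \<equiv> mult_at d (Idl (x ` {..<d}))"

lemma E_pow: "param d x \<Longrightarrow> N > 0 \<Longrightarrow> E (\<lambda>i. x i [^] (N::nat)) = of_nat N ^ d * E x"
  using mult_at_power(2)[OF param_carrier] by (simp add: param_def)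

text \<open>For the parameters \<open>x_j^K\<close> the length inequality
  \<open>len_adjoin_power_le\<close> says the same about \<open>K^d\<close> times the
  multiplicities, up to an error bounded in terms of \<open>N\<close> and \<open>c\<close>. As
  \<open>K\<close> grows, this error becomes negligible.\<close>

lemma E_pow_at_le:
  assumes x: "param d x" and N: "N > 0" and i: "i < d"
  shows "E (x(i := x i [^] (N::nat))) \<le> of_nat N * E x"
proof (rule ccontr)
  let ?x' = "x(i := x i [^] N)"
  define \<delta> where "\<delta> = E ?x' - of_nat N * E x"
  assume "\<not> ?thesis"
  then have \<delta>: "\<delta> > 0" by (simp add: \<delta>_def)
  have x': "param d ?x'" using param_pow_at[OF x N] .
  have *: "of_nat K ^ d * \<delta> \<le> of_nat (N * c)" if K: "K > 0" for K :: nat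
  proof -
    let ?y = "\<lambda>j. x j [^] K"
    have y: "param d ?y" using param_pow[OF x, of "\<lambda>_. K"] K by simp
    have yc: "?y ` ({..<d} - {i}) \<subseteq> carrier R" "?y i \<in> carrier R" using param_in_carrier[OF x] i by auto
    let ?Q = "Idl (?y ` ({..<d} - {i}))"
    have Q: "ideal ?Q R" using yc by (intro genideal_ideal)
    have 1: "Idl (?y ` {..<d}) = adjoin ?Q (?y i)" using param_carrier[OF y] i by (rule Idl_image_split)
    have 2: "Idl ((\<lambda>j. ?x' j [^] K) ` {..<d}) = adjoin ?Q (?y i [^] N)"
    proof -
      have "(\<lambda>j. ?x' j [^] K) ` {..<d} = ?y(i := ?y i [^] N) ` {..<d}"
        using param_in_carrier[OF x] i by (intro image_cong) (auto simp: nat_pow_pow mult.commute)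
      then show ?thesis using Idl_update_split[OF yc(1) nat_pow_closed[OF yc(2)] i] by simp
    qed
    have "len (adjoin ?Q (?y i [^] N)) \<le> N * len (adjoin ?Q (?y i))"
      using y 1 by (intro len_adjoin_power_le Q yc) (simp add: param_def)
    then have "(of_nat (len (adjoin ?Q (?y i [^] N))) :: rat) \<le> of_nat N * of_nat (len (adjoin ?Q (?y i)))"
      by (metis of_nat_le_iff of_nat_mult)
    moreover have "of_nat (len (adjoin ?Q (?y i [^] N))) = of_nat K ^ d * E ?x' + of_nat c"
      using len_param[OF param_pow[OF x', of "\<lambda>_. K"]] E_pow[OF x' K] K 2 by simp
    moreover have "of_nat (len (adjoin ?Q (?y i))) = of_nat K ^ d * E x + of_nat c"
      using len_param[OF y] E_pow[OF x K] 1 by simp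
    ultimately have "of_nat K ^ d * E ?x' + of_nat c \<le> of_nat N * (of_nat K ^ d * E x + of_nat c)" by simp
    then have "of_nat K ^ d * \<delta> + of_nat c \<le> of_nat N * of_nat c" by (simp add: \<delta>_def algebra_simps)
    then show ?thesis by (simp add: add_increasing2 order_trans[rotated])
  qed
  obtain K :: nat where K: "of_nat (N * c) / \<delta> < of_nat K" using reals_Archimedean2 by blast
  then have "of_nat (N * c) < of_nat K * \<delta>" using \<delta> by (simp add: divide_less_eq)
  moreover have K0: "K > 0"
  proof (rule ccontr)
    assume "\<not> K > 0"
    then have "(of_nat (N * c) :: rat) < 0" using calculation by simp
    then show False by (metis of_nat_0_le_iff not_le)
  qed
  moreover have "(of_nat K :: rat) \<le> of_nat K ^ d" using K0 d_pos by (intro self_le_power) auto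
  then have "of_nat K * \<delta> \<le> of_nat K ^ d * \<delta>" using \<delta> by (intro mult_right_mono) auto
  ultimately show False using *[OF K0] by linarith
qed

text \<open>For the converse the other \<open>d - 1\<close> parameters are raised to the power
  \<open>N\<close> too. This gains at most the factor \<open>N^(d-1)\<close>, while the total factor
  is exactly \<open>N^d\<close> by \<open>E_pow\<close>.\<close>

lemma E_pow_at:
  assumes x: "param d x" and N: "N > 0" and i: "i < d"
  shows "E (x(i := x i [^] (N::nat))) = of_nat N * E x"
proof (rule antisym[OF E_pow_at_le[OF assms]])
  let ?x = "x(i := x i [^] N)"
  have x': "param d ?x" using param_pow_at[OF x N] .
  have "E (\<lambda>j. if j \<in> A then ?x j [^] N else ?x j) \<le> of_nat N ^ card A * E ?x" if "finite A" "A \<subseteq> {..<d}" for A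
    using that
  proof (induction A)
    case (insert a A)
    let ?y = "\<lambda>j. if j \<in> A then ?x j [^] N else ?x j"
    have y: "param d ?y" using param_pow_on[OF x' N] .
    have "(\<lambda>j. if j \<in> insert a A then ?x j [^] N else ?x j) = ?y(a := ?y a [^] N)"
      using insert.hyps by auto
    then have "E (\<lambda>j. if j \<in> insert a A then ?x j [^] N else ?x j) = E (?y(a := ?y a [^] N))"
      by (rule arg_cong[where f = E])
    also have "\<dots> \<le> of_nat N * E ?y" using E_pow_at_le[OF y N, of a] insert.prems by blast
    also have "\<dots> \<le> of_nat N * (of_nat N ^ card A * E ?x)" using insert by (intro mult_left_mono) auto
    finally show ?case using insert.hyps by simp
  qed simp
  from this[of "{..<d} - {i}"]
  have "E (\<lambda>j. if j \<in> {..<d} - {i} then ?x j [^] N else ?x j) \<le> of_nat N ^ (d - 1) * E ?x"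
    using i by (simp only: finite_Diff finite_lessThan Diff_subset card_Diff_singleton card_lessThan lessThan_iff)
  moreover have "(\<lambda>j. if j \<in> {..<d} - {i} then ?x j [^] N else ?x j) ` {..<d} = (\<lambda>j. x j [^] N) ` {..<d}"
    by (intro image_cong) auto
  ultimately have "of_nat N ^ d * E x \<le> of_nat N ^ (d - 1) * E ?x" using E_pow[OF x N] by simp
  moreover have "(of_nat N :: rat) ^ d = of_nat N ^ (d - 1) * of_nat N"
    using d_pos by (cases d) auto
  ultimately have "of_nat N ^ (d - 1) * (of_nat N * E x) \<le> of_nat N ^ (d - 1) * E ?x" by (simp add: mult.assoc)
  then show "of_nat N * E x \<le> E ?x" using N by simp
qed

lemma len_pow_at:
  assumes x: "param d x" and N: "N > 0" and i: "i < d"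
  shows "of_nat (len (adjoin (Idl (x ` ({..<d} - {i}))) (x i [^] (N::nat)))) = of_nat N * E x + (of_nat c :: rat)"
proof -
  have "Idl (x(i := x i [^] N) ` {..<d}) = adjoin (Idl (x ` ({..<d} - {i}))) (x i [^] N)"
    using param_in_carrier[OF x] i by (intro Idl_update_split) auto
  then show ?thesis using len_param[OF param_pow_at[OF x N, of i]] E_pow_at[OF assms] by simp
qed

text \<open>The colength of \<open>(Q : y\<^sup>M) + y\<close>, where \<open>Q\<close> is generated by the other parameters,
  equals the multiplicity both for \<open>M = 1\<close> and for the stable value of \<open>Q : y\<^sup>M\<close>.\<close>

lemma weak_sequence_full:
  assumes x: "param d x" and i: "i < d" and b: "b \<in> carrier R"
    and bn: "b \<otimes> x i [^] (n::nat) \<in> Idl (x ` ({..<d} - {i}))"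
  shows "b \<otimes> x i \<in> Idl (x ` ({..<d} - {i}))"
proof -
  let ?Q = "Idl (x ` ({..<d} - {i}))" and ?y = "x i"
  have y: "?y \<in> carrier R" using param_in_carrier[OF x i] .
  have Q: "ideal ?Q R" using param_ideal[OF x] by simp
  have mp: "mprimary (adjoin ?Q ?y)"
    using x Idl_image_split[OF param_carrier[OF x] i] by (simp add: param_def)
  let ?A = "colon ?Q ?y"
  have A: "ideal ?A R" using Q y by (rule colon_ideal)
  have E1: "of_nat (len (adjoin ?Q (?y [^] N))) = of_nat N * E x + (of_nat c :: rat)" if "N > 0" for N :: nat
    using len_pow_at[OF x that i] .
  \<comment> \<open>This colength is the difference of those of \<open>Q + (y^2)\<close> and
    \<open>Q + (y)\<close>, in which \<open>c\<close> cancels.\<close>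
  have lenA: "of_nat (len (adjoin ?A ?y)) = E x"
  proof -
    have "len (adjoin ?Q (?y \<otimes> ?y)) = len (adjoin ?Q ?y) + len (adjoin ?A ?y)"
      using mprimary_adjoin_power[OF Q y mp, of 2] y by (intro len_adjoin_mult Q y) (simp add: numeral_2_eq_2)
    then have "of_nat (len (adjoin ?Q (?y [^] (2::nat)))) = of_nat (len (adjoin ?Q (?y [^] (1::nat)))) + (of_nat (len (adjoin ?A ?y)) :: rat)"
      using y by (simp add: numeral_2_eq_2)
    then show ?thesis using E1[of 2] E1[of 1] by simp
  qed
  obtain M :: nat where M: "M > 0" "\<And>j. colon (colon ?Q (?y [^] M)) (?y [^] (j::nat)) = colon ?Q (?y [^] M)"
    using colon_powers_stabilise[OF Q y] by metis
  let ?D = "colon ?Q (?y [^] M)"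
  have D: "ideal ?D R" using Q y by (intro colon_ideal) auto
  have mpD: "mprimary (adjoin ?D ?y)"
    using mp D Q y by (intro mprimary_mono[OF mp] adjoin_ideal adjoin_mono colon_ge) auto
  \<comment> \<open>Since \<open>?D : y^j = ?D\<close>, the element \<open>y\<close> is a
    nonzerodivisor modulo \<open>?D\<close>, and the colength of \<open>?D + (y^M)\<close> is
    exactly \<open>M\<close> times that of \<open>?D + (y)\<close>. On the other hand it is the
    difference belonging to the exponents \<open>2 M\<close> and \<open>M\<close>.\<close>
  have lenD: "of_nat (len (adjoin ?D ?y)) = E x"
  proof -
    have "len (adjoin ?D (?y [^] j)) = j * len (adjoin ?D ?y)" for j :: nat
    proof (induction j)
      case 0
      have "adjoin ?D \<one> = carrier R"
        using adjoin_self[OF D one_closed] ideal.one_imp_carrier[OF adjoin_ideal[OF D one_closed]] by simp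
      then show ?case by (simp add: len_carrier)
    next
      case (Suc j)
      have "len (adjoin ?D (?y \<otimes> ?y [^] j)) = len (adjoin ?D (?y [^] j)) + len (adjoin (colon ?D (?y [^] j)) ?y)"
        using mprimary_adjoin_power[OF D y mpD, of "Suc j"] y by (intro len_adjoin_mult D) (auto simp: m_comm)
      moreover have "?y [^] Suc j = ?y \<otimes> ?y [^] j" using y by (simp add: m_comm)
      ultimately show ?case using Suc M(2) by simp
    qed
    then have 1: "len (adjoin ?D (?y [^] M)) = M * len (adjoin ?D ?y)" .
    have "len (adjoin ?Q (?y [^] M \<otimes> ?y [^] M)) = len (adjoin ?Q (?y [^] M)) + len (adjoin ?D (?y [^] M))"
      using mprimary_adjoin_power[OF Q y mp, of "M + M"] y by (intro len_adjoin_mult Q) (auto simp: nat_pow_mult)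
    then have "of_nat (len (adjoin ?Q (?y [^] (M + M)))) = of_nat (len (adjoin ?Q (?y [^] M))) + (of_nat M * of_nat (len (adjoin ?D ?y)) :: rat)"
      using y 1 by (simp add: nat_pow_mult)
    then have "of_nat M * (of_nat (len (adjoin ?D ?y)) :: rat) = of_nat M * E x"
      using E1[of "M + M"] E1[of M] M(1) by (simp add: algebra_simps)
    then show ?thesis using M(1) by simp
  qed
  have AD: "?A \<subseteq> ?D"
  proof -
    obtain k where k: "M = Suc k" using M(1) by (meson gr0_conv_Suc)
    have "?D = colon (colon ?Q ?y) (?y [^] k)" using y k by (simp add: colon_colon)
    then show ?thesis using colon_ge[OF A, of "?y [^] k"] y by simp
  qed
  have mpA: "mprimary (adjoin ?A ?y)"
    using Q y by (intro mprimary_mono[OF mp] adjoin_ideal adjoin_mono colon_ge A) auto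
  have "adjoin ?A ?y = adjoin ?D ?y"
  proof (rule len_eq_imp_eq[OF mpA])
    show "ideal (adjoin ?D ?y) R" "adjoin ?A ?y \<subseteq> adjoin ?D ?y"
      using D y AD by (auto intro!: adjoin_ideal dest: subsetD[OF adjoin_mono])
    have "(of_nat (len (adjoin ?A ?y)) :: rat) = of_nat (len (adjoin ?D ?y))" using lenA lenD by simp
    then show "len (adjoin ?A ?y) \<le> len (adjoin ?D ?y)" by (simp only: of_nat_eq_iff)
  qed
  then have DA: "?D \<subseteq> adjoin ?A ?y" using adjoin_ge[OF D y] by simp
  \<comment> \<open>The exponent of \<open>y\<close> is raised step by step: the coefficient of
    \<open>y^(j+1)\<close> is in \<open>?D\<close> again by stability, hence of the form
    \<open>a' + s y\<close> with \<open>a' \<in> ?A\<close>, and \<open>a' y^(j+1)\<close> lies in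
    \<open>?Q\<close>.\<close>
  have DAj: "?D \<subseteq> adjoin ?A (?y [^] Suc j)" for j
  proof (induction j)
    case 0
    then show ?case using DA y by simp
  next
    case (Suc j)
    show ?case
    proof
      fix b assume bD: "b \<in> ?D"
      then obtain a r where ar: "a \<in> ?A" "r \<in> carrier R" "b = a \<oplus> r \<otimes> ?y [^] Suc j"
        using subsetD[OF Suc bD] unfolding mem_adjoin by blast
      have ac: "a \<in> carrier R" using ar A ideal.Icarr by metis
      have yj: "?y [^] Suc j \<in> carrier R" "?y [^] j \<in> carrier R" using y by auto
      have "r \<otimes> ?y [^] Suc j \<oplus> a \<in> ?D" using bD ar ac yj by (simp add: a_comm)
      then have "r \<otimes> ?y [^] Suc j \<in> ?D" using ideal_mem_of_add[OF D] ar AD yj by blast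
      then have "r \<in> ?D" using M(2)[of "Suc j"] ar by (auto simp: mem_colon)
      then obtain a' s where as: "a' \<in> ?A" "s \<in> carrier R" "r = a' \<oplus> s \<otimes> ?y"
        using subsetD[OF DA] unfolding mem_adjoin by blast
      have a'c: "a' \<in> carrier R" using as A ideal.Icarr by metis
      have "?y [^] j \<otimes> (a' \<otimes> ?y) \<in> ?Q" using as yj ideal.I_l_closed[OF Q] by (simp add: mem_colon)
      then have q: "?y [^] j \<otimes> (a' \<otimes> ?y) \<in> ?A" using colon_ge[OF Q y] by auto
      have "b = (a \<oplus> ?y [^] j \<otimes> (a' \<otimes> ?y)) \<oplus> s \<otimes> ?y [^] Suc (Suc j)"
        unfolding ar(3) as(3) nat_pow_Suc using ac a'c as(2) y yj by algebra
      then show "b \<in> adjoin ?A (?y [^] Suc (Suc j))"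
        using ideal_add_mem[OF A ar(1) q] as(2) unfolding mem_adjoin by blast
    qed
  qed
  \<comment> \<open>At the exponent \<open>M\<close> the remaining multiple of \<open>y^M\<close>
    falls into \<open>?Q\<close>, because its coefficient is in \<open>?D\<close>.\<close>
  have "?D \<subseteq> ?A"
  proof
    fix b assume bD: "b \<in> ?D"
    obtain k where k: "M = Suc k" using M(1) by (meson gr0_conv_Suc)
    have "b \<in> adjoin ?A (?y [^] M)" using subsetD[OF DAj bD] unfolding k .
    then obtain a r where ar: "a \<in> ?A" "r \<in> carrier R" "b = a \<oplus> r \<otimes> ?y [^] M"
      by (auto simp: mem_adjoin)
    have ac: "a \<in> carrier R" using ar A ideal.Icarr by metis
    have "r \<otimes> ?y [^] M \<oplus> a \<in> ?D" using bD ar ac y by (simp add: a_comm)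
    then have "r \<otimes> ?y [^] M \<in> ?D" using ideal_mem_of_add[OF D] ar AD y by blast
    then have "r \<in> ?D" using M(2)[of M] ar by (auto simp: mem_colon)
    then have "r \<otimes> ?y [^] M \<in> ?A" using colon_ge[OF Q y] by (auto simp: mem_colon)
    then show "b \<in> ?A" using ar ideal_add_mem[OF A] by simp
  qed
  moreover have "b \<in> ?D"
  proof -
    have "colon ?Q (?y [^] n) \<subseteq> colon (colon ?Q (?y [^] n)) (?y [^] M)"
      using Q y by (intro colon_ge colon_ideal) auto
    also have "\<dots> = colon ?D (?y [^] n)" using y by (simp add: colon_colon m_comm)
    also have "\<dots> = ?D" by (rule M(2))
    finally show ?thesis using b bn by (auto simp: mem_colon)
  qed
  ultimately show ?thesis by (auto simp: mem_colon)
qed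

end

text \<open>The powers \<open>x_j^N\<close> lie in ever higher powers of \<open>\<mm>\<close>, so
  they vanish in the intersection over \<open>N\<close>.\<close>

lemma (in local_noetherian) krull_param:
  assumes A: "x ` A \<subseteq> \<mm>" and B: "x ` B \<subseteq> \<mm>" and b: "b \<in> carrier R"
    and *: "\<And>N::nat. N > 0 \<Longrightarrow> b \<in> Idl (x ` A \<union> (\<lambda>j. x j [^] N) ` B)"
  shows "b \<in> Idl (x ` A)"
proof (rule krull_intersection[OF _ b])
  have Ac: "x ` A \<subseteq> carrier R" using A m_carrier by blast
  then show I: "ideal (Idl (x ` A)) R" by (rule genideal_ideal)
  fix n
  have "Idl (x ` A \<union> (\<lambda>j. x j [^] Suc n) ` B) \<subseteq> Idl (x ` A) <+> ideal_power R \<mm> n"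
  proof (rule Idl_le[OF ideal_sum_m_power[OF I]])
    have "x ` A \<subseteq> Idl (x ` A) <+> ideal_power R \<mm> n"
      using ideal_sum_ge1[OF ideal_power_ideal[OF m_ideal] ideal_subset_carrier[OF I], of n] genideal_self[OF Ac] by blast
    moreover have "(\<lambda>j. x j [^] Suc n) ` B \<subseteq> Idl (x ` A) <+> ideal_power R \<mm> n"
    proof (rule image_subsetI)
      fix j assume "j \<in> B"
      then have "x j [^] Suc n \<in> ideal_power R \<mm> (Suc n)" using B by (intro elem_power_mem m_ideal) auto
      then have "x j [^] Suc n \<in> ideal_power R \<mm> n" using ideal_power_antimono[OF m_ideal, of n "Suc n"] by auto
      then show "x j [^] Suc n \<in> Idl (x ` A) <+> ideal_power R \<mm> n"
        using ideal_sum_ge2[OF I ideal_subset_carrier[OF ideal_power_ideal[OF m_ideal]], of n] by blast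
    qed
    ultimately show "x ` A \<union> (\<lambda>j. x j [^] Suc n) ` B \<subseteq> Idl (x ` A) <+> ideal_power R \<mm> n" by blast
  qed
  then show "b \<in> Idl (x ` A) <+> ideal_power R \<mm> n" using *[of "Suc n"] by auto
qed

section \<open>Weak sequences and colon ideals of partial systems of parameters\<close>

context buchsbaum_local begin

text \<open>The parameters other than \<open>x_l\<close> and those in \<open>A\<close> are replaced
  by their powers \<open>x_j^N\<close>. The case of \<open>d - 1\<close> parameters then applies,
  and \<open>krull_param\<close> removes the powers again.\<close>

lemma weak_sequence:
  assumes x: "param d x" and A: "A \<subseteq> {..<d}" and l: "l < d" "l \<notin> A" and b: "b \<in> carrier R"
    and bn: "b \<otimes> x l [^] (n::nat) \<in> Idl (x ` A)"
  shows "b \<otimes> x l \<in> Idl (x ` A)"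
proof (rule krull_param[where B = "{..<d}"])
  show "x ` A \<subseteq> \<mm>" "x ` {..<d} \<subseteq> \<mm>" "b \<otimes> x l \<in> carrier R"
    using param_in_m[OF x] A l b m_carrier by auto
  fix N :: nat assume N: "N > 0"
  let ?B = "{..<d} - insert l A"
  let ?x = "\<lambda>j. if j \<in> ?B then x j [^] N else x j"
  have x': "param d ?x" using param_pow_on[OF x N] .
  have c: "?x ` ({..<d} - {l}) \<subseteq> carrier R" using param_carrier[OF x'] by blast
  have "x ` A \<subseteq> ?x ` ({..<d} - {l})"
  proof (rule image_subsetI)
    fix j assume "j \<in> A"
    then have "x j = ?x j" "j \<in> {..<d} - {l}" using A l by auto
    then show "x j \<in> ?x ` ({..<d} - {l})" by (rule image_eqI)
  qed
  then have "b \<otimes> ?x l [^] n \<in> Idl (?x ` ({..<d} - {l}))"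
    using bn Idl_mono[OF _ c] by auto
  then have "b \<otimes> ?x l \<in> Idl (?x ` ({..<d} - {l}))" by (rule weak_sequence_full[OF x' l(1) b])
  moreover have "Idl (?x ` ({..<d} - {l})) \<subseteq> Idl (x ` A \<union> (\<lambda>j. x j [^] N) ` {..<d})"
    using param_in_carrier[OF x] A by (intro Idl_mono) auto
  ultimately show "b \<otimes> x l \<in> Idl (x ` A \<union> (\<lambda>j. x j [^] N) ` {..<d})" by auto
qed

lemma Idl_update_add:
  assumes xc: "x ` A \<subseteq> carrier R" and iA: "i \<in> A" and lA: "l \<in> A" and il: "i \<noteq> l" and r: "r \<in> carrier R"
  shows "Idl (x(i := x i \<oplus> r \<otimes> x l) ` A) = Idl (x ` A)"
proof -
  let ?y = "x(i := x i \<oplus> r \<otimes> x l)"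
  have X: "ideal (Idl (x ` A)) R" using xc by (rule genideal_ideal)
  have xm: "x j \<in> Idl (x ` A)" if "j \<in> A" for j using that xc by (intro Idl_mem) auto
  have yX: "?y ` A \<subseteq> Idl (x ` A)"
    using xm assms ideal_add_mem[OF X] ideal.I_l_closed[OF X] by auto
  then have yc: "?y ` A \<subseteq> carrier R" using ideal_subset_carrier[OF X] by blast
  have Y: "ideal (Idl (?y ` A)) R" using yc by (rule genideal_ideal)
  have ym: "?y j \<in> Idl (?y ` A)" if "j \<in> A" for j using that yc by (intro Idl_mem) auto
  have "x i \<in> Idl (?y ` A)"
  proof (rule ideal_mem_of_add[OF Y])
    show "x i \<oplus> r \<otimes> x l \<in> Idl (?y ` A)" using ym[OF iA] by simp
    show "r \<otimes> x l \<in> Idl (?y ` A)" using ym[OF lA] il r ideal.I_l_closed[OF Y] by simp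
  qed (use xc iA in auto)
  then have "x j \<in> Idl (?y ` A)" if "j \<in> A" for j
    using ym[OF that] by (cases "j = i") auto
  then have "x ` A \<subseteq> Idl (?y ` A)" by auto
  then show "Idl (?y ` A) = Idl (x ` A)" using yX X Y by (intro equalityI Idl_le)
qed

lemma param_add:
  assumes x: "param d x" and i: "i < d" and l: "l < d" and il: "i \<noteq> l" and r: "r \<in> carrier R"
  shows "param d (x(i := x i \<oplus> r \<otimes> x l))"
proof -
  have "x(i := x i \<oplus> r \<otimes> x l) ` {..<d} \<subseteq> \<mm>"
    using param_in_m[OF x] i l r ideal_add_mem[OF m_ideal] ideal.I_l_closed[OF m_ideal] by auto
  then show ?thesis
    using x Idl_update_add[OF param_carrier[OF x], of i l r] i l il r by (simp add: param_def)
qed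

text \<open>With \<open>x_i\<close> replaced by \<open>y = x_i + x_l\<close>: since
  \<open>b x_i\<close> is in \<open>(x_C)\<close>, one has \<open>b y^N = b x_l^N\<close> modulo
  \<open>(x_C)\<close>, so \<open>b y^N\<close> is in the ideal generated by \<open>x_C\<close> and
  the powers \<open>x_j^N\<close> of the other parameters. The weak sequence property reduces this
  to \<open>b y\<close>, from which \<open>b x_i\<close> can be subtracted.\<close>

lemma colon_param_eq:
  assumes x: "param d x" and C: "C \<subseteq> {..<d}" and i: "i < d" "i \<notin> C" and l: "l < d" "l \<notin> C"
    and b: "b \<in> carrier R" and bi: "b \<otimes> x i \<in> Idl (x ` C)"
  shows "b \<otimes> x l \<in> Idl (x ` C)"
proof (cases "i = l")
  case False
  show ?thesis
  proof (rule krull_param[where B = "{..<d}"])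
    show "x ` C \<subseteq> \<mm>" "x ` {..<d} \<subseteq> \<mm>" "b \<otimes> x l \<in> carrier R"
      using param_in_m[OF x] C l b m_carrier by auto
    fix N :: nat assume N: "N > 0"
    have QC: "ideal (Idl (x ` C)) R" using param_ideal[OF x C] .
    have xi: "x i \<in> carrier R" and xl: "x l \<in> carrier R" using param_in_carrier[OF x] i l by auto
    let ?y = "x i \<oplus> x l"
    have y: "?y \<in> carrier R" using xi xl by simp
    have x1: "param d (x(i := ?y))" using param_add[OF x i(1) l(1) False one_closed] xl by simp
    let ?B = "{..<d} - insert i C"
    let ?x = "\<lambda>j. if j \<in> ?B then (x(i := ?y)) j [^] N else (x(i := ?y)) j"
    have x': "param d ?x" using param_pow_on[OF x1 N] .
    let ?Q = "Idl (?x ` ({..<d} - {i}))"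
    have c: "?x ` ({..<d} - {i}) \<subseteq> carrier R" using param_carrier[OF x'] by blast
    have Q: "ideal ?Q R" using c by (rule genideal_ideal)
    have "x ` C \<subseteq> ?x ` ({..<d} - {i})"
    proof (rule image_subsetI)
      fix j assume "j \<in> C"
      then have "x j = ?x j" "j \<in> {..<d} - {i}" using C i by auto
      then show "x j \<in> ?x ` ({..<d} - {i})" by (rule image_eqI)
    qed
    then have CQ: "Idl (x ` C) \<subseteq> ?Q" using c by (rule Idl_mono)
    have xlQ: "x l [^] N \<in> ?Q"
    proof -
      have "x l [^] N = ?x l" "l \<in> {..<d} - {i}" using l False by auto
      then have "x l [^] N \<in> ?x ` ({..<d} - {i})" by (rule image_eqI)
      then show ?thesis using c by (rule Idl_mem)
    qed
    have "b \<otimes> ?y [^] n \<ominus> b \<otimes> x l [^] n \<in> Idl (x ` C)" for n :: nat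
    proof (induction n)
      case 0
      have "b \<otimes> \<one> \<ominus> b \<otimes> \<one> = \<zero>" using b by algebra
      then show ?case using ideal_zero_mem[OF QC] by simp
    next
      case (Suc n)
      have p: "?y [^] n \<in> carrier R" "x l [^] n \<in> carrier R" using xi xl by auto
      have "b \<otimes> ?y [^] Suc n \<ominus> b \<otimes> x l [^] Suc n
          = (b \<otimes> ?y [^] n \<ominus> b \<otimes> x l [^] n) \<otimes> ?y \<oplus> x l [^] n \<otimes> (b \<otimes> x i)"
        unfolding nat_pow_Suc using b p xi xl y by algebra
      then show ?case
        using ideal_add_mem[OF QC] ideal.I_r_closed[OF QC Suc y] ideal.I_l_closed[OF QC bi p(2)] by simp
    qed
    then have "b \<otimes> ?y [^] N \<ominus> b \<otimes> x l [^] N \<in> ?Q" using CQ by blast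
    then have "b \<otimes> ?y [^] N \<in> ?Q"
      using ideal_mem_of_diff[OF Q] ideal.I_l_closed[OF Q xlQ b] b y by auto
    then have "b \<otimes> ?x i [^] N \<in> ?Q" by simp
    then have "b \<otimes> ?x i \<in> ?Q" by (rule weak_sequence_full[OF x' i(1) b])
    then have "b \<otimes> ?y \<in> ?Q" by simp
    moreover have "b \<otimes> x l \<oplus> b \<otimes> x i = b \<otimes> ?y" using b xi xl by algebra
    ultimately have "b \<otimes> x l \<in> ?Q"
      using ideal_mem_of_add[OF Q, of "b \<otimes> x l" "b \<otimes> x i"] subsetD[OF CQ bi] b xl by simp
    moreover have "?Q \<subseteq> Idl (x ` C \<union> (\<lambda>j. x j [^] N) ` {..<d})"
      using param_in_carrier[OF x] C by (intro Idl_mono) auto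
    ultimately show "b \<otimes> x l \<in> Idl (x ` C \<union> (\<lambda>j. x j [^] N) ` {..<d})" by auto
  qed
qed (use bi in simp)

text \<open>The following ideal is \<open>(x\<^sub>A) : x\<^sub>l\<close> for each \<open>l \<notin> A\<close>.\<close>

definition unmixed :: "(nat \<Rightarrow> 'a) \<Rightarrow> nat set \<Rightarrow> 'a set"
  where "unmixed x A = {u \<in> carrier R. \<forall>l<d. l \<notin> A \<longrightarrow> u \<otimes> x l \<in> Idl (x ` A)}"

lemma mem_unmixed_iff:
  assumes "param d x" "A \<subseteq> {..<d}" "i < d" "i \<notin> A"
  shows "u \<in> unmixed x A \<longleftrightarrow> u \<in> carrier R \<and> u \<otimes> x i \<in> Idl (x ` A)"
  using assms colon_param_eq[OF assms] by (auto simp: unmixed_def)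

lemma unmixed_ideal:
  assumes x: "param d x" and A: "A \<subseteq> {..<d}"
  shows "ideal (unmixed x A) R"
proof -
  have Q: "ideal (Idl (x ` A)) R" using param_ideal[OF x A] .
  show ?thesis
    by (rule ideal_of_closed)
      (auto simp: unmixed_def param_in_carrier[OF x] ideal_zero_mem[OF Q] l_distr ideal_add_mem[OF Q]
        m_assoc ideal.I_l_closed[OF Q])
qed

lemma Idl_le_unmixed: "param d x \<Longrightarrow> A \<subseteq> {..<d} \<Longrightarrow> Idl (x ` A) \<subseteq> unmixed x A"
  using ideal.I_r_closed[OF param_ideal] ideal.Icarr[OF param_ideal] param_in_carrier
  by (fastforce simp: unmixed_def)

lemma unmixed_mono:
  assumes x: "param d x" and A: "A \<subseteq> B" and B: "B \<subseteq> {..<d}"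
  shows "unmixed x A \<subseteq> unmixed x B"
proof -
  have "x ` B \<subseteq> carrier R" using param_carrier[OF x] B by blast
  then have "Idl (x ` A) \<subseteq> Idl (x ` B)" using A by (intro Idl_mono) auto
  then show ?thesis using A by (auto simp: unmixed_def)
qed

lemma Idl_insert_param:
  assumes "param d x" "A \<subseteq> {..<d}" "i < d"
  shows "Idl (x ` insert i A) = adjoin (Idl (x ` A)) (x i)"
  using assms Idl_insert[of "x i" "x ` A"] param_carrier[OF assms(1)] by auto

lemma unmixed_inter_param:
  assumes x: "param d x" and A: "A \<subseteq> {..<d}" and u: "u \<in> unmixed x A"
    and B: "finite B" "B \<subseteq> {..<d} - A" "u \<in> Idl (x ` (B \<union> A))"
  shows "u \<in> Idl (x ` A)"
  using B
proof (induction B)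
  case (insert l B)
  let ?Q = "Idl (x ` (B \<union> A))"
  have BA: "B \<union> A \<subseteq> {..<d}" and l: "l < d" "l \<notin> B \<union> A" using insert.prems insert.hyps A by auto
  have Q: "ideal ?Q R" using param_ideal[OF x BA] .
  have xl: "x l \<in> carrier R" using param_in_carrier[OF x l(1)] .
  have "u \<in> adjoin ?Q (x l)" using insert.prems Idl_insert_param[OF x BA l(1)] by simp
  then obtain q s where qs: "q \<in> ?Q" "s \<in> carrier R" "u = q \<oplus> s \<otimes> x l" by (auto simp: mem_adjoin)
  have q: "q \<in> carrier R" using qs Q ideal.Icarr by metis
  have "u \<in> unmixed x (B \<union> A)" using u unmixed_mono[OF x _ BA, of A] by auto
  then have "u \<otimes> x l \<in> ?Q" using l by (simp add: unmixed_def)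
  moreover have "s \<otimes> x l [^] (2::nat) \<oplus> q \<otimes> x l = u \<otimes> x l"
    unfolding qs(3) numeral_2_eq_2 using q qs(2) xl by (simp, algebra)
  ultimately have "s \<otimes> x l [^] (2::nat) \<in> ?Q"
    using ideal_mem_of_add[OF Q, of "s \<otimes> x l [^] (2::nat)" "q \<otimes> x l"] ideal.I_r_closed[OF Q qs(1) xl] qs xl by simp
  then have "s \<otimes> x l \<in> ?Q" using weak_sequence[OF x BA l qs(2)] by blast
  then have "u \<in> ?Q" using qs ideal_add_mem[OF Q] by simp
  then show ?case using insert.IH insert.prems by blast
qed simp

text \<open>The representations of \<open>a\<close> by \<open>u\<close> and \<open>v\<close> are
  changed modulo \<open>J\<close> until both use the same element \<open>w\<close>, which is then
  corrected by a multiple of \<open>x_l\<close> to lie in \<open>unmixed x C\<close>.\<close>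

lemma unmixed_sum_inter:
  assumes x: "param d x" and C: "C \<subseteq> {..<d}" and i: "i < d" "i \<notin> C" and l: "l < d" "l \<notin> C" and il: "i \<noteq> l"
    and ai: "a \<in> Idl (x ` {..<d}) <+> unmixed x (insert i C)"
    and al: "a \<in> Idl (x ` {..<d}) <+> unmixed x (insert l C)"
  shows "a \<in> Idl (x ` {..<d}) <+> unmixed x C"
proof -
  let ?J = "Idl (x ` {..<d})" and ?Q = "Idl (x ` C)" and ?Ci = "insert i C" and ?Cl = "insert l C"
  have J: "ideal ?J R" using param_ideal[OF x] by simp
  have Q: "ideal ?Q R" using param_ideal[OF x C] .
  have xi: "x i \<in> carrier R" and xl: "x l \<in> carrier R" using param_in_carrier[OF x] i l by auto
  have sub: "?Ci \<subseteq> {..<d}" "?Cl \<subseteq> {..<d}" "insert l ?Ci \<subseteq> {..<d}" using C i l by auto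
  have Ui: "ideal (unmixed x ?Ci) R" and Ul: "ideal (unmixed x ?Cl) R" and Uil: "ideal (unmixed x (insert l ?Ci)) R"
    using unmixed_ideal[OF x] sub by auto
  have xJ: "x j \<in> ?J" if "j < d" for j using param_carrier[OF x] that by (intro Idl_mem) auto
  obtain p u where u: "p \<in> ?J" "u \<in> unmixed x ?Ci" "a = p \<oplus> u" using ai by (auto simp: mem_ideal_sum)
  obtain p' v where v: "p' \<in> ?J" "v \<in> unmixed x ?Cl" "a = p' \<oplus> v" using al by (auto simp: mem_ideal_sum)
  have car: "p \<in> carrier R" "p' \<in> carrier R" "u \<in> carrier R" "v \<in> carrier R"
    using u v ideal.Icarr[OF J] ideal.Icarr[OF Ui] ideal.Icarr[OF Ul] by auto
  have "u \<ominus> v = p' \<ominus> p"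
  proof -
    have "u \<ominus> v = (p \<oplus> u) \<ominus> v \<ominus> p" using car by algebra
    also have "\<dots> = p' \<ominus> p" unfolding u(3)[symmetric] v(3) using car by algebra
    finally show ?thesis .
  qed
  then have uvJ: "u \<ominus> v \<in> ?J" using ideal_diff_mem[OF J v(1) u(1)] by simp
  have "?Ci \<subseteq> insert l ?Ci" "?Cl \<subseteq> insert l ?Ci" by auto
  then have "unmixed x ?Ci \<subseteq> unmixed x (insert l ?Ci)" "unmixed x ?Cl \<subseteq> unmixed x (insert l ?Ci)"
    using unmixed_mono[OF x _ sub(3)] by blast+
  then have "u \<ominus> v \<in> unmixed x (insert l ?Ci)" using u v ideal_diff_mem[OF Uil] by auto
  moreover have "({..<d} - insert l ?Ci) \<union> insert l ?Ci = {..<d}" using sub(3) by blast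
  then have "u \<ominus> v \<in> Idl (x ` (({..<d} - insert l ?Ci) \<union> insert l ?Ci))" using uvJ by simp
  ultimately have "u \<ominus> v \<in> Idl (x ` insert l ?Ci)"
    by (intro unmixed_inter_param[OF x sub(3), of _ "{..<d} - insert l ?Ci"]) (blast | simp)+
  also have "Idl (x ` insert l ?Ci) = adjoin (adjoin ?Q (x i)) (x l)"
    using Idl_insert_param[OF x sub(1) l(1)] Idl_insert_param[OF x C i(1)] by simp
  finally obtain t s where t: "t \<in> adjoin ?Q (x i)" "s \<in> carrier R" "u \<ominus> v = t \<oplus> s \<otimes> x l"
    unfolding mem_adjoin[of _ _ "x l"] by blast
  then obtain q r where qr: "q \<in> ?Q" "r \<in> carrier R" "t = q \<oplus> r \<otimes> x i" unfolding mem_adjoin by blast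
  note qrs = qr(1,2) t(2) t(3)[unfolded qr(3)]
  have q: "q \<in> carrier R" using qrs Q ideal.Icarr by metis
  \<comment> \<open>From \<open>u - v = q + r x_i + s x_l\<close> this is also
    \<open>v + q + s x_l\<close>, so \<open>w\<close> belongs to both unmixed ideals.\<close>
  define w where "w = u \<ominus> r \<otimes> x i"
  have wc: "w \<in> carrier R" using car qrs xi by (simp add: w_def)
  have Ii: "Idl (x ` ?Ci) = adjoin ?Q (x i)" and Il: "Idl (x ` ?Cl) = adjoin ?Q (x l)"
    using Idl_insert_param[OF x C] i l by auto
  have xiU: "r \<otimes> x i \<in> unmixed x ?Ci"
    using subsetD[OF Idl_le_unmixed[OF x sub(1)], unfolded Ii, OF adjoin_self[OF Q xi]]
      ideal.I_l_closed[OF Ui _ qrs(2)] by blast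
  have wi: "w \<in> unmixed x ?Ci" unfolding w_def using ideal_diff_mem[OF Ui u(2) xiU] .
  have "w = v \<oplus> (q \<oplus> s \<otimes> x l)"
  proof -
    have "w = (u \<ominus> v) \<oplus> v \<ominus> r \<otimes> x i" unfolding w_def using car qrs(2) xi by algebra
    also have "\<dots> = v \<oplus> (q \<oplus> s \<otimes> x l)" unfolding qrs(4) using car q qrs(2,3) xi xl by algebra
    finally show ?thesis .
  qed
  moreover have "q \<oplus> s \<otimes> x l \<in> unmixed x ?Cl"
    using Idl_le_unmixed[OF x sub(2)] qrs unfolding Il mem_adjoin subset_iff by blast
  ultimately have wl: "w \<in> unmixed x ?Cl" using ideal_add_mem[OF Ul v(2)] by simp
  have "w \<otimes> x l \<in> adjoin ?Q (x i)" "w \<otimes> x i \<in> adjoin ?Q (x l)"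
    using wi wl i l il unfolding unmixed_def Ii[symmetric] Il[symmetric] by blast+
  then obtain q1 \<alpha> q2 \<beta> where 1: "q1 \<in> ?Q" "\<alpha> \<in> carrier R" "w \<otimes> x l = q1 \<oplus> \<alpha> \<otimes> x i"
    and 2: "q2 \<in> ?Q" "\<beta> \<in> carrier R" "w \<otimes> x i = q2 \<oplus> \<beta> \<otimes> x l" by (auto simp: mem_adjoin)
  have qc: "q1 \<in> carrier R" "q2 \<in> carrier R" using 1 2 ideal.Icarr[OF Q] by auto
  \<comment> \<open>Eliminating \<open>w\<close> from the two relations puts
    \<open>\<alpha> x_i^2\<close> into \<open>(x_C, x_l^2)\<close>. With \<open>x_l^2\<close> as a
    parameter in place of \<open>x_l\<close>, the weak sequence property cancels one factor
    \<open>x_i\<close>.\<close>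
  let ?x = "x(l := x l [^] (2::nat))"
  have x': "param d ?x" using param_pow_at[OF x, of 2] by simp
  have imC: "?x ` C = x ` C" using l by auto
  have I2: "Idl (?x ` ?Cl) = adjoin ?Q (x l [^] (2::nat))"
    using Idl_insert_param[OF x' C l(1)] imC by simp
  have A2: "ideal (adjoin ?Q (x l [^] (2::nat))) R" using Q xl by (intro adjoin_ideal) auto
  have "\<alpha> \<otimes> x i [^] (2::nat) = (q2 \<otimes> x l \<ominus> q1 \<otimes> x i) \<oplus> \<beta> \<otimes> x l [^] (2::nat)"
  proof -
    have "\<alpha> \<otimes> (x i \<otimes> x i) = (q1 \<oplus> \<alpha> \<otimes> x i) \<otimes> x i \<ominus> q1 \<otimes> x i" using qc 1(2) xi by algebra
    also have "\<dots> = (w \<otimes> x i) \<otimes> x l \<ominus> q1 \<otimes> x i" unfolding 1(3)[symmetric] using wc xi xl qc by algebra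
    also have "\<dots> = (q2 \<otimes> x l \<ominus> q1 \<otimes> x i) \<oplus> \<beta> \<otimes> (x l \<otimes> x l)" unfolding 2(3) using qc 2(2) xi xl by algebra
    finally show ?thesis using xi xl by (simp add: numeral_2_eq_2)
  qed
  moreover have "q2 \<otimes> x l \<ominus> q1 \<otimes> x i \<in> ?Q"
    using ideal_diff_mem[OF Q] ideal.I_r_closed[OF Q] 1 2 xi xl by simp
  ultimately have "\<alpha> \<otimes> ?x i [^] (2::nat) \<in> Idl (?x ` ?Cl)"
    unfolding I2 mem_adjoin using il 2(2) by auto
  then have "\<alpha> \<otimes> ?x i \<in> Idl (?x ` ?Cl)"
    using weak_sequence[OF x' sub(2) i(1) _ 1(2)] il i by blast
  then have "\<alpha> \<otimes> x i \<in> adjoin ?Q (x l [^] (2::nat))" using il I2 by simp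
  then have "w \<otimes> x l \<in> adjoin ?Q (x l [^] (2::nat))"
    unfolding 1(3) using ideal_add_mem[OF A2] 1(1) adjoin_ge[OF Q, of "x l [^] (2::nat)"] xl by auto
  then obtain q3 \<gamma> where 3: "q3 \<in> ?Q" "\<gamma> \<in> carrier R" "w \<otimes> x l = q3 \<oplus> \<gamma> \<otimes> x l [^] (2::nat)"
    by (auto simp: mem_adjoin)
  have q3: "q3 \<in> carrier R" using 3 ideal.Icarr[OF Q] by auto
  have "(w \<ominus> \<gamma> \<otimes> x l) \<otimes> x l = w \<otimes> x l \<ominus> \<gamma> \<otimes> (x l \<otimes> x l)" using wc 3(2) xl by algebra
  also have "\<dots> = q3" unfolding 3(3) numeral_2_eq_2 using q3 3(2) xl by (simp, algebra)
  finally have wU: "w \<ominus> \<gamma> \<otimes> x l \<in> unmixed x C"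
    using mem_unmixed_iff[OF x C l] 3 wc xl by simp
  have "a = (p \<oplus> r \<otimes> x i \<oplus> \<gamma> \<otimes> x l) \<oplus> (w \<ominus> \<gamma> \<otimes> x l)"
    unfolding u(3) w_def using car qrs(2) 3(2) xi xl by algebra
  moreover have "p \<oplus> r \<otimes> x i \<oplus> \<gamma> \<otimes> x l \<in> ?J"
    using u xJ i l qrs 3 ideal_add_mem[OF J] ideal.I_l_closed[OF J] by simp
  ultimately show ?thesis using wU unfolding mem_ideal_sum by blast
qed

text \<open>Descending induction on \<open>C\<close>: if at least two indices are missing,
  \<open>unmixed_sum_inter\<close> combines the results for \<open>C\<close> enlarged by either of
  them. At the end \<open>unmixed x {}\<close> is the annihilator of all parameters.\<close>

lemma socle_intersection:
  assumes x: "param d x" and a: "\<And>i. i < d \<Longrightarrow> a \<in> Idl (x ` {..<d}) <+> unmixed x ({..<d} - {i})"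
  shows "a \<in> Idl (x ` {..<d}) <+> unmixed x {}"
proof -
  have "a \<in> Idl (x ` {..<d}) <+> unmixed x C" if "C \<subseteq> {..<d}" "card ({..<d} - C) = Suc n" for C n
    using that
  proof (induction n arbitrary: C)
    case 0
    then obtain i where "{..<d} - C = {i}" by (auto simp: card_1_singleton_iff)
    then have "C = {..<d} - {i}" "i < d" using 0 by auto
    then show ?case using a by simp
  next
    case (Suc n)
    then have "\<exists>i l. i \<in> {..<d} - C \<and> l \<in> {..<d} - C \<and> i \<noteq> l"
      by (metis card_le_Suc0_iff_eq finite_Diff finite_lessThan not_less_eq_eq Suc_le_mono le0)
    then obtain i l where il: "i \<in> {..<d} - C" "l \<in> {..<d} - C" "i \<noteq> l" by blast
    have "card ({..<d} - insert k C) = Suc n" if "k \<in> {..<d} - C" for k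
      using Suc.prems that by (metis Diff_insert card_Diff_singleton diff_Suc_1)
    then have "a \<in> Idl (x ` {..<d}) <+> unmixed x (insert i C)" "a \<in> Idl (x ` {..<d}) <+> unmixed x (insert l C)"
      using Suc.IH[of "insert i C"] Suc.IH[of "insert l C"] Suc.prems il by auto
    then show ?case using unmixed_sum_inter[OF x Suc.prems(1), of i l a] il by auto
  qed
  from this[of "{}" "d - 1"] show ?thesis using d_pos by simp
qed

end

section \<open>Analytic independence of parameters\<close>

context local_noetherian begin

text \<open>Indices are inspected from the top: a term with coefficient in \<open>\<mm>\<close>
  disappears into \<open>L\<close>, so the first surviving coefficient is a unit.\<close>

lemma leading_term:
  fixes f :: "'i :: linorder \<Rightarrow> 'a"
  assumes L: "ideal L R"
  shows "finite S \<Longrightarrow> f ` S \<subseteq> carrier R \<Longrightarrow> \<forall>a\<in>S. \<forall>r\<in>\<mm>. r \<otimes> f a \<in> L \<Longrightarrow>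
    g \<in> L <+> Idl (f ` S) \<Longrightarrow> g \<notin> L \<Longrightarrow>
    \<exists>a u t. a \<in> S \<and> u \<in> carrier R \<and> u \<notin> \<mm> \<and> t \<in> L <+> Idl (f ` {b \<in> S. b < a}) \<and> g = t \<oplus> u \<otimes> f a"
proof (induction S rule: finite_linorder_max_induct)
  case empty
  have "L <+> {\<zero>} = L" using ideal.Icarr[OF L] by (force simp: set_add_def')
  then show ?case using empty by (simp add: Idl_empty)
next
  case (insert b A)
  have A: "f ` A \<subseteq> carrier R" "f b \<in> carrier R" using insert by auto
  have IA: "ideal (Idl (f ` A)) R" using A by (intro genideal_ideal)
  have LA: "ideal (L <+> Idl (f ` A)) R" using L IA by (rule add_ideals)
  have "Idl (f ` insert b A) = Idl (f ` A) <+> PIdl (f b)"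
    using Idl_insert[OF A(2,1)] by (simp add: adjoin_def)
  then have "L <+> Idl (f ` insert b A) = adjoin (L <+> Idl (f ` A)) (f b)"
    unfolding adjoin_def using ideal_subset_carrier[OF L] ideal_subset_carrier[OF IA]
      ideal_subset_carrier[OF cgenideal_ideal[OF A(2)]]
    by (simp add: add.set_mult_assoc set_add_defs(1))
  then have "g \<in> adjoin (L <+> Idl (f ` A)) (f b)" using insert.prems(3) by simp
  then obtain t u where tu: "t \<in> L <+> Idl (f ` A)" "u \<in> carrier R" "g = t \<oplus> u \<otimes> f b"
    unfolding mem_adjoin by blast
  show ?case
  proof (cases "u \<in> \<mm>")
    case True
    then have "u \<otimes> f b \<in> L <+> Idl (f ` A)"
      using insert.prems(2) ideal_sum_ge1[OF IA ideal_subset_carrier[OF L]] by auto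
    then have g: "g \<in> L <+> Idl (f ` A)" using tu ideal_add_mem[OF LA] by simp
    have "\<forall>a\<in>A. \<forall>r\<in>\<mm>. r \<otimes> f a \<in> L" using insert.prems(2) by simp
    from insert.IH[OF A(1) this g insert.prems(4)] obtain a u t where
      a: "a \<in> A" "u \<in> carrier R" "u \<notin> \<mm>" "t \<in> L <+> Idl (f ` {b \<in> A. b < a})" "g = t \<oplus> u \<otimes> f a"
      by (elim exE conjE) (rule that)
    have "{c \<in> insert b A. c < a} = {c \<in> A. c < a}" using insert.hyps(2) a(1) by auto
    then have "t \<in> L <+> Idl (f ` {c \<in> insert b A. c < a})" using a(4) by simp
    then show ?thesis using a by (intro exI[of _ a] exI[of _ u] exI[of _ t]) simp
  next
    case False
    have "{c \<in> insert b A. c < b} = A" using insert.hyps(2) by auto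
    then have "t \<in> L <+> Idl (f ` {c \<in> insert b A. c < b})" using tu(1) by simp
    then show ?thesis using tu False by (intro exI[of _ b] exI[of _ u] exI[of _ t]) simp
  qed
qed

text \<open>The variable times the Hilbert-Samuel polynomial is compared with \<open>C X^d\<close>
  at the exponent \<open>d + 1\<close>, where the latter has coefficient 0.\<close>

lemma mult_at_nonpos_of_len_bound:
  assumes x: "x ` {..<d} \<subseteq> carrier R" and mp: "mprimary (Idl (x ` {..<d}))"
    and C: "\<And>n. n * len (ideal_power R (Idl (x ` {..<d})) n) \<le> C * n ^ d"
  shows "mult_at d (Idl (x ` {..<d})) \<le> 0"
proof -
  let ?p = "hs_poly (Idl (x ` {..<d}))"
  obtain n0 where p: "degree ?p \<le> d"
    "\<And>n. n \<ge> n0 \<Longrightarrow> of_nat (len (ideal_power R (Idl (x ` {..<d})) n)) = poly ?p (of_nat n)"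
    using hs_poly_props[OF x mp] by blast
  have "Polynomial.coeff (pCons 0 ?p) (Suc d) \<le> Polynomial.coeff (Polynomial.monom (of_nat C) d) (Suc d)"
  proof (rule coeff_le_of_eventually_le[of _ _ _ n0])
    show "degree (pCons 0 ?p) \<le> Suc d" using p(1) degree_pCons_le[of 0 ?p] by linarith
    show "degree (Polynomial.monom (rat_of_nat C) d) \<le> Suc d"
      using degree_monom_le[of "rat_of_nat C" d] by linarith
    fix n assume n: "n0 \<le> n"
    have "(of_nat (n * len (ideal_power R (Idl (x ` {..<d})) n)) :: rat) \<le> of_nat (C * n ^ d)"
      using C[of n] by (simp only: of_nat_le_iff)
    then show "poly (pCons 0 ?p) (of_nat n) \<le> poly (Polynomial.monom (of_nat C) d) (of_nat n)"
      using p(2)[OF n] by (simp add: poly_monom)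
  qed
  then show ?thesis by (simp add: mult_at_def mult_nonneg_nonpos)
qed

end

context buchsbaum_local begin

text \<open>If the multiplicity were 0, the ideals generated by the \<open>x_i\<close> and by the
  \<open>x_i^2\<close> would both have colength \<open>c\<close>, hence be equal. Then
  \<open>J \<subseteq> \<mm>J\<close>, so \<open>J = 0\<close> by Nakayama and \<open>\<mm>\<close>
  is nilpotent.\<close>

lemma E_pos:
  assumes x: "param d x"
  shows "0 < E x"
proof (rule ccontr)
  assume "\<not> ?thesis"
  then have E0: "E x = 0" using mult_at_nonneg[OF param_carrier[OF x]] x by (force simp: param_def)
  let ?J = "Idl (x ` {..<d})" and ?x = "\<lambda>i. x i [^] (2::nat)"
  let ?K = "Idl (?x ` {..<d})"
  have x2: "param d ?x" using param_pow[OF x, of "\<lambda>_. 2"] by simp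
  have "E ?x = 0" using E_pow[OF x, of 2] E0 by simp
  then have "of_nat (len ?K) = (of_nat (len ?J) :: rat)" using len_param[OF x] len_param[OF x2] E0 by simp
  then have l: "len ?K = len ?J" by simp
  have J: "ideal ?J R" and K: "ideal ?K R" using param_ideal[OF x] param_ideal[OF x2] by auto
  have Jm: "?J \<subseteq> \<mm>" using x by (intro Idl_le) (auto simp: param_def)
  have xJ: "x i \<in> ?J" if "i < d" for i using that param_carrier[OF x] by (intro Idl_mem) auto
  have KmJ: "?K \<subseteq> \<mm> \<cdot> ?J"
  proof (rule Idl_le)
    show "ideal (\<mm> \<cdot> ?J) R" using J by (intro ideal_prod_is_ideal) auto
    show "?x ` {..<d} \<subseteq> \<mm> \<cdot> ?J"
      using xJ param_in_m[OF x] param_in_carrier[OF x] by (auto simp: numeral_2_eq_2 intro!: ideal_prod.prod)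
  qed
  also have "\<mm> \<cdot> ?J \<subseteq> ?J" using J by (intro ideal_prod_le2) auto
  finally have "?K = ?J" using x2 J l by (intro len_eq_imp_eq) (auto simp: param_def)
  then have "?J \<subseteq> \<mm> \<cdot> ?J" using KmJ by simp
  also have "\<dots> \<subseteq> {\<zero>} <+> \<mm> \<cdot> ?J"
    using J by (intro ideal_sum_ge2 zeroideal ideal_subset_carrier ideal_prod_is_ideal) auto
  finally have J0: "?J \<subseteq> {\<zero>}" by (rule nakayama[OF J zeroideal])
  obtain n where "ideal_power R \<mm> n \<subseteq> ?J" using x by (auto simp: param_def mprimary_def)
  then have "ideal_power R \<mm> n = {\<zero>}" using J0 ideal_zero_mem[OF ideal_power_ideal[OF m_ideal]] by blast
  then show False using not_nilpotent by blast
qed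

lemma mon_image: "param d x \<Longrightarrow> S \<subseteq> expos d n \<Longrightarrow> mon x ` S \<subseteq> carrier R"
  by (rule mon_image_carrier[OF param_carrier]) (auto simp: expos_def)

lemma mon_in_carrier: "param d x \<Longrightarrow> length a = d \<Longrightarrow> mon x a \<in> carrier R"
  using param_in_carrier by (intro mon_closed) auto

lemma J_ideal: "param d x \<Longrightarrow> ideal (Idl (x ` {..<d})) R"
  using param_ideal by blast

lemma mJ_ideal: "param d x \<Longrightarrow> ideal (\<mm> \<cdot> ideal_power R (Idl (x ` {..<d})) n) R"
  using J_ideal by (intro ideal_prod_is_ideal) auto

text \<open>A monomial \<open>x\<^sup>a\<close> which is a combination of smaller ones modulo \<open>\<mm>J\<^sup>n\<close> makes all its multiples
  superfluous as generators, so the colength of \<open>J\<^sup>n\<close> grows too slowly for positive multiplicity.\<close>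

lemma mon_not_in_lower:
  assumes x: "param d x" and a: "a \<in> expos d n"
  shows "mon x a \<notin> \<mm> \<cdot> ideal_power R (Idl (x ` {..<d})) n <+> Idl (mon x ` {b \<in> expos d n. b < a})"
proof
  let ?J = "Idl (x ` {..<d})"
  assume lead: "mon x a \<in> \<mm> \<cdot> ideal_power R ?J n <+> Idl (mon x ` {b \<in> expos d n. b < a})"
  have J: "ideal ?J R" using J_ideal[OF x] .
  have la: "length a = d" using a by (simp add: expos_def)
  have xi: "\<And>i. i < d \<Longrightarrow> x i \<in> carrier R" using param_in_carrier[OF x] .
  have sub: "mon x ` {b \<in> expos d N. P b} \<subseteq> carrier R" for N P by (rule mon_image[OF x]) auto
  \<comment> \<open>Multiplying the relation for \<open>x^a\<close> by \<open>x^e\<close> gives one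
    of the same kind for \<open>x^(a+e)\<close>, as the order is a monomial order.\<close>
  have lead_mult: "mon x b \<in> \<mm> \<cdot> ideal_power R ?J N <+> Idl (mon x ` {c \<in> expos d N. c < b})"
    if b: "b \<in> expos d N" "list_all2 (\<le>) a b" for b N
  proof -
    obtain e where e: "length e = d" "b = list_add a e" using list_le_diff[OF b(2)] la by auto
    have N: "N = n + sum_list e" using sum_list_add[of a e] a b(1) e by (auto simp: expos_def)
    let ?T = "\<mm> \<cdot> ideal_power R ?J N <+> Idl (mon x ` {c \<in> expos d N. c < b})"
    have T: "ideal ?T R" by (intro add_ideals mJ_ideal[OF x] genideal_ideal sub)
    obtain p q where pq: "p \<in> \<mm> \<cdot> ideal_power R ?J n" "q \<in> Idl (mon x ` {b \<in> expos d n. b < a})" "mon x a = p \<oplus> q"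
      using lead unfolding mem_ideal_sum by blast
    have ec: "mon x e \<in> carrier R" using mon_in_carrier[OF x e(1)] .
    have pc: "p \<in> carrier R" using pq(1) ideal.Icarr[OF mJ_ideal[OF x]] by blast
    have qc: "q \<in> carrier R" using ideal.Icarr[OF genideal_ideal[OF sub] pq(2)] .
    have "p \<otimes> mon x e \<in> (\<mm> \<cdot> ideal_power R ?J n) \<cdot> ideal_power R ?J (sum_list e)"
      using pq(1) mon_in_power[OF param_carrier[OF x] e(1)] by (rule ideal_prod.prod)
    also have "\<dots> = \<mm> \<cdot> ideal_power R ?J N"
      using J by (simp add: N ideal_power_add ideal_prod_assoc)
    finally have 1: "mon x e \<otimes> p \<in> ?T"
      unfolding m_comm[OF pc ec]
      by (rule subsetD[OF ideal_sum_ge1[OF genideal_ideal[OF sub] ideal_subset_carrier[OF mJ_ideal[OF x]]]])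
    have 2: "mon x e \<otimes> q \<in> ?T"
    proof (rule mult_Idl_mem[OF T ec sub _ pq(2)])
      fix y assume "y \<in> mon x ` {b \<in> expos d n. b < a}"
      then obtain b' where b': "b' \<in> expos d n" "b' < a" "y = mon x b'" by auto
      have lb: "length b' = d" using b' by (simp add: expos_def)
      have "mon x e \<otimes> y = mon x (list_add b' e)"
        using mon_add[of b' e x] lb e(1) xi b'(3) m_comm[OF ec, of y] mon_in_carrier[OF x lb] by simp
      moreover have "list_add b' e \<in> expos d N" "list_add b' e < b"
        using b' e la lb N list_add_less[of b' a e] sum_list_add[of b' e] by (auto simp: expos_def)
      ultimately have "mon x e \<otimes> y \<in> Idl (mon x ` {c \<in> expos d N. c < b})"
        using sub by (auto intro!: Idl_mem)
      then show "mon x e \<otimes> y \<in> ?T"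
        by (rule subsetD[OF ideal_sum_ge2[OF mJ_ideal[OF x] ideal_subset_carrier[OF genideal_ideal[OF sub]]]])
    qed
    have "mon x b = mon x a \<otimes> mon x e" using mon_add[of a e x] e la xi by simp
    then have "mon x b = mon x e \<otimes> p \<oplus> mon x e \<otimes> q" unfolding pq(3) using pc qc ec by algebra
    then show ?thesis using ideal_add_mem[OF T 1 2] by simp
  qed
  let ?G = "\<lambda>N. {b \<in> expos d N. \<not> list_all2 (\<le>) a b}"
  \<comment> \<open>By Nakayama one may calculate modulo \<open>\<mm>J^N\<close>. The least monomial
    not yet generated would be a multiple of \<open>x^a\<close>, hence a combination of smaller
    ones, which are generated.\<close>
  have gens: "ideal_power R ?J N \<subseteq> Idl (mon x ` ?G N)" for N
  proof (rule nakayama)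
    show "ideal (ideal_power R ?J N) R" "ideal (Idl (mon x ` ?G N)) R"
      using J by (auto intro: genideal_ideal[OF sub])
    let ?T = "Idl (mon x ` ?G N) <+> \<mm> \<cdot> ideal_power R ?J N"
    have T: "ideal ?T R" by (intro add_ideals mJ_ideal[OF x] genideal_ideal sub)
    have T1: "Idl (mon x ` ?G N) \<subseteq> ?T" and T2: "\<mm> \<cdot> ideal_power R ?J N \<subseteq> ?T"
      by (rule ideal_sum_ge1[OF mJ_ideal[OF x] ideal_subset_carrier[OF genideal_ideal[OF sub]]],
          rule ideal_sum_ge2[OF genideal_ideal[OF sub] ideal_subset_carrier[OF mJ_ideal[OF x]]])
    have "mon x b \<in> ?T" if "b \<in> expos d N" for b
    proof (rule ccontr)
      assume nb: "mon x b \<notin> ?T"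
      let ?B = "{b \<in> expos d N. mon x b \<notin> ?T}"
      have B: "finite ?B" "?B \<noteq> {}" using that nb by auto
      define m where "m = Min ?B"
      have m: "m \<in> ?B" "\<And>c. c \<in> expos d N \<Longrightarrow> c < m \<Longrightarrow> mon x c \<in> ?T"
        using Min_in[OF B] Min_le[OF B(1)] unfolding m_def by (auto simp: not_less[symmetric])
      show False
      proof (cases "list_all2 (\<le>) a m")
        case False
        then have "mon x m \<in> Idl (mon x ` ?G N)" using m(1) sub by (intro Idl_mem) auto
        then show ?thesis using T1 m(1) by auto
      next
        case True
        then have "mon x m \<in> \<mm> \<cdot> ideal_power R ?J N <+> Idl (mon x ` {c \<in> expos d N. c < m})"
          using lead_mult m(1) by blast
        moreover have "Idl (mon x ` {c \<in> expos d N. c < m}) \<subseteq> ?T" using m(2) by (intro Idl_le T) auto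
        ultimately show ?thesis using ideal_sum_le[OF T T2] m(1) by blast
      qed
    qed
    then show "ideal_power R ?J N \<subseteq> ?T"
      unfolding ideal_power_eq_monomials[OF param_carrier[OF x], of N] using T
      by (intro Idl_le) (auto simp: ideal_power_eq_monomials[OF param_carrier[OF x], of N])
  qed
  let ?g = "\<lambda>b. if list_all2 (\<le>) a b then 0 else 1 :: nat"
  \<comment> \<open>Each remaining generator of \<open>J^N\<close> is annihilated by
    \<open>J\<close> modulo \<open>J^(N+1)\<close>, so it contributes at most
    \<open>len ?J\<close>.\<close>
  have step: "len (ideal_power R ?J (Suc N)) \<le> len (ideal_power R ?J N) + len ?J * sum ?g (expos d N)" for N
  proof -
    have mpJ: "mprimary ?J" using x by (simp add: param_def)
    let ?L = "ideal_power R ?J (Suc N)"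
    have L: "ideal ?L R" using J by simp
    have I: "ideal (?L <+> Idl (mon x ` {b \<in> ?G N. P b})) R" "?L \<subseteq> ?L <+> Idl (mon x ` {b \<in> ?G N. P b})" for P
    proof -
      have g: "ideal (Idl (mon x ` {b \<in> ?G N. P b})) R" using mon_image[OF x] by (intro genideal_ideal) blast
      show "ideal (?L <+> Idl (mon x ` {b \<in> ?G N. P b})) R" using L g by (rule add_ideals)
      show "?L \<subseteq> ?L <+> Idl (mon x ` {b \<in> ?G N. P b})" using g L by (intro ideal_sum_ge1 ideal_subset_carrier)
    qed
    have "len (?L) = len (?L <+> Idl (mon x ` ?G N)) +
        (\<Sum>c\<in>?G N. len (colon (?L <+> Idl (mon x ` {b \<in> ?G N. b < c})) (mon x c)))"
      by (rule len_adjoin_finite[OF mprimary_power[OF mpJ]]) (use sub in auto)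
    also have "len (?L <+> Idl (mon x ` ?G N)) \<le> len (ideal_power R ?J N)"
    proof (rule len_mono[OF mprimary_power[OF mpJ]])
      have "?L <+> Idl (mon x ` ?G N) = ?L <+> Idl (mon x ` {b \<in> ?G N. True})" by simp
      then show "ideal (?L <+> Idl (mon x ` ?G N)) R" using I(1)[of "\<lambda>_. True"] by simp
      show "ideal_power R ?J N \<subseteq> ?L <+> Idl (mon x ` ?G N)"
        by (rule order_trans[OF gens ideal_sum_ge2[OF L ideal_subset_carrier[OF genideal_ideal[OF sub]]]])
    qed
    also have "(\<Sum>c\<in>?G N. len (colon (?L <+> Idl (mon x ` {b \<in> ?G N. b < c})) (mon x c))) \<le> of_nat (card (?G N)) * len ?J"
    proof (rule sum_bounded_above)
      fix c assume c: "c \<in> ?G N"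
      then have lc: "length c = d" "sum_list c = N" by (auto simp: expos_def)
      have mc: "mon x c \<in> carrier R" using mon_in_carrier[OF x lc(1)] .
      show "len (colon (?L <+> Idl (mon x ` {b \<in> ?G N. b < c})) (mon x c)) \<le> len ?J"
      proof (rule len_mono[OF mpJ colon_ideal[OF I(1) mc]])
        show "?J \<subseteq> colon (?L <+> Idl (mon x ` {b \<in> ?G N. b < c})) (mon x c)"
        proof
          fix j assume j: "j \<in> ?J"
          have "mon x c \<otimes> j \<in> ?L"
            unfolding ideal_power_Suc using mon_in_power[OF param_carrier[OF x] lc(1)] j lc(2) by (auto intro: ideal_prod.prod)
          then have "mon x c \<otimes> j \<in> ?L <+> Idl (mon x ` {b \<in> ?G N. b < c})" by (rule subsetD[OF I(2)])
          then show "j \<in> colon (?L <+> Idl (mon x ` {b \<in> ?G N. b < c})) (mon x c)"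
            using ideal.Icarr[OF J j] mc by (simp add: mem_colon m_comm)
        qed
      qed
    qed
    also have "card (?G N) = sum ?g (expos d N)"
      by (simp add: sum.If_cases Int_def)
    finally show ?thesis by (simp add: mult.commute)
  qed
  have bound: "len (ideal_power R ?J N) \<le> len ?J * sum ?g (expos_lt d N)" for N
  proof (induction N)
    case 0
    then show ?case by (simp add: ideal_power_0 len_carrier)
  next
    case (Suc N)
    then show ?case using step[of N] by (simp add: sum_expos_lt_Suc distrib_left)
  qed
  \<comment> \<open>\<open>?g\<close> is the indicator function of the monomials not divisible by
    \<open>x^a\<close>. It vanishes at \<open>a\<close>, so the number of generators grows only like
    \<open>N^(d-1)\<close>.\<close>
  have "antitone d ?g" unfolding antitone_def
    by (auto intro: list_all2_trans[of "(\<le>)" "(\<le>)" "(\<le>)"])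
  then obtain C where C: "\<And>N. N * sum ?g (expos_lt d N) \<le> C * N ^ d"
    using sum_expos_lt_vanishing[of d ?g a] la by auto
  have "N * len (ideal_power R ?J N) \<le> (len ?J * C) * N ^ d" for N
  proof -
    have "N * len (ideal_power R ?J N) \<le> N * (len ?J * sum ?g (expos_lt d N))" using bound by (rule mult_le_mono2)
    also have "\<dots> = len ?J * (N * sum ?g (expos_lt d N))" by simp
    also have "\<dots> \<le> len ?J * (C * N ^ d)" using C by (rule mult_le_mono2)
    finally show ?thesis by (simp add: mult.assoc)
  qed
  then have "E x \<le> 0" using x by (intro mult_at_nonpos_of_len_bound[OF param_carrier[OF x]]) (simp add: param_def)
  then show False using E_pos[OF x] by simp
qed

text \<open>In a relation between \<open>x^a\<close> and the other monomials let \<open>x^b\<close>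
  be the leading one of these. The larger of \<open>a\<close> and \<open>b\<close> then violates
  \<open>mon_not_in_lower\<close>.\<close>

lemma analytic_independence:
  assumes x: "param d x" and a: "a \<in> expos d n"
  shows "mon x a \<notin> \<mm> \<cdot> ideal_power R (Idl (x ` {..<d})) n <+> Idl (mon x ` (expos d n - {a}))"
proof
  let ?L = "\<mm> \<cdot> ideal_power R (Idl (x ` {..<d})) n"
  assume *: "mon x a \<in> ?L <+> Idl (mon x ` (expos d n - {a}))"
  have sub: "S \<subseteq> expos d n \<Longrightarrow> mon x ` S \<subseteq> carrier R" for S by (rule mon_image[OF x])
  have Lle: "?L \<subseteq> ?L <+> Idl (mon x ` {b \<in> expos d n. b < c})" for c
    by (intro ideal_sum_ge1 genideal_ideal sub ideal_subset_carrier mJ_ideal[OF x]) auto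
  have 1: "mon x a \<notin> ?L" using mon_not_in_lower[OF x a] Lle by blast
  have 2: "\<forall>b\<in>expos d n - {a}. \<forall>r\<in>\<mm>. r \<otimes> mon x b \<in> ?L"
    using mon_in_power[OF param_carrier[OF x]] by (auto simp: expos_def intro: ideal_prod.prod)
  have "finite (expos d n - {a})" "mon x ` (expos d n - {a}) \<subseteq> carrier R" using sub by auto
  from leading_term[OF mJ_ideal[OF x] this 2 * 1] obtain b u t where
    b: "b \<in> expos d n - {a}" "u \<in> carrier R" "u \<notin> \<mm>"
      "t \<in> ?L <+> Idl (mon x ` {c \<in> expos d n - {a}. c < b})" "mon x a = t \<oplus> u \<otimes> mon x b"
    by (elim exE conjE) (rule that)
  have bc: "mon x b \<in> carrier R" "mon x a \<in> carrier R" using a b(1) mon_in_carrier[OF x] by (auto simp: expos_def)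
  let ?T = "\<lambda>c. ?L <+> Idl (mon x ` {b \<in> expos d n. b < c})"
  have T: "ideal (?T c) R" for c by (intro add_ideals mJ_ideal[OF x] genideal_ideal sub) auto
  have Tge: "Idl (mon x ` S) \<subseteq> ?T c" if "S \<subseteq> {b \<in> expos d n. b < c}" for S c
  proof -
    have "Idl (mon x ` S) \<subseteq> Idl (mon x ` {b \<in> expos d n. b < c})" using that by (intro Idl_mono sub) auto
    also have "\<dots> \<subseteq> ?T c" by (intro ideal_sum_ge2 mJ_ideal[OF x] ideal_subset_carrier genideal_ideal sub) auto
    finally show ?thesis .
  qed
  have mT: "mon x b' \<in> ?T c" if "b' \<in> expos d n" "b' < c" for b' c
    using Tge[of "{b'}" c] that Idl_mem[of "mon x b'" "mon x ` {b'}"] sub[of "{b'}"] by auto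
  consider "b < a" | "a < b" using b(1) by fastforce
  then show False
  proof cases
    case 1
    then have "{c \<in> expos d n - {a}. c < b} \<subseteq> {b \<in> expos d n. b < a}" by auto
    from ideal_sum_le[OF T Lle Tge[OF this]] have "t \<in> ?T a" using b(4) by (rule subsetD)
    moreover have "u \<otimes> mon x b \<in> ?T a" using mT[of b a] b(1,2) 1 ideal.I_l_closed[OF T] by auto
    ultimately have "mon x a \<in> ?T a" unfolding b(5) by (rule ideal_add_mem[OF T])
    then show False using mon_not_in_lower[OF x a] by blast
  next
    case 2
    have "{c \<in> expos d n - {a}. c < b} \<subseteq> {c \<in> expos d n. c < b}" by auto
    from ideal_sum_le[OF T Lle Tge[OF this]] have t: "t \<in> ?T b" using b(4) by (rule subsetD)
    then have tc: "t \<in> carrier R" by (rule ideal.Icarr[OF T])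
    have "u \<otimes> mon x b \<oplus> t \<in> ?T b" using mT[OF a 2] b(2,5) bc tc by (simp add: a_comm)
    then have "u \<otimes> mon x b \<in> ?T b" using ideal_mem_of_add[OF T _ t] b(2) bc by simp
    then have "mon x b \<in> ?T b" using unit_cancel_mem[OF T b(2,3)] bc by blast
    then show False using mon_not_in_lower[OF x, of b n] b(1) by blast
  qed
qed

end

section \<open>Graded primes of the fibre cone\<close>

context buchsbaum_local begin

text \<open>The degree \<open>n\<close> part of the ideal of the Rees algebra generated by \<open>\<mm>\<close> and the \<open>x\<^sub>i t\<close> with \<open>i \<in> C\<close>.\<close>

definition prime_part :: "(nat \<Rightarrow> 'a) \<Rightarrow> nat set \<Rightarrow> nat \<Rightarrow> 'a set"
  where "prime_part x C n = \<mm> \<cdot> ideal_power R (Idl (x ` {..<d})) n <+>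
    (case n of 0 \<Rightarrow> {\<zero>} | Suc k \<Rightarrow> (Idl (x ` C)) \<cdot> ideal_power R (Idl (x ` {..<d})) k)"

lemma prime_part_cong:
  "Idl (x ` {..<d}) = Idl (y ` {..<d}) \<Longrightarrow> Idl (x ` C) = Idl (y ` C) \<Longrightarrow> prime_part x C n = prime_part y C n"
  by (simp only: prime_part_def)

lemma second_part_ideal:
  assumes "param d x" "C \<subseteq> {..<d}"
  shows "ideal (case n of 0 \<Rightarrow> {\<zero>} | Suc k \<Rightarrow> (Idl (x ` C)) \<cdot> ideal_power R (Idl (x ` {..<d})) k) R"
  using assms by (auto split: nat.split intro!: zeroideal ideal_prod_is_ideal param_ideal J_ideal ideal_power_ideal)

lemma prime_part_ideal: "param d x \<Longrightarrow> C \<subseteq> {..<d} \<Longrightarrow> ideal (prime_part x C n) R"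
  unfolding prime_part_def by (intro add_ideals mJ_ideal second_part_ideal)

lemma mJ_le_prime_part: "param d x \<Longrightarrow> C \<subseteq> {..<d} \<Longrightarrow> \<mm> \<cdot> ideal_power R (Idl (x ` {..<d})) n \<subseteq> prime_part x C n"
  unfolding prime_part_def by (intro ideal_sum_ge1 second_part_ideal ideal_subset_carrier mJ_ideal)

lemma second_part_le_prime_part:
  "param d x \<Longrightarrow> C \<subseteq> {..<d} \<Longrightarrow> (Idl (x ` C)) \<cdot> ideal_power R (Idl (x ` {..<d})) k \<subseteq> prime_part x C (Suc k)"
  using ideal_sum_ge2[OF mJ_ideal ideal_subset_carrier[OF second_part_ideal[of x C "Suc k"]], of x "Suc k"]
  by (simp add: prime_part_def)

lemma prime_part_0: "prime_part x C 0 = \<mm>"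
proof -
  have "\<mm> <+> {\<zero>} = \<mm>" using m_carrier by (force simp: set_add_def')
  then show ?thesis by (simp add: prime_part_def ideal_power_0 ideal_prod_one)
qed

lemma prime_part_empty:
  assumes x: "param d x"
  shows "prime_part x {} n = \<mm> \<cdot> ideal_power R (Idl (x ` {..<d})) n"
proof -
  have "{\<zero>} \<cdot> ideal_power R (Idl (x ` {..<d})) k = {\<zero>}" for k
    using ideal_prod_commute[OF zeroideal ideal_power_ideal[OF J_ideal[OF x]]]
      ideal_prod_zero[OF ideal_power_ideal[OF J_ideal[OF x]]] by simp
  then have "(case n of 0 \<Rightarrow> {\<zero>} | Suc k \<Rightarrow> (Idl (x ` {})) \<cdot> ideal_power R (Idl (x ` {..<d})) k) = {\<zero>}"
    by (auto simp: Idl_empty split: nat.split)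
  then show ?thesis
    using ideal.Icarr[OF mJ_ideal[OF x]] by (force simp: prime_part_def set_add_def')
qed

lemma Idl_param_mono: "param d x \<Longrightarrow> A \<subseteq> B \<Longrightarrow> B \<subseteq> {..<d} \<Longrightarrow> Idl (x ` A) \<subseteq> Idl (x ` B)"
  using param_carrier by (intro Idl_mono) blast+

lemma prime_part_mono:
  assumes x: "param d x" and CD: "C \<subseteq> D" "D \<subseteq> {..<d}"
  shows "prime_part x C n \<subseteq> prime_part x D n"
  unfolding prime_part_def using Idl_param_mono[OF x CD]
  by (intro ideal_sum_mono order_refl) (auto split: nat.split dest: subsetD[OF ideal_prod_mono[OF _ order_refl]])

lemma prime_part_mult:
  assumes x: "param d x" and C: "C \<subseteq> {..<d}" and f: "f \<in> prime_part x C s" and g: "g \<in> ideal_power R (Idl (x ` {..<d})) t"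
  shows "f \<otimes> g \<in> prime_part x C (s + t)"
proof -
  let ?J = "Idl (x ` {..<d})"
  have J: "ideal ?J R" using J_ideal[OF x] .
  have P: "ideal (prime_part x C (s + t)) R" using prime_part_ideal[OF x C] .
  obtain p q where pq: "p \<in> \<mm> \<cdot> ideal_power R ?J s"
    "q \<in> (case s of 0 \<Rightarrow> {\<zero>} | Suc k \<Rightarrow> (Idl (x ` C)) \<cdot> ideal_power R ?J k)" "f = p \<oplus> q"
    using f unfolding prime_part_def mem_ideal_sum by blast
  have car: "p \<in> carrier R" "q \<in> carrier R" "g \<in> carrier R"
    using ideal.Icarr[OF mJ_ideal[OF x] pq(1)] ideal.Icarr[OF second_part_ideal[OF x C] pq(2)]
      ideal.Icarr[OF ideal_power_ideal[OF J] g] by auto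
  have "p \<otimes> g \<in> (\<mm> \<cdot> ideal_power R ?J s) \<cdot> ideal_power R ?J t" using pq(1) g by (rule ideal_prod.prod)
  also have "\<dots> = \<mm> \<cdot> ideal_power R ?J (s + t)" using J by (simp add: ideal_power_add ideal_prod_assoc)
  finally have 1: "p \<otimes> g \<in> prime_part x C (s + t)" using mJ_le_prime_part[OF x C] by blast
  have 2: "q \<otimes> g \<in> prime_part x C (s + t)"
  proof (cases s)
    case 0
    then show ?thesis using pq(2) car ideal_zero_mem[OF P] by simp
  next
    case (Suc k)
    then have "q \<otimes> g \<in> ((Idl (x ` C)) \<cdot> ideal_power R ?J k) \<cdot> ideal_power R ?J t"
      using pq(2) g by (auto intro: ideal_prod.prod)
    also have "\<dots> = (Idl (x ` C)) \<cdot> ideal_power R ?J (k + t)"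
      using J param_ideal[OF x C] by (simp add: ideal_power_add ideal_prod_assoc)
    finally show ?thesis using second_part_le_prime_part[OF x C, of "k + t"] Suc by auto
  qed
  show ?thesis unfolding pq(3) using ideal_add_mem[OF P 1 2] car by (simp add: l_distr)
qed

lemma prime_part_le_power:
  assumes x: "param d x" and C: "C \<subseteq> {..<d}"
  shows "prime_part x C n \<subseteq> ideal_power R (Idl (x ` {..<d})) n"
  unfolding prime_part_def
proof (rule ideal_sum_le)
  let ?J = "Idl (x ` {..<d})"
  have J: "ideal ?J R" using J_ideal[OF x] .
  then show n: "ideal (ideal_power R ?J n) R" by simp
  show "\<mm> \<cdot> ideal_power R ?J n \<subseteq> ideal_power R ?J n" using J by (intro ideal_prod_le2) auto
  show "(case n of 0 \<Rightarrow> {\<zero>} | Suc k \<Rightarrow> (Idl (x ` C)) \<cdot> ideal_power R ?J k) \<subseteq> ideal_power R ?J n"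
  proof (cases n)
    case 0
    then show ?thesis using ideal_zero_mem[OF n] by simp
  next
    case (Suc k)
    have "(Idl (x ` C)) \<cdot> ideal_power R ?J k = ideal_power R ?J k \<cdot> (Idl (x ` C))"
      using J param_ideal[OF x C] by (intro ideal_prod_commute) auto
    also have "\<dots> \<subseteq> ideal_power R ?J k \<cdot> ?J" by (intro ideal_prod_mono order_refl Idl_param_mono[OF x C])
    finally show ?thesis using Suc by (simp add: ideal_power_Suc)
  qed
qed

text \<open>Modulo \<open>prime_part x C\<close> the Rees algebra is a polynomial ring over the
  residue field in the variables outside \<open>C\<close>; these are the exponents of its monomials
  of degree \<open>n\<close>.\<close>

definition free_expos :: "nat set \<Rightarrow> nat \<Rightarrow> nat list set"
  where "free_expos C n = {a \<in> expos d n. \<forall>i\<in>C. a ! i = 0}"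

lemma mon_hit_in_prime_part:
  assumes x: "param d x" and C: "C \<subseteq> {..<d}" and a: "a \<in> expos d n - free_expos C n"
  shows "mon x a \<in> prime_part x C n"
proof -
  obtain i where i: "i \<in> C" "0 < a ! i" using a by (auto simp: free_expos_def)
  have la: "length a = d" "sum_list a = n" using a by (auto simp: expos_def)
  have id: "i < d" using i C by auto
  define b where "b = a[i := a ! i - 1]"
  have ab: "a = incr b i" "length b = d" using i id la by (auto simp: b_def incr_def)
  then have n: "n = Suc (sum_list b)" using sum_list_incr[of i b] id la by simp
  have "mon x a = mon x b \<otimes> x i" using mon_incr[of i b x] ab id param_in_carrier[OF x] by simp
  also have "\<dots> = x i \<otimes> mon x b" using mon_in_carrier[OF x ab(2)] param_in_carrier[OF x id] by (rule m_comm)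
  also have "\<dots> \<in> (Idl (x ` C)) \<cdot> ideal_power R (Idl (x ` {..<d})) (sum_list b)"
    using i(1) param_carrier[OF x] C mon_in_power[OF param_carrier[OF x] ab(2)]
    by (intro ideal_prod.prod Idl_mem) auto
  finally show ?thesis using second_part_le_prime_part[OF x C] n by auto
qed

lemma prime_part_le_monomials:
  assumes x: "param d x" and C: "C \<subseteq> {..<d}"
  shows "prime_part x C n \<subseteq> \<mm> \<cdot> ideal_power R (Idl (x ` {..<d})) n <+> Idl (mon x ` (expos d n - free_expos C n))"
proof -
  let ?J = "Idl (x ` {..<d})"
  have sub: "mon x ` (expos d n - free_expos C n) \<subseteq> carrier R" by (rule mon_image[OF x]) auto
  have I: "ideal (Idl (mon x ` (expos d n - free_expos C n))) R" using sub by (rule genideal_ideal)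
  have "(case n of 0 \<Rightarrow> {\<zero>} | Suc k \<Rightarrow> (Idl (x ` C)) \<cdot> ideal_power R ?J k) \<subseteq> Idl (mon x ` (expos d n - free_expos C n))"
  proof (cases n)
    case 0
    then show ?thesis using ideal_zero_mem[OF I] by simp
  next
    case (Suc k)
    have "(Idl (x ` C)) \<cdot> (Idl (mon x ` expos d k)) \<subseteq> Idl (mon x ` (expos d n - free_expos C n))"
    proof (rule Idl_prod_le[OF I])
      show "x ` C \<subseteq> carrier R" using param_carrier[OF x] C by blast
      show "mon x ` expos d k \<subseteq> carrier R" by (rule mon_image[OF x]) auto
      fix a b assume "a \<in> x ` C" "b \<in> mon x ` expos d k"
      then obtain i e where ie: "i \<in> C" "e \<in> expos d k" "a = x i" "b = mon x e" by auto
      have id: "i < d" and le: "length e = d" using ie C by (auto simp: expos_def)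
      have "a \<otimes> b = mon x (incr e i)"
        using mon_incr[of i e x] id le param_in_carrier[OF x] mon_in_carrier[OF x le] ie by (simp add: m_comm)
      moreover have "incr e i ! i \<noteq> 0" using id le by (simp add: incr_def)
      then have "incr e i \<in> expos d n - free_expos C n"
        using incr_in_expos[OF ie(2) id] Suc ie(1) by (auto simp only: free_expos_def)
      ultimately show "a \<otimes> b \<in> Idl (mon x ` (expos d n - free_expos C n))" using sub by (auto intro!: Idl_mem)
    qed
    then show ?thesis using Suc by (simp add: ideal_power_eq_monomials[OF param_carrier[OF x], of k])
  qed
  then show ?thesis unfolding prime_part_def by (intro ideal_sum_mono order_refl)
qed

definition below :: "(nat \<Rightarrow> 'a) \<Rightarrow> nat set \<Rightarrow> nat \<Rightarrow> (nat list \<Rightarrow> bool) \<Rightarrow> 'a set"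
  where "below x C n P = prime_part x C n <+> Idl (mon x ` {b \<in> free_expos C n. P b})"

lemma free_image: "param d x \<Longrightarrow> mon x ` {b \<in> free_expos C n. P b} \<subseteq> carrier R"
  by (rule mon_image) (auto simp: free_expos_def)

lemma below_ideal: "param d x \<Longrightarrow> C \<subseteq> {..<d} \<Longrightarrow> ideal (below x C n P) R"
  unfolding below_def by (intro add_ideals prime_part_ideal genideal_ideal free_image)

lemma prime_part_le_below: "param d x \<Longrightarrow> C \<subseteq> {..<d} \<Longrightarrow> prime_part x C n \<subseteq> below x C n P"
  unfolding below_def by (intro ideal_sum_ge1 genideal_ideal free_image ideal_subset_carrier prime_part_ideal)

lemma mon_in_below:
  assumes x: "param d x" and C: "C \<subseteq> {..<d}" and b: "b \<in> free_expos C n" "P b"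
  shows "mon x b \<in> below x C n P"
proof -
  have "mon x b \<in> Idl (mon x ` {b \<in> free_expos C n. P b})" using b by (intro Idl_mem free_image[OF x]) auto
  then show ?thesis unfolding below_def
    by (rule subsetD[OF ideal_sum_ge2[OF prime_part_ideal[OF x C] ideal_subset_carrier[OF genideal_ideal[OF free_image[OF x]]]]])
qed

text \<open>The prime part is spanned by \<open>\<mm>J^n\<close> and the monomials that involve
  \<open>C\<close>, so membership would be a relation among distinct monomials, against analytic
  independence.\<close>

lemma mon_not_in_below:
  assumes x: "param d x" and C: "C \<subseteq> {..<d}" and a: "a \<in> free_expos C n"
  shows "mon x a \<notin> below x C n (\<lambda>b. b < a)"
proof
  let ?L = "\<mm> \<cdot> ideal_power R (Idl (x ` {..<d})) n"
  let ?T = "?L <+> Idl (mon x ` (expos d n - {a}))"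
  have ad: "a \<in> expos d n" using a by (simp add: free_expos_def)
  have sub: "S \<subseteq> expos d n \<Longrightarrow> mon x ` S \<subseteq> carrier R" for S by (rule mon_image[OF x])
  have T: "ideal ?T R" by (intro add_ideals mJ_ideal[OF x] genideal_ideal sub) auto
  have sT: "?L <+> Idl (mon x ` S) \<subseteq> ?T" if "S \<subseteq> expos d n - {a}" for S
    using that by (intro ideal_sum_mono order_refl Idl_mono sub) auto
  have "prime_part x C n \<subseteq> ?T"
    using prime_part_le_monomials[OF x C, of n] sT[of "expos d n - free_expos C n"] a by auto
  moreover have "Idl (mon x ` {b \<in> free_expos C n. b < a}) \<subseteq> ?T"
  proof -
    have "Idl (mon x ` {b \<in> free_expos C n. b < a}) \<subseteq> Idl (mon x ` (expos d n - {a}))"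
      by (intro Idl_mono sub) (auto simp: free_expos_def)
    also have "\<dots> \<subseteq> ?T" by (intro ideal_sum_ge2 mJ_ideal[OF x] ideal_subset_carrier genideal_ideal sub) auto
    finally show ?thesis .
  qed
  ultimately have "below x C n (\<lambda>b. b < a) \<subseteq> ?T" unfolding below_def by (rule ideal_sum_le[OF T])
  moreover assume "mon x a \<in> below x C n (\<lambda>b. b < a)"
  ultimately show False using analytic_independence[OF x ad] by blast
qed

lemma below_le_power:
  assumes x: "param d x" and C: "C \<subseteq> {..<d}"
  shows "below x C n P \<subseteq> ideal_power R (Idl (x ` {..<d})) n"
  unfolding below_def
proof (rule ideal_sum_le[OF _ prime_part_le_power[OF x C]])
  show "ideal (ideal_power R (Idl (x ` {..<d})) n) R" using J_ideal[OF x] by simp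
  show "Idl (mon x ` {b \<in> free_expos C n. P b}) \<subseteq> ideal_power R (Idl (x ` {..<d})) n"
    unfolding ideal_power_eq_monomials[OF param_carrier[OF x]]
    by (intro Idl_mono mon_image[OF x]) (auto simp: free_expos_def)
qed

lemma below_mult:
  assumes x: "param d x" and C: "C \<subseteq> {..<d}" and ab: "a \<in> free_expos C s" "b \<in> free_expos C t"
    and p: "p \<in> below x C s (\<lambda>c. c < a)" and q: "q \<in> below x C t (\<lambda>c. c \<le> b)"
  shows "p \<otimes> q \<in> below x C (s + t) (\<lambda>c. c < list_add a b)"
proof -
  let ?T = "below x C (s + t) (\<lambda>c. c < list_add a b)"
  have T: "ideal ?T R" using below_ideal[OF x C] .
  obtain p1 p2 where p12: "p1 \<in> prime_part x C s" "p2 \<in> Idl (mon x ` {c \<in> free_expos C s. c < a})" "p = p1 \<oplus> p2"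
    using p unfolding below_def mem_ideal_sum by blast
  obtain q1 q2 where q12: "q1 \<in> prime_part x C t" "q2 \<in> Idl (mon x ` {c \<in> free_expos C t. c \<le> b})" "q = q1 \<oplus> q2"
    using q unfolding below_def mem_ideal_sum by blast
  have car: "p1 \<in> carrier R" "p2 \<in> carrier R" "q1 \<in> carrier R" "q2 \<in> carrier R" "q \<in> carrier R"
    using ideal.Icarr[OF prime_part_ideal[OF x C] p12(1)] ideal.Icarr[OF genideal_ideal[OF free_image[OF x]] p12(2)]
      ideal.Icarr[OF prime_part_ideal[OF x C] q12(1)] ideal.Icarr[OF genideal_ideal[OF free_image[OF x]] q12(2)]
      ideal.Icarr[OF below_ideal[OF x C] q] by auto
  have "p1 \<otimes> q \<in> ?T"
    using prime_part_mult[OF x C p12(1) subsetD[OF below_le_power[OF x C] q]] prime_part_le_below[OF x C] by blast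
  moreover have "p2 \<otimes> q1 \<in> ?T"
  proof -
    have "p2 \<in> below x C s (\<lambda>c. c < a)" unfolding below_def
      by (rule subsetD[OF ideal_sum_ge2[OF prime_part_ideal[OF x C] ideal_subset_carrier[OF genideal_ideal[OF free_image[OF x]]]] p12(2)])
    then have "q1 \<otimes> p2 \<in> prime_part x C (t + s)"
      using prime_part_mult[OF x C q12(1) subsetD[OF below_le_power[OF x C]]] by blast
    then have "p2 \<otimes> q1 \<in> prime_part x C (s + t)" using car by (simp add: m_comm add.commute)
    then show ?thesis using prime_part_le_below[OF x C] by blast
  qed
  moreover have "p2 \<otimes> q2 \<in> ?T"
  proof -
    have "(Idl (mon x ` {c \<in> free_expos C s. c < a})) \<cdot> (Idl (mon x ` {c \<in> free_expos C t. c \<le> b})) \<subseteq> ?T"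
    proof (rule Idl_prod_le[OF T free_image[OF x] free_image[OF x]])
      fix u v assume "u \<in> mon x ` {c \<in> free_expos C s. c < a}" "v \<in> mon x ` {c \<in> free_expos C t. c \<le> b}"
      then obtain e f where ef: "e \<in> free_expos C s" "e < a" "u = mon x e" "f \<in> free_expos C t" "f \<le> b" "v = mon x f"
        by blast
      have l: "length e = d" "length f = d" "length a = d" "length b = d" using ef ab by (auto simp: free_expos_def expos_def)
      have uv: "u \<otimes> v = mon x (list_add e f)" using mon_add[of e f x] l param_in_carrier[OF x] ef by simp
      have "list_add e f < list_add a f" using ef(2) l by (intro list_add_less) auto
      also have "list_add a f \<le> list_add a b"
        using ef(5) l list_add_less[of f b a] by (auto simp: list_add_commute[of a] order_le_less)
      finally have "list_add e f < list_add a b" .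
      moreover have "list_add e f \<in> free_expos C (s + t)"
        using ef(1,4) l C by (auto simp: free_expos_def subset_eq list_add_in_expos)
      ultimately show "u \<otimes> v \<in> ?T" unfolding uv by (intro mon_in_below[OF x C])
    qed
    then show ?thesis using p12(2) q12(2) by (auto intro: ideal_prod.prod)
  qed
  moreover have "p \<otimes> q = p1 \<otimes> q \<oplus> (p2 \<otimes> q1 \<oplus> p2 \<otimes> q2)"
  proof -
    have "p \<otimes> q = p1 \<otimes> q \<oplus> p2 \<otimes> q" unfolding p12(3) using car by (simp add: l_distr)
    also have "p2 \<otimes> q = p2 \<otimes> q1 \<oplus> p2 \<otimes> q2" unfolding q12(3) using car by (simp add: r_distr)
    finally show ?thesis .
  qed
  ultimately show ?thesis using ideal_add_mem[OF T] by simp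
qed

text \<open>The monomials involving \<open>C\<close> are absorbed by the prime part, which leaves an
  application of \<open>leading_term\<close> to the free ones.\<close>

lemma prime_part_leading:
  assumes x: "param d x" and C: "C \<subseteq> {..<d}" and f: "f \<in> ideal_power R (Idl (x ` {..<d})) n" "f \<notin> prime_part x C n"
  obtains a u t where "a \<in> free_expos C n" "u \<in> carrier R" "u \<notin> \<mm>" "t \<in> below x C n (\<lambda>b. b < a)" "f = t \<oplus> u \<otimes> mon x a"
proof -
  let ?P = "prime_part x C n"
  have P: "ideal ?P R" using prime_part_ideal[OF x C] .
  have fin: "finite (free_expos C n)" by (rule finite_subset[of _ "expos d n"]) (auto simp: free_expos_def)
  have sub: "mon x ` free_expos C n \<subseteq> carrier R" by (rule mon_image[OF x]) (auto simp: free_expos_def)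
  have m: "\<forall>a\<in>free_expos C n. \<forall>r\<in>\<mm>. r \<otimes> mon x a \<in> ?P"
  proof (intro ballI)
    fix a r assume "a \<in> free_expos C n" "r \<in> \<mm>"
    then have "r \<otimes> mon x a \<in> \<mm> \<cdot> ideal_power R (Idl (x ` {..<d})) n"
      using mon_in_power[OF param_carrier[OF x], of a] by (auto simp: free_expos_def expos_def intro: ideal_prod.prod)
    then show "r \<otimes> mon x a \<in> ?P" using mJ_le_prime_part[OF x C] by blast
  qed
  have T: "ideal (?P <+> Idl (mon x ` free_expos C n)) R" using P sub by (intro add_ideals genideal_ideal)
  have "Idl (mon x ` expos d n) \<subseteq> ?P <+> Idl (mon x ` free_expos C n)"
  proof (rule Idl_le[OF T], rule image_subsetI)
    fix a assume a: "a \<in> expos d n"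
    show "mon x a \<in> ?P <+> Idl (mon x ` free_expos C n)"
    proof (cases "a \<in> free_expos C n")
      case True
      then have "mon x a \<in> Idl (mon x ` free_expos C n)" using sub by (intro Idl_mem) auto
      then show ?thesis by (rule subsetD[OF ideal_sum_ge2[OF P ideal_subset_carrier[OF genideal_ideal[OF sub]]]])
    next
      case False
      then have "mon x a \<in> ?P" using mon_hit_in_prime_part[OF x C] a by blast
      then show ?thesis by (rule subsetD[OF ideal_sum_ge1[OF genideal_ideal[OF sub] ideal_subset_carrier[OF P]]])
    qed
  qed
  then have "f \<in> ?P <+> Idl (mon x ` free_expos C n)"
    using f(1) unfolding ideal_power_eq_monomials[OF param_carrier[OF x]] by blast
  from leading_term[OF P fin sub m this f(2)] show ?thesis
    unfolding below_def[symmetric] by (elim exE conjE) (rule that)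
qed

text \<open>As in a polynomial ring over a field: the leading term of \<open>f g\<close> is the
  product of the leading terms, its coefficient \<open>u v\<close> is a unit, and everything else is
  below \<open>a + b\<close>.\<close>

lemma prime_part_prime:
  assumes x: "param d x" and C: "C \<subseteq> {..<d}"
    and f: "f \<in> ideal_power R (Idl (x ` {..<d})) s" "f \<notin> prime_part x C s"
    and g: "g \<in> ideal_power R (Idl (x ` {..<d})) t" "g \<notin> prime_part x C t"
  shows "f \<otimes> g \<notin> prime_part x C (s + t)"
proof
  assume fg: "f \<otimes> g \<in> prime_part x C (s + t)"
  obtain a u p where a: "a \<in> free_expos C s" "u \<in> carrier R" "u \<notin> \<mm>" "p \<in> below x C s (\<lambda>b. b < a)" "f = p \<oplus> u \<otimes> mon x a"
    by (rule prime_part_leading[OF x C f])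
  obtain b v q where b: "b \<in> free_expos C t" "v \<in> carrier R" "v \<notin> \<mm>" "q \<in> below x C t (\<lambda>c. c < b)" "g = q \<oplus> v \<otimes> mon x b"
    by (rule prime_part_leading[OF x C g])
  let ?T = "below x C (s + t) (\<lambda>c. c < list_add a b)"
  have T: "ideal ?T R" using below_ideal[OF x C] .
  have l: "length a = d" "length b = d" using a b by (auto simp: free_expos_def expos_def)
  have car: "p \<in> carrier R" "q \<in> carrier R" "mon x a \<in> carrier R" "mon x b \<in> carrier R"
    using ideal.Icarr[OF below_ideal[OF x C] a(4)] ideal.Icarr[OF below_ideal[OF x C] b(4)] mon_in_carrier[OF x] l by auto
  have qle: "q \<in> below x C t (\<lambda>c. c \<le> b)"
  proof -
    have "below x C t (\<lambda>c. c < b) \<subseteq> below x C t (\<lambda>c. c \<le> b)" unfolding below_def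
      by (intro ideal_sum_mono order_refl Idl_mono free_image[OF x]) auto
    then show ?thesis using b(4) by blast
  qed
  have ma: "u \<otimes> mon x a \<in> below x C s (\<lambda>c. c \<le> a)" and mb: "v \<otimes> mon x b \<in> below x C t (\<lambda>c. c \<le> b)"
    using mon_in_below[OF x C a(1), of "\<lambda>c. c \<le> a"] mon_in_below[OF x C b(1), of "\<lambda>c. c \<le> b"] a(2) b(2)
      ideal.I_l_closed[OF below_ideal[OF x C]] by auto
  have g': "g \<in> below x C t (\<lambda>c. c \<le> b)" unfolding b(5) using qle mb by (rule ideal_add_mem[OF below_ideal[OF x C]])
  have 1: "p \<otimes> g \<in> ?T" by (rule below_mult[OF x C a(1) b(1) a(4) g'])
  have 2: "(u \<otimes> mon x a) \<otimes> q \<in> ?T"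
    using below_mult[OF x C b(1) a(1) b(4) ma] car a(2) by (simp add: m_comm add.commute list_add_commute[of b])
  have fgT: "f \<otimes> g \<in> ?T" using fg prime_part_le_below[OF x C] by blast
  have gc: "g \<in> carrier R" using ideal.Icarr[OF below_ideal[OF x C] g'] .
  have ab: "mon x (list_add a b) = mon x a \<otimes> mon x b" using mon_add[of a b x] l param_in_carrier[OF x] by simp
  have "(u \<otimes> v) \<otimes> mon x (list_add a b) = (u \<otimes> mon x a) \<otimes> (v \<otimes> mon x b)"
    unfolding ab using car a(2) b(2) by algebra
  also have "\<dots> = (u \<otimes> mon x a) \<otimes> g \<ominus> (u \<otimes> mon x a) \<otimes> q" unfolding b(5) using car a(2) b(2) by algebra
  also have "(u \<otimes> mon x a) \<otimes> g = f \<otimes> g \<ominus> p \<otimes> g" unfolding a(5) using car gc a(2) by algebra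
  finally have "(u \<otimes> v) \<otimes> mon x (list_add a b) \<in> ?T" using ideal_diff_mem[OF T ideal_diff_mem[OF T fgT 1] 2] by simp
  moreover have "u \<otimes> v \<notin> \<mm>" using primeideal.I_prime[OF m_prime a(2) b(2)] a(3) b(3) by blast
  ultimately have "mon x (list_add a b) \<in> ?T"
    using unit_cancel_mem[OF T, of "u \<otimes> v" "mon x (list_add a b)"] a(2) b(2) car ab by simp
  moreover have "list_add a b \<in> free_expos C (s + t)"
    using a(1) b(1) l C by (auto simp: free_expos_def subset_eq list_add_in_expos)
  ultimately show False using mon_not_in_below[OF x C] by blast
qed

lemma param_in_prime_part:
  assumes x: "param d x" and C: "C \<subseteq> {..<d}" and i: "i \<in> C"
  shows "x i \<in> prime_part x C 1"
proof -
  have "x i \<otimes> \<one> \<in> (Idl (x ` C)) \<cdot> ideal_power R (Idl (x ` {..<d})) 0"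
    using i param_carrier[OF x] C by (intro ideal_prod.prod Idl_mem) (auto simp: ideal_power_0)
  moreover have "x i \<otimes> \<one> = x i" using param_in_carrier[OF x] i C by auto
  ultimately show ?thesis using subsetD[OF second_part_le_prime_part[OF x C, of 0]] by simp
qed

lemma param_not_in_prime_part:
  assumes x: "param d x" and C: "C \<subseteq> {..<d}" and i: "i < d" "i \<notin> C"
  shows "x i \<notin> prime_part x C 1"
proof -
  let ?e = "incr (replicate d 0) i"
  have "mon x ?e = x i"
    using mon_incr[of i "replicate d 0" x] i param_in_carrier[OF x] by (simp add: mon_replicate_0)
  moreover have "?e \<in> free_expos C 1"
    using i C incr_in_expos[of "replicate d 0" d 0 i] by (auto simp: free_expos_def expos_0 incr_def nth_list_update)
  then have "mon x ?e \<notin> prime_part x C 1"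
    using mon_not_in_below[OF x C] prime_part_le_below[OF x C] by blast
  ultimately show ?thesis by simp
qed

end

section \<open>Generic parameters\<close>

lemma (in cring) PIdl_prodE:
  assumes "a \<in> (PIdl y) \<cdot> K" "y \<in> carrier R" "ideal K R"
  obtains g where "g \<in> K" "a = y \<otimes> g"
proof -
  from assms(1) have "\<exists>g\<in>K. a = y \<otimes> g"
  proof induction
    case (prod i j)
    then obtain r where r: "r \<in> carrier R" "i = r \<otimes> y" by (auto simp: cgenideal_def)
    have j: "j \<in> carrier R" using prod assms(3) ideal.Icarr by metis
    have "i \<otimes> j = y \<otimes> (r \<otimes> j)" using r j assms(2) by (simp add: m_ac)
    moreover have "r \<otimes> j \<in> K" using ideal.I_l_closed[OF assms(3) prod(2) r(1)] .
    ultimately show ?case by blast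
  next
    case (sum s1 s2)
    then obtain g h where gh: "g \<in> K" "h \<in> K" "s1 = y \<otimes> g" "s2 = y \<otimes> h" by auto
    then have "g \<in> carrier R" "h \<in> carrier R" using assms(3) ideal.Icarr by metis+
    then have "s1 \<oplus> s2 = y \<otimes> (g \<oplus> h)" using gh assms(2) by (simp add: r_distr)
    then show ?case using ideal_add_mem[OF assms(3) gh(1,2)] by blast
  qed
  then show ?thesis using that by blast
qed

locale buchsbaum_infinite = buchsbaum_local +
  assumes infinite_residue: "infinite (carrier (R Quot \<mm>))"
begin

text \<open>Differences of these representatives are units, which makes the linear forms
  \<open>x_i + r x_l\<close> pairwise coprime.\<close>

lemma ex_incongruent:
  obtains \<Lambda> where "finite \<Lambda>" "card \<Lambda> = n" "\<Lambda> \<subseteq> carrier R" "\<And>a b. a \<in> \<Lambda> \<Longrightarrow> b \<in> \<Lambda> \<Longrightarrow> a \<noteq> b \<Longrightarrow> a \<ominus> b \<notin> \<mm>"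
proof -
  obtain B where B: "finite B" "card B = n" "B \<subseteq> carrier (R Quot \<mm>)"
    using infinite_arbitrarily_large[OF infinite_residue] by blast
  have "\<forall>X\<in>B. \<exists>a. a \<in> carrier R \<and> X = \<mm> +> a"
    using B(3) by (auto simp: FactRing_def A_RCOSETS_def')
  then obtain rep where rep: "\<And>X. X \<in> B \<Longrightarrow> rep X \<in> carrier R \<and> X = \<mm> +> rep X" by metis
  have "inj_on rep B" by (rule inj_onI) (metis rep)
  then have "card (rep ` B) = n" using B(2) by (simp add: card_image)
  moreover have "a \<ominus> b \<notin> \<mm>" if "a \<in> rep ` B" "b \<in> rep ` B" "a \<noteq> b" for a b
  proof
    assume "a \<ominus> b \<in> \<mm>"
    then have "\<mm> +> a = \<mm> +> b" using quotient_eq_iff_same_a_r_cos[OF m_ideal] that rep by blast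
    then show False using that rep by auto
  qed
  moreover have "rep ` B \<subseteq> carrier R" using rep by auto
  ultimately show ?thesis using that[of "rep ` B"] B(1) by auto
qed

text \<open>Membership in the prime enlarged by the linear form \<open>y\<close> means divisibility
  by \<open>y\<close> modulo the smaller prime.\<close>

lemma linear_factor:
  assumes x: "param d x" and C: "C \<subseteq> {..<d}" and i: "i < d" "i \<notin> C" and y: "y \<in> carrier R"
    and X: "param d (x(i := y))" and J: "Idl (x(i := y) ` {..<d}) = Idl (x ` {..<d})"
    and f: "f \<in> prime_part (x(i := y)) (insert i C) (Suc s)"
  obtains p g where "p \<in> prime_part x C (Suc s)" "g \<in> ideal_power R (Idl (x ` {..<d})) s" "f = p \<oplus> y \<otimes> g"
proof -
  let ?J = "Idl (x ` {..<d})" and ?Q = "Idl (x ` C)"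
  have Js: "ideal (ideal_power R ?J n) R" for n using J_ideal[OF x] by simp
  have Q: "ideal ?Q R" using param_ideal[OF x C] .
  have P: "ideal (prime_part x C (Suc s)) R" using prime_part_ideal[OF x C] .
  have "x(i := y) ` insert i C = insert y (x ` C)" using i by auto
  moreover have "x ` C \<subseteq> carrier R" using param_carrier[OF x] C by blast
  ultimately have I: "Idl (x(i := y) ` insert i C) = ?Q <+> PIdl y"
    using Idl_insert[OF y] by (simp only: adjoin_def)
  have "f \<in> \<mm> \<cdot> ideal_power R ?J (Suc s) <+> (?Q <+> PIdl y) \<cdot> ideal_power R ?J s"
    using f unfolding prime_part_def I J by simp
  then obtain p h where ph: "p \<in> \<mm> \<cdot> ideal_power R ?J (Suc s)" "h \<in> (?Q <+> PIdl y) \<cdot> ideal_power R ?J s" "f = p \<oplus> h"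
    unfolding mem_ideal_sum by blast
  have "h \<in> ?Q \<cdot> ideal_power R ?J s <+> (PIdl y) \<cdot> ideal_power R ?J s"
    using ph(2) ideal_prod_distr(2)[OF Js Q cgenideal_ideal[OF y]] by simp
  then obtain q k where qk: "q \<in> ?Q \<cdot> ideal_power R ?J s" "k \<in> (PIdl y) \<cdot> ideal_power R ?J s" "h = q \<oplus> k"
    unfolding mem_ideal_sum by blast
  obtain g where g: "g \<in> ideal_power R ?J s" "k = y \<otimes> g" using PIdl_prodE[OF qk(2) y Js] .
  have p': "p \<in> prime_part x C (Suc s)" using ph(1) mJ_le_prime_part[OF x C] by blast
  have q': "q \<in> prime_part x C (Suc s)" using qk(1) second_part_le_prime_part[OF x C] by blast
  have "f = (p \<oplus> q) \<oplus> y \<otimes> g"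
    unfolding ph(3) qk(3) g(2) using ideal.Icarr[OF P p'] ideal.Icarr[OF P q'] y ideal.Icarr[OF Js g(1)]
    by (simp add: a_assoc)
  then show ?thesis using that ideal_add_mem[OF P p' q'] g(1) by blast
qed

text \<open>A form of degree \<open>s\<close> with \<open>s + 1\<close> pairwise coprime linear
  factors is zero. The factor for \<open>r0\<close> is split off; it lies outside the primes of the
  other \<open>r\<close>, so the cofactor, of degree one less, stays in all of them.\<close>

lemma mem_of_many_linear:
  assumes x: "param d x" and C: "C \<subseteq> {..<d}" and i: "i < d" "i \<notin> C" and l: "l < d" "l \<notin> C" and il: "i \<noteq> l"
  shows "finite \<Lambda> \<Longrightarrow> card \<Lambda> = Suc s \<Longrightarrow> \<Lambda> \<subseteq> carrier R \<Longrightarrow> \<forall>a\<in>\<Lambda>. \<forall>b\<in>\<Lambda>. a \<noteq> b \<longrightarrow> a \<ominus> b \<notin> \<mm> \<Longrightarrow>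
    f \<in> ideal_power R (Idl (x ` {..<d})) s \<Longrightarrow>
    \<forall>r\<in>\<Lambda>. f \<in> prime_part (x(i := x i \<oplus> r \<otimes> x l)) (insert i C) s \<Longrightarrow> f \<in> prime_part x C s"
proof (induction s arbitrary: f \<Lambda>)
  case 0
  then obtain r where "r \<in> \<Lambda>" by fastforce
  then have "f \<in> prime_part (x(i := x i \<oplus> r \<otimes> x l)) (insert i C) 0" using 0 by blast
  then show ?case by (simp only: prime_part_0)
next
  case (Suc s)
  let ?J = "Idl (x ` {..<d})"
  let ?y = "\<lambda>r. x i \<oplus> r \<otimes> x l"
  let ?X = "\<lambda>r. x(i := ?y r)"
  have xi: "x i \<in> carrier R" and xl: "x l \<in> carrier R" using param_in_carrier[OF x] i l by auto
  have Js: "ideal (ideal_power R ?J n) R" for n using J_ideal[OF x] by simp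
  have X: "param d (?X r)" and JX: "Idl (?X r ` {..<d}) = ?J" if "r \<in> carrier R" for r
    using param_add[OF x i(1) l(1) il that] Idl_update_add[OF param_carrier[OF x] _ _ il that] i l by auto
  have iC: "insert i C \<subseteq> {..<d}" using C i by auto
  have le: "prime_part x C n \<subseteq> prime_part (?X r) (insert i C) n" if "r \<in> carrier R" for r n
  proof -
    have "?X r ` C = x ` C" using i by (intro image_cong) auto
    then have "prime_part x C n = prime_part (?X r) C n" using JX[OF that] by (intro prime_part_cong) auto
    then show ?thesis using prime_part_mono[OF X[OF that] _ iC, of C n] by auto
  qed
  obtain r0 where r0: "r0 \<in> \<Lambda>" using Suc.prems(2) by fastforce
  have r0c: "r0 \<in> carrier R" using r0 Suc.prems(3) by auto
  have yc: "?y r0 \<in> carrier R" using xi xl r0c by simp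
  have "f \<in> prime_part (?X r0) (insert i C) (Suc s)" using Suc.prems(6) r0 by blast
  then obtain p g where pg: "p \<in> prime_part x C (Suc s)" "g \<in> ideal_power R ?J s" "f = p \<oplus> ?y r0 \<otimes> g"
    by (rule linear_factor[OF x C i yc X[OF r0c] JX[OF r0c]])
  have gc: "g \<in> carrier R" and pc: "p \<in> carrier R"
    using ideal.Icarr[OF Js pg(2)] ideal.Icarr[OF prime_part_ideal[OF x C] pg(1)] by auto
  have "g \<in> prime_part x C s"
  proof (rule Suc.IH[of "\<Lambda> - {r0}"])
    show "finite (\<Lambda> - {r0})" "card (\<Lambda> - {r0}) = Suc s" "\<Lambda> - {r0} \<subseteq> carrier R" "g \<in> ideal_power R ?J s"
      "\<forall>a\<in>\<Lambda> - {r0}. \<forall>b\<in>\<Lambda> - {r0}. a \<noteq> b \<longrightarrow> a \<ominus> b \<notin> \<mm>"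
      using Suc.prems r0 pg(2) by auto
    show "\<forall>r\<in>\<Lambda> - {r0}. g \<in> prime_part (?X r) (insert i C) s"
    proof (intro ballI, rule ccontr)
      fix r assume r: "r \<in> \<Lambda> - {r0}" and ng: "g \<notin> prime_part (?X r) (insert i C) s"
      have rc: "r \<in> carrier R" using r Suc.prems(3) by auto
      have PX: "ideal (prime_part (?X r) (insert i C) n) R" for n using prime_part_ideal[OF X[OF rc] iC] .
      have "f \<in> prime_part (?X r) (insert i C) (Suc s)" using Suc.prems(6) r by blast
      moreover have "?y r0 \<otimes> g \<oplus> p = f" using pg(3) pc gc yc by (simp only: a_comm m_closed)
      ultimately have "?y r0 \<otimes> g \<oplus> p \<in> prime_part (?X r) (insert i C) (Suc s)" by simp
      then have yg: "?y r0 \<otimes> g \<in> prime_part (?X r) (insert i C) (Suc s)"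
        using ideal_mem_of_add[OF PX _ subsetD[OF le[OF rc] pg(1)]] yc gc by simp
      \<comment> \<open>Otherwise the prime would contain the difference of two forms of the pencil,
        a unit times \<open>x_l\<close>.\<close>
      have "?y r0 \<notin> prime_part (?X r) (insert i C) 1"
      proof
        assume y0: "?y r0 \<in> prime_part (?X r) (insert i C) 1"
        have yr: "?y r \<in> prime_part (?X r) (insert i C) 1"
          using param_in_prime_part[OF X[OF rc] iC, of i] by simp
        have "?y r0 \<ominus> ?y r = (r0 \<ominus> r) \<otimes> x l" using xi xl r0c rc by algebra
        then have "(r0 \<ominus> r) \<otimes> x l \<in> prime_part (?X r) (insert i C) 1" using ideal_diff_mem[OF PX y0 yr] by simp
        moreover have "r0 \<ominus> r \<notin> \<mm>" using Suc.prems(4) r r0 by auto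
        ultimately have "x l \<in> prime_part (?X r) (insert i C) 1"
          using unit_cancel_mem[OF PX, of "r0 \<ominus> r" "x l"] r0c rc xl by auto
        then show False using param_not_in_prime_part[OF X[OF rc] iC l(1)] il l(2) by auto
      qed
      moreover have "?y r0 \<in> ideal_power R ?J 1"
      proof -
        have "x i \<in> ?J" "x l \<in> ?J" using param_carrier[OF x] i l by (auto intro!: Idl_mem)
        then show ?thesis using J_ideal[OF x] r0c by (simp add: ideal_power_1 ideal_add_mem ideal.I_l_closed)
      qed
      ultimately have "?y r0 \<otimes> g \<notin> prime_part (?X r) (insert i C) (1 + s)"
        using prime_part_prime[OF X[OF rc] iC, unfolded JX[OF rc], of "?y r0" 1 g s] ng pg(2) by blast
      then show False using yg by simp
    qed
  qed
  then have "g \<otimes> ?y r0 \<in> prime_part x C (s + 1)"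
  proof (rule prime_part_mult[OF x C])
    have "x i \<in> ?J" "x l \<in> ?J" using param_carrier[OF x] i l by (auto intro!: Idl_mem)
    then show "?y r0 \<in> ideal_power R ?J 1"
      using J_ideal[OF x] r0c by (simp add: ideal_power_1 ideal_add_mem ideal.I_l_closed)
  qed
  then have "?y r0 \<otimes> g \<in> prime_part x C (Suc s)" using gc yc by (simp add: m_comm)
  then show ?case unfolding pg(3) using ideal_add_mem[OF prime_part_ideal[OF x C] pg(1)] by blast
qed

lemma ex_linear_change:
  assumes x: "param d x" and C: "C \<subseteq> {..<d}" and i: "i < d" "i \<notin> C" and l: "l < d" "l \<notin> C" and il: "i \<noteq> l"
    and f: "f \<in> ideal_power R (Idl (x ` {..<d})) s" "f \<notin> prime_part x C s"
  obtains r where "r \<in> carrier R" "f \<notin> prime_part (x(i := x i \<oplus> r \<otimes> x l)) (insert i C) s"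
proof -
  obtain \<Lambda> where \<Lambda>: "finite \<Lambda>" "card \<Lambda> = Suc s" "\<Lambda> \<subseteq> carrier R" "\<And>a b. a \<in> \<Lambda> \<Longrightarrow> b \<in> \<Lambda> \<Longrightarrow> a \<noteq> b \<Longrightarrow> a \<ominus> b \<notin> \<mm>"
    using ex_incongruent by blast
  then have inc: "\<forall>a\<in>\<Lambda>. \<forall>b\<in>\<Lambda>. a \<noteq> b \<longrightarrow> a \<ominus> b \<notin> \<mm>" by blast
  have "\<exists>r\<in>\<Lambda>. f \<notin> prime_part (x(i := x i \<oplus> r \<otimes> x l)) (insert i C) s"
  proof (rule ccontr)
    assume "\<not> ?thesis"
    then have "\<forall>r\<in>\<Lambda>. f \<in> prime_part (x(i := x i \<oplus> r \<otimes> x l)) (insert i C) s" by blast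
    from mem_of_many_linear[OF x C i l il \<Lambda>(1-3) inc f(1) this] show False using f(2) by contradiction
  qed
  then show ?thesis using that \<Lambda>(3) by blast
qed

text \<open>The conclusion says that \<open>f\<close> does not vanish at any of the \<open>d\<close>
  coordinate points of projective space over the residue field.\<close>

lemma generic_parameters:
  assumes x: "param d x" and f: "f \<in> ideal_power R (Idl (x ` {..<d})) s"
    and fn: "f \<notin> \<mm> \<cdot> ideal_power R (Idl (x ` {..<d})) s"
  obtains y where "param d y" "Idl (y ` {..<d}) = Idl (x ` {..<d})"
    "\<And>i. i < d \<Longrightarrow> f \<notin> prime_part y ({..<d} - {i}) s"
proof -
  let ?J = "Idl (x ` {..<d})"
  \<comment> \<open>The coordinate point of index 0 comes first: multiples of \<open>y 0\<close> are
    added to the other parameters, one after the other, so that \<open>f\<close> survives modulo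
    more and more of them.\<close>
  have "\<exists>y. param d y \<and> Idl (y ` {..<d}) = ?J \<and> f \<notin> prime_part y {1..<Suc k} s" if "k < d" for k
    using that
  proof (induction k)
    case 0
    have "{1..<Suc 0} = ({} :: nat set)" by auto
    then show ?case using x fn by (intro exI[of _ x]) (simp add: prime_part_empty)
  next
    case (Suc k)
    then obtain y where y: "param d y" "Idl (y ` {..<d}) = ?J" "f \<notin> prime_part y {1..<Suc k} s" by auto
    have h: "{1..<Suc k} \<subseteq> {..<d}" "Suc k < d" "Suc k \<notin> {1..<Suc k}" "0 < d" "0 \<notin> {1..<Suc k}" "Suc k \<noteq> 0"
      using Suc.prems by auto
    have fy: "f \<in> ideal_power R (Idl (y ` {..<d})) s" using f y(2) by simp
    obtain r where r: "r \<in> carrier R"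
      "f \<notin> prime_part (y(Suc k := y (Suc k) \<oplus> r \<otimes> y 0)) (insert (Suc k) {1..<Suc k}) s"
      by (rule ex_linear_change[OF y(1) h fy y(3)])
    have "insert (Suc k) {1..<Suc k} = {1..<Suc (Suc k)}" by auto
    moreover have "param d (y(Suc k := y (Suc k) \<oplus> r \<otimes> y 0))" using param_add[OF y(1) h(2,4,6) r(1)] .
    moreover have "Idl (y(Suc k := y (Suc k) \<oplus> r \<otimes> y 0) ` {..<d}) = ?J"
      using Idl_update_add[OF param_carrier[OF y(1)] _ _ h(6) r(1)] h y(2) by simp
    ultimately show ?case using r(2) by metis
  qed
  from this[of "d - 1"] have "\<exists>y. param d y \<and> Idl (y ` {..<d}) = ?J \<and> f \<notin> prime_part y {1..<d} s"
    using d_pos by simp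
  moreover have "{1..<d} = {..<d} - {0}" by auto
  ultimately obtain y0 where y0: "param d y0" "Idl (y0 ` {..<d}) = ?J" "f \<notin> prime_part y0 ({..<d} - {0}) s" by auto
  \<comment> \<open>For each further index \<open>i\<close> a multiple of \<open>y i\<close> is
    added to \<open>y 0\<close>. Points already treated are unaffected: the prime of index 0 is
    generated without \<open>y 0\<close>, and the prime of any other \<open>j\<close> contains both
    \<open>y 0\<close> and \<open>y i\<close>.\<close>
  have "\<exists>y. param d y \<and> Idl (y ` {..<d}) = ?J \<and> (\<forall>i\<in>insert 0 B. f \<notin> prime_part y ({..<d} - {i}) s)"
    if "finite B" "B \<subseteq> {1..<d}" for B
    using that
  proof (induction B)
    case empty
    then show ?case using y0 by auto
  next
    case (insert i B)
    then obtain y where y: "param d y" "Idl (y ` {..<d}) = ?J" "\<forall>j\<in>insert 0 B. f \<notin> prime_part y ({..<d} - {j}) s"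
      by auto
    let ?C = "{..<d} - {0, i}"
    have h: "?C \<subseteq> {..<d}" "0 < d" "0 \<notin> ?C" "i < d" "i \<notin> ?C" "0 \<noteq> i" using insert.prems by auto
    have fy: "f \<in> ideal_power R (Idl (y ` {..<d})) s" using f y(2) by simp
    have "f \<notin> prime_part y ?C s"
    proof -
      have "?C \<subseteq> {..<d} - {0}" "{..<d} - {0} \<subseteq> {..<d}" by auto
      then show ?thesis using prime_part_mono[OF y(1)] y(3) by blast
    qed
    then obtain r where r: "r \<in> carrier R" "f \<notin> prime_part (y(0 := y 0 \<oplus> r \<otimes> y i)) (insert 0 ?C) s"
      by (rule ex_linear_change[OF y(1) h fy])
    let ?y = "y(0 := y 0 \<oplus> r \<otimes> y i)"
    have py: "param d ?y" using param_add[OF y(1) h(2,4,6) r(1)] .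
    have Jy: "Idl (?y ` {..<d}) = Idl (y ` {..<d})"
      using Idl_update_add[OF param_carrier[OF y(1)] _ _ h(6) r(1)] h by simp
    have "f \<notin> prime_part ?y ({..<d} - {j}) s" if j: "j \<in> insert 0 (insert i B)" for j
    proof -
      consider "j = i" | "j = 0" | "j \<in> B" "j \<noteq> 0" "j \<noteq> i" using j insert.hyps by blast
      then show ?thesis
      proof cases
        case 1
        have "insert 0 ?C = {..<d} - {i}" using h by auto
        then show ?thesis using r(2) 1 by simp
      next
        case 2
        have "?y ` ({..<d} - {0}) = y ` ({..<d} - {0})" by (intro image_cong) auto
        then have "prime_part ?y ({..<d} - {0}) s = prime_part y ({..<d} - {0}) s"
          using Jy by (intro prime_part_cong) auto
        then show ?thesis using y(3) 2 by simp
      next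
        case 3
        have "y ` ({..<d} - {j}) \<subseteq> carrier R" using param_carrier[OF y(1)] by blast
        then have "Idl (?y ` ({..<d} - {j})) = Idl (y ` ({..<d} - {j}))"
          using 3 h by (intro Idl_update_add r(1)) auto
        then have "prime_part ?y ({..<d} - {j}) s = prime_part y ({..<d} - {j}) s"
          using Jy by (intro prime_part_cong)
        then show ?thesis using y(3) 3 by simp
      qed
    qed
    then show ?case using py Jy y(2) by metis
  qed
  from this[of "{1..<d}"] obtain y where y: "param d y" "Idl (y ` {..<d}) = ?J"
      "\<forall>i\<in>insert 0 {1..<d}. f \<notin> prime_part y ({..<d} - {i}) s" by auto
  have "f \<notin> prime_part y ({..<d} - {i}) s" if "i < d" for i
    using y(3) that by (cases "i = 0") auto
  then show ?thesis using that y(1,2) by blast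
qed

text \<open>A monomial of degree \<open>s\<close> is \<open>x_i^s\<close> or involves another
  parameter.\<close>

lemma power_eq_single:
  assumes x: "param d x" and i: "i < d"
  shows "ideal_power R (Idl (x ` {..<d})) s \<subseteq> (case s of 0 \<Rightarrow> {\<zero>} | Suc k \<Rightarrow>
    (Idl (x ` ({..<d} - {i}))) \<cdot> ideal_power R (Idl (x ` {..<d})) k) <+> PIdl (x i [^] s)"
proof (induction s)
  case 0
  have "carrier R \<subseteq> PIdl \<one>" using one_closed
    by (metis cgenideal_ideal cgenideal_self ideal.one_imp_carrier order_refl)
  also have "PIdl \<one> \<subseteq> {\<zero>} <+> PIdl \<one>"
    by (intro ideal_sum_ge2 zeroideal ideal_subset_carrier cgenideal_ideal one_closed)
  finally show ?case by (simp add: ideal_power_0)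
next
  case (Suc s)
  let ?J = "Idl (x ` {..<d})" and ?Q = "Idl (x ` ({..<d} - {i}))"
  let ?A = "\<lambda>s. (case s of 0 \<Rightarrow> {\<zero>} | Suc k \<Rightarrow> ?Q \<cdot> ideal_power R ?J k)"
  have Js: "ideal (ideal_power R ?J n) R" for n using J_ideal[OF x] by simp
  have J: "ideal ?J R" and Q: "ideal ?Q R" using J_ideal[OF x] param_ideal[OF x, of "{..<d} - {i}"] by auto
  have xi: "x i \<in> carrier R" using param_in_carrier[OF x i] .
  have A: "ideal (?A n) R" for n using second_part_ideal[OF x, of "{..<d} - {i}" n] by auto
  have Pi: "ideal (PIdl (x i [^] n)) R" for n :: nat using xi by (intro cgenideal_ideal) auto
  let ?T = "?Q \<cdot> ideal_power R ?J s <+> PIdl (x i [^] Suc s)"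
  have QJ: "ideal (?Q \<cdot> ideal_power R ?J s) R" using Q Js by (rule ideal_prod_is_ideal)
  have T: "ideal ?T R" using QJ Pi by (rule add_ideals)
  have T1: "?Q \<cdot> ideal_power R ?J s \<subseteq> ?T" and T2: "PIdl (x i [^] Suc s) \<subseteq> ?T"
    by (rule ideal_sum_ge1[OF Pi ideal_subset_carrier[OF QJ]], rule ideal_sum_ge2[OF QJ ideal_subset_carrier[OF Pi]])
  have QsT: "a \<otimes> b \<in> ?T" if "a \<in> ideal_power R ?J s" "b \<in> ?Q" for a b
  proof -
    have "b \<otimes> a \<in> ?Q \<cdot> ideal_power R ?J s" using that by (intro ideal_prod.prod)
    then show ?thesis using T1 ideal.Icarr[OF Js that(1)] ideal.Icarr[OF Q that(2)] by (auto simp: m_comm)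
  qed
  have JQ: "?J = ?Q <+> PIdl (x i)"
    using Idl_image_split[OF param_carrier[OF x] i] by (simp add: adjoin_def)
  have "ideal_power R ?J (Suc s) \<subseteq> ?T"
    unfolding ideal_power_Suc ideal_prod_le_iff[OF T]
  proof (intro ballI)
    fix a b assume a: "a \<in> ideal_power R ?J s" and b: "b \<in> ?J"
    obtain p r where pr: "p \<in> ?A s" "r \<in> carrier R" "a = p \<oplus> r \<otimes> x i [^] s"
      using subsetD[OF Suc a] unfolding mem_ideal_sum cgenideal_def by blast
    obtain q t where qt: "q \<in> ?Q" "t \<in> carrier R" "b = q \<oplus> t \<otimes> x i"
      using b unfolding JQ mem_ideal_sum cgenideal_def by blast
    have car: "p \<in> carrier R" "q \<in> carrier R" "a \<in> carrier R" "x i [^] s \<in> carrier R"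
      using ideal.Icarr[OF A pr(1)] ideal.Icarr[OF Q qt(1)] ideal.Icarr[OF Js a] xi by auto
    have "p \<otimes> x i \<in> ?T"
    proof (cases s)
      case 0
      then show ?thesis using pr(1) xi ideal_zero_mem[OF T] by simp
    next
      case (Suc k)
      then have "p \<otimes> x i \<in> (?Q \<cdot> ideal_power R ?J k) \<cdot> ?J"
        using pr(1) param_carrier[OF x] i by (auto intro!: ideal_prod.prod Idl_mem)
      also have "\<dots> = ?Q \<cdot> ideal_power R ?J s" using Q Js J Suc by (simp add: ideal_prod_assoc ideal_power_Suc)
      finally show ?thesis using T1 by blast
    qed
    then have 1: "t \<otimes> (p \<otimes> x i) \<in> ?T" using ideal.I_l_closed[OF T] qt by blast
    have 2: "a \<otimes> q \<in> ?T" using QsT a qt by blast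
    have "(r \<otimes> t) \<otimes> x i [^] Suc s \<in> PIdl (x i [^] Suc s)"
      using ideal.I_l_closed[OF Pi cgenideal_self] pr qt xi nat_pow_closed[OF xi] by blast
    then have 3: "(r \<otimes> t) \<otimes> x i [^] Suc s \<in> ?T" using T2 by blast
    have "a \<otimes> b = a \<otimes> q \<oplus> a \<otimes> (t \<otimes> x i)" unfolding qt(3) using car qt xi by (simp add: r_distr)
    also have "a \<otimes> (t \<otimes> x i) = t \<otimes> (p \<otimes> x i) \<oplus> (r \<otimes> t) \<otimes> x i [^] Suc s"
      unfolding pr(3) nat_pow_Suc using car pr(2) qt(2) xi by algebra
    finally show "a \<otimes> b \<in> ?T" using ideal_add_mem[OF T 2 ideal_add_mem[OF T 1 3]] by simp
  qed
  then show ?case by simp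
qed

text \<open>For generic parameters \<open>y\<close>, the form \<open>f\<close> is a unit times \<open>y\<^sub>i\<^sup>s\<close> modulo the other parameters,
  so \<open>f a \<in> \<mm>J\<^sup>s\<^sup>+\<^sup>1\<close> puts a multiple of \<open>y\<^sub>i\<close> away from \<open>a\<close> into the colon of the other parameters by \<open>y\<^sub>i\<close>.\<close>

lemma mem_sum_unmixed:
  assumes y: "param d y" and i: "i < d" and a: "a \<in> carrier R"
    and f: "f \<in> ideal_power R (Idl (y ` {..<d})) s" "f \<notin> prime_part y ({..<d} - {i}) s"
    and fa: "f \<otimes> a \<in> ideal_power R (Idl (y ` {..<d})) (Suc s)"
  shows "a \<in> Idl (y ` {..<d}) <+> unmixed y ({..<d} - {i})"
proof -
  let ?J = "Idl (y ` {..<d})" and ?C = "{..<d} - {i}"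
  let ?Q = "Idl (y ` ?C)"
  let ?A = "\<lambda>s. (case s of 0 \<Rightarrow> {\<zero>} | Suc k \<Rightarrow> ?Q \<cdot> ideal_power R ?J k)"
  have C: "?C \<subseteq> {..<d}" by auto
  have J: "ideal ?J R" and Q: "ideal ?Q R" and U: "ideal (unmixed y ?C) R"
    using J_ideal[OF y] param_ideal[OF y C] unmixed_ideal[OF y C] by auto
  have yi: "y i \<in> carrier R" using param_in_carrier[OF y i] .
  have AQ: "?A n \<subseteq> ?Q" for n
    using ideal_zero_mem[OF Q] subsetD[OF ideal_prod_le1[OF Q ideal_power_ideal[OF J]]]
    by (cases n) auto
  have P: "ideal (prime_part y ?C s) R" using prime_part_ideal[OF y C] .
  obtain q r where qr: "q \<in> ?A s" "r \<in> carrier R" "f = q \<oplus> r \<otimes> y i [^] s"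
    using subsetD[OF power_eq_single[OF y i] f(1)] unfolding mem_ideal_sum cgenideal_def by blast
  obtain q' z where qz: "q' \<in> ?A (Suc s)" "z \<in> carrier R" "f \<otimes> a = q' \<oplus> z \<otimes> y i [^] Suc s"
    using subsetD[OF power_eq_single[OF y i] fa] unfolding mem_ideal_sum cgenideal_def by blast
  have qQ: "q \<in> ?Q" "q' \<in> ?Q" using AQ qr(1) qz(1) by blast+
  have car: "q \<in> carrier R" "q' \<in> carrier R" "y i [^] s \<in> carrier R" using qQ ideal.Icarr[OF Q] yi by auto
  \<comment> \<open>This is where general position is used: with \<open>r \<in> \<mm>\<close> both
    summands of \<open>f\<close> would lie in the prime.\<close>
  have "r \<notin> \<mm>"
  proof
    assume "r \<in> \<mm>"
    moreover have "y i [^] s \<in> ideal_power R ?J s"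
      using param_carrier[OF y] i by (intro elem_power_mem J Idl_mem) auto
    ultimately have "r \<otimes> y i [^] s \<in> prime_part y ?C s"
      using mJ_le_prime_part[OF y C] by (blast intro: ideal_prod.prod)
    moreover have "q \<in> prime_part y ?C s"
    proof (cases s)
      case 0
      then show ?thesis using qr(1) ideal_zero_mem[OF P] by simp
    next
      case (Suc k)
      then show ?thesis using qr(1) second_part_le_prime_part[OF y C, of k] by auto
    qed
    ultimately show False using f(2) qr(3) ideal_add_mem[OF P] by simp
  qed
  have "(r \<otimes> a \<ominus> z \<otimes> y i) \<otimes> y i [^] s = q' \<ominus> q \<otimes> a"
  proof -
    have "(r \<otimes> a \<ominus> z \<otimes> y i) \<otimes> y i [^] s = (q \<oplus> r \<otimes> y i [^] s) \<otimes> a \<ominus> q \<otimes> a \<ominus> z \<otimes> (y i [^] s \<otimes> y i)"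
      using car qr(2) qz(2) a yi by algebra
    also have "\<dots> = (q' \<oplus> z \<otimes> (y i [^] s \<otimes> y i)) \<ominus> q \<otimes> a \<ominus> z \<otimes> (y i [^] s \<otimes> y i)"
      using qz(3) unfolding qr(3) by simp
    also have "\<dots> = q' \<ominus> q \<otimes> a" using car qz(2) a yi by algebra
    finally show ?thesis .
  qed
  then have "(r \<otimes> a \<ominus> z \<otimes> y i) \<otimes> y i [^] s \<in> ?Q"
    using ideal_diff_mem[OF Q qQ(2)] ideal.I_r_closed[OF Q qQ(1) a] by simp
  then have "(r \<otimes> a \<ominus> z \<otimes> y i) \<otimes> y i \<in> ?Q"
    using qr(2) qz(2) a yi by (intro weak_sequence_full[OF y i]) auto
  then have "r \<otimes> a \<ominus> z \<otimes> y i \<in> unmixed y ?C"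
    using mem_unmixed_iff[OF y C i] qr(2) qz(2) a yi by simp
  moreover have "z \<otimes> y i \<in> ?J"
    using param_carrier[OF y] i by (intro ideal.I_l_closed[OF J] Idl_mem qz) auto
  moreover have "r \<otimes> a = z \<otimes> y i \<oplus> (r \<otimes> a \<ominus> z \<otimes> y i)" using qr(2) qz(2) a yi by algebra
  ultimately have "r \<otimes> a \<in> ?J <+> unmixed y ?C" unfolding mem_ideal_sum by blast
  then show ?thesis using unit_cancel_mem[OF add_ideals[OF J U] qr(2) \<open>r \<notin> \<mm>\<close> a] by blast
qed

text \<open>This is the annihilator \<open>0 : J\<close>. It equals \<open>unmixed y {}\<close> for
  any system of parameters \<open>y\<close> generating \<open>J\<close>.\<close>

definition socle :: "'a set \<Rightarrow> 'a set"
  where "socle J = {w \<in> carrier R. \<forall>j\<in>J. w \<otimes> j = \<zero>}"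

lemma socle_ideal:
  assumes J: "ideal J R"
  shows "ideal (socle J) R"
proof (rule ideal_of_closed)
  fix u v assume "u \<in> socle J" "v \<in> socle J"
  then show "u \<oplus> v \<in> socle J" using ideal.Icarr[OF J] by (auto simp: socle_def l_distr)
next
  fix u v assume "u \<in> carrier R" "v \<in> socle J"
  then show "u \<otimes> v \<in> socle J" using ideal.Icarr[OF J] by (auto simp: socle_def m_assoc)
qed (use ideal.Icarr[OF J] in \<open>auto simp: socle_def\<close>)

text \<open>General position only gives \<open>a = j + w\<close> with \<open>j \<in> J\<close> and
  \<open>w \<in> 0 : J\<close>. For \<open>s > 0\<close> the form \<open>f\<close> is in
  \<open>J\<close>, so \<open>f w = 0\<close> and \<open>f j\<close> is in
  \<open>\<mm>J^(s+1)\<close>; as the fibre cone is a domain, \<open>j\<close> is in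
  \<open>\<mm>J\<close>. For \<open>s = 0\<close> the element \<open>f\<close> is a unit.\<close>

lemma mem_sum_socle:
  assumes x: "param d x" and f: "f \<in> ideal_power R (Idl (x ` {..<d})) s"
    and fn: "f \<notin> \<mm> \<cdot> ideal_power R (Idl (x ` {..<d})) s" and a: "a \<in> carrier R"
    and fa: "f \<otimes> a \<in> \<mm> \<cdot> ideal_power R (Idl (x ` {..<d})) (Suc s)"
  shows "a \<in> \<mm> \<cdot> (Idl (x ` {..<d})) <+> socle (Idl (x ` {..<d}))"
proof -
  let ?J = "Idl (x ` {..<d})"
  have J: "ideal ?J R" using J_ideal[OF x] .
  have Js: "ideal (ideal_power R ?J n) R" for n using J by simp
  have m1: "\<mm> \<cdot> ?J = \<mm> \<cdot> ideal_power R ?J 1" using J by (simp add: ideal_power_1)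
  have mJ: "ideal (\<mm> \<cdot> ?J) R" unfolding m1 by (rule mJ_ideal[OF x])
  have W: "ideal (socle ?J) R" using J by (rule socle_ideal)
  have fc: "f \<in> carrier R" using ideal.Icarr[OF Js f] .
  show ?thesis
  proof (cases s)
    case 0
    have "f \<notin> \<mm>" using fn 0 by (simp add: ideal_power_0 ideal_prod_one)
    moreover have "f \<otimes> a \<in> \<mm> \<cdot> ?J" using fa 0 J by (simp add: ideal_power_1)
    ultimately have "a \<in> \<mm> \<cdot> ?J" using unit_cancel_mem[OF mJ fc] a by blast
    then show ?thesis by (rule subsetD[OF ideal_sum_ge1[OF W ideal_subset_carrier[OF mJ]]])
  next
    case (Suc k)
    obtain y where y: "param d y" "Idl (y ` {..<d}) = ?J" "\<And>i. i < d \<Longrightarrow> f \<notin> prime_part y ({..<d} - {i}) s"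
      by (rule generic_parameters[OF x f fn]) (rule that)
    have "\<mm> \<cdot> ideal_power R ?J (Suc s) \<subseteq> ideal_power R ?J (Suc s)" using Js by (intro ideal_prod_le2) auto
    then have fa': "f \<otimes> a \<in> ideal_power R ?J (Suc s)" using fa by blast
    have "a \<in> Idl (y ` {..<d}) <+> unmixed y {}"
    proof (rule socle_intersection[OF y(1)])
      fix i assume i: "i < d"
      show "a \<in> Idl (y ` {..<d}) <+> unmixed y ({..<d} - {i})"
        using mem_sum_unmixed[OF y(1) i a] y(2) y(3)[OF i] f fa' by simp
    qed
    then obtain j w where jw: "j \<in> ?J" "w \<in> unmixed y {}" "a = j \<oplus> w" unfolding y(2) mem_ideal_sum by blast
    have wc: "w \<in> carrier R" using jw(2) by (simp add: unmixed_def)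
    have jc: "j \<in> carrier R" using jw(1) ideal.Icarr[OF J] by auto
    have w0: "w \<otimes> h = \<zero>" if h: "h \<in> ?J" for h
    proof -
      have "w \<otimes> z \<in> {\<zero>}" if "z \<in> y ` {..<d}" for z using jw(2) that by (auto simp: unmixed_def Idl_empty)
      moreover have "h \<in> Idl (y ` {..<d})" using h y(2) by simp
      ultimately have "w \<otimes> h \<in> {\<zero>}" by (rule mult_Idl_mem[OF zeroideal wc param_carrier[OF y(1)]])
      then show ?thesis by simp
    qed
    have fJ: "f \<in> ?J" using f ideal_power_antimono[OF J, of "Suc 0" s] J Suc by (auto simp: ideal_power_1)
    have "f \<otimes> a = f \<otimes> j \<oplus> w \<otimes> f" unfolding jw(3) using fc jc wc by algebra
    then have fj: "f \<otimes> j \<in> \<mm> \<cdot> ideal_power R ?J (s + 1)" using fa w0[OF fJ] fc jc by simp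
    have "j \<in> \<mm> \<cdot> ?J"
    proof (rule ccontr)
      assume "j \<notin> \<mm> \<cdot> ?J"
      then have "j \<notin> prime_part x {} 1" unfolding prime_part_empty[OF x] m1[symmetric] .
      moreover have "f \<notin> prime_part x {} s" unfolding prime_part_empty[OF x] by (rule fn)
      moreover have "j \<in> ideal_power R ?J 1" using jw(1) J by (simp add: ideal_power_1)
      ultimately have "f \<otimes> j \<notin> prime_part x {} (s + 1)" using f by (intro prime_part_prime[OF x]) auto
      then show False unfolding prime_part_empty[OF x] using fj by contradiction
    qed
    moreover have "w \<in> socle ?J" using wc w0 by (simp add: socle_def)
    ultimately show ?thesis unfolding jw(3) mem_ideal_sum by blast
  qed
qed

end

section \<open>Quotients\<close>

lemma height_eq:
  assumes f: "\<And>A. A \<in> F \<Longrightarrow> f A \<in> G \<and> g (f A) = A" and g: "\<And>B. B \<in> G \<Longrightarrow> g B \<in> F \<and> f (g B) = B"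
    and "mono f" "mono g"
  shows "height F = height G"
proof (rule antisym)
  show "height F \<le> height G"
    using f \<open>mono f\<close> by (intro height_map[of F f]) (auto simp: psubset_eq mono_def, metis)
  show "height G \<le> height F"
    using g \<open>mono g\<close> by (intro height_map[of G g]) (auto simp: psubset_eq mono_def, metis)
qed

lemma krull_dim_eq_height: "krull_dim R = height {P. primeideal P R}"
  by (simp add: krull_dim_def height_def chain_in_def)

context cring begin

lemma quotient_cosets:
  assumes "ideal I R"
  shows "X \<in> carrier (R Quot I) \<longleftrightarrow> (\<exists>a\<in>carrier R. X = I +> a)"
  by (auto simp: FactRing_def A_RCOSETS_def')

lemma quotient_mult:
  "ideal I R \<Longrightarrow> a \<in> carrier R \<Longrightarrow> b \<in> carrier R \<Longrightarrow> (I +> a) \<otimes>\<^bsub>R Quot I\<^esub> (I +> b) = I +> (a \<otimes> b)"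
  by (simp add: FactRing_def ideal.rcoset_mult_add)

lemma quotient_correspondence:
  assumes I: "ideal I R"
  shows "ideal J R \<Longrightarrow> I \<subseteq> J \<Longrightarrow> ideal ((+>) I ` J) (R Quot I) \<and> \<Union>((+>) I ` J) = J"
    and "ideal K (R Quot I) \<Longrightarrow> ideal (\<Union>K) R \<and> I \<subseteq> \<Union>K \<and> (+>) I ` \<Union>K = K"
proof -
  note b = quot_ideal_correspondence[OF I]
  show "ideal ((+>) I ` J) (R Quot I) \<and> \<Union>((+>) I ` J) = J" if "ideal J R" "I \<subseteq> J"
    using ring_ideal_imp_quot_ideal[OF I that(1)] ideal_incl_iff[OF I that(1)] that(2) by simp
  show "ideal (\<Union>K) R \<and> I \<subseteq> \<Union>K \<and> (+>) I ` \<Union>K = K" if K: "ideal K (R Quot I)"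
  proof -
    have "K \<in> (\<lambda>J. (+>) I ` J) ` {J. ideal J R \<and> I \<subseteq> J}"
      unfolding bij_betw_imp_surj_on[OF b] using K by simp
    then obtain J where J: "ideal J R" "I \<subseteq> J" "K = (+>) I ` J" by auto
    then have "\<Union>K = J" using ideal_incl_iff[OF I J(1)] by simp
    then show ?thesis using J by simp
  qed
qed

lemma krull_dim_quotient:
  assumes I: "ideal I R"
  shows "krull_dim (R Quot I) = height {P. primeideal P R \<and> I \<subseteq> P}"
  unfolding krull_dim_eq_height
proof (rule height_eq[where f = Union and g = "\<lambda>J. (+>) I ` J"])
  interpret h: ring_hom_ring R "R Quot I" "(+>) I" using I by (rule ideal.rcos_ring_hom_ring)
  have Q: "cring (R Quot I)" using ideal.quotient_is_cring[OF I] cring_axioms by simp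
  fix K assume "K \<in> {P. primeideal P (R Quot I)}"
  then have K: "primeideal K (R Quot I)" by simp
  note c = quotient_correspondence(2)[OF I primeideal.axioms(1)[OF K]]
  have "primeideal {r \<in> carrier R. I +> r \<in> K} R" using h.primeideal_vimage[OF cring_axioms K] .
  moreover have "\<Union>K = {r \<in> carrier R. I +> r \<in> K}"
    using canonical_proj_vimage_in_carrier[OF I] canonical_proj_vimage_mem_iff[OF I]
      ideal_subset_carrier[OF primeideal.axioms(1)[OF K]] by blast
  ultimately show "\<Union>K \<in> {P. primeideal P R \<and> I \<subseteq> P} \<and> (+>) I ` \<Union>K = K" using c by simp
next
  have Q: "cring (R Quot I)" using ideal.quotient_is_cring[OF I] cring_axioms by simp
  fix J assume "J \<in> {P. primeideal P R \<and> I \<subseteq> P}"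
  then have J: "primeideal J R" "I \<subseteq> J" by auto
  note c = quotient_correspondence(1)[OF I primeideal.axioms(1)[OF J(1)] J(2)]
  have mem: "I +> a \<in> (+>) I ` J \<longleftrightarrow> a \<in> J" if "a \<in> carrier R" for a
    using canonical_proj_vimage_mem_iff[OF I ideal_subset_carrier that, of "(+>) I ` J"] c by simp
  have "primeideal ((+>) I ` J) (R Quot I)"
  proof (rule primeidealI)
    show "ideal ((+>) I ` J) (R Quot I)" "cring (R Quot I)" using c Q by auto
    show "carrier (R Quot I) \<noteq> (+>) I ` J"
    proof
      assume "carrier (R Quot I) = (+>) I ` J"
      moreover have "I +> \<one> \<in> carrier (R Quot I)" unfolding quotient_cosets[OF I] using one_closed by (intro bexI) simp
      ultimately have "\<one> \<in> J" using mem[of \<one>] by simp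
      then show False
        using primeideal.I_notcarr[OF J(1)] ideal.one_imp_carrier[OF primeideal.axioms(1)[OF J(1)]] by simp
    qed
    fix X Y assume "X \<in> carrier (R Quot I)" "Y \<in> carrier (R Quot I)" "X \<otimes>\<^bsub>R Quot I\<^esub> Y \<in> (+>) I ` J"
    then obtain a b where ab: "a \<in> carrier R" "b \<in> carrier R" "X = I +> a" "Y = I +> b" "I +> (a \<otimes> b) \<in> (+>) I ` J"
      unfolding quotient_cosets[OF I] using quotient_mult[OF I] by metis
    then have "a \<in> J \<or> b \<in> J" using primeideal.I_prime[OF J(1)] mem[of "a \<otimes> b"] by simp
    then show "X \<in> (+>) I ` J \<or> Y \<in> (+>) I ` J" using ab by auto
  qed
  then show "(+>) I ` J \<in> {P. primeideal P (R Quot I)} \<and> \<Union>((+>) I ` J) = J" using c by simp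
qed (auto simp: mono_def)

text \<open>A scalar acts on cosets just as its class does. This leads from the module-theoretic
  \<open>colength\<close> to chains of ideals above \<open>I\<close>.\<close>

lemma submodule_iff_quotient_ideal:
  assumes I: "ideal I R"
  shows "submodule K R (quotient_module (ring_module R (carrier R)) I) \<longleftrightarrow> ideal K (R Quot I)"
proof -
  let ?M = "quotient_module (ring_module R (carrier R)) I"
  have Q: "cring (R Quot I)" using ideal.quotient_is_cring[OF I] cring_axioms by simp
  have add: "subgroup K (add_monoid ?M) \<longleftrightarrow> subgroup K (add_monoid (R Quot I))"
    by (simp add: subgroup_def m_inv_def quotient_module_def ring_module_def FactRing_def A_RCOSETS_defs set_add_defs r_coset_def)
  have coset: "I +>\<^bsub>ring_module R (carrier R)\<^esub> a = I +> a" for a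
    by (simp add: ring_module_def a_r_coset_defs)
  have sm: "a \<odot>\<^bsub>?M\<^esub> (I +> b) = I +> (a \<otimes> b)" if ab: "a \<in> carrier R" "b \<in> carrier R" for a b
  proof -
    have "I +> (a \<otimes> y) = I +> (a \<otimes> b)" if y: "y \<in> I +> b" for y
    proof -
      obtain i where i: "i \<in> I" "y = i \<oplus> b" using y by (auto simp: a_r_coset_def')
      have ic: "i \<in> carrier R" using i(1) I ideal.Icarr by metis
      have "a \<otimes> y \<ominus> a \<otimes> b = a \<otimes> i" unfolding i(2) using ab ic by algebra
      then have "a \<otimes> y \<ominus> a \<otimes> b \<in> I" using ideal.I_l_closed[OF I i(1) ab(1)] by simp
      then show ?thesis using quotient_eq_iff_same_a_r_cos[OF I, of "a \<otimes> y" "a \<otimes> b"] ab ic i(2) by simp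
    qed
    moreover have "b \<in> I +> b"
      using ideal_zero_mem[OF I] ab(2) l_zero[OF ab(2)] unfolding a_r_coset_def' by force
    ultimately have "(\<Union>y\<in>I +> b. I +> (a \<otimes> y)) = I +> (a \<otimes> b)" by blast
    then show ?thesis by (simp add: quotient_module_def coset) (simp add: ring_module_def)
  qed
  show ?thesis
  proof
    assume K: "submodule K R ?M"
    then have sub: "subgroup K (add_monoid (R Quot I))" unfolding add[symmetric] by (rule submodule.axioms(1))
    then have Kc: "K \<subseteq> carrier (R Quot I)" using subgroup.subset[OF sub] by simp
    have 1: "X \<otimes>\<^bsub>R Quot I\<^esub> Y \<in> K" if "X \<in> carrier (R Quot I)" "Y \<in> K" for X Y
    proof -
      have "\<exists>a\<in>carrier R. X = I +> a" "\<exists>b\<in>carrier R. Y = I +> b"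
        using that(1) subsetD[OF Kc that(2)] by (simp_all only: quotient_cosets[OF I])
      then obtain a b where ab: "a \<in> carrier R" "X = I +> a" "b \<in> carrier R" "Y = I +> b" by (elim bexE)
      have "a \<odot>\<^bsub>?M\<^esub> Y \<in> K" by (rule submodule.smult_closed[OF K ab(1) that(2)])
      then show ?thesis unfolding ab(2,4) sm[OF ab(1,3)] quotient_mult[OF I ab(1,3)] .
    qed
    show "ideal K (R Quot I)"
    proof (rule idealI)
      show "ring (R Quot I)" using Q cring.axioms(1) by auto
      show "subgroup K (add_monoid (R Quot I))" by (rule sub)
      fix X Y assume "X \<in> K" "Y \<in> carrier (R Quot I)"
      then show "Y \<otimes>\<^bsub>R Quot I\<^esub> X \<in> K" "X \<otimes>\<^bsub>R Quot I\<^esub> Y \<in> K"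
        using 1[of Y X] Kc cring.cring_simprules(14)[OF Q, of X Y] by auto
    qed
  next
    assume K: "ideal K (R Quot I)"
    show "submodule K R ?M"
    proof (intro submodule.intro)
      show "subgroup K (add_monoid ?M)"
        unfolding add using additive_subgroup.a_subgroup[OF ideal.axioms(1)[OF K]] .
      show "submodule_axioms K R ?M"
      proof
        fix a X assume a: "a \<in> carrier R" and X: "X \<in> K"
        have "\<exists>b\<in>carrier R. X = I +> b"
          using subsetD[OF ideal_subset_carrier[OF K] X] by (simp only: quotient_cosets[OF I])
        then obtain b where b: "b \<in> carrier R" "X = I +> b" by (elim bexE)
        have "(I +> a) \<otimes>\<^bsub>R Quot I\<^esub> X \<in> K"
          by (rule ideal.I_l_closed[OF K X]) (unfold quotient_cosets[OF I], use a in blast)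
        then show "a \<odot>\<^bsub>?M\<^esub> X \<in> K" unfolding b(2) sm[OF a b(1)] quotient_mult[OF I a b(1)] .
      qed
    qed
  qed
qed

lemma colength_eq_height:
  assumes I: "ideal I R"
  shows "colength R I = height {K. ideal K R \<and> I \<subseteq> K}"
proof -
  have "colength R I = height {K. ideal K (R Quot I)}"
    by (simp add: colength_def module_length_def height_def chain_in_def submodule_iff_quotient_ideal[OF I])
  also have "\<dots> = height {K. ideal K R \<and> I \<subseteq> K}"
    using quotient_correspondence[OF I]
    by (intro height_eq[where f = Union and g = "\<lambda>J. (+>) I ` J"]) (auto simp: mono_def)
  finally show ?thesis .
qed

end

section \<open>Systems of parameters and minimal reductions\<close>

lemma (in cring) primeideal_pow:
  assumes P: "primeideal P R" and a: "a \<in> carrier R" and n: "a [^] (n::nat) \<in> P"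
  shows "a \<in> P"
  using n
proof (induction n)
  case 0
  then show ?case
    using primeideal.I_notcarr[OF P] ideal.one_imp_carrier[OF primeideal.axioms(1)[OF P]] by simp
next
  case (Suc n)
  then have "a [^] n \<in> P \<or> a \<in> P" using a by (intro primeideal.I_prime[OF P]) auto
  then show ?case using Suc.IH by blast
qed

context local_noetherian begin

lemma the_colength: "ideal I R \<Longrightarrow> the_enat (colength R I) = len I"
  by (simp add: len_def ideals_over_def colength_eq_height)

lemma samuel_multiplicity_eq:
  assumes "krull_dim R = enat d" "ideal I R"
  shows "samuel_multiplicity R I = mult_at d I"
  using assms by (simp add: samuel_multiplicity_def mult_at_def hilbert_samuel_poly_def hs_poly_def the_colength)

text \<open>Every prime contains the nilpotent elements, so \<open>\<mm>\<close> is the only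
  one.\<close>

lemma krull_dim_nilpotent:
  assumes n: "ideal_power R \<mm> n = {\<zero>}"
  shows "krull_dim R = 0"
proof -
  have "P = \<mm>" if P: "primeideal P R" for P
  proof
    show "P \<subseteq> \<mm>" using prime_le_m[OF P] .
    show "\<mm> \<subseteq> P"
    proof
      fix a assume a: "a \<in> \<mm>"
      then have "a [^] n = \<zero>" using elem_power_mem[OF m_ideal a, of n] n by simp
      then have "a [^] n \<in> P" using ideal_zero_mem[OF primeideal.axioms(1)[OF P]] by simp
      then show "a \<in> P" using primeideal_pow[OF P] a m_carrier by blast
    qed
  qed
  then show ?thesis unfolding krull_dim_eq_height by (intro height_singleton[of _ \<mm>]) auto
qed

lemma param_system_of_parameters:
  assumes d: "krull_dim R = enat d" and x: "param d x"
  shows "system_of_parameters R \<mm> (map x [0..<d])"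
proof -
  let ?Q = "Idl (x ` {..<d})"
  have Q: "ideal ?Q R" using x by (simp add: param_def mprimary_ideal)
  have Qm: "?Q \<subseteq> \<mm>" using x by (intro Idl_le) (auto simp: param_def)
  obtain n where n: "ideal_power R \<mm> n \<subseteq> ?Q" using x by (auto simp: param_def mprimary_def)
  have rad: "radical R ?Q = \<mm>"
  proof
    show "radical R ?Q \<subseteq> \<mm>" using primeideal_pow[OF m_prime] Qm by (auto simp: radical_def)
    show "\<mm> \<subseteq> radical R ?Q"
    proof
      fix a assume a: "a \<in> \<mm>"
      then have "a [^] n \<in> ?Q" using elem_power_mem[OF m_ideal a, of n] n by blast
      then show "a \<in> radical R ?Q" using a m_carrier by (auto simp: radical_def)
    qed
  qed
  have "?Q \<noteq> carrier R" using Qm one_not_in_m one_closed by blast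
  moreover have "a \<in> ?Q \<or> b \<in> \<mm>" if "a \<in> carrier R" "b \<in> carrier R" "a \<otimes> b \<in> ?Q" for a b
    using unit_cancel_mem[OF Q that(2) _ that(1)] that by (auto simp: m_comm)
  ultimately have "primary_ideal R ?Q" using Q rad by (auto simp: primary_ideal_def)
  moreover have "set (map x [0..<d]) = x ` {..<d}" by auto
  ultimately show ?thesis using d rad x by (simp add: system_of_parameters_def param_def)
qed

text \<open>The generators are parameters because
  \<open>\<mm>^(r+1) = J \<mm>^r \<subseteq> J\<close>.\<close>

lemma minimal_reduction_param:
  assumes d: "krull_dim R = enat d" and J: "minimal_reduction R J \<mm>"
  obtains x r where "param d x" "J = Idl (x ` {..<d})" "ideal_power R \<mm> (Suc r) = J \<cdot> ideal_power R \<mm> r"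
proof -
  obtain xs r where xs: "J \<subseteq> \<mm>" "enat (length xs) = krull_dim R" "set xs \<subseteq> carrier R" "J = Idl (set xs)"
    "ideal_power R \<mm> (r + 1) = J \<cdot> ideal_power R \<mm> r"
    using J unfolding minimal_reduction_def by blast
  have l: "length xs = d" using xs(2) d by simp
  have im: "(\<lambda>i. xs ! i) ` {..<d} = set xs" using l by (auto simp: set_conv_nth)
  have Ji: "ideal J R" unfolding xs(4) using xs(3) by (rule genideal_ideal)
  have "J \<cdot> ideal_power R \<mm> r \<subseteq> J" using Ji by (intro ideal_prod_le1) auto
  then have "ideal_power R \<mm> (Suc r) \<subseteq> J" using xs(5) by simp
  then have "mprimary J" using Ji unfolding mprimary_def by blast
  moreover have "set xs \<subseteq> \<mm>" using xs(1,3,4) genideal_self by blast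
  ultimately have "param d (\<lambda>i. xs ! i)" using xs(4) im by (simp add: param_def)
  then show ?thesis using that[of "\<lambda>i. xs ! i" r] xs(4,5) im by simp
qed

end

lemma buchsbaum_ring_locale:
  assumes B: "buchsbaum_ring R \<mm>" and d: "krull_dim R = enat d" "d > 0" and inf: "infinite (carrier (R Quot \<mm>))"
  obtains c where "buchsbaum_infinite R \<mm> d c"
proof -
  have "local_noetherian_ring R \<mm>" using B by (simp add: buchsbaum_ring_def)
  then interpret local_noetherian R \<mm>
    unfolding local_noetherian_ring_def local_noetherian_def local_noetherian_axioms_def by blast
  obtain c :: nat where c: "\<And>xs. system_of_parameters R \<mm> xs \<Longrightarrow>
      of_nat (the_enat (colength R (Idl\<^bsub>R\<^esub> (set xs)))) - samuel_multiplicity R (Idl\<^bsub>R\<^esub> (set xs)) = of_nat c"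
    using B unfolding buchsbaum_ring_def by blast
  have "buchsbaum_infinite R \<mm> d c"
  proof (intro buchsbaum_infinite.intro buchsbaum_local.intro buchsbaum_local_axioms.intro
      buchsbaum_infinite_axioms.intro local_noetherian_axioms)
    show "ideal_power R \<mm> n \<noteq> {\<zero>\<^bsub>R\<^esub>}" for n using krull_dim_nilpotent[of n] d by (auto simp: zero_enat_def)
    show "of_nat (len (Idl\<^bsub>R\<^esub> (x ` {..<d}))) = mult_at d (Idl\<^bsub>R\<^esub> (x ` {..<d})) + (of_nat c :: rat)" if x: "param d x" for x
    proof -
      have I: "ideal (Idl\<^bsub>R\<^esub> (x ` {..<d})) R" using x by (simp add: param_def mprimary_ideal)
      have "set (map x [0..<d]) = x ` {..<d}" by auto
      then show ?thesis
        using c[OF param_system_of_parameters[OF d(1) x]] the_colength[OF I] samuel_multiplicity_eq[OF d(1) I] by simp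
    qed
  qed (use d inf in auto)
  then show ?thesis using that by blast
qed

section \<open>Rees algebras\<close>

context cring begin

lemma ideal_finsum_mem:
  assumes I: "ideal I R" and f: "\<And>i. i \<in> A \<Longrightarrow> f i \<in> I"
  shows "(\<Oplus>i\<in>A. f i) \<in> I"
proof (cases "finite A")
  case True
  then show ?thesis using f
  proof (induction A rule: finite_induct)
    case (insert a A)
    then have "f \<in> A \<rightarrow> carrier R" "f a \<in> carrier R" using ideal.Icarr[OF I] by auto
    then show ?case using insert ideal_add_mem[OF I] by simp
  qed (simp add: ideal_zero_mem[OF I])
qed (simp add: ideal_zero_mem[OF I])

text \<open>The homogeneous element \<open>a t^n\<close>.\<close>

definition single :: "'a \<Rightarrow> nat \<Rightarrow> nat \<Rightarrow> 'a"
  where "single a n = (\<lambda>i. if i = n then a else \<zero>)"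

lemma UP_cring_UP: "UP_cring R"
  by (simp add: UP_cring_def cring_axioms)

lemma cring_UP: "cring (UP R)"
  using UP_cring.UP_cring[OF UP_cring_UP] by simp

lemma carrier_UP: "carrier (UP R) = up R"
  by (simp add: UP_def)

lemma add_UP: "f \<in> up R \<Longrightarrow> g \<in> up R \<Longrightarrow> f \<oplus>\<^bsub>UP R\<^esub> g = (\<lambda>i. f i \<oplus> g i)"
  by (simp add: UP_def)

lemma mult_UP: "f \<in> up R \<Longrightarrow> g \<in> up R \<Longrightarrow> f \<otimes>\<^bsub>UP R\<^esub> g = (\<lambda>n. \<Oplus>i\<in>{..n}. f i \<otimes> g (n - i))"
  by (simp add: UP_def)

lemma zero_UP: "\<zero>\<^bsub>UP R\<^esub> = (\<lambda>i. \<zero>)"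
  by (simp add: UP_def)

lemma one_UP: "\<one>\<^bsub>UP R\<^esub> = single \<one> 0"
  by (simp add: UP_def single_def)

lemma monom_UP: "a \<in> carrier R \<Longrightarrow> up_ring.monom (UP R) a n = single a n"
  by (simp add: UP_def single_def)

lemma single_up: "a \<in> carrier R \<Longrightarrow> single a n \<in> up R"
  by (auto simp: single_def up_def bound_def)

lemma single_apply [simp]: "single a n n = a" "i \<noteq> n \<Longrightarrow> single a n i = \<zero>"
  by (auto simp: single_def)

lemma single_zero: "single \<zero> n = (\<lambda>i. \<zero>)"
  by (auto simp: single_def)

lemma single_add:
  "a \<in> carrier R \<Longrightarrow> b \<in> carrier R \<Longrightarrow> single (a \<oplus> b) n = single a n \<oplus>\<^bsub>UP R\<^esub> single b n"
  by (simp add: add_UP single_up) (auto simp: single_def)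

lemma single_mult_apply:
  assumes a: "a \<in> carrier R" and f: "f \<in> up R"
  shows "(single a m \<otimes>\<^bsub>UP R\<^esub> f) k = (if m \<le> k then a \<otimes> f (k - m) else \<zero>)"
proof -
  have fc: "f i \<in> carrier R" for i using f by auto
  have "(single a m \<otimes>\<^bsub>UP R\<^esub> f) k = (\<Oplus>i\<in>{..k}. if m = i then a \<otimes> f (k - i) else \<zero>)"
    unfolding mult_UP[OF single_up[OF a] f] using a fc
    by (intro finsum_cong') (auto simp: single_def)
  also have "\<dots> = (if m \<le> k then a \<otimes> f (k - m) else \<zero>)"
  proof (cases "m \<le> k")
    case True
    then show ?thesis
      using add.finprod_singleton[of m "{..k}" "\<lambda>i. a \<otimes> f (k - i)"] a fc by simp
  next
    case False
    then have "(\<Oplus>i\<in>{..k}. if m = i then a \<otimes> f (k - i) else \<zero>) = (\<Oplus>i\<in>{..k}. \<zero>)"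
      by (intro finsum_cong') auto
    then show ?thesis using False by simp
  qed
  finally show ?thesis .
qed

lemma single_mult_single:
  assumes "a \<in> carrier R" "b \<in> carrier R"
  shows "single a m \<otimes>\<^bsub>UP R\<^esub> single b n = single (a \<otimes> b) (m + n)"
  using assms by (auto simp: fun_eq_iff single_mult_apply single_up) (auto simp: single_def)

lemma single_pow:
  assumes "a \<in> carrier R"
  shows "single a m [^]\<^bsub>UP R\<^esub> (n::nat) = single (a [^] n) (m * n)"
  using assms by (induction n) (simp_all add: Group.nat_pow_0 Group.nat_pow_Suc one_UP single_mult_single add.commute)

lemma up_induct:
  assumes f: "f \<in> up R" and S0: "(\<lambda>i. \<zero>) \<in> S"
    and S: "\<And>g h. g \<in> S \<Longrightarrow> h \<in> S \<Longrightarrow> g \<oplus>\<^bsub>UP R\<^esub> h \<in> S" and sing: "\<And>n. single (f n) n \<in> S"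
  shows "f \<in> S"
proof -
  have fc: "f i \<in> carrier R" for i using f by auto
  have tr: "(\<lambda>i. if i < N then f i else \<zero>) \<in> up R" for N
    using fc by (auto simp: up_def bound_def intro: exI[of _ N])
  have "(\<lambda>i. if i < N then f i else \<zero>) \<in> S" for N
  proof (induction N)
    case 0
    then show ?case using S0 by simp
  next
    case (Suc N)
    have "(\<lambda>i. if i < Suc N then f i else \<zero>) = (\<lambda>i. if i < N then f i else \<zero>) \<oplus>\<^bsub>UP R\<^esub> single (f N) N"
      unfolding add_UP[OF tr single_up[OF fc]] using fc by (auto simp: single_def less_Suc_eq)
    then show ?case using S[OF Suc sing[of N]] by simp
  qed
  moreover obtain N where "bound \<zero> N f" using f by auto
  then have "f = (\<lambda>i. if i < Suc N then f i else \<zero>)" by (auto simp: bound_def)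
  ultimately show ?thesis by metis
qed

lemma rees_carrier: "carrier (rees_algebra R K) = {f \<in> up R. \<forall>n. f n \<in> ideal_power R K n}"
  by (auto simp: rees_algebra_def UP_def)

lemma single_in_rees:
  assumes K: "ideal K R" and a: "a \<in> ideal_power R K n"
  shows "single a n \<in> carrier (rees_algebra R K)"
proof -
  have "single a n i \<in> ideal_power R K i" for i
    using a ideal_zero_mem[OF ideal_power_ideal[OF K]] by (cases "i = n") auto
  then show ?thesis using single_up ideal.Icarr[OF ideal_power_ideal[OF K] a] by (simp add: rees_carrier)
qed

text \<open>A coefficient in \<open>I K^n\<close> is a sum of products \<open>i j\<close>, and
  \<open>i j t^n\<close> is the constant \<open>i\<close> times the element \<open>j t^n\<close> of
  the Rees algebra; general elements are sums of their homogeneous components.\<close>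

lemma ideal_times_rees_eq:
  assumes I: "ideal I R" and K: "ideal K R"
  shows "ideal_times_rees R I K = {f \<in> up R. \<forall>n. f n \<in> I \<cdot> ideal_power R K n}"
proof -
  interpret P: cring "UP R" by (rule cring_UP)
  have IK: "ideal (I \<cdot> ideal_power R K n) R" for n using I K by (intro ideal_prod_is_ideal) auto
  have Ic: "a \<in> I \<Longrightarrow> a \<in> carrier R" for a using I ideal.Icarr by metis
  have Kc: "a \<in> ideal_power R K n \<Longrightarrow> a \<in> carrier R" for a n using K ideal.Icarr ideal_power_ideal by metis
  let ?N = "ideal_prod (UP R) ((\<lambda>a. up_ring.monom (UP R) a 0) ` I) (carrier (rees_algebra R K))"
  have "?N \<subseteq> {f \<in> up R. \<forall>n. f n \<in> I \<cdot> ideal_power R K n}"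
  proof
    fix f assume "f \<in> ?N"
    then show "f \<in> {f \<in> up R. \<forall>n. f n \<in> I \<cdot> ideal_power R K n}"
    proof induction
      case (prod i j)
      then obtain a where a: "a \<in> I" "i = single a 0" using monom_UP Ic by auto
      have j: "j \<in> up R" "\<And>n. j n \<in> ideal_power R K n" using prod by (auto simp: rees_carrier)
      have "i \<otimes>\<^bsub>UP R\<^esub> j \<in> up R"
        using P.m_closed[of i j] j single_up[OF Ic[OF a(1)], of 0] a(2) by (simp add: carrier_UP)
      moreover have "(i \<otimes>\<^bsub>UP R\<^esub> j) n \<in> I \<cdot> ideal_power R K n" for n
        unfolding a(2) single_mult_apply[OF Ic[OF a(1)] j(1)] using a(1) j(2) by (auto intro: ideal_prod.prod)
      ultimately show ?case by simp
    next
      case (sum s1 s2)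
      then show ?case using P.a_closed[of s1 s2] by (auto simp: carrier_UP add_UP ideal_add_mem[OF IK])
    qed
  qed
  moreover have "f \<in> ?N" if f: "f \<in> up R" "\<And>n. f n \<in> I \<cdot> ideal_power R K n" for f
  proof (rule up_induct[OF f(1)])
    have single: "single c n \<in> ?N" if "c \<in> I \<cdot> ideal_power R K n" for c n
      using that
    proof induction
      case (prod i j)
      have "single j n \<in> carrier (rees_algebra R K)"
        using single_in_rees[OF K] prod by blast
      moreover have "single (i \<otimes> j) n = up_ring.monom (UP R) i 0 \<otimes>\<^bsub>UP R\<^esub> single j n"
        using prod Ic Kc by (simp add: monom_UP single_mult_single)
      ultimately show ?case using prod by (auto intro: ideal_prod.prod)
    next
      case (sum s1 s2)
      then show ?case using ideal.Icarr[OF IK] by (auto simp: single_add intro: ideal_prod.sum)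
    qed
    show "single (f n) n \<in> ?N" for n using single f(2) by blast
    show "(\<lambda>i. \<zero>) \<in> ?N" using single[OF ideal_zero_mem[OF IK], of 0] by (simp add: single_zero)
    show "g \<oplus>\<^bsub>UP R\<^esub> h \<in> ?N" if "g \<in> ?N" "h \<in> ?N" for g h using that by (rule ideal_prod.sum)
  qed
  ultimately show ?thesis unfolding ideal_times_rees_def by blast
qed

end

locale rees = cring R for R (structure) +
  fixes K :: "'a set"
  assumes K_ideal: "ideal K R"
begin

abbreviation A :: "(nat \<Rightarrow> 'a) ring"
  where "A \<equiv> rees_algebra R K"

lemma powers_ideal: "ideal (ideal_power R K n) R"
  using K_ideal by simp

lemma powers_mult: "a \<in> ideal_power R K m \<Longrightarrow> b \<in> ideal_power R K n \<Longrightarrow> a \<otimes> b \<in> ideal_power R K (m + n)"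
  using K_ideal by (rule ideal_power_prod_mem)

lemma A_ops:
  "add A = add (UP R)" "mult A = mult (UP R)" "zero A = (\<lambda>i. \<zero>)" "one A = single \<one> 0"
  by (simp_all add: rees_algebra_def zero_UP one_UP)

lemma A_up: "f \<in> carrier A \<Longrightarrow> f \<in> up R"
  by (simp add: rees_carrier)

lemma single_in_A: "a \<in> ideal_power R K n \<Longrightarrow> single a n \<in> carrier A"
  using K_ideal by (rule single_in_rees)

lemma A_add_apply: "f \<in> carrier A \<Longrightarrow> g \<in> carrier A \<Longrightarrow> (f \<oplus>\<^bsub>A\<^esub> g) n = f n \<oplus> g n"
  by (simp add: A_ops add_UP A_up)

lemma A_mult_apply:
  "f \<in> carrier A \<Longrightarrow> g \<in> carrier A \<Longrightarrow> (f \<otimes>\<^bsub>A\<^esub> g) n = (\<Oplus>i\<in>{..n}. f i \<otimes> g (n - i))"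
  by (simp add: A_ops mult_UP A_up)

sublocale A: cring "rees_algebra R K"
proof -
  interpret P: cring "UP R" by (rule cring_UP)
  have add: "f \<oplus>\<^bsub>A\<^esub> g \<in> carrier A" if "f \<in> carrier A" "g \<in> carrier A" for f g
    using that P.a_closed[of f g] ideal_add_mem[OF powers_ideal]
    by (auto simp: A_ops rees_carrier add_UP carrier_UP)
  have mult: "f \<otimes>\<^bsub>A\<^esub> g \<in> carrier A" if "f \<in> carrier A" "g \<in> carrier A" for f g
  proof -
    have "(\<Oplus>i\<in>{..n}. f i \<otimes> g (n - i)) \<in> ideal_power R K n" for n
    proof (rule ideal_finsum_mem[OF powers_ideal])
      fix i assume "i \<in> {..n}"
      then show "f i \<otimes> g (n - i) \<in> ideal_power R K n"
        using powers_mult[of "f i" i "g (n - i)" "n - i"] that by (simp add: rees_carrier)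
    qed
    then show ?thesis using that P.m_closed[of f g] by (auto simp: A_ops rees_carrier mult_UP carrier_UP)
  qed
  have zero: "\<zero>\<^bsub>A\<^esub> \<in> carrier A" using P.zero_closed ideal_zero_mem[OF powers_ideal]
    by (simp add: A_ops rees_carrier zero_UP carrier_UP)
  have one: "\<one>\<^bsub>A\<^esub> \<in> carrier A" using single_in_A[of \<one> 0] by (simp add: A_ops ideal_power_0)
  have sub: "f \<in> carrier A \<Longrightarrow> f \<in> carrier (UP R)" for f by (simp add: rees_carrier carrier_UP)
  have neg: "\<exists>g\<in>carrier A. g \<oplus>\<^bsub>A\<^esub> f = \<zero>\<^bsub>A\<^esub>" if f: "f \<in> carrier A" for f
  proof
    have fc: "f i \<in> carrier R" for i using A_up[OF f] by auto
    show "(\<lambda>i. \<ominus> f i) \<in> carrier A"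
      using f up_a_inv_closed[OF A_up[OF f]] ideal_minus_mem[OF powers_ideal] by (simp add: rees_carrier)
    then show "(\<lambda>i. \<ominus> f i) \<oplus>\<^bsub>A\<^esub> f = \<zero>\<^bsub>A\<^esub>"
      using f fc by (simp add: A_ops add_UP A_up l_neg)
  qed
  have ops: "add A = add (UP R)" "mult A = mult (UP R)" "zero A = zero (UP R)" "one A = one (UP R)"
    by (simp_all add: rees_algebra_def)
  show "cring A"
  proof (rule cringI)
    show "abelian_group A"
    proof (rule abelian_groupI)
      fix f g h assume "f \<in> carrier A" "g \<in> carrier A" "h \<in> carrier A"
      then show "f \<oplus>\<^bsub>A\<^esub> g \<oplus>\<^bsub>A\<^esub> h = f \<oplus>\<^bsub>A\<^esub> (g \<oplus>\<^bsub>A\<^esub> h)" using sub by (simp add: ops P.a_assoc)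
    next
      fix f g assume "f \<in> carrier A" "g \<in> carrier A"
      then show "f \<oplus>\<^bsub>A\<^esub> g = g \<oplus>\<^bsub>A\<^esub> f" using sub by (simp add: ops P.a_comm)
    next
      fix f assume "f \<in> carrier A"
      then show "\<zero>\<^bsub>A\<^esub> \<oplus>\<^bsub>A\<^esub> f = f" using sub by (simp add: ops)
    qed (use add zero neg in auto)
    show "comm_monoid A"
    proof (rule comm_monoidI)
      fix f g h assume "f \<in> carrier A" "g \<in> carrier A" "h \<in> carrier A"
      then show "f \<otimes>\<^bsub>A\<^esub> g \<otimes>\<^bsub>A\<^esub> h = f \<otimes>\<^bsub>A\<^esub> (g \<otimes>\<^bsub>A\<^esub> h)" using sub by (simp add: ops P.m_assoc)
    next
      fix f g assume "f \<in> carrier A" "g \<in> carrier A"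
      then show "f \<otimes>\<^bsub>A\<^esub> g = g \<otimes>\<^bsub>A\<^esub> f" using sub by (simp add: ops P.m_comm)
    next
      fix f assume "f \<in> carrier A"
      then show "\<one>\<^bsub>A\<^esub> \<otimes>\<^bsub>A\<^esub> f = f" using sub by (simp add: ops)
    qed (use mult one in auto)
    fix f g h assume "f \<in> carrier A" "g \<in> carrier A" "h \<in> carrier A"
    then show "(f \<oplus>\<^bsub>A\<^esub> g) \<otimes>\<^bsub>A\<^esub> h = f \<otimes>\<^bsub>A\<^esub> h \<oplus>\<^bsub>A\<^esub> g \<otimes>\<^bsub>A\<^esub> h"
      using sub by (simp add: ops P.l_distr)
  qed
qed

lemma A_pow: "f [^]\<^bsub>A\<^esub> (n::nat) = f [^]\<^bsub>UP R\<^esub> n"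
  by (induction n) (simp_all add: Group.nat_pow_0 Group.nat_pow_Suc A_ops one_UP)

lemma A_induct:
  assumes f: "f \<in> carrier A" and S0: "\<zero>\<^bsub>A\<^esub> \<in> S"
    and S: "\<And>g h. g \<in> S \<Longrightarrow> h \<in> S \<Longrightarrow> g \<oplus>\<^bsub>A\<^esub> h \<in> S" and sing: "\<And>n. single (f n) n \<in> S"
  shows "f \<in> S"
  using up_induct[OF A_up[OF f], of S] S0 S sing by (simp add: A_ops)

definition graded :: "(nat \<Rightarrow> 'a set) \<Rightarrow> (nat \<Rightarrow> 'a) set"
  where "graded G = {f \<in> carrier A. \<forall>n. f n \<in> G n}"

lemma graded_ideal:
  assumes G: "\<And>n. ideal (G n) R"
    and mult: "\<And>s t a b. a \<in> G s \<Longrightarrow> b \<in> ideal_power R K t \<Longrightarrow> a \<otimes> b \<in> G (s + t)"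
  shows "ideal (graded G) A"
proof (rule A.ideal_of_closed)
  show "\<zero>\<^bsub>A\<^esub> \<in> graded G" using A.zero_closed ideal_zero_mem[OF G] by (simp add: graded_def A_ops(3))
  show "f \<oplus>\<^bsub>A\<^esub> g \<in> graded G" if "f \<in> graded G" "g \<in> graded G" for f g
    using that A.a_closed by (auto simp: graded_def A_add_apply ideal_add_mem[OF G])
  show "r \<otimes>\<^bsub>A\<^esub> f \<in> graded G" if r: "r \<in> carrier A" and f: "f \<in> graded G" for r f
  proof -
    have fA: "f \<in> carrier A" and fG: "\<And>n. f n \<in> G n" using f by (auto simp: graded_def)
    have "(r \<otimes>\<^bsub>A\<^esub> f) n \<in> G n" for n unfolding A_mult_apply[OF r fA]
    proof (rule ideal_finsum_mem[OF G])
      fix i assume i: "i \<in> {..n}"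
      have "f (n - i) \<otimes> r i \<in> G n"
        using mult[OF fG[of "n - i"], of "r i" i] r i by (simp add: rees_carrier)
      then show "r i \<otimes> f (n - i) \<in> G n" using A_up[OF r] A_up[OF fA] by (simp add: m_comm mem_upD)
    qed
    then show ?thesis using A.m_closed[OF r fA] by (simp add: graded_def)
  qed
qed (auto simp: graded_def)

text \<open>Let \<open>s\<close> and \<open>t\<close> be the lowest degrees in which the two factors
  leave \<open>G\<close>. In degree \<open>s + t\<close> of the product every summand except
  \<open>f s \<otimes> g t\<close> lies in \<open>G\<close>, so this one does as well if the product
  does.\<close>

lemma graded_prime:
  assumes G: "\<And>n. ideal (G n) R"
    and mult: "\<And>s t a b. a \<in> G s \<Longrightarrow> b \<in> ideal_power R K t \<Longrightarrow> a \<otimes> b \<in> G (s + t)"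
    and one: "\<one> \<notin> G 0"
    and prime: "\<And>s t a b. a \<in> ideal_power R K s \<Longrightarrow> a \<notin> G s \<Longrightarrow> b \<in> ideal_power R K t \<Longrightarrow> b \<notin> G t \<Longrightarrow> a \<otimes> b \<notin> G (s + t)"
  shows "primeideal (graded G) A"
proof (rule primeidealI)
  show "ideal (graded G) A" using G mult by (rule graded_ideal)
  show "cring A" by (rule A.cring_axioms)
  have "\<one>\<^bsub>A\<^esub> 0 = \<one>" by (simp add: A_ops)
  then have "\<one>\<^bsub>A\<^esub> \<notin> graded G" using one by (metis (mono_tags, lifting) graded_def mem_Collect_eq)
  then show "carrier A \<noteq> graded G" using A.one_closed by metis
  fix f g assume f: "f \<in> carrier A" and g: "g \<in> carrier A" and fg: "f \<otimes>\<^bsub>A\<^esub> g \<in> graded G"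
  have car: "f i \<in> carrier R" "g i \<in> carrier R" for i using A_up[OF f] A_up[OF g] by auto
  have fK: "f i \<in> ideal_power R K i" and gK: "g i \<in> ideal_power R K i" for i
    using f g by (auto simp: rees_carrier)
  show "f \<in> graded G \<or> g \<in> graded G"
  proof (rule ccontr)
    assume "\<not> ?thesis"
    then have ex: "\<exists>s. f s \<notin> G s" "\<exists>t. g t \<notin> G t" using f g by (auto simp: graded_def)
    define s where "s = (LEAST s. f s \<notin> G s)"
    define t where "t = (LEAST t. g t \<notin> G t)"
    have s: "f s \<notin> G s" "\<And>i. i < s \<Longrightarrow> f i \<in> G i"
      using LeastI_ex[OF ex(1)] not_less_Least unfolding s_def by blast+
    have t: "g t \<notin> G t" "\<And>i. i < t \<Longrightarrow> g i \<in> G i"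
      using LeastI_ex[OF ex(2)] not_less_Least unfolding t_def by blast+
    have "(\<Oplus>i\<in>{..s + t}. f i \<otimes> g (s + t - i)) = f s \<otimes> g t \<oplus> (\<Oplus>i\<in>{..s + t} - {s}. f i \<otimes> g (s + t - i))"
    proof -
      have "{..s + t} = insert s ({..s + t} - {s})" by auto
      then have "(\<Oplus>i\<in>{..s + t}. f i \<otimes> g (s + t - i)) = (\<Oplus>i\<in>insert s ({..s + t} - {s}). f i \<otimes> g (s + t - i))" by simp
      also have "\<dots> = f s \<otimes> g (s + t - s) \<oplus> (\<Oplus>i\<in>{..s + t} - {s}. f i \<otimes> g (s + t - i))"
        using car by (intro finsum_insert) auto
      finally show ?thesis by simp
    qed
    moreover have "(\<Oplus>i\<in>{..s + t} - {s}. f i \<otimes> g (s + t - i)) \<in> G (s + t)"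
    proof (rule ideal_finsum_mem[OF G])
      fix i assume i: "i \<in> {..s + t} - {s}"
      show "f i \<otimes> g (s + t - i) \<in> G (s + t)"
      proof (cases "i < s")
        case True
        then show ?thesis using mult[OF s(2) gK, of i "s + t - i"] by simp
      next
        case False
        then have "s + t - i < t" using i by auto
        then have "g (s + t - i) \<otimes> f i \<in> G (s + t)" using mult[OF t(2) fK, of "s + t - i" i] i by simp
        then show ?thesis using car by (simp add: m_comm)
      qed
    qed
    moreover have "(\<Oplus>i\<in>{..s + t}. f i \<otimes> g (s + t - i)) \<in> G (s + t)"
      using fg by (simp add: graded_def flip: A_mult_apply[OF f g])
    ultimately have "f s \<otimes> g t \<in> G (s + t)"
      using ideal_mem_of_add[OF G] car by simp
    then show False using prime[OF fK s(1) gK t(1)] by contradiction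
  qed
qed

end

section \<open>The annihilator of the Sally module\<close>

lemma annihilator_quotient_module:
  assumes S: "ring S" and add: "subgroup N' (add_monoid S)" and N'N: "N' \<subseteq> N" and N: "N \<subseteq> carrier S"
    and AS: "carrier A \<subseteq> carrier S"
    and stable: "\<And>a x. a \<in> carrier A \<Longrightarrow> x \<in> N' \<Longrightarrow> a \<otimes>\<^bsub>S\<^esub> x \<in> N'"
  shows "annihilator A (quotient_module (ring_module S N) N') = {a \<in> carrier A. \<forall>x\<in>N. a \<otimes>\<^bsub>S\<^esub> x \<in> N'}"
proof -
  interpret S: ring S by (rule S)
  interpret N': additive_subgroup N' S using add by (rule additive_subgroupI)
  let ?M = "ring_module S N"
  have coset: "N' +>\<^bsub>?M\<^esub> x = N' +>\<^bsub>S\<^esub> x" for x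
    by (simp add: ring_module_def a_r_coset_defs)
  have car: "carrier (quotient_module ?M N') = {N' +>\<^bsub>S\<^esub> x | x. x \<in> N}"
    by (auto simp: quotient_module_def A_RCOSETS_def' ring_module_def a_r_coset_def')
  have sm: "a \<odot>\<^bsub>quotient_module ?M N'\<^esub> X = (\<Union>x\<in>X. N' +>\<^bsub>S\<^esub> (a \<otimes>\<^bsub>S\<^esub> x))" for a X
    by (simp add: quotient_module_def coset) (simp add: ring_module_def)
  have zero: "\<zero>\<^bsub>quotient_module ?M N'\<^esub> = N'" by (simp add: quotient_module_def)
  have self: "x \<in> N' +>\<^bsub>S\<^esub> x" if "x \<in> carrier S" for x
  proof -
    have "\<zero>\<^bsub>S\<^esub> \<oplus>\<^bsub>S\<^esub> x \<in> N' +>\<^bsub>S\<^esub> x" unfolding a_r_coset_def' using N'.zero_closed by blast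
    then show ?thesis using that by simp
  qed
  have abs: "N' +>\<^bsub>S\<^esub> x = N'" if "x \<in> N'" for x
    using S.a_coset_join2[OF N'.a_Hcarr[OF that] N'.a_subgroup that] .
  have key: "a \<odot>\<^bsub>quotient_module ?M N'\<^esub> (N' +>\<^bsub>S\<^esub> x) = N' \<longleftrightarrow> a \<otimes>\<^bsub>S\<^esub> x \<in> N'"
    if a: "a \<in> carrier A" and x: "x \<in> N" for a x
  proof
    have ac: "a \<in> carrier S" and xc: "x \<in> carrier S" using a x AS N by auto
    {
      assume eq: "a \<odot>\<^bsub>quotient_module ?M N'\<^esub> (N' +>\<^bsub>S\<^esub> x) = N'"
      have "a \<otimes>\<^bsub>S\<^esub> x \<in> N' +>\<^bsub>S\<^esub> (a \<otimes>\<^bsub>S\<^esub> x)" using self ac xc by simp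
      then have "a \<otimes>\<^bsub>S\<^esub> x \<in> (\<Union>y\<in>N' +>\<^bsub>S\<^esub> x. N' +>\<^bsub>S\<^esub> (a \<otimes>\<^bsub>S\<^esub> y))" by (intro UN_I[OF self[OF xc]])
      then show "a \<otimes>\<^bsub>S\<^esub> x \<in> N'" unfolding sm[symmetric] eq .
    next
      assume ax: "a \<otimes>\<^bsub>S\<^esub> x \<in> N'"
      have "N' +>\<^bsub>S\<^esub> (a \<otimes>\<^bsub>S\<^esub> y) = N'" if "y \<in> N' +>\<^bsub>S\<^esub> x" for y
      proof (rule abs)
        have "y \<in> (\<Union>i\<in>N'. {i \<oplus>\<^bsub>S\<^esub> x})" using that unfolding a_r_coset_def' .
        then obtain i where i: "i \<in> N'" "y = i \<oplus>\<^bsub>S\<^esub> x" by (elim UN_E singletonE)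
        have "a \<otimes>\<^bsub>S\<^esub> y = a \<otimes>\<^bsub>S\<^esub> i \<oplus>\<^bsub>S\<^esub> a \<otimes>\<^bsub>S\<^esub> x"
          unfolding i(2) using ac xc N'.a_Hcarr[OF i(1)] by (simp add: S.r_distr)
        then show "a \<otimes>\<^bsub>S\<^esub> y \<in> N'" using N'.a_closed[OF stable[OF a i(1)] ax] by simp
      qed
      then have "(\<Union>y\<in>N' +>\<^bsub>S\<^esub> x. N' +>\<^bsub>S\<^esub> (a \<otimes>\<^bsub>S\<^esub> y)) = (\<Union>y\<in>N' +>\<^bsub>S\<^esub> x. N')" by (rule SUP_cong[OF refl])
      also have "\<dots> = N'" by (rule UN_constant[THEN trans]) (use self[OF xc] in auto)
      finally show "a \<odot>\<^bsub>quotient_module ?M N'\<^esub> (N' +>\<^bsub>S\<^esub> x) = N'" unfolding sm .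
    }
  qed
  show ?thesis unfolding annihilator_def car zero
  proof (intro Collect_cong conj_cong refl)
    fix a assume a: "a \<in> carrier A"
    show "(\<forall>X\<in>{N' +>\<^bsub>S\<^esub> x |x. x \<in> N}. a \<odot>\<^bsub>quotient_module ?M N'\<^esub> X = N') \<longleftrightarrow> (\<forall>x\<in>N. a \<otimes>\<^bsub>S\<^esub> x \<in> N')"
      (is "?P \<longleftrightarrow> ?Q")
    proof -
      have "?Q \<longleftrightarrow> (\<forall>x\<in>N. a \<odot>\<^bsub>quotient_module ?M N'\<^esub> (N' +>\<^bsub>S\<^esub> x) = N')"
        by (rule ball_cong[OF refl]) (rule key[OF a, symmetric])
      then show ?thesis by blast
    qed
  qed
qed

context rees begin

text \<open>Both modules are direct sums of homogeneous parts, so the annihilator can be tested on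
  elements \<open>c t^n\<close> and is homogeneous itself.\<close>

lemma annihilator_sally:
  assumes I: "ideal I R" and KI: "K \<subseteq> I"
  shows "annihilator A (sally_module R K I) = graded (\<lambda>s. {a \<in> ideal_power R K s.
    \<forall>n. \<forall>c\<in>I \<cdot> ideal_power R I n. a \<otimes> c \<in> I \<cdot> ideal_power R K (s + n)})"
proof -
  interpret P: cring "UP R" by (rule cring_UP)
  let ?N' = "ideal_times_rees R I K" and ?N = "ideal_times_rees R I I"
  have N': "?N' = {f \<in> up R. \<forall>n. f n \<in> I \<cdot> ideal_power R K n}" and N: "?N = {f \<in> up R. \<forall>n. f n \<in> I \<cdot> ideal_power R I n}"
    using ideal_times_rees_eq[OF I] K_ideal I by auto
  have IK: "ideal (I \<cdot> ideal_power R K n) R" and II: "ideal (I \<cdot> ideal_power R I n) R" for n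
    using I K_ideal by (auto intro: ideal_prod_is_ideal)
  have le: "I \<cdot> ideal_power R K n \<subseteq> I \<cdot> ideal_power R I n" for n
    by (intro ideal_prod_mono ideal_power_base_mono KI order_refl)
  have IKK: "c \<otimes> a \<in> I \<cdot> ideal_power R K (m + n)" if "c \<in> I \<cdot> ideal_power R K m" "a \<in> ideal_power R K n" for a c m n
  proof -
    have "c \<otimes> a \<in> (I \<cdot> ideal_power R K m) \<cdot> ideal_power R K n" using that by (rule ideal_prod.prod)
    then show ?thesis using I K_ideal by (simp add: ideal_power_add ideal_prod_assoc)
  qed
  have stable: "a \<otimes>\<^bsub>UP R\<^esub> f \<in> ?N'" if a: "a \<in> carrier A" and f: "f \<in> ?N'" for a f
  proof -
    have fu: "f \<in> up R" "\<And>n. f n \<in> I \<cdot> ideal_power R K n" using f N' by auto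
    have au: "a \<in> up R" "\<And>n. a n \<in> ideal_power R K n" using a by (auto simp: rees_carrier)
    have "(\<Oplus>i\<in>{..n}. a i \<otimes> f (n - i)) \<in> I \<cdot> ideal_power R K n" for n
    proof (rule ideal_finsum_mem[OF IK])
      fix i assume i: "i \<in> {..n}"
      have "f (n - i) \<otimes> a i \<in> I \<cdot> ideal_power R K n" using IKK[OF fu(2) au(2), of "n - i" i] i by simp
      then show "a i \<otimes> f (n - i) \<in> I \<cdot> ideal_power R K n" using fu(1) au(1) by (simp add: m_comm mem_upD)
    qed
    then show ?thesis unfolding N' using fu(1) au(1) P.m_closed[of a f] by (simp add: mult_UP carrier_UP)
  qed
  have sub: "subgroup ?N' (add_monoid (UP R))"
  proof (rule P.add.subgroupI)
    show "?N' \<subseteq> carrier (UP R)" using N' by (auto simp: carrier_UP)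
    have "\<zero>\<^bsub>UP R\<^esub> \<in> ?N'" unfolding N' using P.zero_closed ideal_zero_mem[OF IK] by (simp add: zero_UP carrier_UP)
    then show "?N' \<noteq> {}" by blast
    fix f g assume f: "f \<in> ?N'" and g: "g \<in> ?N'"
    then have fc: "f \<in> carrier (UP R)" "g \<in> carrier (UP R)" using N' by (auto simp: carrier_UP)
    show "f \<oplus>\<^bsub>UP R\<^esub> g \<in> ?N'"
      using f g P.a_closed[OF fc] ideal_add_mem[OF IK] unfolding N' by (auto simp: add_UP carrier_UP)
    have "\<ominus>\<^bsub>UP R\<^esub> \<one>\<^bsub>UP R\<^esub> = (\<lambda>i. \<ominus> (\<one>\<^bsub>UP R\<^esub> i))"
    proof (rule P.minus_equality)
      have c: "\<one>\<^bsub>UP R\<^esub> i \<in> carrier R" for i by (simp add: one_UP single_def)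
      have u: "\<one>\<^bsub>UP R\<^esub> \<in> up R" using P.one_closed by (simp add: carrier_UP)
      show "(\<lambda>i. \<ominus> (\<one>\<^bsub>UP R\<^esub> i)) \<in> carrier (UP R)" using up_a_inv_closed[OF u] by (simp add: carrier_UP)
      show "(\<lambda>i. \<ominus> (\<one>\<^bsub>UP R\<^esub> i)) \<oplus>\<^bsub>UP R\<^esub> \<one>\<^bsub>UP R\<^esub> = \<zero>\<^bsub>UP R\<^esub>"
        using c by (simp add: add_UP up_a_inv_closed[OF u] u zero_UP l_neg)
    qed simp
    then have "\<ominus>\<^bsub>UP R\<^esub> \<one>\<^bsub>UP R\<^esub> = single (\<ominus> \<one>) 0" by (auto simp: one_UP single_def fun_eq_iff)
    then have "\<ominus>\<^bsub>UP R\<^esub> \<one>\<^bsub>UP R\<^esub> \<in> carrier A" using single_in_A[of "\<ominus> \<one>" 0] by (simp add: ideal_power_0)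
    then have "(\<ominus>\<^bsub>UP R\<^esub> \<one>\<^bsub>UP R\<^esub>) \<otimes>\<^bsub>UP R\<^esub> f \<in> ?N'" using stable f by blast
    then show "\<ominus>\<^bsub>UP R\<^esub> f \<in> ?N'" using fc(1) P.l_minus[of "\<one>\<^bsub>UP R\<^esub>" f] by simp
  qed
  have "annihilator A (sally_module R K I) = {a \<in> carrier A. \<forall>x\<in>?N. a \<otimes>\<^bsub>UP R\<^esub> x \<in> ?N'}"
    unfolding sally_module_def
  proof (rule annihilator_quotient_module[OF P.ring_axioms sub])
    show "?N' \<subseteq> ?N" "?N \<subseteq> carrier (UP R)" "carrier A \<subseteq> carrier (UP R)"
      using subsetD[OF le] A_up unfolding N N' by (auto simp: carrier_UP)
  qed (rule stable)
  also have "\<dots> = graded (\<lambda>s. {a \<in> ideal_power R K s. \<forall>n. \<forall>c\<in>I \<cdot> ideal_power R I n. a \<otimes> c \<in> I \<cdot> ideal_power R K (s + n)})"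
    (is "?L = ?G")
  proof
    show "?L \<subseteq> ?G"
    proof
      fix g assume "g \<in> ?L"
      then have g: "g \<in> carrier A" "\<And>f. f \<in> ?N \<Longrightarrow> g \<otimes>\<^bsub>UP R\<^esub> f \<in> ?N'" by auto
      have gc: "g s \<in> carrier R" for s using A_up[OF g(1)] by auto
      have "g s \<otimes> c \<in> I \<cdot> ideal_power R K (s + n)" if c: "c \<in> I \<cdot> ideal_power R I n" for s n c
      proof -
        have cc: "c \<in> carrier R" using ideal.Icarr[OF II c] .
        have "single c n i \<in> I \<cdot> ideal_power R I i" for i
          using c ideal_zero_mem[OF II] by (cases "i = n") auto
        then have N1: "single c n \<in> ?N" unfolding N using single_up[OF cc] by simp
        then have "(g \<otimes>\<^bsub>UP R\<^esub> single c n) (s + n) \<in> I \<cdot> ideal_power R K (s + n)" using g(2)[OF N1] unfolding N' by simp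
        moreover have "g \<otimes>\<^bsub>UP R\<^esub> single c n = single c n \<otimes>\<^bsub>UP R\<^esub> g"
          using A_up[OF g(1)] single_up[OF cc] by (intro P.m_comm) (simp_all add: carrier_UP)
        ultimately show ?thesis
          using single_mult_apply[OF cc A_up[OF g(1)], of n "s + n"] gc cc by (simp add: m_comm)
      qed
      then show "g \<in> ?G" using g(1) by (auto simp: graded_def rees_carrier)
    qed
    show "?G \<subseteq> ?L"
    proof
      fix g assume "g \<in> ?G"
      then have g: "g \<in> carrier A" "\<And>s n c. c \<in> I \<cdot> ideal_power R I n \<Longrightarrow> g s \<otimes> c \<in> I \<cdot> ideal_power R K (s + n)"
        by (auto simp: graded_def)
      have "g \<otimes>\<^bsub>UP R\<^esub> f \<in> ?N'" if f: "f \<in> ?N" for f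
      proof -
        have fu: "f \<in> up R" "\<And>n. f n \<in> I \<cdot> ideal_power R I n" using f N by auto
        have "(\<Oplus>i\<in>{..n}. g i \<otimes> f (n - i)) \<in> I \<cdot> ideal_power R K n" for n
        proof (rule ideal_finsum_mem[OF IK])
          fix i assume i: "i \<in> {..n}"
          show "g i \<otimes> f (n - i) \<in> I \<cdot> ideal_power R K n" using g(2)[OF fu(2), of i "n - i"] i by simp
        qed
        then show ?thesis unfolding N'
          using fu(1) A_up[OF g(1)] P.m_closed[of g f] by (simp add: mult_UP carrier_UP)
      qed
      then show "g \<in> ?L" using g(1) by blast
    qed
  qed
  finally show ?thesis .
qed

end

section \<open>Chains of primes and growth\<close>

text \<open>The growth of the filtration \<open>L\<close> modulo the first prime of a chain of length \<open>n\<close> is at least that of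
  a polynomial of degree \<open>n\<close>: if \<open>h \<in> Q' - Q\<close>, multiplication by \<open>h\<close> embeds \<open>R/Q\<close> into \<open>Q'/Q\<close>.\<close>

context cring begin

text \<open>Submodules of \<open>R\<close> over a set \<open>S\<close> of scalars. \<open>S\<close>
  will be the degree 0 part of the Rees algebra, and the height of \<open>between S Q U\<close> is
  the length of \<open>U / Q\<close> over it.\<close>

definition smod :: "'a set \<Rightarrow> 'a set \<Rightarrow> bool"
  where "smod S V \<longleftrightarrow> V \<subseteq> carrier R \<and> \<zero> \<in> V \<and> (\<forall>u\<in>V. \<forall>v\<in>V. u \<ominus> v \<in> V) \<and> (\<forall>s\<in>S. \<forall>v\<in>V. s \<otimes> v \<in> V)"

definition between :: "'a set \<Rightarrow> 'a set \<Rightarrow> 'a set \<Rightarrow> 'a set set"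
  where "between S Q U = {V. smod S V \<and> Q \<subseteq> V \<and> V \<subseteq> U}"

lemma smod_carrier: "smod S V \<Longrightarrow> v \<in> V \<Longrightarrow> v \<in> carrier R"
  by (auto simp: smod_def)

lemma smod_zero: "smod S V \<Longrightarrow> \<zero> \<in> V"
  by (auto simp: smod_def)

lemma smod_diff: "smod S V \<Longrightarrow> u \<in> V \<Longrightarrow> v \<in> V \<Longrightarrow> u \<ominus> v \<in> V"
  by (auto simp: smod_def)

lemma smod_mult: "smod S V \<Longrightarrow> s \<in> S \<Longrightarrow> v \<in> V \<Longrightarrow> s \<otimes> v \<in> V"
  by (auto simp: smod_def)

lemma smod_add:
  assumes "smod S V" "u \<in> V" "v \<in> V"
  shows "u \<oplus> v \<in> V"
proof -
  have c: "u \<in> carrier R" "v \<in> carrier R" using assms smod_carrier by auto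
  have "u \<ominus> (\<zero> \<ominus> v) \<in> V" using assms smod_diff smod_zero by metis
  moreover have "u \<ominus> (\<zero> \<ominus> v) = u \<oplus> v" using c by algebra
  ultimately show ?thesis by simp
qed

lemma smod_ideal: "ideal I R \<Longrightarrow> S \<subseteq> carrier R \<Longrightarrow> smod S I"
  unfolding smod_def using ideal_subset_carrier[of I R] ideal_zero_mem[of I R] ideal_diff_mem[of I] ideal.I_l_closed[of I R]
  by blast

lemma smod_Int: "smod S U \<Longrightarrow> smod S V \<Longrightarrow> smod S (U \<inter> V)"
  by (auto simp: smod_def)

lemma smod_sum:
  assumes U: "smod S U" and V: "smod S V" and S: "S \<subseteq> carrier R"
  shows "smod S (U <+> V)"
  unfolding smod_def
proof (intro conjI ballI subsetI)
  show "\<zero> \<in> U <+> V" unfolding mem_ideal_sum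
    using smod_zero[OF U] smod_zero[OF V] by (metis r_zero zero_closed)
  show "a \<in> carrier R" if "a \<in> U <+> V" for a
    using that smod_carrier[OF U] smod_carrier[OF V] unfolding mem_ideal_sum by blast
  fix a assume "a \<in> U <+> V"
  then obtain u v where a: "u \<in> U" "v \<in> V" "a = u \<oplus> v" unfolding mem_ideal_sum by blast
  note ac = smod_carrier[OF U a(1)] smod_carrier[OF V a(2)]
  show "a \<ominus> b \<in> U <+> V" if "b \<in> U <+> V" for b
  proof -
    obtain u' v' where b: "u' \<in> U" "v' \<in> V" "b = u' \<oplus> v'" using \<open>b \<in> U <+> V\<close> unfolding mem_ideal_sum by blast
    have "a \<ominus> b = (u \<ominus> u') \<oplus> (v \<ominus> v')"
      unfolding a(3) b(3) using ac smod_carrier[OF U b(1)] smod_carrier[OF V b(2)] by algebra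
    then show ?thesis unfolding mem_ideal_sum using smod_diff[OF U a(1) b(1)] smod_diff[OF V a(2) b(2)] by blast
  qed
  show "s \<otimes> a \<in> U <+> V" if s: "s \<in> S" for s
  proof -
    have "s \<otimes> a = s \<otimes> u \<oplus> s \<otimes> v" unfolding a(3) using ac s S by (intro r_distr) auto
    then show ?thesis unfolding mem_ideal_sum using smod_mult[OF U s a(1)] smod_mult[OF V s a(2)] by blast
  qed
qed

lemma smod_sum_ge:
  assumes U: "smod S U" and V: "smod S V"
  shows "U \<subseteq> U <+> V" "V \<subseteq> U <+> V"
proof -
  show "U \<subseteq> U <+> V"
  proof
    fix u assume u: "u \<in> U"
    then have "u = u \<oplus> \<zero>" using smod_carrier[OF U] by simp
    then show "u \<in> U <+> V" unfolding mem_ideal_sum using u smod_zero[OF V] by blast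
  qed
  show "V \<subseteq> U <+> V"
  proof
    fix v assume v: "v \<in> V"
    then have "v = \<zero> \<oplus> v" using smod_carrier[OF V] by simp
    then show "v \<in> U <+> V" unfolding mem_ideal_sum using v smod_zero[OF U] by blast
  qed
qed

lemma smod_sum_le: "smod S W \<Longrightarrow> U \<subseteq> W \<Longrightarrow> V \<subseteq> W \<Longrightarrow> U <+> V \<subseteq> W"
  unfolding mem_ideal_sum subset_iff by (blast intro: smod_add)

lemma smod_modular:
  assumes V: "smod S V" "smod S V'" "V \<subseteq> V'" and U: "smod S U"
    and "V \<inter> U = V' \<inter> U" "V <+> U = V' <+> U"
  shows "V = V'"
proof
  show "V' \<subseteq> V"
  proof
    fix v' assume v': "v' \<in> V'"
    then have "v' \<in> V <+> U" using smod_sum_ge(1)[OF V(2) U] assms(6) by blast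
    then obtain v u where vu: "v \<in> V" "u \<in> U" "v' = v \<oplus> u" unfolding mem_ideal_sum by blast
    have "u = v' \<ominus> v" unfolding vu(3) using smod_carrier[OF V(1) vu(1)] smod_carrier[OF U vu(2)] by algebra
    then have "u \<in> V'" using smod_diff[OF V(2) v'] vu(1) V(3) by auto
    then have "u \<in> V" using vu(2) assms(5) by blast
    then show "v' \<in> V" unfolding vu(3) using smod_add[OF V(1) vu(1)] by blast
  qed
qed (rule V(3))

text \<open>Modulo \<open>Q\<close> every scalar is 0 or invertible, so \<open>W / U\<close> is a
  vector space with one generator and nothing lies strictly between \<open>U\<close> and
  \<open>W\<close>. The modular law then bounds the increase of the height by 1.\<close>

lemma height_between_extend:
  assumes S: "S \<subseteq> carrier R" "smod S S" and Q: "ideal Q R" and U: "smod S U" "Q \<subseteq> U"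
    and unit: "\<forall>s\<in>S. s \<in> Q \<or> (\<exists>s'\<in>S. s' \<otimes> s = \<one>)" and e: "e \<in> carrier R"
  defines "W \<equiv> U <+> (\<lambda>s. s \<otimes> e) ` S"
  shows "smod S W" "U \<subseteq> W" "\<one> \<in> S \<Longrightarrow> e \<in> W" "height (between S Q W) \<le> height (between S Q U) + 1"
proof -
  have Se: "smod S ((\<lambda>s. s \<otimes> e) ` S)" unfolding smod_def
  proof (intro conjI ballI)
    show "(\<lambda>s. s \<otimes> e) ` S \<subseteq> carrier R" using S(1) e by auto
    show "\<zero> \<in> (\<lambda>s. s \<otimes> e) ` S" using smod_zero[OF S(2)] e by (metis image_eqI l_null)
    fix u assume "u \<in> (\<lambda>s. s \<otimes> e) ` S"
    then obtain s where s: "s \<in> S" "u = s \<otimes> e" by auto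
    show "u \<ominus> v \<in> (\<lambda>s. s \<otimes> e) ` S" if v: "v \<in> (\<lambda>s. s \<otimes> e) ` S" for v
    proof -
      obtain r where r: "r \<in> S" "v = r \<otimes> e" using v by auto
      have "r \<in> carrier R" "s \<in> carrier R" using r s S by auto
      then have "u \<ominus> v = (s \<ominus> r) \<otimes> e" unfolding s(2) r(2) using e by algebra
      then show ?thesis using smod_diff[OF S(2) s(1) r(1)] by blast
    qed
    show "r \<otimes> u \<in> (\<lambda>s. s \<otimes> e) ` S" if r: "r \<in> S" for r
    proof -
      have "r \<otimes> u = (r \<otimes> s) \<otimes> e" unfolding s(2) using r s S(1) e by (subst m_assoc) auto
      then show ?thesis using smod_mult[OF S(2) r s(1)] by blast
    qed
  qed
  show W: "smod S W" unfolding W_def using U(1) Se S(1) by (rule smod_sum)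
  show UW: "U \<subseteq> W" unfolding W_def using smod_sum_ge[OF U(1) Se] by blast
  have SW: "(\<lambda>s. s \<otimes> e) ` S \<subseteq> W" unfolding W_def using smod_sum_ge[OF U(1) Se] by blast
  show "e \<in> W" if "\<one> \<in> S" using that SW e by force
  have dich: "V = U \<or> V = W" if V: "smod S V" "U \<subseteq> V" "V \<subseteq> W" for V
  proof (rule disjCI)
    assume "V \<noteq> W"
    have "V \<subseteq> U"
    proof
      fix v assume v: "v \<in> V"
      then obtain u s where us: "u \<in> U" "s \<in> S" "v = u \<oplus> s \<otimes> e" using subsetD[OF V(3) v] unfolding W_def mem_ideal_sum by blast
      have c: "u \<in> carrier R" "s \<in> carrier R" using smod_carrier[OF U(1) us(1)] us(2) S by auto
      have "s \<otimes> e = v \<ominus> u" unfolding us(3) using c e by algebra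
      then have se: "s \<otimes> e \<in> V" using smod_diff[OF V(1) v] us(1) V(2) by auto
      have "\<not> (\<exists>s'\<in>S. s' \<otimes> s = \<one>)"
      proof
        assume "\<exists>s'\<in>S. s' \<otimes> s = \<one>"
        then obtain s' where s': "s' \<in> S" "s' \<otimes> s = \<one>" by blast
        have s'c: "s' \<in> carrier R" using s' S by auto
        have "e = s' \<otimes> (s \<otimes> e)" using s'(2) s'c c(2) e by (metis l_one m_assoc)
        then have eV: "e \<in> V" using smod_mult[OF V(1) s'(1) se] by simp
        then have "(\<lambda>s. s \<otimes> e) ` S \<subseteq> V" using smod_mult[OF V(1)] by blast
        then have "W \<subseteq> V" unfolding W_def using smod_sum_le[OF V(1,2)] by blast
        then show False using V(3) \<open>V \<noteq> W\<close> by blast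
      qed
      then have "s \<in> Q" using unit us(2) by blast
      then have "s \<otimes> e \<in> U" using ideal.I_r_closed[OF Q _ e] U(2) by blast
      then show "v \<in> U" unfolding us(3) using smod_add[OF U(1) us(1)] by blast
    qed
    then show "V = U" using V(2) by blast
  qed
  have "height (between S Q W) \<le> height (between S Q U) + height {U, W}"
  proof (rule height_split[where f = "\<lambda>V. V \<inter> U" and g = "\<lambda>V. V <+> U"])
    fix V assume "V \<in> between S Q W"
    then have V: "smod S V" "Q \<subseteq> V" "V \<subseteq> W" by (auto simp: between_def)
    show "V \<inter> U \<in> between S Q U" using V U smod_Int by (auto simp: between_def)
    have "V <+> U \<subseteq> W" using V(3) UW by (rule smod_sum_le[OF W])
    then show "V <+> U \<in> {U, W}" using dich[OF smod_sum[OF V(1) U(1) S(1)]] smod_sum_ge[OF V(1) U(1)] by blast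
  next
    fix V V' assume "V \<in> between S Q W" "V' \<in> between S Q W" "V \<subset> V'"
    then show "V \<inter> U = V' \<inter> U \<Longrightarrow> V <+> U = V' <+> U \<Longrightarrow> False"
      using smod_modular[of S V V' U] U(1) by (auto simp: between_def)
  qed (auto intro: ideal_sum_mono[THEN subsetD])
  also have "\<dots> \<le> height (between S Q U) + 1" by (intro add_left_mono height_le_one) auto
  finally show "height (between S Q W) \<le> height (between S Q U) + 1" .
qed

lemma height_between_generated:
  assumes S: "S \<subseteq> carrier R" "smod S S" "\<one> \<in> S" and Q: "ideal Q R"
    and unit: "\<forall>s\<in>S. s \<in> Q \<or> (\<exists>s'\<in>S. s' \<otimes> s = \<one>)" and E: "finite E" "E \<subseteq> carrier R"
  obtains U where "smod S U" "Q \<subseteq> U" "E \<subseteq> U" "height (between S Q U) \<le> enat (card E)"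
proof -
  have "\<exists>U. smod S U \<and> Q \<subseteq> U \<and> E \<subseteq> U \<and> height (between S Q U) \<le> enat (card E)"
    using E
  proof (induction E rule: finite_induct)
    case empty
    have "height (between S Q Q) = 0" by (rule height_singleton[of _ Q]) (auto simp: between_def)
    then show ?case using smod_ideal[OF Q S(1)] by auto
  next
    case (insert e E)
    then obtain U where U: "smod S U" "Q \<subseteq> U" "E \<subseteq> U" "height (between S Q U) \<le> enat (card E)" by auto
    have e: "e \<in> carrier R" using insert.prems by simp
    note W = height_between_extend[OF S(1,2) Q U(1,2) unit e]
    have "height (between S Q (U <+> (\<lambda>s. s \<otimes> e) ` S)) \<le> enat (card E) + 1"
      using W(4) U(4) by (meson add_right_mono order_trans)
    then have "height (between S Q (U <+> (\<lambda>s. s \<otimes> e) ` S)) \<le> enat (card (insert e E))"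
      using insert.hyps by (simp add: one_enat_def)
    then show ?case using W(1,2) W(3)[OF S(3)] U(2,3) by blast
  qed
  then show ?thesis using that by blast
qed

text \<open>The chains to be joined run below and above \<open>Q' \<inter> (Q + L')\<close>: the
  lower ones are images of multiplication by \<open>h\<close>, strict because \<open>Q\<close> is
  prime, and the upper ones are intersections with \<open>Q + L'\<close>, strict because
  \<open>L \<subseteq> L'\<close>.\<close>

lemma height_between_step:
  assumes S: "S \<subseteq> carrier R" and Q: "primeideal Q R" and Q': "ideal Q' R" "Q \<subseteq> Q'" and h: "h \<in> Q'" "h \<notin> Q"
    and L: "smod S L" "smod S L'" "L \<subseteq> L'" and hL: "\<And>v. v \<in> L \<Longrightarrow> h \<otimes> v \<in> L'"
  shows "height (between S Q (Q <+> L)) + height (between S Q' (Q' <+> L)) \<le> height (between S Q (Q <+> L'))"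
proof -
  have Qi: "ideal Q R" using primeideal.axioms(1)[OF Q] .
  have Qs: "smod S Q" "smod S Q'" using smod_ideal[OF Qi S] smod_ideal[OF Q'(1) S] by auto
  have hc: "h \<in> carrier R" using ideal.Icarr[OF Q'(1) h(1)] .
  have QL': "smod S (Q <+> L')" and QL: "smod S (Q <+> L)" using smod_sum[OF Qs(1) _ S] L by auto
  note geL' = smod_sum_ge[OF Qs(1) L(2)]
  let ?F = "between S Q (Q <+> L')"
  let ?G = "{W \<in> ?F. W \<subseteq> Q'}" and ?H = "{W \<in> ?F. Q' \<inter> (Q <+> L') \<subseteq> W}"
  have "height (between S Q (Q <+> L)) \<le> height ?G"
  proof (rule height_map[where f = "\<lambda>V. Q <+> (\<lambda>v. h \<otimes> v) ` V"])
    fix V assume "V \<in> between S Q (Q <+> L)"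
    then have V: "smod S V" "Q \<subseteq> V" "V \<subseteq> Q <+> L" by (auto simp: between_def)
    have hV: "smod S ((\<lambda>v. h \<otimes> v) ` V)" unfolding smod_def
    proof (intro conjI ballI)
      show "(\<lambda>v. h \<otimes> v) ` V \<subseteq> carrier R" using hc smod_carrier[OF V(1)] by auto
      show "\<zero> \<in> (\<lambda>v. h \<otimes> v) ` V" using smod_zero[OF V(1)] hc by (metis image_eqI r_null)
      fix u assume "u \<in> (\<lambda>v. h \<otimes> v) ` V"
      then obtain v where v: "v \<in> V" "u = h \<otimes> v" by auto
      show "u \<ominus> w \<in> (\<lambda>v. h \<otimes> v) ` V" if w: "w \<in> (\<lambda>v. h \<otimes> v) ` V" for w
      proof -
        obtain v' where v': "v' \<in> V" "w = h \<otimes> v'" using w by auto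
        have "u \<ominus> w = h \<otimes> (v \<ominus> v')" unfolding v(2) v'(2)
          using hc smod_carrier[OF V(1) v(1)] smod_carrier[OF V(1) v'(1)] by algebra
        then show ?thesis using smod_diff[OF V(1) v(1) v'(1)] by blast
      qed
      show "s \<otimes> u \<in> (\<lambda>v. h \<otimes> v) ` V" if s: "s \<in> S" for s
      proof -
        have "s \<in> carrier R" using s S by auto
        then have "s \<otimes> u = h \<otimes> (s \<otimes> v)" unfolding v(2) using hc smod_carrier[OF V(1) v(1)] by (simp add: m_lcomm)
        then show ?thesis using smod_mult[OF V(1) s v(1)] by blast
      qed
    qed
    have le: "h \<otimes> v \<in> Q <+> L'" if v: "v \<in> V" for v
    proof -
      obtain q l where ql: "q \<in> Q" "l \<in> L" "v = q \<oplus> l" using subsetD[OF V(3) v] unfolding mem_ideal_sum by blast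
      have "h \<otimes> v = h \<otimes> q \<oplus> h \<otimes> l" unfolding ql(3)
        using hc smod_carrier[OF Qs(1) ql(1)] smod_carrier[OF L(1) ql(2)] by (simp add: r_distr)
      then show ?thesis unfolding mem_ideal_sum using ideal.I_l_closed[OF Qi ql(1) hc] hL[OF ql(2)] by blast
    qed
    have "Q <+> (\<lambda>v. h \<otimes> v) ` V \<subseteq> Q <+> L'" using geL' le by (intro smod_sum_le[OF QL']) auto
    moreover have "Q <+> (\<lambda>v. h \<otimes> v) ` V \<subseteq> Q'"
      using Q' h(1) smod_carrier[OF V(1)] ideal.I_r_closed[OF Q'(1) h(1)] by (intro smod_sum_le[OF Qs(2)]) auto
    ultimately show "Q <+> (\<lambda>v. h \<otimes> v) ` V \<in> ?G"
      using smod_sum[OF Qs(1) hV S] smod_sum_ge[OF Qs(1) hV] by (simp add: between_def)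
  next
    fix V V' assume "V \<in> between S Q (Q <+> L)" "V' \<in> between S Q (Q <+> L)" "V \<subset> V'"
    then have V: "smod S V" "Q \<subseteq> V" "smod S V'" "V \<subset> V'" by (auto simp: between_def)
    have "Q <+> (\<lambda>v. h \<otimes> v) ` V \<noteq> Q <+> (\<lambda>v. h \<otimes> v) ` V'"
    proof
      assume eq: "Q <+> (\<lambda>v. h \<otimes> v) ` V = Q <+> (\<lambda>v. h \<otimes> v) ` V'"
      obtain v' where v': "v' \<in> V'" "v' \<notin> V" using V(4) by auto
      have vc: "v' \<in> carrier R" using smod_carrier[OF V(3) v'(1)] .
      have "h \<otimes> v' = \<zero> \<oplus> h \<otimes> v'" using hc vc by simp
      then have "h \<otimes> v' \<in> Q <+> (\<lambda>v. h \<otimes> v) ` V" unfolding eq mem_ideal_sum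
        using v'(1) smod_zero[OF Qs(1)] by blast
      then obtain q v where qv: "q \<in> Q" "v \<in> V" "h \<otimes> v' = q \<oplus> h \<otimes> v" unfolding mem_ideal_sum by blast
      have c: "q \<in> carrier R" "v \<in> carrier R" using smod_carrier[OF Qs(1) qv(1)] smod_carrier[OF V(1) qv(2)] by auto
      have "h \<otimes> (v' \<ominus> v) = h \<otimes> v' \<ominus> h \<otimes> v" using hc vc c by algebra
      also have "\<dots> = q" unfolding qv(3) using hc vc c by algebra
      finally have "h \<otimes> (v' \<ominus> v) \<in> Q" using qv(1) by simp
      then have "v' \<ominus> v \<in> Q" using primeideal.I_prime[OF Q hc, of "v' \<ominus> v"] h(2) vc c by auto
      then have "(v' \<ominus> v) \<oplus> v \<in> V" using smod_add[OF V(1)] V(2) qv(2) by blast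
      moreover have "(v' \<ominus> v) \<oplus> v = v'" using vc c by algebra
      ultimately show False using v'(2) by simp
    qed
    moreover have "Q <+> (\<lambda>v. h \<otimes> v) ` V \<subseteq> Q <+> (\<lambda>v. h \<otimes> v) ` V'"
      using V(4) by (intro ideal_sum_mono) auto
    ultimately show "Q <+> (\<lambda>v. h \<otimes> v) ` V \<subset> Q <+> (\<lambda>v. h \<otimes> v) ` V'" by blast
  qed
  moreover have "height (between S Q' (Q' <+> L)) \<le> height ?H"
  proof (rule height_map[where f = "\<lambda>V. V \<inter> (Q <+> L')"])
    fix V assume "V \<in> between S Q' (Q' <+> L)"
    then have V: "smod S V" "Q' \<subseteq> V" "V \<subseteq> Q' <+> L" by (auto simp: between_def)
    have "Q \<subseteq> V \<inter> (Q <+> L')" using V(2) Q'(2) geL' by blast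
    then show "V \<inter> (Q <+> L') \<in> ?H" using V smod_Int[OF V(1) QL'] by (auto simp: between_def)
  next
    fix V V' assume "V \<in> between S Q' (Q' <+> L)" "V' \<in> between S Q' (Q' <+> L)" "V \<subset> V'"
    then have V: "smod S V" "Q' \<subseteq> V" "smod S V'" "V' \<subseteq> Q' <+> L" "V \<subset> V'" by (auto simp: between_def)
    have "V \<inter> (Q <+> L') \<noteq> V' \<inter> (Q <+> L')"
    proof
      assume eq: "V \<inter> (Q <+> L') = V' \<inter> (Q <+> L')"
      have "V' \<subseteq> V"
      proof
        fix v assume v: "v \<in> V'"
        then obtain q l where ql: "q \<in> Q'" "l \<in> L" "v = q \<oplus> l" using subsetD[OF V(4) v] unfolding mem_ideal_sum by blast
        have c: "q \<in> carrier R" "l \<in> carrier R" using smod_carrier[OF Qs(2) ql(1)] smod_carrier[OF L(1) ql(2)] by auto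
        have "l = v \<ominus> q" unfolding ql(3) using c by algebra
        moreover have "q \<in> V'" using ql(1) V(2,5) by blast
        ultimately have "l \<in> V'" using smod_diff[OF V(3) v] by simp
        then have "l \<in> V" using eq ql(2) L(3) geL' by blast
        then show "v \<in> V" unfolding ql(3) using smod_add[OF V(1)] V(2) ql(1) by blast
      qed
      then show False using V(5) by blast
    qed
    then show "V \<inter> (Q <+> L') \<subset> V' \<inter> (Q <+> L')" using V(5) by blast
  qed
  moreover have "height ?G + height ?H \<le> height ?F"
    by (rule height_concat) (auto simp: between_def)
  ultimately show ?thesis by (meson add_mono order_trans)
qed

end

lemma binomial_growth:
  assumes *: "\<And>k. (k choose n) \<le> (k * t + 1) ^ d"
  shows "n \<le> d"
proof (rule ccontr)
  assume "\<not> n \<le> d"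
  then have n: "d < n" by simp
  \<comment> \<open>Chosen so that \<open>k\<close> exceeds \<open>n^n (t+1)^d\<close>. By
    \<open>(k/n)^n \<le> (k choose n)\<close> the hypothesis bounds \<open>k^(n-d)\<close>, and
    hence \<open>k\<close>, by exactly this number.\<close>
  define k where "k = n * (n ^ n * (t + 1) ^ d + 1)"
  have kn: "n \<le> k" "k > 0" using n by (auto simp: k_def)
  have "(of_nat k / of_nat n :: real) ^ n \<le> of_nat (k choose n)" using kn by (intro binomial_ge_n_over_k_pow_k) auto
  then have "real k ^ n \<le> real (k choose n) * real n ^ n" using n by (simp add: power_divide divide_simps)
  then have "real (k ^ n) \<le> real ((k choose n) * n ^ n)" by simp
  then have "k ^ n \<le> (k choose n) * n ^ n" by (simp only: of_nat_le_iff)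
  also have "\<dots> \<le> (k * t + 1) ^ d * n ^ n" using * by simp
  also have "\<dots> \<le> (k * (t + 1)) ^ d * n ^ n" using kn by (intro mult_right_mono power_mono) auto
  also have "\<dots> = k ^ d * ((t + 1) ^ d * n ^ n)" unfolding power_mult_distrib by (simp only: mult.assoc)
  finally have "k ^ d * k ^ (n - d) \<le> k ^ d * ((t + 1) ^ d * n ^ n)" using n by (simp flip: power_add)
  then have "k ^ (n - d) \<le> (t + 1) ^ d * n ^ n" using kn by simp
  moreover have "k \<le> k ^ (n - d)" using kn n by (intro self_le_power) auto
  moreover have "(t + 1) ^ d * n ^ n < k"
  proof -
    have "(t + 1) ^ d * n ^ n < n ^ n * (t + 1) ^ d + 1" by simp
    also have "\<dots> = 1 * (n ^ n * (t + 1) ^ d + 1)" by simp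
    also have "\<dots> \<le> k" unfolding k_def using n by (intro mult_right_mono) auto
    finally show ?thesis .
  qed
  ultimately show False by linarith
qed

text \<open>With a common degree bound \<open>t\<close> for elements
  \<open>h i \<in> P (i+1) - P i\<close>, \<open>height_between_step\<close> has the shape of
  Pascal's rule. The height modulo \<open>P (n-i)\<close> in degree \<open>k t\<close> is therefore
  at least \<open>k choose i\<close>, and \<open>i = n\<close> conflicts with growth of order
  \<open>d\<close> unless \<open>n \<le> d\<close>.\<close>

lemma (in cring) prime_chain_length_le:
  assumes S: "S \<subseteq> carrier R"
    and P: "\<And>i. i \<le> n \<Longrightarrow> primeideal (P i) R" and less: "\<And>i. i < n \<Longrightarrow> P i \<subset> P (Suc i)"
    and L: "\<And>D. smod S (L D)" "\<And>D E. D \<le> E \<Longrightarrow> L D \<subseteq> L E" "\<one> \<in> L 0"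
    and mult: "\<And>a b D E. a \<in> L D \<Longrightarrow> b \<in> L E \<Longrightarrow> a \<otimes> b \<in> L (D + E)"
    and cover: "\<And>a. a \<in> carrier R \<Longrightarrow> \<exists>D. a \<in> L D"
    and growth: "\<And>D. height (between S (P 0) (P 0 <+> L D)) \<le> enat ((D + 1) ^ d)"
  shows "n \<le> d"
proof -
  have Pi: "ideal (P i) R" if "i \<le> n" for i using primeideal.axioms(1)[OF P[OF that]] .
  have "\<forall>i\<in>{..<n}. \<exists>h. h \<in> P (Suc i) \<and> h \<notin> P i" using less by blast
  then obtain h where h: "\<And>i. i < n \<Longrightarrow> h i \<in> P (Suc i) \<and> h i \<notin> P i" by (metis lessThan_iff)
  have "\<forall>i\<in>{..<n}. \<exists>D. h i \<in> L D" using h cover ideal.Icarr[OF Pi] by (metis Suc_leI lessThan_iff)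
  then obtain T where T: "\<And>i. i < n \<Longrightarrow> h i \<in> L (T i)" by (metis lessThan_iff)
  define t where "t = Max (insert 0 (T ` {..<n}))"
  have t: "h i \<in> L t" if "i < n" for i
    using T[OF that] L(2)[of "T i" t] that by (auto simp: t_def)
  let ?H = "\<lambda>i D. height (between S (P i) (P i <+> L D))"
  have base: "1 \<le> ?H n D" for D
  proof -
    have Ps: "smod S (P n)" using smod_ideal[OF Pi S] by simp
    note ge = smod_sum_ge[OF Ps L(1)[of D]]
    have "\<one> \<in> L D" using L(2)[of 0 D] L(3) by auto
    then have "\<one> \<in> P n <+> L D" using ge by blast
    moreover have "\<one> \<notin> P n"
      using primeideal.I_notcarr[OF P] ideal.one_imp_carrier[OF Pi] by auto
    ultimately have "P n \<subset> P n <+> L D" using ge by blast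
    then have "chain_in (between S (P n) (P n <+> L D)) 1 (\<lambda>i. if i = 0 then P n else P n <+> L D)"
      using Ps smod_sum[OF Ps L(1) S] by (auto simp: chain_in_def between_def)
    then show ?thesis using height_ge by (metis one_enat_def)
  qed
  have "enat (k choose i) \<le> ?H (n - i) (k * t)" if "i \<le> n" for k i
    using that
  proof (induction k arbitrary: i)
    case 0
    then show ?case using base[of 0] by (cases i) (auto simp: one_enat_def zero_enat_def[symmetric])
  next
    case (Suc k)
    show ?case
    proof (cases i)
      case 0
      then show ?thesis using base by (simp add: one_enat_def)
    next
      case (Suc j)
      define l where "l = n - Suc j"
      have l: "l < n" "n - j = Suc l" "n - i = l" using Suc.prems Suc by (auto simp: l_def)
      have "enat (Suc k choose i) = enat (k choose Suc j) + enat (k choose j)" using Suc by simp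
      also have "\<dots> \<le> ?H l (k * t) + ?H (Suc l) (k * t)"
        using Suc.IH[of i] Suc.IH[of j] Suc.prems Suc l by (intro add_mono) auto
      also have "\<dots> \<le> ?H l (Suc k * t)"
      proof (rule height_between_step[OF S])
        show "primeideal (P l) R" "ideal (P (Suc l)) R" "P l \<subseteq> P (Suc l)" using P Pi less l by auto
        show "h l \<in> P (Suc l)" "h l \<notin> P l" using h l by auto
        show "L (k * t) \<subseteq> L (Suc k * t)" by (intro L(2)) simp
        show "h l \<otimes> v \<in> L (Suc k * t)" if "v \<in> L (k * t)" for v using mult[OF t that] l by simp
      qed (rule L(1))+
      finally show ?thesis using l by simp
    qed
  qed
  from this[of n] have "enat (k choose n) \<le> enat ((k * t + 1) ^ d)" for k
    using growth[of "k * t"] by (metis diff_self_eq_0 order_refl order_trans)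
  then show ?thesis by (intro binomial_growth[of n t d]) simp
qed

section \<open>The dimension of the Sally module\<close>

locale sally = buchsbaum_infinite +
  fixes x :: "nat \<Rightarrow> 'a" and r :: nat
  assumes x: "param d x"
    and reduction: "ideal_power R \<mm> (Suc r) = (Idl (x ` {..<d})) \<cdot> ideal_power R \<mm> r"
begin

abbreviation J :: "'a set"
  where "J \<equiv> Idl (x ` {..<d})"

sublocale rees R J
  by (intro rees.intro rees_axioms.intro cring_axioms J_ideal[OF x])

lemma J_le_m: "J \<subseteq> \<mm>"
  using param_in_m[OF x] by (intro Idl_le) auto

lemma mJ: "ideal (\<mm> \<cdot> ideal_power R J n) R"
  by (rule mJ_ideal[OF x])

lemma m_power_Suc: "\<mm> \<cdot> ideal_power R \<mm> n = ideal_power R \<mm> (Suc n)"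
  by (simp add: ideal_power_Suc ideal_prod_commute)

lemma m_power_reduction: "ideal_power R \<mm> (Suc r + n) = ideal_power R J n \<cdot> ideal_power R \<mm> (Suc r)"
proof (induction n)
  case 0
  then show ?case by (simp add: ideal_power_0 carrier_prod)
next
  case (Suc n)
  have m: "ideal (ideal_power R \<mm> (Suc r)) R" "ideal (ideal_power R \<mm> r) R" by simp_all
  have "ideal_power R \<mm> (Suc r + Suc n) = ideal_power R \<mm> (Suc r + n) \<cdot> \<mm>"
    by (simp only: add_Suc_right ideal_power_Suc)
  also have "\<dots> = ideal_power R J n \<cdot> (ideal_power R \<mm> (Suc r) \<cdot> \<mm>)"
    unfolding Suc using m(1) powers_ideal by (intro ideal_prod_assoc) auto
  also have "ideal_power R \<mm> (Suc r) \<cdot> \<mm> = J \<cdot> ideal_power R \<mm> (Suc r)"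
    unfolding reduction using K_ideal m(2) by (subst ideal_prod_assoc) (simp_all add: ideal_power_Suc flip: reduction)
  also have "ideal_power R J n \<cdot> (J \<cdot> ideal_power R \<mm> (Suc r)) = (ideal_power R J n \<cdot> J) \<cdot> ideal_power R \<mm> (Suc r)"
    using K_ideal m(1) powers_ideal by (intro ideal_prod_assoc[symmetric]) auto
  finally show ?case by (simp only: ideal_power_Suc)
qed

definition ann_part :: "nat \<Rightarrow> 'a set"
  where "ann_part s = {a \<in> ideal_power R J s.
    \<forall>n. \<forall>z\<in>\<mm> \<cdot> ideal_power R \<mm> n. a \<otimes> z \<in> \<mm> \<cdot> ideal_power R J (s + n)}"

lemma annihilator_eq: "annihilator A (sally_module R J \<mm>) = graded ann_part"
  unfolding ann_part_def[abs_def] using annihilator_sally[OF m_ideal J_le_m] by simp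

lemma mm_carrier: "z \<in> \<mm> \<cdot> ideal_power R \<mm> n \<Longrightarrow> z \<in> carrier R"
  unfolding m_power_Suc using ideal.Icarr[OF ideal_power_ideal[OF m_ideal]] .

lemma ann_part_ideal: "ideal (ann_part s) R"
proof (rule ideal_of_closed)
  have car: "a \<in> carrier R" if "a \<in> ideal_power R J s" for a using ideal.Icarr[OF powers_ideal that] .
  show "ann_part s \<subseteq> carrier R" using car by (auto simp: ann_part_def)
  show "\<zero> \<in> ann_part s"
    using ideal_zero_mem[OF powers_ideal] ideal_zero_mem[OF mJ] mm_carrier by (simp add: ann_part_def)
  show "a \<oplus> b \<in> ann_part s" if "a \<in> ann_part s" "b \<in> ann_part s" for a b
    using that car mm_carrier ideal_add_mem[OF powers_ideal] ideal_add_mem[OF mJ]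
    by (simp add: ann_part_def l_distr)
  show "b \<otimes> a \<in> ann_part s" if "b \<in> carrier R" "a \<in> ann_part s" for a b
    using that car mm_carrier ideal.I_l_closed[OF powers_ideal] ideal.I_l_closed[OF mJ]
    by (simp add: ann_part_def m_assoc)
qed

lemma ann_part_mult:
  assumes a: "a \<in> ann_part s" and b: "b \<in> ideal_power R J t"
  shows "a \<otimes> b \<in> ann_part (s + t)"
proof -
  have aJ: "a \<in> ideal_power R J s"
    and ac: "\<And>n z. z \<in> \<mm> \<cdot> ideal_power R \<mm> n \<Longrightarrow> a \<otimes> z \<in> \<mm> \<cdot> ideal_power R J (s + n)"
    using a by (auto simp: ann_part_def)
  have car: "a \<in> carrier R" "b \<in> carrier R"
    using ideal.Icarr[OF powers_ideal] aJ b by blast+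
  have "(a \<otimes> b) \<otimes> z \<in> \<mm> \<cdot> ideal_power R J (s + t + n)" if z: "z \<in> \<mm> \<cdot> ideal_power R \<mm> n" for n z
  proof -
    have "(a \<otimes> z) \<otimes> b \<in> (\<mm> \<cdot> ideal_power R J (s + n)) \<cdot> ideal_power R J t" using ac[OF z] b by (rule ideal_prod.prod)
    also have "\<dots> = \<mm> \<cdot> ideal_power R J (s + n + t)"
      unfolding ideal_power_add[OF K_ideal, of "s + n" t] by (intro ideal_prod_assoc m_ideal powers_ideal)
    also have "s + n + t = s + t + n" by simp
    also have "(a \<otimes> z) \<otimes> b = (a \<otimes> b) \<otimes> z" using car mm_carrier[OF z] by algebra
    finally show ?thesis .
  qed
  then show ?thesis using powers_mult[OF aJ b] by (simp add: ann_part_def)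
qed

lemma annihilator_ideal: "ideal (graded ann_part) A"
  using ann_part_ideal ann_part_mult by (rule graded_ideal)

lemma single_in_ann:
  assumes "a \<in> ann_part n"
  shows "single a n \<in> graded ann_part"
proof -
  have "single a n i \<in> ann_part i" for i
    using assms ideal_zero_mem[OF ann_part_ideal] by (cases "i = n") auto
  then show ?thesis using single_in_A assms by (simp add: graded_def ann_part_def)
qed

lemma single_in_prime:
  assumes P: "primeideal P A" and a: "a \<in> ideal_power R J n" and k: "single (a [^] k) (n * k) \<in> P"
  shows "single a n \<in> P"
proof (rule A.primeideal_pow[OF P single_in_A[OF a]])
  show "single a n [^]\<^bsub>A\<^esub> k \<in> P" using k ideal.Icarr[OF powers_ideal a] by (simp add: A_pow single_pow)
qed

text \<open>Already \<open>a^r\<close> annihilates the Sally module, since \<open>a^r \<mm>^(n+1)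
  \<subseteq> \<mm>^(r+1+n) = J^n \<mm>^(r+1) \<subseteq> \<mm>J^n\<close>.\<close>

lemma m_in_prime:
  assumes P: "primeideal P A" "graded ann_part \<subseteq> P" and a: "a \<in> \<mm>"
  shows "single a 0 \<in> P"
proof (rule single_in_prime[OF P(1), where k = r])
  show "a \<in> ideal_power R J 0" using a m_carrier by (simp add: ideal_power_0)
  have "a [^] r \<in> ann_part 0" unfolding ann_part_def
  proof (intro CollectI conjI allI ballI)
    show "a [^] r \<in> ideal_power R J 0" using a m_carrier by (simp add: ideal_power_0)
    fix n z assume z: "z \<in> \<mm> \<cdot> ideal_power R \<mm> n"
    have "a [^] r \<otimes> z \<in> ideal_power R \<mm> (r + Suc n)"
      using z unfolding m_power_Suc by (intro ideal_power_prod_mem m_ideal elem_power_mem a)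
    also have "ideal_power R \<mm> (r + Suc n) = ideal_power R J n \<cdot> ideal_power R \<mm> (Suc r)"
      using m_power_reduction[of n] by simp
    also have "\<dots> \<subseteq> ideal_power R J n \<cdot> \<mm>"
      using ideal_power_antimono[OF m_ideal, of 1 "Suc r"] by (intro ideal_prod_mono order_refl) (simp add: ideal_power_1)
    also have "\<dots> = \<mm> \<cdot> ideal_power R J (0 + n)" using ideal_prod_commute[OF powers_ideal m_ideal] by simp
    finally show "a [^] r \<otimes> z \<in> \<mm> \<cdot> ideal_power R J (0 + n)" .
  qed
  then show "single (a [^] r) (0 * r) \<in> P" using single_in_ann P(2) by auto
qed

text \<open>The summand \<open>0 : J\<close> persists through the induction for
  \<open>\<mm>^(k+1) \<subseteq> \<mm>J^k + (0 : J)\<close>. It disappears when a factor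
  \<open>J\<close> is split off from the power of \<open>\<mm>\<close>, which is possible beyond the
  exponent \<open>r + 1\<close>.\<close>

lemma m_power_le:
  assumes f: "f \<in> ideal_power R J s" "f \<notin> \<mm> \<cdot> ideal_power R J s" "f \<in> ann_part s"
  shows "ideal_power R \<mm> (Suc (Suc (r + n))) \<subseteq> \<mm> \<cdot> ideal_power R J (Suc (r + n))"
proof -
  let ?W = "socle J"
  have W: "ideal ?W R" using K_ideal by (rule socle_ideal)
  have mJW: "ideal (\<mm> \<cdot> ideal_power R J k <+> ?W) R" for k using mJ W by (rule add_ideals)
  have mJ_le: "\<mm> \<cdot> ideal_power R J k \<subseteq> \<mm> \<cdot> ideal_power R J k <+> ?W" for k
    by (intro ideal_sum_ge1 W ideal_subset_carrier mJ)
  have W_le: "?W \<subseteq> \<mm> \<cdot> ideal_power R J k <+> ?W" for k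
    by (intro ideal_sum_ge2 mJ ideal_subset_carrier W)
  \<comment> \<open>Only the condition of \<open>ann_part\<close> for \<open>n = 1\<close> is used,
    that is \<open>f \<mm>^2 \<subseteq> \<mm>J^(s+1)\<close>.\<close>
  have square: "\<mm> \<cdot> \<mm> \<subseteq> \<mm> \<cdot> J <+> ?W"
  proof
    fix a assume a: "a \<in> \<mm> \<cdot> \<mm>"
    have "\<mm> \<cdot> \<mm> = \<mm> \<cdot> ideal_power R \<mm> 1" by (simp add: ideal_power_1)
    then have "f \<otimes> a \<in> \<mm> \<cdot> ideal_power R J (s + 1)" using a f(3) unfolding ann_part_def by blast
    moreover have "a \<in> carrier R" using a ideal.Icarr[OF ideal_prod_is_ideal[OF m_ideal m_ideal]] by blast
    ultimately show "a \<in> \<mm> \<cdot> J <+> ?W" using mem_sum_socle[OF x f(1,2)] by simp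
  qed
  have le: "ideal_power R \<mm> (Suc k) \<subseteq> \<mm> \<cdot> ideal_power R J k <+> ?W" for k
  proof (induction k)
    case 0
    then show ?case using mJ_le[of 0] by (simp add: ideal_power_1 ideal_power_0 ideal_prod_one)
  next
    case (Suc k)
    have "ideal_power R \<mm> (Suc (Suc k)) = ideal_power R \<mm> (Suc k) \<cdot> \<mm>" by (rule ideal_power_Suc)
    also have "\<dots> \<subseteq> (\<mm> \<cdot> ideal_power R J k <+> ?W) \<cdot> \<mm>" by (intro ideal_prod_mono Suc order_refl)
    also have "\<dots> \<subseteq> \<mm> \<cdot> ideal_power R J (Suc k) <+> ?W"
      unfolding ideal_prod_le_iff[OF mJW]
    proof (intro ballI)
      fix a b assume a: "a \<in> \<mm> \<cdot> ideal_power R J k <+> ?W" and b: "b \<in> \<mm>"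
      obtain p w where pw: "p \<in> \<mm> \<cdot> ideal_power R J k" "w \<in> ?W" "a = p \<oplus> w" using a unfolding mem_ideal_sum by blast
      have car: "p \<in> carrier R" "w \<in> carrier R" "b \<in> carrier R"
        using ideal.Icarr[OF mJ pw(1)] ideal.Icarr[OF W pw(2)] m_carrier[OF b] by auto
      have wb: "w \<otimes> b \<in> ?W" using ideal.I_r_closed[OF W pw(2) car(3)] .
      have pb: "p \<otimes> b \<in> \<mm> \<cdot> ideal_power R J (Suc k) <+> ?W"
      proof -
        have "p \<otimes> b \<in> (\<mm> \<cdot> ideal_power R J k) \<cdot> \<mm>" using pw(1) b by (rule ideal_prod.prod)
        also have "\<dots> = (ideal_power R J k \<cdot> \<mm>) \<cdot> \<mm>" using ideal_prod_commute[OF m_ideal powers_ideal] by simp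
        also have "\<dots> = ideal_power R J k \<cdot> (\<mm> \<cdot> \<mm>)" by (intro ideal_prod_assoc powers_ideal m_ideal)
        also have "\<dots> \<subseteq> ideal_power R J k \<cdot> (\<mm> \<cdot> J <+> ?W)" by (intro ideal_prod_mono square order_refl)
        also have "\<dots> \<subseteq> \<mm> \<cdot> ideal_power R J (Suc k) <+> ?W"
          unfolding ideal_prod_le_iff[OF mJW]
        proof (intro ballI)
          fix g z assume g: "g \<in> ideal_power R J k" and z: "z \<in> \<mm> \<cdot> J <+> ?W"
          obtain q v where qv: "q \<in> \<mm> \<cdot> J" "v \<in> ?W" "z = q \<oplus> v" using z unfolding mem_ideal_sum by blast
          have gc: "g \<in> carrier R" "q \<in> carrier R" "v \<in> carrier R"
            using ideal.Icarr[OF powers_ideal g] ideal.Icarr[OF ideal_prod_is_ideal[OF m_ideal K_ideal] qv(1)]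
              ideal.Icarr[OF W qv(2)] by auto
          have "q \<otimes> g \<in> (\<mm> \<cdot> J) \<cdot> ideal_power R J k" using qv(1) g by (rule ideal_prod.prod)
          also have "\<dots> = \<mm> \<cdot> (J \<cdot> ideal_power R J k)" by (intro ideal_prod_assoc m_ideal K_ideal powers_ideal)
          also have "J \<cdot> ideal_power R J k = ideal_power R J (Suc k)"
            unfolding ideal_power_Suc by (intro ideal_prod_commute K_ideal powers_ideal)
          finally have 1: "q \<otimes> g \<in> \<mm> \<cdot> ideal_power R J (Suc k) <+> ?W" using mJ_le by blast
          have 2: "g \<otimes> v \<in> \<mm> \<cdot> ideal_power R J (Suc k) <+> ?W"
            using ideal.I_l_closed[OF W qv(2) gc(1)] W_le by blast
          have "g \<otimes> z = q \<otimes> g \<oplus> g \<otimes> v" unfolding qv(3) using gc by algebra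
          then show "g \<otimes> z \<in> \<mm> \<cdot> ideal_power R J (Suc k) <+> ?W" using ideal_add_mem[OF mJW 1 2] by simp
        qed
        finally show ?thesis .
      qed
      have "a \<otimes> b = p \<otimes> b \<oplus> w \<otimes> b" unfolding pw(3) using car by (simp add: l_distr)
      then show "a \<otimes> b \<in> \<mm> \<cdot> ideal_power R J (Suc k) <+> ?W"
        using ideal_add_mem[OF mJW pb subsetD[OF W_le wb]] by simp
    qed
    finally show ?case .
  qed
  have "ideal_power R \<mm> (Suc (Suc (r + n))) = (J \<cdot> ideal_power R J n) \<cdot> ideal_power R \<mm> (Suc r)"
    using m_power_reduction[of "Suc n"] by (simp add: ideal_power_Suc ideal_prod_commute[OF K_ideal powers_ideal])
  also have "\<dots> = J \<cdot> (ideal_power R J n \<cdot> ideal_power R \<mm> (Suc r))"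
    by (intro ideal_prod_assoc K_ideal powers_ideal ideal_power_ideal m_ideal)
  also have "\<dots> = J \<cdot> ideal_power R \<mm> (Suc (r + n))" using m_power_reduction[of n] by simp
  also have "\<dots> \<subseteq> J \<cdot> (\<mm> \<cdot> ideal_power R J (r + n) <+> ?W)" by (intro ideal_prod_mono le order_refl)
  also have "\<dots> \<subseteq> \<mm> \<cdot> ideal_power R J (Suc (r + n))"
    unfolding ideal_prod_le_iff[OF mJ]
  proof (intro ballI)
    fix j a assume j: "j \<in> J" and a: "a \<in> \<mm> \<cdot> ideal_power R J (r + n) <+> ?W"
    obtain p w where pw: "p \<in> \<mm> \<cdot> ideal_power R J (r + n)" "w \<in> ?W" "a = p \<oplus> w" using a unfolding mem_ideal_sum by blast
    have car: "p \<in> carrier R" "w \<in> carrier R" "j \<in> carrier R"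
      using ideal.Icarr[OF mJ pw(1)] ideal.Icarr[OF W pw(2)] ideal.Icarr[OF K_ideal j] by auto
    have "w \<otimes> j = \<zero>" using pw(2) j by (simp add: socle_def)
    then have "j \<otimes> a = p \<otimes> j" unfolding pw(3) using car by (simp add: r_distr m_comm)
    also have "p \<otimes> j \<in> (\<mm> \<cdot> ideal_power R J (r + n)) \<cdot> J" using pw(1) j by (rule ideal_prod.prod)
    also have "\<dots> = \<mm> \<cdot> ideal_power R J (Suc (r + n))"
      unfolding ideal_power_Suc by (intro ideal_prod_assoc m_ideal powers_ideal K_ideal)
    finally show "j \<otimes> a \<in> \<mm> \<cdot> ideal_power R J (Suc (r + n))" .
  qed
  finally show ?thesis .
qed

lemma height_eq_0:
  assumes f: "f \<in> ideal_power R J s" "f \<notin> \<mm> \<cdot> ideal_power R J s" "f \<in> ann_part s"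
  shows "height {P. primeideal P A \<and> graded ann_part \<subseteq> P} = 0"
proof (rule height_singleton)
  let ?M = "{f \<in> carrier A. f 0 \<in> \<mm>}"
  have "P = ?M" if P: "primeideal P A" "graded ann_part \<subseteq> P" for P
  proof
    have Pi: "ideal P A" using primeideal.axioms(1)[OF P(1)] .
    \<comment> \<open>The power \<open>a^(r+1)\<close> has degree \<open>n (r+1)\<close>, at least
      \<open>r + 1\<close>, the range in which \<open>m_power_le\<close> shows that it annihilates
      the Sally module.\<close>
    have pos: "single a n \<in> P" if a: "a \<in> ideal_power R J n" and n: "n > 0" for a n
    proof (rule single_in_prime[OF P(1) a, where k = "Suc r"])
      have "a [^] Suc r \<in> ideal_power R J (n * Suc r)"
        using elem_power_mem[OF powers_ideal a, of "Suc r"] ideal_power_mult[OF K_ideal] by simp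
      moreover obtain m where m: "n * Suc r = Suc (r + m)"
        using n by (metis add_Suc le_add_diff_inverse mult.commute mult_le_mono1 nat_mult_1_right Suc_leI One_nat_def)
      ultimately have a': "a [^] Suc r \<in> ideal_power R J (Suc (r + m))" by simp
      have "a [^] Suc r \<in> ann_part (Suc (r + m))" unfolding ann_part_def
      proof (intro CollectI conjI allI ballI a')
        fix k z assume z: "z \<in> \<mm> \<cdot> ideal_power R \<mm> k"
        have "a [^] Suc r \<in> ideal_power R \<mm> (Suc (r + m))" using a' ideal_power_base_mono[OF J_le_m] by blast
        then have "a [^] Suc r \<otimes> z \<in> ideal_power R \<mm> (Suc (r + m) + Suc k)"
          using z unfolding m_power_Suc by (intro ideal_power_prod_mem m_ideal)
        also have "Suc (r + m) + Suc k = Suc (Suc (r + (m + k)))" by simp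
        also have "ideal_power R \<mm> (Suc (Suc (r + (m + k)))) \<subseteq> \<mm> \<cdot> ideal_power R J (Suc (r + (m + k)))"
          by (rule m_power_le[OF f])
        also have "Suc (r + (m + k)) = Suc (r + m) + k" by simp
        finally show "a [^] Suc r \<otimes> z \<in> \<mm> \<cdot> ideal_power R J (Suc (r + m) + k)" .
      qed
      then show "single (a [^] Suc r) (n * Suc r) \<in> P" using single_in_ann P(2) m by auto
    qed
    show MP: "?M \<subseteq> P"
    proof
      fix f assume f: "f \<in> ?M"
      show "f \<in> P"
      proof (rule A_induct)
        show "f \<in> carrier A" using f by simp
        show "single (f n) n \<in> P" for n
          using f m_in_prime[OF P] pos[of "f n" n] by (cases n) (auto simp: rees_carrier)
      qed (use ideal_zero_mem[OF Pi] ideal_add_mem[OF Pi] in auto)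
    qed
    show "P \<subseteq> ?M"
    proof
      fix f assume fP: "f \<in> P"
      have f: "f \<in> carrier A" using ideal.Icarr[OF Pi fP] .
      have f0: "f 0 \<in> carrier R" using A_up[OF f] by auto
      \<comment> \<open>The part of positive degree lies in \<open>?M\<close>, hence in
        \<open>P\<close>. Subtracting it leaves the constant term in \<open>P\<close>, which
        therefore cannot be a unit.\<close>
      let ?g = "\<lambda>n. if n = 0 then \<zero> else f n"
      have gA: "?g \<in> carrier A" using f ideal_zero_mem[OF powers_ideal] A_up[OF f]
        by (auto simp: rees_carrier up_def bound_def)
      then have "?g \<in> ?M" using ideal_zero_mem[OF m_ideal] by simp
      then have gP: "?g \<in> P" using MP by blast
      have s: "single (f 0) 0 \<in> carrier A" using f0 by (intro single_in_A) (simp add: ideal_power_0)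
      have "f = single (f 0) 0 \<oplus>\<^bsub>A\<^esub> ?g"
      proof
        fix n show "f n = (single (f 0) 0 \<oplus>\<^bsub>A\<^esub> ?g) n"
          unfolding A_add_apply[OF s gA] using mem_upD[OF A_up[OF f]] by (cases n) auto
      qed
      then have sP: "single (f 0) 0 \<in> P" using A.ideal_mem_of_add[OF Pi _ gP s] fP by simp
      have "f 0 \<in> \<mm>"
      proof (rule ccontr)
        assume "f 0 \<notin> \<mm>"
        then obtain v where v: "v \<in> carrier R" "v \<otimes> f 0 = \<one>" using unit_of_not_in_m[OF f0] by blast
        have "single v 0 \<in> carrier A" using v by (intro single_in_A) (simp add: ideal_power_0)
        then have "single v 0 \<otimes>\<^bsub>A\<^esub> single (f 0) 0 \<in> P" using ideal.I_l_closed[OF Pi sP] by blast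
        then have "\<one>\<^bsub>A\<^esub> \<in> P" using v f0 by (simp add: A_ops single_mult_single)
        then show False using primeideal.I_notcarr[OF P(1)] ideal.one_imp_carrier[OF Pi] by simp
      qed
      then show "f \<in> ?M" using f by simp
    qed
  qed
  then show "{P. primeideal P A \<and> graded ann_part \<subseteq> P} \<subseteq> {?M}" by auto
qed

lemma prime_part_graded_prime:
  assumes C: "C \<subseteq> {..<d}"
  shows "primeideal (graded (prime_part x C)) A"
proof (rule graded_prime)
  show "ideal (prime_part x C n) R" for n using x C by (rule prime_part_ideal)
  show "a \<otimes> b \<in> prime_part x C (s + t)" if "a \<in> prime_part x C s" "b \<in> ideal_power R J t" for s t a b
    using prime_part_mult[OF x C that] .
  show "\<one> \<notin> prime_part x C 0" unfolding prime_part_0 by (rule one_not_in_m)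
  show "a \<otimes> b \<notin> prime_part x C (s + t)" if "a \<in> ideal_power R J s" "a \<notin> prime_part x C s"
    "b \<in> ideal_power R J t" "b \<notin> prime_part x C t" for s t a b
    using prime_part_prime[OF x C that] .
qed

text \<open>The chain consists of the primes generated by \<open>\<mm>\<close> and
  \<open>x_0 t, ..., x_(i-1) t\<close> for \<open>i \<le> d\<close>; consecutive ones are separated
  by \<open>x_i t\<close>.\<close>

lemma height_ge_d:
  assumes "graded ann_part \<subseteq> graded (prime_part x {})"
  shows "enat d \<le> height {P. primeideal P A \<and> graded ann_part \<subseteq> P}"
proof (rule height_ge)
  have mono: "graded (prime_part x B) \<subseteq> graded (prime_part x C)" if "B \<subseteq> C" "C \<subseteq> {..<d}" for B C
    using prime_part_mono[OF x that] by (auto simp: graded_def)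
  show "chain_in {P. primeideal P A \<and> graded ann_part \<subseteq> P} d (\<lambda>i. graded (prime_part x {..<i}))"
    unfolding chain_in_def
  proof (intro conjI allI impI)
    fix i assume "i \<le> d"
    then have i: "{..<i} \<subseteq> {..<d}" by auto
    show "graded (prime_part x {..<i}) \<in> {P. primeideal P A \<and> graded ann_part \<subseteq> P}"
      using prime_part_graded_prime[OF i] assms mono[OF empty_subsetI i] by blast
  next
    fix i assume i: "i < d"
    have sub: "{..<i} \<subseteq> {..<d}" "{..<Suc i} \<subseteq> {..<d}" using i by auto
    have xi: "x i \<in> prime_part x {..<Suc i} 1" using param_in_prime_part[OF x sub(2)] by simp
    have "single (x i) 1 n \<in> prime_part x {..<Suc i} n" for n
      using xi ideal_zero_mem[OF prime_part_ideal[OF x sub(2)]] by (cases "n = 1") auto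
    moreover have "x i \<in> ideal_power R J 1" using prime_part_le_power[OF x sub(2)] xi by blast
    ultimately have "single (x i) 1 \<in> graded (prime_part x {..<Suc i})"
      using single_in_A by (simp add: graded_def)
    moreover have "single (x i) 1 1 \<notin> prime_part x {..<i} 1"
      using param_not_in_prime_part[OF x sub(1) i] by simp
    then have "single (x i) 1 \<notin> graded (prime_part x {..<i})" unfolding graded_def by blast
    ultimately show "graded (prime_part x {..<i}) \<subset> graded (prime_part x {..<Suc i})"
      using mono[OF _ sub(2), of "{..<i}"] by auto
  qed
qed

definition scalars :: "(nat \<Rightarrow> 'a) set"
  where "scalars = (\<lambda>a. single a 0) ` carrier R"

definition deg_le :: "nat \<Rightarrow> (nat \<Rightarrow> 'a) set"
  where "deg_le D = {f \<in> carrier A. \<forall>n>D. f n = \<zero>}"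

lemma A_diff_apply:
  assumes f: "f \<in> carrier A" and g: "g \<in> carrier A"
  shows "(f \<ominus>\<^bsub>A\<^esub> g) n = f n \<ominus> g n"
proof -
  have fg: "f \<ominus>\<^bsub>A\<^esub> g \<in> carrier A" using f g by simp
  have car: "f n \<in> carrier R" "g n \<in> carrier R" "(f \<ominus>\<^bsub>A\<^esub> g) n \<in> carrier R"
    using mem_upD[OF A_up] f g fg by auto
  have "(f \<ominus>\<^bsub>A\<^esub> g) \<oplus>\<^bsub>A\<^esub> g = f" using f g by (simp add: a_minus_def A.a_assoc A.l_neg)
  then have "f n = (f \<ominus>\<^bsub>A\<^esub> g) n \<oplus> g n" using A_add_apply[OF fg g, of n] by simp
  then show ?thesis using car by (simp add: a_minus_def a_assoc r_neg)
qed

lemma single_0_in_A: "a \<in> carrier R \<Longrightarrow> single a 0 \<in> carrier A"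
  by (intro single_in_A) (simp add: ideal_power_0)

lemma scalars_carrier: "scalars \<subseteq> carrier A"
  using single_0_in_A by (auto simp: scalars_def)

lemma scalars_smod: "A.smod scalars scalars"
  unfolding A.smod_def
proof (intro conjI ballI scalars_carrier)
  show "\<zero>\<^bsub>A\<^esub> \<in> scalars"
    unfolding scalars_def by (rule image_eqI[of _ _ \<zero>]) (simp_all add: single_zero A_ops)
  fix u v assume "u \<in> scalars" "v \<in> scalars"
  then obtain a b where ab: "a \<in> carrier R" "u = single a 0" "b \<in> carrier R" "v = single b 0"
    by (auto simp: scalars_def)
  have "u \<ominus>\<^bsub>A\<^esub> v = single (a \<ominus> b) 0"
  proof
    fix n show "(u \<ominus>\<^bsub>A\<^esub> v) n = single (a \<ominus> b) 0 n"
      unfolding ab A_diff_apply[OF single_0_in_A[OF ab(1)] single_0_in_A[OF ab(3)]]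
      by (cases n) (simp_all add: a_minus_def)
  qed
  then show "u \<ominus>\<^bsub>A\<^esub> v \<in> scalars" using ab by (auto simp: scalars_def)
  have "u \<otimes>\<^bsub>A\<^esub> v = single (a \<otimes> b) 0" using ab by (simp add: A_ops single_mult_single)
  then show "u \<otimes>\<^bsub>A\<^esub> v \<in> scalars" using ab by (auto simp: scalars_def)
qed

lemma deg_le_smod: "A.smod scalars (deg_le D)"
  unfolding A.smod_def
proof (intro conjI ballI)
  show "deg_le D \<subseteq> carrier A" by (auto simp: deg_le_def)
  show "\<zero>\<^bsub>A\<^esub> \<in> deg_le D" using A.zero_closed by (simp add: deg_le_def A_ops)
  show "f \<ominus>\<^bsub>A\<^esub> g \<in> deg_le D" if "f \<in> deg_le D" "g \<in> deg_le D" for f g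
    using that A.minus_closed[of f g] A_diff_apply[of f g] by (simp add: deg_le_def minus_eq)
  show "s \<otimes>\<^bsub>A\<^esub> f \<in> deg_le D" if s: "s \<in> scalars" and f: "f \<in> deg_le D" for s f
  proof -
    obtain a where a: "a \<in> carrier R" "s = single a 0" using s by (auto simp: scalars_def)
    have fA: "f \<in> carrier A" and f0: "\<And>n. n > D \<Longrightarrow> f n = \<zero>" using f by (auto simp: deg_le_def)
    have "(s \<otimes>\<^bsub>A\<^esub> f) n = a \<otimes> f n" for n
      unfolding a(2) A_ops using single_mult_apply[OF a(1) A_up[OF fA], of 0 n] by simp
    then show ?thesis using A.m_closed[of s f] fA f0 single_0_in_A[OF a(1)] a by (simp add: deg_le_def)
  qed
qed

lemma deg_le_mult:
  assumes f: "f \<in> deg_le D" and g: "g \<in> deg_le D'"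
  shows "f \<otimes>\<^bsub>A\<^esub> g \<in> deg_le (D + D')"
proof -
  have fA: "f \<in> carrier A" "\<And>n. n > D \<Longrightarrow> f n = \<zero>" and gA: "g \<in> carrier A" "\<And>n. n > D' \<Longrightarrow> g n = \<zero>"
    using f g by (auto simp: deg_le_def)
  have "(f \<otimes>\<^bsub>A\<^esub> g) n = \<zero>" if n: "n > D + D'" for n
  proof -
    have "(\<Oplus>i\<in>{..n}. f i \<otimes> g (n - i)) \<in> {\<zero>}"
    proof (rule ideal_finsum_mem[OF zeroideal])
      fix i
      have "i > D \<or> n - i > D'" using n by linarith
      then show "f i \<otimes> g (n - i) \<in> {\<zero>}"
        using fA(2)[of i] gA(2)[of "n - i"] mem_upD[OF A_up[OF fA(1)]] mem_upD[OF A_up[OF gA(1)]] by auto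
    qed
    then show ?thesis using A_mult_apply[OF fA(1) gA(1)] by simp
  qed
  then show ?thesis using A.m_closed[OF fA(1) gA(1)] by (simp add: deg_le_def)
qed

lemma deg_le_cover:
  assumes f: "f \<in> carrier A"
  shows "\<exists>D. f \<in> deg_le D"
proof -
  obtain D where "bound \<zero> D f" using A_up[OF f] by auto
  then have "f \<in> deg_le D" using f by (auto simp: deg_le_def bound_def)
  then show ?thesis by blast
qed

text \<open>Modulo \<open>\<mm>\<close>, the elements of degree at most \<open>D\<close> are spanned by the monomials in the parameters.\<close>

lemma deg_le_growth:
  assumes P: "primeideal P A" "graded ann_part \<subseteq> P"
  shows "height (A.between scalars P (P <+>\<^bsub>A\<^esub> deg_le D)) \<le> enat ((D + 1) ^ d)"
proof -
  have Pi: "ideal P A" using primeideal.axioms(1)[OF P(1)] .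
  let ?e = "\<lambda>a. single (mon x a) (sum_list a)"
  let ?E = "?e ` expos_lt d (D + 1)"
  have mA: "?e a \<in> carrier A" if "length a = d" for a
    using mon_in_power[OF param_carrier[OF x] that] by (rule single_in_A)
  have "card ?E \<le> card (expos_lt d (D + 1))" by (rule card_image_le) simp
  also have "\<dots> \<le> card {a. set a \<subseteq> {..<D + 1} \<and> length a = d}"
    using finite_lists_length_eq[of "{..<D + 1}" d] by (intro card_mono expos_lt_subset) simp
  also have "\<dots> = (D + 1) ^ d" using card_lists_length_eq[of "{..<D + 1}" d] by simp
  finally have card: "card ?E \<le> (D + 1) ^ d" .
  \<comment> \<open>Scalars from \<open>\<mm>\<close> lie in \<open>P\<close> by
    \<open>m_in_prime\<close> and all others are invertible, so the scalars act modulo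
    \<open>P\<close> through the residue field.\<close>
  have unit: "\<forall>s\<in>scalars. s \<in> P \<or> (\<exists>s'\<in>scalars. s' \<otimes>\<^bsub>A\<^esub> s = \<one>\<^bsub>A\<^esub>)"
  proof
    fix s assume "s \<in> scalars"
    then obtain a where a: "a \<in> carrier R" "s = single a 0" by (auto simp: scalars_def)
    show "s \<in> P \<or> (\<exists>s'\<in>scalars. s' \<otimes>\<^bsub>A\<^esub> s = \<one>\<^bsub>A\<^esub>)"
    proof (cases "a \<in> \<mm>")
      case True
      then show ?thesis using m_in_prime[OF P] a by simp
    next
      case False
      then obtain v where v: "v \<in> carrier R" "v \<otimes> a = \<one>" using unit_of_not_in_m[OF a(1)] by blast
      then have "single v 0 \<otimes>\<^bsub>A\<^esub> s = \<one>\<^bsub>A\<^esub>" using a by (simp add: A_ops single_mult_single)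
      then show ?thesis using v(1) by (auto simp: scalars_def)
    qed
  qed
  have one: "\<one>\<^bsub>A\<^esub> \<in> scalars" by (auto simp: scalars_def A_ops)
  have Efin: "finite ?E" by simp
  have Ec: "?E \<subseteq> carrier A" using mA by (auto simp: expos_lt_def)
  obtain U where U: "A.smod scalars U" "P \<subseteq> U" "?E \<subseteq> U" "height (A.between scalars P U) \<le> enat (card ?E)"
    by (rule A.height_between_generated[OF scalars_carrier scalars_smod one Pi unit Efin Ec])
  have monU: "single z n \<in> U" if z: "z \<in> ideal_power R J n" and n: "n \<le> D" for z n
  proof -
    have sub: "mon x ` expos d n \<subseteq> carrier R" by (rule mon_image[OF x order_refl])
    have "ideal {z \<in> carrier R. single z n \<in> U} R"
    proof (rule ideal_of_closed)
      show "\<zero> \<in> {z \<in> carrier R. single z n \<in> U}"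
        using A.smod_zero[OF U(1)] by (simp add: single_zero A_ops)
      fix a b assume "a \<in> {z \<in> carrier R. single z n \<in> U}" "b \<in> {z \<in> carrier R. single z n \<in> U}"
      then show "a \<oplus> b \<in> {z \<in> carrier R. single z n \<in> U}"
        using A.smod_add[OF U(1), of "single a n" "single b n"] by (simp add: A_ops single_add)
    next
      fix a b assume a: "a \<in> carrier R" and b: "b \<in> {z \<in> carrier R. single z n \<in> U}"
      have "single a 0 \<otimes>\<^bsub>A\<^esub> single b n \<in> U"
        using A.smod_mult[OF U(1), of "single a 0" "single b n"] a b by (simp add: scalars_def)
      then show "a \<otimes> b \<in> {z \<in> carrier R. single z n \<in> U}" using a b by (simp add: A_ops single_mult_single)
    qed auto
    moreover have "mon x ` expos d n \<subseteq> {z \<in> carrier R. single z n \<in> U}"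
    proof (rule image_subsetI)
      fix a assume a: "a \<in> expos d n"
      then have "a \<in> expos_lt d (D + 1)" "sum_list a = n" using n by (auto simp: expos_def expos_lt_def)
      then have "single (mon x a) n \<in> U" using U(3) by blast
      then show "mon x a \<in> {z \<in> carrier R. single z n \<in> U}" using sub a by blast
    qed
    ultimately have "Idl (mon x ` expos d n) \<subseteq> {z \<in> carrier R. single z n \<in> U}" by (rule Idl_le)
    then show ?thesis using z unfolding ideal_power_eq_monomials[OF param_carrier[OF x]] by blast
  qed
  have "deg_le D \<subseteq> U"
  proof
    fix f assume f: "f \<in> deg_le D"
    then have fA: "f \<in> carrier A" by (simp add: deg_le_def)
    show "f \<in> U"
    proof (rule A_induct[OF fA])
      show z: "\<zero>\<^bsub>A\<^esub> \<in> U" by (rule A.smod_zero[OF U(1)])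
      show "g \<oplus>\<^bsub>A\<^esub> h \<in> U" if "g \<in> U" "h \<in> U" for g h using A.smod_add[OF U(1) that] .
      show "single (f n) n \<in> U" for n
      proof (cases "n \<le> D")
        case True
        then show ?thesis using fA by (intro monU) (auto simp: rees_carrier)
      next
        case False
        then have "f n = \<zero>" using f by (simp add: deg_le_def)
        then show ?thesis using z by (simp add: single_zero A_ops)
      qed
    qed
  qed
  then have "P <+>\<^bsub>A\<^esub> deg_le D \<subseteq> U" using U(2) by (intro A.smod_sum_le[OF U(1)])
  then have "height (A.between scalars P (P <+>\<^bsub>A\<^esub> deg_le D)) \<le> height (A.between scalars P U)"
    by (intro height_mono) (auto simp: A.between_def)
  also have "\<dots> \<le> enat (card ?E)" by (rule U(4))
  also have "\<dots> \<le> enat ((D + 1) ^ d)" using card by simp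
  finally show ?thesis .
qed

lemma height_le_d: "height {P. primeideal P A \<and> graded ann_part \<subseteq> P} \<le> enat d"
proof (rule height_le)
  fix n N assume N: "chain_in {P. primeideal P A \<and> graded ann_part \<subseteq> P} n N"
  have "n \<le> d"
  proof (rule A.prime_chain_length_le[where P = N and L = deg_le])
    show "scalars \<subseteq> carrier A" by (rule scalars_carrier)
    show "primeideal (N i) A" if "i \<le> n" for i using N that by (auto simp: chain_in_def)
    show "N i \<subset> N (Suc i)" if "i < n" for i using N that by (auto simp: chain_in_def)
    show "A.smod scalars (deg_le D)" for D by (rule deg_le_smod)
    show "deg_le D \<subseteq> deg_le D'" if "D \<le> D'" for D D' using that by (auto simp: deg_le_def)
    show "\<one>\<^bsub>A\<^esub> \<in> deg_le 0" using A.one_closed by (simp add: deg_le_def A_ops)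
    show "a \<otimes>\<^bsub>A\<^esub> b \<in> deg_le (D + D')" if "a \<in> deg_le D" "b \<in> deg_le D'" for a b D D'
      using that by (rule deg_le_mult)
    show "\<exists>D. a \<in> deg_le D" if "a \<in> carrier A" for a using that by (rule deg_le_cover)
    show "height (A.between scalars (N 0) (N 0 <+>\<^bsub>A\<^esub> deg_le D)) \<le> enat ((D + 1) ^ d)" for D
      using N by (intro deg_le_growth) (auto simp: chain_in_def)
  qed
  then show "enat n \<le> enat d" by simp
qed

lemma sally_module_dim:
  "module_dim A (sally_module R J \<mm>) = enat d \<or> module_dim A (sally_module R J \<mm>) = 0"
proof -
  have dim: "module_dim A (sally_module R J \<mm>) = height {P. primeideal P A \<and> graded ann_part \<subseteq> P}"
    unfolding module_dim_def annihilator_eq by (rule A.krull_dim_quotient[OF annihilator_ideal])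
  show ?thesis
  \<comment> \<open>For the homogeneous annihilator, such a coefficient exists exactly if it is not
    contained in \<open>\<mm>\<close> times the Rees algebra, the lowest prime of the chain in
    \<open>height_ge_d\<close>.\<close>
  proof (cases "\<exists>s f. f \<in> ann_part s \<and> f \<notin> \<mm> \<cdot> ideal_power R J s")
    case True
    then obtain s f where f: "f \<in> ann_part s" "f \<notin> \<mm> \<cdot> ideal_power R J s" by blast
    then have "f \<in> ideal_power R J s" by (simp add: ann_part_def)
    then show ?thesis unfolding dim using height_eq_0 f by blast
  next
    case False
    then have "graded ann_part \<subseteq> graded (prime_part x {})"
      unfolding prime_part_empty[OF x, abs_def] by (auto simp: graded_def)
    then show ?thesis unfolding dim using height_ge_d height_le_d by (blast intro: antisym)
  qed
qed

end

theorem proposition2p6: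
  fixes R :: "('a, 'b) ring_scheme"
    and \<mm> J :: "'a set"
    and d :: nat
  assumes "buchsbaum_ring R \<mm>"
    and "krull_dim R = enat d"
    and "d > 0"
    and "infinite (carrier (R Quot \<mm>))"
    and "minimal_reduction R J \<mm>"
  shows "module_dim (rees_algebra R J) (sally_module R J \<mm>) = enat d \<or>
         module_dim (rees_algebra R J) (sally_module R J \<mm>) = 0"
proof -
  obtain c where "buchsbaum_infinite R \<mm> d c"
    using buchsbaum_ring_locale assms(1-4) by blast
  then interpret buchsbaum_infinite R \<mm> d c .
  obtain x r where xr: "param d x" "J = Idl\<^bsub>R\<^esub> (x ` {..<d})"
    "ideal_power R \<mm> (Suc r) = J \<cdot>\<^bsub>R\<^esub> ideal_power R \<mm> r"
    using minimal_reduction_param[OF assms(2,5)] by blast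
  interpret sally R \<mm> d c x r
    using xr by (intro sally.intro sally_axioms.intro buchsbaum_infinite_axioms) simp_all
  show ?thesis unfolding xr(2) by (rule sally_module_dim)
qed

end
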